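(* Let $N^3(c)$ be a complete Riemannian $3$-manifold of constant curvature $c$ (not necessarily simply connected), let $M^2$ be a compact oriented $2$-manifold, and let $f\colon M^2\to N^3(c)$ be a (co-oriented) front with singular set $\Sigma$, where $M^2\setminus\Sigma$ is dense in $M^2$, such that the extrinsic curvature satisfies $K^{\mathrm{ext}}<0$ and $\log|K^{\mathrm{ext}}|$ is bounded on $M^2\setminus\Sigma$. Then $\chi(M^2)=0$.
   Context: Manifolds are smooth and without boundary. A $C^\infty$-map $f\colon M^2\to N^3(c)$ is a front if each point of $M^2$ has a neighbourhood $U$ with a unit vector field $\nu$ along $f|_U$ such that $\langle df(X),\nu\rangle=0$ for all $X\in TU$ and $\nu\colon U\to T_1N^3(c)$ (unit tangent bundle) is an immersion. Co-oriented means: $\nu$ is globally defined on $M^2$ and the rank $2$ bundle $\mathcal{E}_f=\{w\in f^*TN^3(c): w\perp\nu\}$ is orientable (with a fixed orientation). Put $\varphi(X)=df(X)$ and $\psi(X)=\nabla_X\nu$ ($\nabla$ the Levi-Civita connection of $N^3(c)$), both homomorphisms $TM^2\to\mathcal{E}_f$. The singular set $\Sigma$ of $f$ is the set of points where $\varphi$ is not bijective. With $I(X,Y)=\langle\varphi(X),\varphi(Y)\rangle$ and $I\!I(X,Y)=-\langle\varphi(X),\psi(Y)\rangle$ (which is symmetric), the extrinsic curvature on $M^2\setminus\Sigma$ is $K^{\mathrm{ext}}=\det I\!I/\det I$ (determinants of the representation matrices in local coordinates). *)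

theory Defs
  imports "HOL-Analysis.Analysis" "HOL-Homology.Homology"
begin

section \<open>Smooth manifolds\<close>

primrec Ck_on :: "nat \<Rightarrow> 'a::real_normed_vector set \<Rightarrow> ('a \<Rightarrow> 'b::real_normed_vector) \<Rightarrow> bool" where
  "Ck_on 0 S f \<longleftrightarrow> continuous_on S f"
| "Ck_on (Suc k) S f \<longleftrightarrow>
     f differentiable_on S \<and> (\<forall>v. Ck_on k S (\<lambda>x. frechet_derivative f (at x) v))"

text \<open>This is only used for open \<open>S\<close>.\<close>

definition smooth_on :: "'a::real_normed_vector set \<Rightarrow> ('a \<Rightarrow> 'b::real_normed_vector) \<Rightarrow> bool" where
  "smooth_on S f \<longleftrightarrow> (\<forall>k. Ck_on k S f)"

text \<open>A chart is a coordinate domain together with its coordinate map, whose values outside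
  the domain are irrelevant. A manifold is given by an atlas; its point set and its topology
  are the ones determined by the atlas.\<close>

type_synonym ('a, 'e) chart = "'a set \<times> ('a \<Rightarrow> 'e)"

definition points :: "('a, 'e) chart set \<Rightarrow> 'a set" where
  "points A = (\<Union>c\<in>A. fst c)"

abbreviation chart_inv :: "('a, 'e) chart \<Rightarrow> 'e \<Rightarrow> 'a" where
  "chart_inv c \<equiv> inv_into (fst c) (snd c)"

definition coord_rep :: "('a, 'e) chart \<Rightarrow> ('b, 'h) chart \<Rightarrow> ('a \<Rightarrow> 'b) \<Rightarrow> 'e \<Rightarrow> 'h" where
  "coord_rep c d F = (\<lambda>z. snd d (F (chart_inv c z)))"

definition smooth_atlas :: "('a, 'e::euclidean_space) chart set \<Rightarrow> bool" where
  "smooth_atlas A \<longleftrightarrow>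
     (\<forall>c\<in>A. inj_on (snd c) (fst c) \<and> open (snd c ` fst c)) \<and>
     (\<forall>c\<in>A. \<forall>d\<in>A. open (snd c ` (fst c \<inter> fst d)) \<and>
        smooth_on (snd c ` (fst c \<inter> fst d)) (coord_rep c d (\<lambda>x. x)))"

definition mfd_topology :: "('a, 'e::euclidean_space) chart set \<Rightarrow> 'a topology" where
  "mfd_topology A =
     topology (\<lambda>S. S \<subseteq> points A \<and> (\<forall>c\<in>A. open (snd c ` (fst c \<inter> S))))"

lemma openin_mfd_topology:
  assumes "smooth_atlas A"
  shows "openin (mfd_topology A) S \<longleftrightarrow> S \<subseteq> points A \<and> (\<forall>c\<in>A. open (snd c ` (fst c \<inter> S)))"
proof -
  let ?L = "\<lambda>S. S \<subseteq> points A \<and> (\<forall>c\<in>A. open (snd c ` (fst c \<inter> S)))"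
  have "istopology ?L"
    unfolding istopology_def
  proof (intro conjI allI impI)
    fix S T assume S: "?L S" and T: "?L T"
    show "S \<inter> T \<subseteq> points A" using S by blast
    show "\<forall>c\<in>A. open (snd c ` (fst c \<inter> (S \<inter> T)))"
    proof
      fix c assume c: "c \<in> A"
      then have "inj_on (snd c) (fst c)" using assms by (simp add: smooth_atlas_def)
      then have "snd c ` (fst c \<inter> (S \<inter> T)) = snd c ` (fst c \<inter> S) \<inter> snd c ` (fst c \<inter> T)"
        by (auto simp: inj_on_def)
      then show "open (snd c ` (fst c \<inter> (S \<inter> T)))" using S T c by (simp add: open_Int)
    qed
  next
    fix K assume K: "\<forall>S\<in>K. ?L S"
    show "\<Union>K \<subseteq> points A" using K by blast
    show "\<forall>c\<in>A. open (snd c ` (fst c \<inter> \<Union>K))"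
    proof
      fix c assume c: "c \<in> A"
      have "snd c ` (fst c \<inter> \<Union>K) = (\<Union>S\<in>K. snd c ` (fst c \<inter> S))" by auto
      then show "open (snd c ` (fst c \<inter> \<Union>K))" using K c by auto
    qed
  qed
  then show ?thesis by (simp add: mfd_topology_def)
qed

lemma topspace_mfd_topology:
  assumes "smooth_atlas A"
  shows "topspace (mfd_topology A) = points A"
proof
  show "topspace (mfd_topology A) \<subseteq> points A"
    using openin_mfd_topology[OF assms] openin_topspace by metis
  have "openin (mfd_topology A) (fst c)" if "c \<in> A" for c
    using assms that
    by (auto simp: openin_mfd_topology[OF assms] points_def smooth_atlas_def)
  then show "points A \<subseteq> topspace (mfd_topology A)"
    by (auto simp: points_def dest: openin_subset)
qed

definition smooth_manifold :: "('a, 'e::euclidean_space) chart set \<Rightarrow> bool" where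
  "smooth_manifold A \<longleftrightarrow>
     smooth_atlas A \<and> Hausdorff_space (mfd_topology A) \<and> second_countable (mfd_topology A)"

text \<open>An orientation is given by an atlas all of whose coordinate changes preserve the
  orientation of the model space.\<close>

definition oriented_atlas :: "('a, real^'n) chart set \<Rightarrow> bool" where
  "oriented_atlas A \<longleftrightarrow>
     (\<forall>c\<in>A. \<forall>d\<in>A. \<forall>p\<in>fst c \<inter> fst d.
        det (matrix (frechet_derivative (coord_rep c d (\<lambda>x. x)) (at (snd c p)))) > 0)"

definition restrict_atlas :: "('a, 'e) chart set \<Rightarrow> 'a set \<Rightarrow> ('a, 'e) chart set" where
  "restrict_atlas A U = (\<lambda>c. (fst c \<inter> U, snd c)) ` A"

lemma restrict_atlas_points [simp]: "restrict_atlas A (points A) = A"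
proof -
  have "(fst c \<inter> points A, snd c) = c" if "c \<in> A" for c
    using that by (auto simp: points_def prod_eq_iff)
  then show ?thesis by (simp add: restrict_atlas_def)
qed

definition smooth_map ::
  "('a, 'e::euclidean_space) chart set \<Rightarrow> ('b, 'h::euclidean_space) chart set \<Rightarrow> ('a \<Rightarrow> 'b) \<Rightarrow> bool" where
  "smooth_map A B F \<longleftrightarrow>
     F ` points A \<subseteq> points B \<and>
     (\<forall>c\<in>A. \<forall>d\<in>B.
        open (snd c ` (fst c \<inter> F -` fst d)) \<and>
        smooth_on (snd c ` (fst c \<inter> F -` fst d)) (coord_rep c d F))"

section \<open>Tangent vectors\<close>

text \<open>A tangent vector at \<open>p\<close> is a family of component vectors, one for each chart around
  \<open>p\<close>, which transforms by the derivatives of the coordinate changes. The entries for all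
  other charts are 0.\<close>

type_synonym ('a, 'e) tvec = "('a, 'e) chart \<Rightarrow> 'e"

definition tangent_space ::
  "('a, 'e::euclidean_space) chart set \<Rightarrow> 'a \<Rightarrow> ('a, 'e) tvec set" where
  "tangent_space A p =
     {v. (\<forall>c. \<not> (c \<in> A \<and> p \<in> fst c) \<longrightarrow> v c = 0) \<and>
         (\<forall>c\<in>A. \<forall>d\<in>A. p \<in> fst c \<and> p \<in> fst d \<longrightarrow>
            v d = frechet_derivative (coord_rep c d (\<lambda>x. x)) (at (snd c p)) (v c))}"

text \<open>The tangent vector at \<open>p\<close> with components \<open>w\<close> in the chart \<open>c\<close>.\<close>

definition coord_vec ::
  "('a, 'e::euclidean_space) chart set \<Rightarrow> ('a, 'e) chart \<Rightarrow> 'a \<Rightarrow> 'e \<Rightarrow> ('a, 'e) tvec" where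
  "coord_vec A c p w =
     (\<lambda>d. if d \<in> A \<and> p \<in> fst d
          then frechet_derivative (coord_rep c d (\<lambda>x. x)) (at (snd c p)) w else 0)"

definition tangent_atlas ::
  "('a, 'e::euclidean_space) chart set \<Rightarrow> ('a \<times> ('a, 'e) tvec, 'e \<times> 'e) chart set" where
  "tangent_atlas A =
     (\<lambda>c. ({(p, v). p \<in> fst c \<and> v \<in> tangent_space A p}, \<lambda>(p, v). (snd c p, v c))) ` A"

text \<open>An arbitrary chart around \<open>p\<close>; the notions below do not depend on which one is chosen.\<close>

definition chart_at :: "('a, 'e) chart set \<Rightarrow> 'a \<Rightarrow> ('a, 'e) chart" where
  "chart_at A p = (SOME c. c \<in> A \<and> p \<in> fst c)"

definition tangent_map ::
  "('a, 'e::euclidean_space) chart set \<Rightarrow> ('b, 'h::euclidean_space) chart set \<Rightarrow> ('a \<Rightarrow> 'b)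
    \<Rightarrow> 'a \<Rightarrow> ('a, 'e) tvec \<Rightarrow> ('b, 'h) tvec" where
  "tangent_map A B F p X =
     (let c = chart_at A p in
      (\<lambda>d. if d \<in> B \<and> F p \<in> fst d
           then frechet_derivative (coord_rep c d F) (at (snd c p)) (X c) else 0))"

definition immersion ::
  "('a, 'e::euclidean_space) chart set \<Rightarrow> ('b, 'h::euclidean_space) chart set \<Rightarrow> ('a \<Rightarrow> 'b) \<Rightarrow> bool" where
  "immersion A B F \<longleftrightarrow>
     smooth_map A B F \<and> (\<forall>p\<in>points A. inj_on (tangent_map A B F p) (tangent_space A p))"

section \<open>Riemannian manifolds\<close>

type_synonym ('a, 'e) metric = "'a \<Rightarrow> ('a, 'e) tvec \<Rightarrow> ('a, 'e) tvec \<Rightarrow> real"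

definition metric_coord ::
  "('a, 'e::euclidean_space) chart set \<Rightarrow> ('a, 'e) metric \<Rightarrow> ('a, 'e) chart \<Rightarrow> 'e \<Rightarrow> 'e \<Rightarrow> 'e \<Rightarrow> real" where
  "metric_coord B g d z u v =
     (let q = chart_inv d z in g q (coord_vec B d q u) (coord_vec B d q v))"

definition riemannian_metric ::
  "('a, 'e::euclidean_space) chart set \<Rightarrow> ('a, 'e) metric \<Rightarrow> bool" where
  "riemannian_metric B g \<longleftrightarrow>
     (\<forall>d\<in>B.
        (\<forall>z\<in>snd d ` fst d.
           bilinear (metric_coord B g d z) \<and>
           (\<forall>u v. metric_coord B g d z u v = metric_coord B g d z v u) \<and>
           (\<forall>u. u \<noteq> 0 \<longrightarrow> metric_coord B g d z u u > 0)) \<and>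
        (\<forall>u v. smooth_on (snd d ` fst d) (\<lambda>z. metric_coord B g d z u v)))"

definition metric_matrix ::
  "('a, real^'n) chart set \<Rightarrow> ('a, real^'n) metric \<Rightarrow> ('a, real^'n) chart \<Rightarrow> real^'n \<Rightarrow> real^'n^'n" where
  "metric_matrix B g d z = (\<chi> i j. metric_coord B g d z (axis i 1) (axis j 1))"

abbreviation partial_deriv :: "'n \<Rightarrow> (real^'n \<Rightarrow> real) \<Rightarrow> real^'n \<Rightarrow> real" where
  "partial_deriv i h z \<equiv> frechet_derivative h (at z) (axis i 1)"

text \<open>The Christoffel symbols \<open>\<Gamma>\<^sup>k\<^sub>i\<^sub>j\<close> of the Levi-Civita connection in the chart \<open>d\<close>.\<close>

definition christoffel ::
  "('a, real^'n) chart set \<Rightarrow> ('a, real^'n) metric \<Rightarrow> ('a, real^'n) chart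
    \<Rightarrow> 'n \<Rightarrow> 'n \<Rightarrow> 'n \<Rightarrow> real^'n \<Rightarrow> real" where
  "christoffel B g d k i j z =
     (1/2) * (\<Sum>l\<in>UNIV. matrix_inv (metric_matrix B g d z) $ k $ l *
        (partial_deriv i (\<lambda>y. metric_matrix B g d y $ j $ l) z
         + partial_deriv j (\<lambda>y. metric_matrix B g d y $ i $ l) z
         - partial_deriv l (\<lambda>y. metric_matrix B g d y $ i $ j) z))"

text \<open>The Levi-Civita covariant derivative \<open>\<nabla>\<^sub>X V\<close> at \<open>p\<close> of a vector field \<open>V\<close> along
  a map \<open>F\<close>.\<close>

definition cov_deriv ::
  "('a, 'e::euclidean_space) chart set \<Rightarrow> ('b, real^'n) chart set \<Rightarrow> ('b, real^'n) metric
    \<Rightarrow> ('a \<Rightarrow> 'b) \<Rightarrow> ('a \<Rightarrow> ('b, real^'n) tvec) \<Rightarrow> 'a \<Rightarrow> ('a, 'e) tvec \<Rightarrow> ('b, real^'n) tvec" where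
  "cov_deriv A B g F V p X =
     (let c = chart_at A p in
      (\<lambda>d. if d \<in> B \<and> F p \<in> fst d
          then frechet_derivative (\<lambda>z. V (chart_inv c z) d) (at (snd c p)) (X c)
            + (\<chi> k. \<Sum>i\<in>UNIV. \<Sum>j\<in>UNIV.
                 christoffel B g d k i j (snd d (F p))
                 * tangent_map A B F p X d $ i * V p d $ j)
          else 0))"

text \<open>Coefficients of the curvature tensor:
  \<open>R(\<partial>\<^sub>i, \<partial>\<^sub>j) \<partial>\<^sub>k = \<nabla>\<^sub>i \<nabla>\<^sub>j \<partial>\<^sub>k - \<nabla>\<^sub>j \<nabla>\<^sub>i \<partial>\<^sub>k\<close> is the sum of these times
  \<open>\<partial>\<^sub>l\<close> over \<open>l\<close>.\<close>

definition curvature_coeff ::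
  "('a, real^'n) chart set \<Rightarrow> ('a, real^'n) metric \<Rightarrow> ('a, real^'n) chart
    \<Rightarrow> 'n \<Rightarrow> 'n \<Rightarrow> 'n \<Rightarrow> 'n \<Rightarrow> real^'n \<Rightarrow> real" where
  "curvature_coeff B g d l i j k z =
     partial_deriv i (christoffel B g d l j k) z - partial_deriv j (christoffel B g d l i k) z
     + (\<Sum>m\<in>UNIV. christoffel B g d m j k z * christoffel B g d l i m z
          - christoffel B g d m i k z * christoffel B g d l j m z)"

definition curvature_op ::
  "('a, real^'n) chart set \<Rightarrow> ('a, real^'n) metric \<Rightarrow> ('a, real^'n) chart
    \<Rightarrow> real^'n \<Rightarrow> real^'n \<Rightarrow> real^'n \<Rightarrow> real^'n \<Rightarrow> real^'n" where
  "curvature_op B g d z u v w =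
     (\<chi> l. \<Sum>i\<in>UNIV. \<Sum>j\<in>UNIV. \<Sum>k\<in>UNIV.
        curvature_coeff B g d l i j k z * u $ i * v $ j * w $ k)"

definition sectional_curvature ::
  "('a, real^'n) chart set \<Rightarrow> ('a, real^'n) metric \<Rightarrow> ('a, real^'n) chart
    \<Rightarrow> real^'n \<Rightarrow> real^'n \<Rightarrow> real^'n \<Rightarrow> real" where
  "sectional_curvature B g d z u v =
     (let G = metric_coord B g d z in
      G (curvature_op B g d z u v v) u / (G u u * G v v - (G u v)\<^sup>2))"

definition constant_curvature ::
  "('a, real^'n) chart set \<Rightarrow> ('a, real^'n) metric \<Rightarrow> real \<Rightarrow> bool" where
  "constant_curvature B g \<kappa> \<longleftrightarrow>
     (\<forall>d\<in>B. \<forall>z\<in>snd d ` fst d. \<forall>u v.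
        u \<noteq> v \<and> independent {u, v} \<longrightarrow> sectional_curvature B g d z u v = \<kappa>)"

definition line_atlas :: "(real, real) chart set" where
  "line_atlas = {(UNIV, \<lambda>t. t)}"

definition unit_tangent :: "real \<Rightarrow> (real, real) tvec" where
  "unit_tangent t = coord_vec line_atlas (UNIV, \<lambda>t. t) t 1"

definition velocity :: "('b, real^'n) chart set \<Rightarrow> (real \<Rightarrow> 'b) \<Rightarrow> real \<Rightarrow> ('b, real^'n) tvec" where
  "velocity B \<gamma> t = tangent_map line_atlas B \<gamma> t (unit_tangent t)"

definition geodesic ::
  "('b, real^'n) chart set \<Rightarrow> ('b, real^'n) metric \<Rightarrow> (real \<Rightarrow> 'b) \<Rightarrow> bool" where
  "geodesic B g \<gamma> \<longleftrightarrow>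
     smooth_map line_atlas B \<gamma> \<and>
     (\<forall>t. cov_deriv line_atlas B g \<gamma> (velocity B \<gamma>) t (unit_tangent t) = (\<lambda>_. 0))"

text \<open>Completeness in the sense of geodesics: every tangent vector is the initial velocity of
  a geodesic defined on the whole real line.\<close>

definition complete_metric :: "('b, real^'n) chart set \<Rightarrow> ('b, real^'n) metric \<Rightarrow> bool" where
  "complete_metric B g \<longleftrightarrow>
     (\<forall>q\<in>points B. \<forall>v\<in>tangent_space B q.
        \<exists>\<gamma>. geodesic B g \<gamma> \<and> \<gamma> 0 = q \<and> velocity B \<gamma> 0 = v)"

section \<open>Fronts\<close>

text \<open>Here \<open>A\<close> is the atlas of the source surface, \<open>B\<close> and \<open>g\<close> those of the target and its
  metric. The unit tangent bundle is a regular submanifold of the tangent bundle, so that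
  an immersion into it is an immersion into the tangent bundle taking values in it.\<close>

definition unit_normal_on ::
  "('a, 'e::euclidean_space) chart set \<Rightarrow> ('b, 'h::euclidean_space) chart set \<Rightarrow> ('b, 'h) metric
    \<Rightarrow> 'a set \<Rightarrow> ('a \<Rightarrow> 'b) \<Rightarrow> ('a \<Rightarrow> ('b, 'h) tvec) \<Rightarrow> bool" where
  "unit_normal_on A B g U f \<nu> \<longleftrightarrow>
     (\<forall>p\<in>U. \<nu> p \<in> tangent_space B (f p) \<and> g (f p) (\<nu> p) (\<nu> p) = 1 \<and>
        (\<forall>X\<in>tangent_space A p. g (f p) (tangent_map A B f p X) (\<nu> p) = 0)) \<and>
     immersion (restrict_atlas A U) (tangent_atlas B) (\<lambda>p. (f p, \<nu> p))"

definition front ::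
  "('a, 'e::euclidean_space) chart set \<Rightarrow> ('b, 'h::euclidean_space) chart set \<Rightarrow> ('b, 'h) metric
    \<Rightarrow> ('a \<Rightarrow> 'b) \<Rightarrow> bool" where
  "front A B g f \<longleftrightarrow>
     smooth_map A B f \<and>
     (\<forall>p\<in>points A. \<exists>U \<nu>. openin (mfd_topology A) U \<and> p \<in> U \<and> unit_normal_on A B g U f \<nu>)"

text \<open>The fibre at \<open>p\<close> of the limiting tangent bundle \<open>\<E>\<^sub>f\<close>.\<close>

definition normal_complement ::
  "('b, 'h::euclidean_space) chart set \<Rightarrow> ('b, 'h) metric \<Rightarrow> ('a \<Rightarrow> 'b) \<Rightarrow> ('a \<Rightarrow> ('b, 'h) tvec)
    \<Rightarrow> 'a \<Rightarrow> ('b, 'h) tvec set" where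
  "normal_complement B g f \<nu> p = {w \<in> tangent_space B (f p). g (f p) w (\<nu> p) = 0}"

definition lincomb ::
  "real \<Rightarrow> ('b, 'h::real_vector) tvec \<Rightarrow> real \<Rightarrow> ('b, 'h) tvec \<Rightarrow> ('b, 'h) tvec" where
  "lincomb a v b w = (\<lambda>d. a *\<^sub>R v d + b *\<^sub>R w d)"

definition plane_basis ::
  "('b, 'h::real_vector) tvec set \<Rightarrow> ('b, 'h) tvec \<Rightarrow> ('b, 'h) tvec \<Rightarrow> bool" where
  "plane_basis P e1 e2 \<longleftrightarrow>
     P = {lincomb a e1 b e2 | a b. True} \<and>
     (\<forall>a b. lincomb a e1 b e2 = (\<lambda>_. 0) \<longrightarrow> a = 0 \<and> b = 0)"

text \<open>An orientation of a rank two subbundle \<open>E\<close> of the pullback of the tangent bundle along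
  \<open>f\<close>: at each point a class \<open>\<omega> p\<close> of ordered bases of the fibre related by positive
  determinants, represented near every point by a smooth frame.\<close>

definition bundle_orientation ::
  "('a, 'e::euclidean_space) chart set \<Rightarrow> ('b, 'h::euclidean_space) chart set \<Rightarrow> ('a \<Rightarrow> 'b)
    \<Rightarrow> ('a \<Rightarrow> ('b, 'h) tvec set) \<Rightarrow> ('a \<Rightarrow> (('b, 'h) tvec \<times> ('b, 'h) tvec) set) \<Rightarrow> bool" where
  "bundle_orientation A B f E \<omega> \<longleftrightarrow>
     (\<forall>p\<in>points A. \<exists>e1 e2. plane_basis (E p) e1 e2 \<and>
        \<omega> p = {(lincomb a e1 b e2, lincomb a' e1 b' e2) | a b a' b'. a * b' - b * a' > 0}) \<and>
     (\<forall>p\<in>points A. \<exists>U s1 s2. openin (mfd_topology A) U \<and> p \<in> U \<and>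
        smooth_map (restrict_atlas A U) (tangent_atlas B) (\<lambda>q. (f q, s1 q)) \<and>
        smooth_map (restrict_atlas A U) (tangent_atlas B) (\<lambda>q. (f q, s2 q)) \<and>
        (\<forall>q\<in>U. (s1 q, s2 q) \<in> \<omega> q))"

definition co_oriented_front ::
  "('a, 'e::euclidean_space) chart set \<Rightarrow> ('b, 'h::euclidean_space) chart set \<Rightarrow> ('b, 'h) metric
    \<Rightarrow> ('a \<Rightarrow> 'b) \<Rightarrow> ('a \<Rightarrow> ('b, 'h) tvec)
    \<Rightarrow> ('a \<Rightarrow> (('b, 'h) tvec \<times> ('b, 'h) tvec) set) \<Rightarrow> bool" where
  "co_oriented_front A B g f \<nu> \<omega> \<longleftrightarrow>
     front A B g f \<and> unit_normal_on A B g (points A) f \<nu> \<and>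
     bundle_orientation A B f (normal_complement B g f \<nu>) \<omega>"

definition singular_set ::
  "('a, 'e::euclidean_space) chart set \<Rightarrow> ('b, 'h::euclidean_space) chart set \<Rightarrow> ('b, 'h) metric
    \<Rightarrow> ('a \<Rightarrow> 'b) \<Rightarrow> ('a \<Rightarrow> ('b, 'h) tvec) \<Rightarrow> 'a set" where
  "singular_set A B g f \<nu> =
     {p \<in> points A.
        \<not> bij_betw (tangent_map A B f p) (tangent_space A p) (normal_complement B g f \<nu> p)}"

definition fundamental_form_I ::
  "('a, 'e::euclidean_space) chart set \<Rightarrow> ('b, 'h::euclidean_space) chart set \<Rightarrow> ('b, 'h) metric
    \<Rightarrow> ('a \<Rightarrow> 'b) \<Rightarrow> 'a \<Rightarrow> ('a, 'e) tvec \<Rightarrow> ('a, 'e) tvec \<Rightarrow> real" where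
  "fundamental_form_I A B g f p X Y =
     g (f p) (tangent_map A B f p X) (tangent_map A B f p Y)"

definition fundamental_form_II ::
  "('a, 'e::euclidean_space) chart set \<Rightarrow> ('b, real^'n) chart set \<Rightarrow> ('b, real^'n) metric
    \<Rightarrow> ('a \<Rightarrow> 'b) \<Rightarrow> ('a \<Rightarrow> ('b, real^'n) tvec) \<Rightarrow> 'a \<Rightarrow> ('a, 'e) tvec \<Rightarrow> ('a, 'e) tvec \<Rightarrow> real" where
  "fundamental_form_II A B g f \<nu> p X Y =
     - g (f p) (tangent_map A B f p X) (cov_deriv A B g f \<nu> p Y)"

definition form_matrix ::
  "('a, real^'m) chart set \<Rightarrow> 'a \<Rightarrow> (('a, real^'m) tvec \<Rightarrow> ('a, real^'m) tvec \<Rightarrow> real)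
    \<Rightarrow> real^'m^'m" where
  "form_matrix A p h =
     (let c = chart_at A p in
      (\<chi> i j. h (coord_vec A c p (axis i 1)) (coord_vec A c p (axis j 1))))"

definition extrinsic_curvature ::
  "('a, real^'m) chart set \<Rightarrow> ('b, real^'n) chart set \<Rightarrow> ('b, real^'n) metric
    \<Rightarrow> ('a \<Rightarrow> 'b) \<Rightarrow> ('a \<Rightarrow> ('b, real^'n) tvec) \<Rightarrow> 'a \<Rightarrow> real" where
  "extrinsic_curvature A B g f \<nu> p =
     det (form_matrix A p (fundamental_form_II A B g f \<nu> p))
     / det (form_matrix A p (fundamental_form_I A B g f p))"

section \<open>Euler characteristic\<close>

text \<open>The rank of an abelian group, used for groups of finite rank only: the largest number of
  elements that are linearly independent over the integers.\<close>

definition int_independent :: "('a, 'b) monoid_scheme \<Rightarrow> 'a set \<Rightarrow> bool" where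
  "int_independent G S \<longleftrightarrow>
     finite S \<and> S \<subseteq> carrier G \<and>
     (\<forall>a :: 'a \<Rightarrow> int. finprod G (\<lambda>x. x [^]\<^bsub>G\<^esub> a x) S = \<one>\<^bsub>G\<^esub> \<longrightarrow> (\<forall>x\<in>S. a x = 0))"

definition abelian_rank :: "('a, 'b) monoid_scheme \<Rightarrow> nat" where
  "abelian_rank G = Sup {card S | S. int_independent G S}"

text \<open>Used for compact manifolds: their integral singular homology is finitely generated and
  vanishes above the dimension.\<close>

definition euler_characteristic :: "('a, 'e::euclidean_space) chart set \<Rightarrow> int" where
  "euler_characteristic A =
     (\<Sum>k\<le>DIM('e). (-1) ^ k * int (abelian_rank (homology_group (int k) (mfd_topology A))))"

end

theory Submission
  imports Defs
begin

text \<open>A principal direction is a tangent vector \<open>w\<close> for which \<open>\<phi>(w)\<close> and \<open>\<psi>(w)\<close> are linearly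
  dependent, that is, a zero of the quadratic form \<open>w \<mapsto> vol(\<phi>(w), \<psi>(w), \<nu>)\<close>. Where the
  extrinsic curvature is negative this form is indefinite. Boundedness of \<open>log |K\<^sup>e\<^sup>x\<^sup>t|\<close> says
  that \<open>det \<phi>\<close> and \<open>det \<psi>\<close> are comparable on a dense set, hence everywhere, so at a singular
  point both maps have rank one; their kernels are different because \<open>(f, \<nu>)\<close> is an immersion,
  and the form is still indefinite. Thus the principal directions form two transverse line fields
  on all of \<open>M\<^sup>2\<close>, up to their order.

  In place of the Poincare-Hopf theorem, the leaves of the two line fields, which are locally
  Lipschitz, give topological charts in which every coordinate change has the form
  \<open>(x, y) \<mapsto> (\<alpha>(x), \<beta>(y))\<close> or \<open>(x, y) \<mapsto> (\<beta>(y), \<alpha>(x))\<close>. Cover \<open>M\<^sup>2\<close> by finitely many small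
  open coordinate boxes. All their nonempty intersections are boxes, so that \<open>\<chi>(M\<^sup>2)\<close> is the alternating
  number of nonempty intersections. Each of these has four corners, and each corner lies in some
  open box of the cover; adding or removing this box pairs off the terms with opposite signs.\<close>

section \<open>Homological algebra: ranks of abelian groups, Euler numbers of pairs, vanishing above
  a degree\<close>

section \<open>Ranks of abelian groups\<close>

text \<open>\<open>euler_characteristic\<close> stops at degree 2, so two separate facts are
  established: the stable value of the alternating sum of ranks, which is additive over unions
  (\<open>has_euler\<close>), and the vanishing of homology above degree 2 (\<open>hvan\<close>),
  which rests on finite unions of open boxes in the plane having no homology above degree 1. The
  obstacle in the count is that the boxes belong to different charts. The cover is made so fine that
  a closed box meeting another one lies in the chart domain of the latter. As coordinate changes act
  on the two coordinates separately, an intersection is a box in each chart concerned, and its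
  corners are points of the surface that do not depend on the chart. The passage to the singular set
  avoids division: if p and q are the oriented areas of the images of a coordinate basis under
  \<phi> and \<psi>, the curvature bound reads p^2 + C p q \<le> 0 and q^2 + C p q \<le> 0. These
  conditions are closed, and they leave only p q < 0 or p = q = 0; in both cases the form is
  indefinite.\<close>

lemma integer_system_solvable:
  fixes A :: "'j \<Rightarrow> 'i \<Rightarrow> int"
  assumes "finite J" "finite I" "card J < card I"
  shows "\<exists>x. (\<exists>i\<in>I. x i \<noteq> 0) \<and> (\<forall>j\<in>J. (\<Sum>i\<in>I. A j i * x i) = 0)"
  using assms
proof (induction J arbitrary: I A rule: finite_induct)
  case empty
  then have "I \<noteq> {}" by auto
  then show ?case by (intro exI[of _ "\<lambda>_. 1"]) auto
next
  case (insert j J)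
  show ?case
  proof (cases "\<forall>i\<in>I. A j i = 0")
    case True
    have "card J < card I" using insert.prems insert.hyps by simp
    from insert.IH[OF \<open>finite I\<close> this, of A]
    obtain x where x: "\<exists>i\<in>I. x i \<noteq> 0" "\<forall>j\<in>J. (\<Sum>i\<in>I. A j i * x i) = 0" by blast
    have "(\<Sum>i\<in>I. A j i * x i) = 0" using True by (intro sum.neutral) auto
    with x show ?thesis by blast
  next
    case False
    then obtain k where k: "k \<in> I" "A j k \<noteq> 0" by auto
    let ?I = "I - {k}"
    have fin: "finite ?I" and card: "card J < card ?I" using insert.prems insert.hyps k by auto
    \<comment> \<open>Elimination of the unknown \<open>k\<close> without division: each remaining
      equation is multiplied by the pivot \<open>A j k\<close>. The other unknowns are later scaled
      by the same pivot, so that \<open>x k\<close> stays an integer.\<close>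
    from insert.IH[OF fin card, of "\<lambda>j' i. A j k * A j' i - A j' k * A j i"]
    obtain y where y: "\<exists>i\<in>?I. y i \<noteq> 0"
      and y0: "\<And>j'. j' \<in> J \<Longrightarrow> (\<Sum>i\<in>?I. (A j k * A j' i - A j' k * A j i) * y i) = 0" by blast
    define x where "x i = (if i = k then - (\<Sum>i\<in>?I. A j i * y i) else A j k * y i)" for i
    have sum: "(\<Sum>i\<in>I. A j' i * x i)
        = A j k * (\<Sum>i\<in>?I. A j' i * y i) - A j' k * (\<Sum>i\<in>?I. A j i * y i)" for j'
    proof -
      have "(\<Sum>i\<in>I. A j' i * x i) = A j' k * x k + (\<Sum>i\<in>?I. A j' i * x i)"
        using k \<open>finite I\<close> by (simp add: sum.remove)
      also have "(\<Sum>i\<in>?I. A j' i * x i) = (\<Sum>i\<in>?I. A j k * (A j' i * y i))"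
        by (intro sum.cong) (auto simp: x_def)
      finally show ?thesis by (simp add: x_def sum_distrib_left)
    qed
    have "(\<Sum>i\<in>I. A j' i * x i) = 0" if "j' \<in> insert j J" for j'
    proof (cases "j' = j")
      case True
      then show ?thesis by (simp add: sum)
    next
      case False
      then have "(\<Sum>i\<in>?I. (A j k * A j' i - A j' k * A j i) * y i) = 0" using that y0 by auto
      moreover have "(\<Sum>i\<in>?I. (A j k * A j' i - A j' k * A j i) * y i)
          = A j k * (\<Sum>i\<in>?I. A j' i * y i) - A j' k * (\<Sum>i\<in>?I. A j i * y i)"
        by (simp add: sum_distrib_left left_diff_distrib mult.assoc sum_subtractf)
      ultimately show ?thesis by (simp add: sum)
    qed
    moreover have "\<exists>i\<in>I. x i \<noteq> 0" using y k by (auto simp: x_def)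
    ultimately show ?thesis by blast
  qed
qed

definition zcomb :: "('a, 'b) monoid_scheme \<Rightarrow> ('a \<Rightarrow> int) \<Rightarrow> 'a set \<Rightarrow> 'a" where
  "zcomb G a S = finprod G (\<lambda>x. x [^]\<^bsub>G\<^esub> a x) S"

text \<open>\<open>abelian_rank\<close> is a supremum, meaningful only if it is attained; here the
  maximum is required to exist. The subset \<open>K\<close> lets kernels and images be ranked inside
  the ambient group.\<close>

definition has_rank :: "('a, 'b) monoid_scheme \<Rightarrow> 'a set \<Rightarrow> nat \<Rightarrow> bool" where
  "has_rank G K r \<longleftrightarrow>
     (\<exists>S\<subseteq>K. int_independent G S \<and> card S = r) \<and> (\<forall>S\<subseteq>K. int_independent G S \<longrightarrow> card S \<le> r)"

lemma int_independent_zcomb: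
  "int_independent G S \<longleftrightarrow> finite S \<and> S \<subseteq> carrier G \<and>
     (\<forall>a. zcomb G a S = \<one>\<^bsub>G\<^esub> \<longrightarrow> (\<forall>x\<in>S. a x = 0))"
  by (simp add: int_independent_def zcomb_def)

lemma has_rank_unique: "has_rank G K r \<Longrightarrow> has_rank G K s \<Longrightarrow> r = s"
  by (metis has_rank_def le_antisym)

lemma abelian_rank_eq: "has_rank G (carrier G) r \<Longrightarrow> abelian_rank G = r"
  unfolding abelian_rank_def has_rank_def
  by (intro cSup_eq_maximum) (auto simp: int_independent_def)

lemma has_rank_exists:
  assumes "\<And>S. S \<subseteq> K \<Longrightarrow> int_independent G S \<Longrightarrow> card S \<le> n"
  shows "\<exists>r\<le>n. has_rank G K r"
proof -
  let ?X = "{card S | S. S \<subseteq> K \<and> int_independent G S}"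
  have fin: "finite ?X" by (rule finite_subset[of _ "{..n}"]) (use assms in auto)
  have "int_independent G {}" by (simp add: int_independent_def)
  then have ne: "?X \<noteq> {}" by blast
  have "Max ?X \<in> ?X" using Max_in[OF fin ne] .
  then obtain S where S: "S \<subseteq> K" "int_independent G S" "card S = Max ?X" by auto
  then have "has_rank G K (card S)"
    using Max_ge[OF fin] unfolding has_rank_def by auto
  then show ?thesis using assms S by blast
qed

context comm_group begin

lemma zcomb_closed: "S \<subseteq> carrier G \<Longrightarrow> zcomb G a S \<in> carrier G"
  unfolding zcomb_def by (intro finprod_closed) auto

lemma zcomb_insert:
  assumes "finite S" "x \<notin> S" "insert x S \<subseteq> carrier G"
  shows "zcomb G a (insert x S) = x [^] a x \<otimes> zcomb G a S"
  using assms unfolding zcomb_def by (subst finprod_insert) auto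

lemma zcomb_empty [simp]: "zcomb G a {} = \<one>" by (simp add: zcomb_def)

lemma zcomb_cong: "S \<subseteq> carrier G \<Longrightarrow> (\<And>x. x \<in> S \<Longrightarrow> a x = b x) \<Longrightarrow> zcomb G a S = zcomb G b S"
  unfolding zcomb_def by (intro finprod_cong') auto

lemma zcomb_zero: "S \<subseteq> carrier G \<Longrightarrow> (\<And>x. x \<in> S \<Longrightarrow> a x = 0) \<Longrightarrow> zcomb G a S = \<one>"
  unfolding zcomb_def by (intro finprod_one_eqI) auto

lemma zcomb_Un:
  assumes "finite S" "finite T" "S \<inter> T = {}" "S \<union> T \<subseteq> carrier G"
  shows "zcomb G a (S \<union> T) = zcomb G a S \<otimes> zcomb G a T"
  using assms unfolding zcomb_def by (intro finprod_Un_disjoint) auto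

lemma int_pow_zcomb:
  assumes "finite S" "S \<subseteq> carrier G"
  shows "zcomb G a S [^] (n::int) = zcomb G (\<lambda>x. n * a x) S"
  using assms
proof (induction S rule: finite_induct)
  case (insert x S)
  then show ?case
    by (simp add: zcomb_insert zcomb_closed int_pow_distrib int_pow_pow mult.commute)
qed simp

lemma zcomb_add:
  assumes "finite S" "S \<subseteq> carrier G"
  shows "zcomb G a S \<otimes> zcomb G b S = zcomb G (\<lambda>x. a x + b x) S"
  using assms
proof (induction S rule: finite_induct)
  case (insert x S)
  then have c: "zcomb G a S \<in> carrier G" "zcomb G b S \<in> carrier G" "x \<in> carrier G"
    by (auto intro: zcomb_closed)
  have "zcomb G a (insert x S) \<otimes> zcomb G b (insert x S)
      = (x [^] a x \<otimes> zcomb G a S) \<otimes> (x [^] b x \<otimes> zcomb G b S)"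
    using insert by (simp add: zcomb_insert)
  also have "\<dots> = (x [^] a x \<otimes> x [^] b x) \<otimes> (zcomb G a S \<otimes> zcomb G b S)"
    using c by (simp add: m_ac)
  also have "\<dots> = x [^] (a x + b x) \<otimes> zcomb G (\<lambda>x. a x + b x) S"
    using c insert by (simp add: int_pow_mult)
  finally show ?case using insert by (simp add: zcomb_insert)
qed simp

lemma finprod_zcomb:
  assumes "finite U" "finite S" "S \<subseteq> carrier G"
  shows "finprod G (\<lambda>u. zcomb G (A u) S) U = zcomb G (\<lambda>x. \<Sum>u\<in>U. A u x) S"
  using \<open>finite U\<close>
proof (induction U rule: finite_induct)
  case empty
  then show ?case using assms by (simp add: zcomb_zero)
next
  case (insert u U)
  then show ?case using assms by (simp add: zcomb_closed zcomb_add)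
qed

lemma one_notin_independent: "int_independent G S \<Longrightarrow> \<one> \<notin> S"
proof
  assume S: "int_independent G S" "\<one> \<in> S"
  have "zcomb G (\<lambda>x. if x = \<one> then 1 else 0) S = \<one>"
    unfolding zcomb_def by (intro finprod_one_eqI) auto
  with S show False by (auto simp: int_independent_zcomb dest!: spec)
qed

text \<open>By maximality \<open>insert u S\<close> is dependent, and the coefficient of
  \<open>u\<close> in a relation cannot vanish because \<open>S\<close> is independent. Integers
  cannot be divided and torsion may occur, so only a multiple of \<open>u\<close> is
  reached.\<close>

lemma maximal_independent_spans:
  assumes r: "has_rank G K r" and S: "S \<subseteq> K" "int_independent G S" "card S = r"
    and u: "u \<in> K" "u \<in> carrier G"
  shows "\<exists>n a. n \<noteq> 0 \<and> u [^] (n::int) = zcomb G a S"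
proof (cases "u \<in> S")
  case True
  have fin: "finite S" and SG: "S \<subseteq> carrier G" using S by (auto simp: int_independent_def)
  let ?a = "\<lambda>x. if x = u then 1 else (0::int)"
  have "S = insert u (S - {u})" using True by auto
  then have "zcomb G ?a S = zcomb G ?a (insert u (S - {u}))" by simp
  also have "\<dots> = u [^] (1::int) \<otimes> zcomb G ?a (S - {u})"
    using fin SG u by (subst zcomb_insert) auto
  also have "zcomb G ?a (S - {u}) = \<one>" using SG by (intro zcomb_zero) auto
  finally have "u [^] (1::int) = zcomb G ?a S" using u by (simp add: int_pow_1)
  then show ?thesis by (intro exI[of _ "1::int"] exI[of _ ?a]) simp
next
  case False
  have fin: "finite S" and SG: "S \<subseteq> carrier G" using S by (auto simp: int_independent_def)
  have "\<not> int_independent G (insert u S)"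
    using r S False u fin unfolding has_rank_def by (metis card_insert_disjoint insert_subset not_less_eq_eq order_refl)
  then obtain a x where a: "zcomb G a (insert u S) = \<one>" "x \<in> insert u S" "a x \<noteq> 0"
    using fin SG u by (auto simp: int_independent_zcomb)
  have eq: "u [^] a u \<otimes> zcomb G a S = \<one>" using a(1) False fin SG u by (simp add: zcomb_insert)
  have "a u \<noteq> 0"
  proof
    assume "a u = 0"
    then have "zcomb G a S = \<one>" using eq zcomb_closed[OF SG] by simp
    then show False using S \<open>a u = 0\<close> a by (auto simp: int_independent_zcomb)
  qed
  moreover have "u [^] a u = zcomb G a S [^] (-1::int)"
    using eq zcomb_closed[OF SG] u by (metis int_pow_1 int_pow_closed int_pow_neg inv_equality inv_inv)
  ultimately show ?thesis using int_pow_zcomb[OF fin SG] by metis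
qed

text \<open>Exchange argument: expressing multiples of the elements of \<open>U\<close> by
  \<open>S\<close> turns a relation among them into \<open>card S\<close> integer equations for
  \<open>card U\<close> unknowns, solvable in a nontrivial way as soon as \<open>U\<close> is
  larger.\<close>

lemma independent_card_le:
  assumes U: "int_independent G U" and S: "finite S" "S \<subseteq> carrier G"
    and span: "\<And>u. u \<in> U \<Longrightarrow> \<exists>n a. n \<noteq> 0 \<and> u [^] (n::int) = zcomb G a S"
  shows "card U \<le> card S"
proof (rule ccontr)
  assume "\<not> card U \<le> card S"
  then have less: "card S < card U" by simp
  have fin: "finite U" and UG: "U \<subseteq> carrier G" using U by (auto simp: int_independent_def)
  from span obtain n A where nA: "\<And>u. u \<in> U \<Longrightarrow> n u \<noteq> (0::int)"
    "\<And>u. u \<in> U \<Longrightarrow> u [^] n u = zcomb G (A u) S" by metis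
  from integer_system_solvable[OF S(1) fin less, of "\<lambda>s u. A u s"]
  obtain x where x: "\<exists>i\<in>U. x i \<noteq> 0" "\<And>s. s \<in> S \<Longrightarrow> (\<Sum>u\<in>U. A u s * x u) = 0" by blast
  have "zcomb G (\<lambda>u. n u * x u) U = finprod G (\<lambda>u. zcomb G (\<lambda>s. x u * A u s) S) U"
    unfolding zcomb_def[of G _ U]
  proof (intro finprod_cong')
    fix u assume u: "u \<in> U"
    then have "u [^] (n u * x u) = (u [^] n u) [^] x u" using UG by (auto simp: int_pow_pow)
    then show "u [^] (n u * x u) = zcomb G (\<lambda>s. x u * A u s) S"
      using nA(2)[OF u] S by (simp add: int_pow_zcomb)
  qed (use S in \<open>auto simp: zcomb_closed\<close>)
  also have "\<dots> = zcomb G (\<lambda>s. \<Sum>u\<in>U. x u * A u s) S" using fin S by (rule finprod_zcomb)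
  also have "\<dots> = \<one>" using S x(2) by (intro zcomb_zero) (auto simp: mult.commute)
  finally have "zcomb G (\<lambda>u. n u * x u) U = \<one>" .
  moreover have "\<forall>a. zcomb G a U = \<one> \<longrightarrow> (\<forall>u\<in>U. a u = 0)" using U by (simp add: int_independent_zcomb)
  ultimately have "\<forall>u\<in>U. n u * x u = 0" by blast
  then show False using x nA by auto
qed

end

lemma hom_zcomb:
  assumes "comm_group G" "comm_group H" "h \<in> hom G H" "finite S" "S \<subseteq> carrier G"
  shows "h (zcomb G a S) = finprod H (\<lambda>x. h x [^]\<^bsub>H\<^esub> a x) S"
proof -
  interpret G: comm_group G by fact
  interpret H: comm_group H by fact
  interpret group_hom G H h using assms by (simp add: group_hom_def group_hom_axioms_def G.is_group H.is_group)
  show ?thesis using assms(4,5)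
  proof (induction S rule: finite_induct)
    case (insert x S)
    then have "(\<lambda>x. h x [^]\<^bsub>H\<^esub> a x) \<in> S \<rightarrow> carrier H" by auto
    with insert show ?case by (simp add: G.zcomb_insert G.zcomb_closed hom_int_pow)
  qed simp
qed

text \<open>Under \<open>h\<close> a relation loses its kernel part, so the coefficients on the
  lifted elements vanish first, and then those on \<open>S\<close>.\<close>

lemma independent_lift:
  assumes GH: "comm_group G" "comm_group H" and h: "h \<in> hom G H"
    and S: "int_independent G S" "S \<subseteq> kernel G H h"
    and T: "int_independent H T" and l: "\<And>t. t \<in> T \<Longrightarrow> l t \<in> carrier G \<and> h (l t) = t"
  shows "int_independent G (S \<union> l ` T)" "card (S \<union> l ` T) = card S + card T"
proof -
  interpret G: comm_group G by fact
  interpret H: comm_group H by fact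
  interpret group_hom G H h using assms by (simp add: group_hom_def group_hom_axioms_def G.is_group H.is_group)
  have fin: "finite S" "finite T" and SG: "S \<subseteq> carrier G" using S T by (auto simp: int_independent_def)
  have inj: "inj_on l T" using l by (metis inj_onI)
  have disj: "S \<inter> l ` T = {}"
    using S(2) l H.one_notin_independent[OF T] by (auto simp: kernel_def)
  show "card (S \<union> l ` T) = card S + card T"
    using fin disj inj by (simp add: card_Un_disjoint card_image)
  have lG: "l ` T \<subseteq> carrier G" using l by auto
  show "int_independent G (S \<union> l ` T)"
    unfolding int_independent_zcomb
  proof (intro conjI allI impI)
    fix a assume a: "zcomb G a (S \<union> l ` T) = \<one>\<^bsub>G\<^esub>"
    have eq: "zcomb G a S \<otimes>\<^bsub>G\<^esub> zcomb G a (l ` T) = \<one>\<^bsub>G\<^esub>"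
      using a G.zcomb_Un[of S "l ` T" a] fin disj SG lG by simp
    have hS: "h (zcomb G a S) = \<one>\<^bsub>H\<^esub>"
      unfolding hom_zcomb[OF GH h fin(1) SG]
      using S(2) by (intro H.finprod_one_eqI) (auto simp: kernel_def)
    have "h (zcomb G a S) \<otimes>\<^bsub>H\<^esub> h (zcomb G a (l ` T)) = \<one>\<^bsub>H\<^esub>"
      using eq SG lG by (metis G.zcomb_closed hom_mult hom_one)
    then have "h (zcomb G a (l ` T)) = \<one>\<^bsub>H\<^esub>" using hS G.zcomb_closed[OF lG] by simp
    moreover have "h (zcomb G a (l ` T)) = finprod H (\<lambda>x. h x [^]\<^bsub>H\<^esub> a x) (l ` T)"
      using GH h fin lG by (intro hom_zcomb) auto
    moreover have "\<dots> = finprod H (\<lambda>t. h (l t) [^]\<^bsub>H\<^esub> a (l t)) T"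
      using inj lG by (subst H.finprod_reindex) auto
    moreover have "\<dots> = zcomb H (\<lambda>t. a (l t)) T"
      unfolding zcomb_def using T l by (intro H.finprod_cong') (auto simp: int_independent_def)
    ultimately have "\<forall>t\<in>T. a (l t) = 0" using T by (auto simp: int_independent_zcomb)
    then have aT: "\<forall>x\<in>l ` T. a x = 0" by auto
    then have "zcomb G a (l ` T) = \<one>\<^bsub>G\<^esub>" using lG by (intro G.zcomb_zero) auto
    then have "zcomb G a S = \<one>\<^bsub>G\<^esub>" using eq G.zcomb_closed[OF SG] by simp
    then have "\<forall>x\<in>S. a x = 0" using S by (auto simp: int_independent_zcomb)
    with aT show "\<forall>x\<in>S \<union> l ` T. a x = 0" by auto
  qed (use fin SG lG in auto)
qed

text \<open>Rank-nullity up to multiples. For the upper bound, a multiple of \<open>h u\<close> is a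
  combination of \<open>T\<close>; subtracting its lift lands in the kernel, where a further
  multiple is a combination of \<open>S\<close>.\<close>

lemma has_rank_hom:
  assumes GH: "comm_group G" "comm_group H" and h: "h \<in> hom G H"
    and ker: "has_rank G (kernel G H h) r" and im: "has_rank H (h ` carrier G) s"
  shows "has_rank G (carrier G) (r + s)"
proof -
  interpret G: comm_group G by fact
  interpret H: comm_group H by fact
  interpret group_hom G H h using assms by (simp add: group_hom_def group_hom_axioms_def G.is_group H.is_group)
  from ker obtain S where S: "S \<subseteq> kernel G H h" "int_independent G S" "card S = r"
    by (auto simp: has_rank_def)
  from im obtain T where T: "T \<subseteq> h ` carrier G" "int_independent H T" "card T = s"
    by (auto simp: has_rank_def)
  define l where "l = inv_into (carrier G) h"
  have l: "l t \<in> carrier G \<and> h (l t) = t" if "t \<in> T" for t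
    using T(1) that by (auto simp: l_def inv_into_into f_inv_into_f subset_iff)
  note ind = independent_lift[OF GH h S(2,1) T(2), of l, OF l]
  have fin: "finite S" "finite T" and SG: "S \<subseteq> carrier G" using S T by (auto simp: int_independent_def)
  have TH: "T \<subseteq> carrier H" using T by (auto simp: int_independent_def)
  have inj: "inj_on l T" using l by (metis inj_onI)
  have lG: "l ` T \<subseteq> carrier G" using l by auto
  have disj: "S \<inter> l ` T = {}"
    using S(1) l H.one_notin_independent[OF T(2)] by (auto simp: kernel_def)
  have span: "\<exists>n a. n \<noteq> 0 \<and> u [^]\<^bsub>G\<^esub> (n::int) = zcomb G a (S \<union> l ` T)" if u: "u \<in> carrier G" for u
  proof -
    from H.maximal_independent_spans[OF im T] u
    obtain n a where n: "n \<noteq> 0" "h u [^]\<^bsub>H\<^esub> (n::int) = zcomb H a T" by (metis hom_closed imageI)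
    let ?z = "zcomb G (\<lambda>x. a (h x)) (l ` T)"
    have zG: "?z \<in> carrier G" using lG by (rule G.zcomb_closed)
    have "h ?z = finprod H (\<lambda>x. h x [^]\<^bsub>H\<^esub> a (h x)) (l ` T)"
      using GH h fin lG by (intro hom_zcomb) auto
    also have "\<dots> = finprod H (\<lambda>t. h (l t) [^]\<^bsub>H\<^esub> a (h (l t))) T"
      using inj lG by (subst H.finprod_reindex) auto
    also have "\<dots> = zcomb H a T"
      unfolding zcomb_def using l TH by (intro H.finprod_cong') auto
    finally have hz: "h ?z = h (u [^]\<^bsub>G\<^esub> n)" using n u by (simp add: hom_int_pow)
    let ?w = "u [^]\<^bsub>G\<^esub> n \<otimes>\<^bsub>G\<^esub> inv\<^bsub>G\<^esub> ?z"
    have w: "?w \<in> kernel G H h" "?w \<in> carrier G"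
      using u zG hz by (auto simp: kernel_def)
    from G.maximal_independent_spans[OF ker S w]
    obtain m b where m: "m \<noteq> 0" "?w [^]\<^bsub>G\<^esub> (m::int) = zcomb G b S" by blast
    have "u [^]\<^bsub>G\<^esub> n = ?w \<otimes>\<^bsub>G\<^esub> ?z" using u zG by (simp add: G.m_assoc)
    then have "u [^]\<^bsub>G\<^esub> (n * m) = (?w \<otimes>\<^bsub>G\<^esub> ?z) [^]\<^bsub>G\<^esub> m" using u by (metis G.int_pow_pow)
    also have "\<dots> = zcomb G b S \<otimes>\<^bsub>G\<^esub> zcomb G (\<lambda>x. m * a (h x)) (l ` T)"
      using w zG m fin lG by (simp add: G.int_pow_distrib G.int_pow_zcomb)
    also have "\<dots> = zcomb G (\<lambda>x. if x \<in> S then b x else m * a (h x)) (S \<union> l ` T)"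
    proof -
      have "zcomb G b S = zcomb G (\<lambda>x. if x \<in> S then b x else m * a (h x)) S"
        using SG by (intro G.zcomb_cong) auto
      moreover have "zcomb G (\<lambda>x. m * a (h x)) (l ` T)
          = zcomb G (\<lambda>x. if x \<in> S then b x else m * a (h x)) (l ` T)"
        using lG disj by (intro G.zcomb_cong) auto
      ultimately show ?thesis using fin disj SG lG by (subst G.zcomb_Un) auto
    qed
    finally have "u [^]\<^bsub>G\<^esub> (n * m) = zcomb G (\<lambda>x. if x \<in> S then b x else m * a (h x)) (S \<union> l ` T)" .
    then show ?thesis using n m by (meson mult_eq_0_iff)
  qed
  show ?thesis unfolding has_rank_def
  proof (intro conjI allI impI)
    show "\<exists>S\<subseteq>carrier G. int_independent G S \<and> card S = r + s"
      using ind S T SG lG by (intro exI[of _ "S \<union> l ` T"]) auto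
    fix U assume "U \<subseteq> carrier G" "int_independent G U"
    then have "card U \<le> card (S \<union> l ` T)"
      using fin SG lG span by (intro G.independent_card_le) auto
    then show "card U \<le> r + s" using ind S T by simp
  qed
qed

text \<open>The bound \<open>r\<close> forces kernel and image to have finite ranks, and additivity
  gives the sum. In an exact sequence this splits a known rank into the ranks of the incoming and
  the outgoing map.\<close>

lemma has_rank_hom_split:
  assumes GH: "comm_group G" "comm_group H" and h: "h \<in> hom G H"
    and r: "has_rank G (carrier G) r"
  obtains a b where "has_rank G (kernel G H h) a" "has_rank H (h ` carrier G) b" "r = a + b"
proof -
  have "\<exists>a\<le>r. has_rank G (kernel G H h) a"
    using r by (intro has_rank_exists) (auto simp: has_rank_def kernel_def)
  moreover have "\<exists>b\<le>r. has_rank H (h ` carrier G) b"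
  proof (rule has_rank_exists)
    fix T assume T: "T \<subseteq> h ` carrier G" "int_independent H T"
    define l where "l = inv_into (carrier G) h"
    have l: "l t \<in> carrier G \<and> h (l t) = t" if "t \<in> T" for t
      using T(1) that by (auto simp: l_def inv_into_into f_inv_into_f subset_iff)
    have "int_independent G {}" by (simp add: int_independent_def)
    from independent_lift[OF GH h this _ T(2), of l, OF _ l]
    have "int_independent G (l ` T)" "card (l ` T) = card T" by auto
    then show "card T \<le> r" using r by (metis has_rank_def int_independent_def)
  qed
  ultimately obtain a b where ab: "has_rank G (kernel G H h) a" "has_rank H (h ` carrier G) b" by blast
  then have "has_rank G (carrier G) (a + b)" by (rule has_rank_hom[OF GH h])
  then have "r = a + b" using r has_rank_unique by blast
  with ab that show ?thesis by blast
qed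

lemma has_rank_one: "comm_group G \<Longrightarrow> has_rank G {\<one>\<^bsub>G\<^esub>} 0"
proof -
  assume "comm_group G"
  then interpret comm_group G .
  have "S = {}" if "S \<subseteq> {\<one>\<^bsub>G\<^esub>}" "int_independent G S" for S
    using that one_notin_independent[of S] by blast
  moreover have "int_independent G {}" by (simp add: int_independent_def)
  ultimately show ?thesis unfolding has_rank_def by (metis card.empty empty_subsetI order_refl)
qed

lemma has_rank_iso:
  assumes GH: "comm_group G" "comm_group H" and "G \<cong> H" and r: "has_rank G (carrier G) r"
  shows "has_rank H (carrier H) r"
proof -
  obtain h where h: "h \<in> iso G H" using \<open>G \<cong> H\<close> by (auto simp: is_iso_def)
  then have hom: "h \<in> hom G H" and inj: "inj_on h (carrier G)" and im: "h ` carrier G = carrier H"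
    by (auto simp: iso_def bij_betw_def)
  interpret group_hom G H h
    using GH hom by (simp add: group_hom_def group_hom_axioms_def comm_group_def)
  obtain a b where ab: "has_rank G (kernel G H h) a" "has_rank H (h ` carrier G) b" "r = a + b"
    using has_rank_hom_split[OF GH hom r] .
  have "kernel G H h = {\<one>\<^bsub>G\<^esub>}" using inj inj_iff_trivial_ker by blast
  then have "a = 0" using ab(1) has_rank_one[OF GH(1)] has_rank_unique by metis
  then show ?thesis using ab im by simp
qed

lemma has_rank_trivial: "comm_group G \<Longrightarrow> trivial_group G \<Longrightarrow> has_rank G (carrier G) 0"
  using has_rank_one by (metis trivial_group_def)

lemma has_rank_integer_group: "has_rank integer_group (carrier integer_group) 1"
proof -
  interpret comm_group integer_group by (rule abelian_integer_group)
  have z: "zcomb integer_group a S = (\<Sum>x\<in>S. a x * x)" if "finite S" for a :: "int \<Rightarrow> int" and S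
    using that
    by (induction S rule: finite_induct) (simp_all add: zcomb_insert)
  have "int_independent integer_group {1}" by (auto simp: int_independent_zcomb z)
  moreover have "card S \<le> 1" if S: "int_independent integer_group S" for S
  proof (rule ccontr)
    assume "\<not> card S \<le> 1"
    moreover have "finite S" using S by (simp add: int_independent_def)
    ultimately obtain x where "\<exists>i\<in>S. x i \<noteq> 0" "(\<Sum>i\<in>S. i * x i) = 0"
      using integer_system_solvable[of "{()}" S "\<lambda>_ i. i"] by auto
    moreover have "zcomb integer_group x S = (\<Sum>i\<in>S. i * x i)"
      using z[OF \<open>finite S\<close>] by (simp add: mult.commute)
    ultimately show False using S by (auto simp: int_independent_zcomb)
  qed
  ultimately show ?thesis unfolding has_rank_def by (intro conjI exI[of _ "{1}"]) auto
qed

lemma homology_kernel_boundary: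
  "kernel (relative_homology_group p X S) (homology_group (p-1) (subtopology X S)) (hom_boundary p X S)
     = hom_induced p X {} X S id ` carrier (homology_group p X)"
  using homology_exactness_axiom_1[of p X S] by simp

lemma homology_kernel_inclusion:
  "kernel (homology_group (p-1) (subtopology X S)) (homology_group (p-1) X)
       (hom_induced (p-1) (subtopology X S) {} X {} id)
     = hom_boundary p X S ` carrier (relative_homology_group p X S)"
  using homology_exactness_axiom_2[of p X S] by simp

lemma homology_kernel_relativization:
  "kernel (homology_group p X) (relative_homology_group p X S) (hom_induced p X {} X S id)
     = hom_induced p (subtopology X S) {} X {} id ` carrier (homology_group p (subtopology X S))"
  using homology_exactness_axiom_3[of p X S] by simp

lemma trivial_group_exact:
  assumes "group_hom F G h" "group_hom G K k" "kernel G K k = h ` carrier F"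
    and "trivial_group F" "trivial_group K"
  shows "trivial_group G"
proof -
  interpret h: group_hom F G h by fact
  interpret k: group_hom G K k by fact
  have "k x = \<one>\<^bsub>K\<^esub>" if "x \<in> carrier G" for x
    using assms(5) k.hom_closed[OF that] by (auto simp: trivial_group_def)
  then have "carrier G = kernel G K k" by (auto simp: kernel_def)
  also have "\<dots> = {\<one>\<^bsub>G\<^esub>}" using assms(3,4) by (auto simp: trivial_group_def)
  finally show ?thesis by (simp add: trivial_group_def h.H.is_group)
qed

lemma group_hom_relativization:
  "group_hom (homology_group p X) (relative_homology_group p X S) (hom_induced p X {} X S id)"
  "group_hom (relative_homology_group p X S) (homology_group (p-1) (subtopology X S)) (hom_boundary p X S)"
  "group_hom (homology_group p (subtopology X S)) (homology_group p X) (hom_induced p (subtopology X S) {} X {} id)"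
  by (simp_all add: group_hom_def group_hom_axioms_def hom_induced_hom hom_boundary_hom)

section \<open>The Euler characteristic of a pair\<close>

text \<open>The sum has to become stable, but no degree is named from which on it is; degree bounds
  come separately from \<open>hvan\<close>.\<close>

definition euler_ranks :: "(nat \<Rightarrow> nat) \<Rightarrow> int \<Rightarrow> bool" where
  "euler_ranks r e \<longleftrightarrow> (\<exists>N. \<forall>n\<ge>N. r n = 0 \<and> (\<Sum>k\<le>n. (-1) ^ k * int (r k)) = e)"

definition has_euler :: "'a topology \<Rightarrow> 'a set \<Rightarrow> int \<Rightarrow> bool" where
  "has_euler X S e \<longleftrightarrow>
     (\<exists>r. euler_ranks r e \<and>
       (\<forall>k. has_rank (relative_homology_group (int k) X S)
              (carrier (relative_homology_group (int k) X S)) (r k)))"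

text \<open>\<open>a\<close>, \<open>x\<close>, \<open>r\<close> stand for the ranks of subspace,
  space and pair in a long exact sequence, and \<open>d\<close>, \<open>i\<close>, \<open>j\<close>
  for those of the boundary, inclusion and relativization maps. Truncation at degree
  \<open>n\<close> leaves the single term with \<open>d (Suc n)\<close>, which vanishes eventually;
  \<open>d 0 = 0\<close> because the boundary map in degree 0 has a trivial target.\<close>

lemma euler_ranks_exact:
  assumes a: "\<And>k. a k = d (Suc k) + i k" and x: "\<And>k. x k = i k + j k"
    and r: "\<And>k. r k = j k + d k" and d: "d 0 = 0"
  shows "euler_ranks a e \<Longrightarrow> euler_ranks x f \<Longrightarrow> euler_ranks r (f - e)"
    and "euler_ranks a e \<Longrightarrow> euler_ranks r f \<Longrightarrow> euler_ranks x (e + f)"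
proof -
  have sum: "(\<Sum>k\<le>n. (-1) ^ k * int (x k)) + (-1) ^ n * int (d (Suc n))
      = (\<Sum>k\<le>n. (-1) ^ k * int (a k)) + (\<Sum>k\<le>n. (-1) ^ k * int (r k))" for n
    by (induction n) (simp_all add: a x r d algebra_simps)
  {
    assume "euler_ranks a e" "euler_ranks x f"
    then obtain M N where M: "\<And>n. n \<ge> M \<Longrightarrow> a n = 0 \<and> (\<Sum>k\<le>n. (-1) ^ k * int (a k)) = e"
      and N: "\<And>n. n \<ge> N \<Longrightarrow> x n = 0 \<and> (\<Sum>k\<le>n. (-1) ^ k * int (x k)) = f"
      unfolding euler_ranks_def by blast
    have "r n = 0 \<and> (\<Sum>k\<le>n. (-1) ^ k * int (r k)) = f - e" if n: "n \<ge> Suc (max M N)" for n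
    proof -
      obtain m where m: "n = Suc m" "m \<ge> M" "m \<ge> N" using n by (cases n) auto
      have "d (Suc n) = 0" using M[of n] a[of n] m by auto
      moreover have "d n = 0" using M[of m] a[of m] m by auto
      moreover have "j n = 0" using N[of n] x[of n] m by auto
      ultimately show ?thesis using sum[of n] M[of n] N[of n] r[of n] m by auto
    qed
    then show "euler_ranks r (f - e)" unfolding euler_ranks_def by blast
  next
    assume "euler_ranks a e" "euler_ranks r f"
    then obtain M N where M: "\<And>n. n \<ge> M \<Longrightarrow> a n = 0 \<and> (\<Sum>k\<le>n. (-1) ^ k * int (a k)) = e"
      and N: "\<And>n. n \<ge> N \<Longrightarrow> r n = 0 \<and> (\<Sum>k\<le>n. (-1) ^ k * int (r k)) = f"
      unfolding euler_ranks_def by blast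
    have "x n = 0 \<and> (\<Sum>k\<le>n. (-1) ^ k * int (x k)) = e + f" if n: "n \<ge> max M N" for n
      using n sum[of n] M[of n] N[of n] x[of n] a[of n] r[of n] by auto
    then show "euler_ranks x (e + f)" unfolding euler_ranks_def by blast
  }
qed

lemma has_euler_exact:
  assumes S: "has_euler (subtopology X S) {} e"
  shows "has_euler X {} f \<Longrightarrow> has_euler X S (f - e)"
    and "has_euler X S f \<Longrightarrow> has_euler X {} (e + f)"
proof -
  let ?A = "\<lambda>k. homology_group (int k) (subtopology X S)"
  let ?X = "\<lambda>k. homology_group (int k) X"
  let ?R = "\<lambda>k. relative_homology_group (int k) X S"
  let ?i = "\<lambda>k. hom_induced (int k) (subtopology X S) {} X {} id"
  let ?j = "\<lambda>k. hom_induced (int k) X {} X S id"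
  let ?d = "\<lambda>k. hom_boundary (int k) X S"
  have i: "?i k \<in> hom (?A k) (?X k)" and j: "?j k \<in> hom (?X k) (?R k)"
    and d: "?d k \<in> hom (?R k) (homology_group (int k - 1) (subtopology X S))" for k
    by (simp_all add: hom_induced_hom hom_boundary_hom)
  have ki: "kernel (?A k) (?X k) (?i k) = ?d (Suc k) ` carrier (?R (Suc k))" for k
    using homology_kernel_inclusion[of "int (Suc k)" X S] by simp
  have kj: "kernel (?X k) (?R k) (?j k) = ?i k ` carrier (?A k)" for k
    by (rule homology_kernel_relativization)
  have kd: "kernel (?R k) (homology_group (int k - 1) (subtopology X S)) (?d k) = ?j k ` carrier (?X k)" for k
    by (rule homology_kernel_boundary)
  obtain a where a: "euler_ranks a e" "\<And>k. has_rank (?A k) (carrier (?A k)) (a k)"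
    using S by (auto simp: has_euler_def)
  have "\<exists>d i. has_rank (?A k) (kernel (?A k) (?X k) (?i k)) d \<and>
      has_rank (?X k) (?i k ` carrier (?A k)) i \<and> a k = d + i" for k
    using has_rank_hom_split[OF abelian_homology_group abelian_homology_group i a(2)] by blast
  then obtain \<delta> \<iota> where di: "\<And>k. has_rank (?A k) (kernel (?A k) (?X k) (?i k)) (\<delta> k)"
      "\<And>k. has_rank (?X k) (?i k ` carrier (?A k)) (\<iota> k)" "\<And>k. a k = \<delta> k + \<iota> k" by metis
  \<comment> \<open>The boundary map lowers the degree: its rank in degree \<open>Suc k\<close> is
    that of the kernel of the inclusion in degree \<open>k\<close>. In degree 0 it maps into
    homology of degree -1, which is trivial.\<close>
  define \<delta>' where "\<delta>' k = (case k of 0 \<Rightarrow> 0 | Suc k \<Rightarrow> \<delta> k)" for k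
  have \<delta>': "has_rank (homology_group (int k - 1) (subtopology X S)) (?d k ` carrier (?R k)) (\<delta>' k)" for k
  proof (cases k)
    case (Suc l)
    then show ?thesis using di(1)[of l] ki[of l] by (simp add: \<delta>'_def)
  next
    case 0
    let ?H = "homology_group (- 1) (subtopology X S)"
    have "trivial_group ?H" by simp
    then have "carrier ?H = {\<one>\<^bsub>?H\<^esub>}" by (simp add: trivial_group_def)
    moreover have "?d 0 ` carrier (?R 0) \<subseteq> carrier ?H" "?d 0 ` carrier (?R 0) \<noteq> {}"
      using d[of 0] monoid.one_closed[OF group.is_monoid[OF group_relative_homology_group]]
      by (fastforce simp: hom_def)+
    ultimately have "?d 0 ` carrier (?R 0) = {\<one>\<^bsub>?H\<^esub>}" by blast
    then show ?thesis using 0 has_rank_one[OF abelian_homology_group] by (simp add: \<delta>'_def)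
  qed
  have \<delta>'0: "\<delta>' 0 = 0" by (simp add: \<delta>'_def)
  have a': "a k = \<delta>' (Suc k) + \<iota> k" for k using di(3) by (simp add: \<delta>'_def)
  {
    assume "has_euler X {} f"
    then obtain x where x: "euler_ranks x f" "\<And>k. has_rank (?X k) (carrier (?X k)) (x k)"
      by (auto simp: has_euler_def)
    have "\<exists>g. has_rank (?R k) (?j k ` carrier (?X k)) g \<and> x k = \<iota> k + g" for k
      using has_rank_hom_split[OF abelian_homology_group abelian_relative_homology_group j x(2)]
        di(2) kj has_rank_unique by metis
    then obtain \<gamma> where g: "\<And>k. has_rank (?R k) (?j k ` carrier (?X k)) (\<gamma> k)" "\<And>k. x k = \<iota> k + \<gamma> k"
      by metis
    have "has_rank (?R k) (carrier (?R k)) (\<gamma> k + \<delta>' k)" for k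
      using has_rank_hom[OF abelian_relative_homology_group abelian_homology_group d[of k]] kd g(1) \<delta>'
      by metis
    moreover have "euler_ranks (\<lambda>k. \<gamma> k + \<delta>' k) (f - e)"
      using euler_ranks_exact(1)[OF a' g(2) refl \<delta>'0 a(1) x(1)] .
    ultimately show "has_euler X S (f - e)" unfolding has_euler_def by blast
  next
    assume "has_euler X S f"
    then obtain r where r: "euler_ranks r f" "\<And>k. has_rank (?R k) (carrier (?R k)) (r k)"
      by (auto simp: has_euler_def)
    have "\<exists>g. has_rank (?R k) (?j k ` carrier (?X k)) g \<and> r k = g + \<delta>' k" for k
      using has_rank_hom_split[OF abelian_relative_homology_group abelian_homology_group d r(2)]
        \<delta>' kd has_rank_unique by metis
    then obtain \<gamma> where g: "\<And>k. has_rank (?R k) (?j k ` carrier (?X k)) (\<gamma> k)" "\<And>k. r k = \<gamma> k + \<delta>' k"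
      by metis
    have "has_rank (?X k) (carrier (?X k)) (\<iota> k + \<gamma> k)" for k
      using has_rank_hom[OF abelian_homology_group abelian_relative_homology_group j[of k]] kj g(1) di(2)
      by metis
    moreover have "euler_ranks (\<lambda>k. \<iota> k + \<gamma> k) (e + f)"
      using euler_ranks_exact(2)[OF a' refl g(2) \<delta>'0 a(1) r(1)] .
    ultimately show "has_euler X {} (e + f)" unfolding has_euler_def by blast
  }
qed

lemma has_euler_iso:
  assumes "has_euler X S e"
    and "\<And>p. relative_homology_group p X S \<cong> relative_homology_group p Y T"
  shows "has_euler Y T e"
  using assms has_rank_iso[OF abelian_relative_homology_group abelian_relative_homology_group]
  unfolding has_euler_def by blast

text \<open>The set \<open>U - V\<close> is excised from the pair \<open>(U \<union> V, U)\<close>: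
  it is closed in the union because \<open>V\<close> is open, and \<open>U\<close> is its own
  interior.\<close>

lemma excision_union_iso:
  assumes "openin X U" "openin X V"
  shows "relative_homology_group p (subtopology X V) (U \<inter> V)
           \<cong> relative_homology_group p (subtopology X (U \<union> V)) U"
proof -
  let ?Y = "subtopology X (U \<union> V)"
  have UV: "U \<subseteq> topspace X" "V \<subseteq> topspace X" using assms by (auto dest: openin_subset)
  then have top: "topspace ?Y = U \<union> V" by auto
  have oU: "openin ?Y U" and oV: "openin ?Y V"
    using assms by (auto simp: openin_subtopology_Int2 openin_subtopology intro: exI[of _ U] exI[of _ V])
  have "closedin ?Y (U - V)"
  proof -
    have "U - V = topspace ?Y - V" using top by auto
    then show ?thesis using oV by (metis closedin_diff closedin_topspace)
  qed
  then have "?Y closure_of (U - V) = U - V" by (simp add: closure_of_closedin)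
  moreover have "?Y interior_of U = U" using oU by (simp add: interior_of_openin)
  ultimately have "?Y closure_of (U - V) \<subseteq> ?Y interior_of U" by auto
  from homology_excision_axiom[OF this, of "U \<union> V" p]
  have "hom_induced p (subtopology ?Y (U \<union> V - (U - V))) (U - (U - V)) (subtopology ?Y (U \<union> V)) U id
      \<in> iso (relative_homology_group p (subtopology ?Y (U \<union> V - (U - V))) (U - (U - V)))
         (relative_homology_group p (subtopology ?Y (U \<union> V)) U)" by simp
  moreover have "U \<union> V - (U - V) = V" by auto
  then have "subtopology ?Y (U \<union> V - (U - V)) = subtopology X V"
    by (simp add: subtopology_subtopology Int_absorb1)
  moreover have "U - (U - V) = U \<inter> V" by auto
  moreover have "subtopology ?Y (U \<union> V) = ?Y" by (simp add: subtopology_subtopology)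
  ultimately show ?thesis by (auto simp: is_iso_def)
qed

text \<open>By excision the pair \<open>(U \<union> V, U)\<close> has the Euler number
  \<open>b - c\<close> of the pair \<open>(V, U \<inter> V)\<close>; the exact sequence of the first
  pair adds \<open>a\<close>.\<close>

lemma has_euler_Un:
  assumes "openin X U" "openin X V"
    and "has_euler (subtopology X U) {} a" "has_euler (subtopology X V) {} b"
    and "has_euler (subtopology X (U \<inter> V)) {} c"
  shows "has_euler (subtopology X (U \<union> V)) {} (a + b - c)"
proof -
  have "subtopology (subtopology X V) (U \<inter> V) = subtopology X (U \<inter> V)"
    by (simp add: subtopology_subtopology Int_absorb1 Int_absorb2)
  then have "has_euler (subtopology X V) (U \<inter> V) (b - c)"
    using has_euler_exact(1)[of "subtopology X V" "U \<inter> V" c b] assms by simp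
  then have "has_euler (subtopology X (U \<union> V)) U (b - c)"
    by (rule has_euler_iso) (rule excision_union_iso[OF assms(1,2)])
  moreover have "subtopology (subtopology X (U \<union> V)) U = subtopology X U"
    by (simp add: subtopology_subtopology Int_absorb1 Int_absorb2)
  ultimately show ?thesis
    using has_euler_exact(2)[of "subtopology X (U \<union> V)" U a "b - c"] assms(3)
    by (simp add: add_diff_eq)
qed

section \<open>Vanishing of homology\<close>

definition hvan :: "'a topology \<Rightarrow> 'a set \<Rightarrow> int \<Rightarrow> bool" where
  "hvan X S d \<longleftrightarrow> (\<forall>p>d. trivial_group (relative_homology_group p X S))"

lemma hvan_mono: "hvan X S d \<Longrightarrow> d \<le> d' \<Longrightarrow> hvan X S d'"
  by (simp add: hvan_def)

lemma hvan_pair: "hvan X {} d \<Longrightarrow> hvan (subtopology X S) {} (d - 1) \<Longrightarrow> hvan X S d"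
  unfolding hvan_def
  by (intro allI impI, rule trivial_group_exact[OF group_hom_relativization(1,2) homology_kernel_boundary]) simp_all

lemma hvan_total: "hvan X S d \<Longrightarrow> hvan (subtopology X S) {} d \<Longrightarrow> hvan X {} d"
  unfolding hvan_def
  by (intro allI impI, rule trivial_group_exact[OF group_hom_relativization(3,1) homology_kernel_relativization[of _ X S]]) simp_all

lemma trivial_group_iso: "G \<cong> H \<Longrightarrow> group G \<Longrightarrow> group H \<Longrightarrow> trivial_group G \<Longrightarrow> trivial_group H"
  using isomorphic_group_triviality by blast

lemma hvan_iso:
  "hvan X S d \<Longrightarrow> (\<And>p. relative_homology_group p X S \<cong> relative_homology_group p Y T) \<Longrightarrow> hvan Y T d"
  unfolding hvan_def
  by (meson trivial_group_iso[OF _ group_relative_homology_group group_relative_homology_group])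

lemma hvan_homeomorphic: "hvan X {} d \<Longrightarrow> X homeomorphic_space Y \<Longrightarrow> hvan Y {} d"
  by (rule hvan_iso) (auto intro: homeomorphic_space_imp_isomorphic_homology_groups)

lemma hvan_Un_rel:
  assumes "openin X U" "openin X V"
    and "hvan (subtopology X U) {} d" "hvan (subtopology X V) (U \<inter> V) d"
  shows "hvan (subtopology X (U \<union> V)) {} d"
proof -
  have "hvan (subtopology X (U \<union> V)) U d"
    using assms(4) by (rule hvan_iso) (rule excision_union_iso[OF assms(1,2)])
  moreover have "subtopology (subtopology X (U \<union> V)) U = subtopology X U"
    by (simp add: subtopology_subtopology Int_absorb1 Int_absorb2)
  ultimately show ?thesis using hvan_total assms(3) by metis
qed

lemma hvan_Un:
  assumes "openin X U" "openin X V"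
    and "hvan (subtopology X U) {} d" "hvan (subtopology X V) {} d"
    and "hvan (subtopology X (U \<inter> V)) {} (d - 1)"
  shows "hvan (subtopology X (U \<union> V)) {} d"
proof -
  have "subtopology (subtopology X V) (U \<inter> V) = subtopology X (U \<inter> V)"
    by (simp add: subtopology_subtopology Int_absorb1 Int_absorb2)
  then have "hvan (subtopology X V) (U \<inter> V) d" using hvan_pair[of "subtopology X V" d "U \<inter> V"] assms by metis
  then show ?thesis using assms by (intro hvan_Un_rel)
qed

text \<open>A bound 0 in the sense of \<open>hvan\<close> says nothing about the number of
  components. Gluing without raising the bound needs connectedness too, hence reduced homology;
  nonemptiness is included because all homology of the empty space is trivial.\<close>

definition acyclic_space :: "'a topology \<Rightarrow> bool" where
  "acyclic_space X \<longleftrightarrow> topspace X \<noteq> {} \<and> (\<forall>p. trivial_group (reduced_homology_group p X))"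

lemma acyclic_contractible: "contractible_space X \<Longrightarrow> topspace X \<noteq> {} \<Longrightarrow> acyclic_space X"
  by (simp add: acyclic_space_def trivial_reduced_homology_group_contractible_space)

lemma acyclic_hvan: "acyclic_space X \<Longrightarrow> hvan X {} 0"
  unfolding acyclic_space_def hvan_def
proof (intro allI impI)
  fix p :: int
  assume "topspace X \<noteq> {} \<and> (\<forall>p. trivial_group (reduced_homology_group p X))" "0 < p"
  then show "trivial_group (homology_group p X)" using un_reduced_homology_group[of p X] by (metis less_irrefl)
qed

text \<open>The bound \<open>d\<close> is arbitrary: by the reduced exact sequence all relative
  groups vanish, also in degrees 0 and 1.\<close>

lemma hvan_pair_acyclic:
  assumes X: "acyclic_space X" and S: "acyclic_space (subtopology X S)"
  shows "hvan X S d"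
  unfolding hvan_def
proof (intro allI impI)
  fix p
  have ne: "topspace X \<inter> S \<noteq> {}" using S by (simp add: acyclic_space_def)
  show "trivial_group (relative_homology_group p X S)"
  proof (rule trivial_group_exact)
    show "group_hom (reduced_homology_group p X) (relative_homology_group p X S) (hom_induced p X {} X S id)"
      using homology_exactness_reduced_1[OF ne, of p] by simp
    show "group_hom (relative_homology_group p X S) (reduced_homology_group (p-1) (subtopology X S)) (hom_boundary p X S)"
      by (simp add: group_hom_def group_hom_axioms_def hom_boundary_reduced_hom)
    show "kernel (relative_homology_group p X S) (reduced_homology_group (p-1) (subtopology X S))
       (hom_boundary p X S) = hom_induced p X {} X S id ` carrier (reduced_homology_group p X)"
      using homology_exactness_reduced_1[OF ne, of p] by simp
  qed (use X S in \<open>auto simp: acyclic_space_def\<close>)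
qed

lemma acyclic_total:
  assumes ne: "topspace X \<inter> S \<noteq> {}" and S: "acyclic_space (subtopology X S)" and "\<And>d. hvan X S d"
  shows "acyclic_space X"
  unfolding acyclic_space_def
proof (intro conjI allI)
  fix p
  have R: "trivial_group (relative_homology_group p X S)" using assms(3)[of "p - 1"] by (simp add: hvan_def)
  note ex = homology_exactness_reduced_3[of p X S]
  show "trivial_group (reduced_homology_group p X)"
  proof (rule trivial_group_exact)
    show "group_hom (reduced_homology_group p (subtopology X S)) (reduced_homology_group p X)
        (hom_induced p (subtopology X S) {} X {} id)"
      by (simp add: group_hom_def group_hom_axioms_def hom_induced_reduced_hom)
    show "group_hom (reduced_homology_group p X) (relative_homology_group p X S) (hom_induced p X {} X S id)"
      using ex by (simp add: group_hom_def group_hom_axioms_def)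
    show "kernel (reduced_homology_group p X) (relative_homology_group p X S) (hom_induced p X {} X S id) =
        hom_induced p (subtopology X S) {} X {} id ` carrier (reduced_homology_group p (subtopology X S))"
      using ex by simp
  qed (use R S in \<open>auto simp: acyclic_space_def\<close>)
qed (use ne in auto)

lemma acyclic_Un:
  assumes "openin X U" "openin X V"
    and "acyclic_space (subtopology X U)" "acyclic_space (subtopology X V)"
    and "acyclic_space (subtopology X (U \<inter> V))"
  shows "acyclic_space (subtopology X (U \<union> V))"
proof (rule acyclic_total[of _ U])
  have eq: "subtopology (subtopology X V) (U \<inter> V) = subtopology X (U \<inter> V)"
    "subtopology (subtopology X (U \<union> V)) U = subtopology X U"
    by (simp_all add: subtopology_subtopology Int_absorb1 Int_absorb2)
  show "acyclic_space (subtopology (subtopology X (U \<union> V)) U)" using assms eq by metis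
  then show "topspace (subtopology X (U \<union> V)) \<inter> U \<noteq> {}" by (auto simp: acyclic_space_def)
  fix d
  have "hvan (subtopology X V) (U \<inter> V) d"
    using hvan_pair_acyclic[of "subtopology X V" "U \<inter> V" d] assms eq by metis
  then show "hvan (subtopology X (U \<union> V)) U d"
    by (rule hvan_iso) (rule excision_union_iso[OF assms(1,2)])
qed

text \<open>Attaching along an acyclic set keeps the bound \<open>d\<close>, whereas
  \<open>hvan_Un\<close> asks for \<open>d - 1\<close> on the intersection; for \<open>d = 0\<close>
  that would force the intersection to be empty.\<close>

lemma hvan_Un_acyclic:
  assumes "openin X U" "openin X V"
    and "hvan (subtopology X U) {} d" "acyclic_space (subtopology X V)"
    and "acyclic_space (subtopology X (U \<inter> V))"
  shows "hvan (subtopology X (U \<union> V)) {} d"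
proof -
  have "subtopology (subtopology X V) (U \<inter> V) = subtopology X (U \<inter> V)"
    by (simp add: subtopology_subtopology Int_absorb1 Int_absorb2)
  then have "hvan (subtopology X V) (U \<inter> V) d" using hvan_pair_acyclic[of "subtopology X V" "U \<inter> V" d] assms by metis
  then show ?thesis using assms by (intro hvan_Un_rel)
qed

lemma has_euler_contractible:
  assumes "contractible_space X" "topspace X \<noteq> {}"
  shows "has_euler X {} 1"
  unfolding has_euler_def
proof (intro exI conjI allI)
  show "euler_ranks (\<lambda>k. if k = 0 then 1 else 0) 1"
    unfolding euler_ranks_def by (rule exI[of _ 1]) (auto simp: if_distrib cong: if_cong)
  fix k
  show "has_rank (homology_group (int k) X) (carrier (homology_group (int k) X)) (if k = 0 then 1 else 0)"
  proof (cases "k = 0")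
    case True
    have "integer_group \<cong> homology_group 0 X"
      using isomorphic_integer_zeroth_homology_group[OF contractible_imp_path_connected_space[OF assms(1)] assms(2)]
        group.iso_sym[OF group_relative_homology_group] by blast
    then show ?thesis
      using has_rank_iso[OF abelian_integer_group abelian_homology_group _ has_rank_integer_group] True by simp
  next
    case False
    then have "trivial_group (homology_group (int k) X)"
      using trivial_reduced_homology_group_contractible_space[OF assms(1), of "int k"]
      by (simp add: un_reduced_homology_group)
    then show ?thesis using False has_rank_trivial[OF abelian_homology_group] by simp
  qed
qed

lemma has_euler_empty: "topspace X = {} \<Longrightarrow> has_euler X {} 0"
  unfolding has_euler_def
  by (intro exI[of _ "\<lambda>_. 0"])
     (auto simp: euler_ranks_def trivial_relative_homology_group_empty intro!: has_rank_trivial)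

text \<open>\<open>has_euler\<close> fixes only the eventual value of the alternating sum, while
  \<open>euler_characteristic\<close> ends at degree 2; the second hypothesis makes the ranks in
  between zero.\<close>

lemma euler_characteristic_eq:
  fixes A :: "('a, real^2) chart set"
  assumes "has_euler (mfd_topology A) {} e" "hvan (mfd_topology A) {} 2"
  shows "euler_characteristic A = e"
proof -
  obtain r where r: "euler_ranks r e"
    "\<And>k. has_rank (homology_group (int k) (mfd_topology A)) (carrier (homology_group (int k) (mfd_topology A))) (r k)"
    using assms(1) by (auto simp: has_euler_def)
  obtain N where N: "\<And>n. n \<ge> N \<Longrightarrow> (\<Sum>k\<le>n. (-1) ^ k * int (r k)) = e" using r(1) by (auto simp: euler_ranks_def)
  have "r k = 0" if "k > 2" for k
    using r(2)[of k] assms(2) that has_rank_trivial[OF abelian_homology_group, of "int k" "mfd_topology A"]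
    by (auto simp: hvan_def dest: has_rank_unique)
  then have "(\<Sum>k\<le>max 2 N. (-1) ^ k * int (r k)) = (\<Sum>k\<le>2. (-1) ^ k * int (r k))"
    by (intro sum.mono_neutral_right) auto
  moreover have "(\<Sum>k\<le>max 2 N. (-1) ^ k * int (r k)) = e" using N by simp
  moreover have "abelian_rank (homology_group (int k) (mfd_topology A)) = r k" for k
    using r(2) by (rule abelian_rank_eq)
  ultimately show ?thesis by (simp add: euler_characteristic_def)
qed

section \<open>Combinatorics of boxes: unions in the plane, nerves of covers, surfaces with product
  charts\<close>

section \<open>Finite unions of open boxes in the plane\<close>

definition bx :: "real \<Rightarrow> real \<Rightarrow> real \<Rightarrow> real \<Rightarrow> (real \<times> real) set" where
  "bx a b c d = {a<..<b} \<times> {c<..<d}"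

lemma bx_Int: "bx a b c d \<inter> bx a' b' c' d' = bx (max a a') (min b b') (max c c') (min d d')"
  by (auto simp: bx_def)

lemma open_bx [simp]: "open (bx a b c d)"
  by (simp add: bx_def open_Times)

lemma mem_bx: "(x, y) \<in> bx a b c d \<longleftrightarrow> a < x \<and> x < b \<and> c < y \<and> y < d"
  by (auto simp: bx_def)

lemma bx_eq_empty: "bx a b c d = {} \<longleftrightarrow> b \<le> a \<or> d \<le> c"
  by (auto simp: bx_def greaterThanLessThan_empty_iff)

lemma contractible_bx: "contractible (bx a b c d)"
  by (simp add: bx_def convex_imp_contractible convex_Times)

lemma acyclic_bx: "bx a b c d \<noteq> {} \<Longrightarrow> acyclic_space (top_of_set (bx a b c d))"
  by (rule acyclic_contractible) (simp_all add: contractible_bx)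

lemma hvan_empty: "topspace X = {} \<Longrightarrow> hvan X {} d"
  by (simp add: hvan_def trivial_relative_homology_group_empty)

lemma hvan_bx: "hvan (top_of_set (bx a b c d)) {} 0"
proof (cases "bx a b c d = {}")
  case True
  then show ?thesis by (intro hvan_empty) simp
next
  case False
  then show ?thesis by (intro acyclic_hvan acyclic_bx)
qed

text \<open>All boxes share the corner \<open>(a, c)\<close>, so the union meets one of them in a
  family of the same kind, with the opposite sides cut down to minima. The induction is on the
  length because its hypothesis is applied to two different lists.\<close>

lemma acyclic_corner_boxes:
  assumes "xs \<noteq> []" "\<And>b d. (b, d) \<in> set xs \<Longrightarrow> a < b \<and> c < d"
  shows "acyclic_space (top_of_set (\<Union>(b, d)\<in>set xs. bx a b c d))"
  using assms
proof (induction "length xs" arbitrary: xs)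
  case (Suc n)
  then obtain b d ys where xs: "xs = (b, d) # ys" by (cases xs) auto
  have bd: "a < b" "c < d" using Suc.prems xs by auto
  have ys: "a < b'" "c < d'" if "(b', d') \<in> set ys" for b' d'
    using Suc.prems(2)[of b' d'] that xs by auto
  then have B: "acyclic_space (top_of_set (bx a b c d))" using bd by (intro acyclic_bx) (simp add: bx_eq_empty)
  show ?case
  proof (cases "ys = []")
    case True
    then show ?thesis using B xs by simp
  next
    case False
    let ?zs = "map (\<lambda>(b', d'). (min b' b, min d' d)) ys"
    let ?U = "\<Union>(b, d)\<in>set ys. bx a b c d"
    have "acyclic_space (top_of_set ?U)" using Suc.hyps(2) ys xs False by (intro Suc.hyps(1)) auto
    moreover have "acyclic_space (top_of_set (\<Union>(b, d)\<in>set ?zs. bx a b c d))"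
      using Suc.hyps(2) ys xs False bd by (intro Suc.hyps(1)) auto
    moreover have "(\<Union>(b, d)\<in>set ?zs. bx a b c d) = ?U \<inter> bx a b c d"
      by (auto simp: bx_def)
    moreover have "open ?U" by auto
    ultimately have "acyclic_space (top_of_set (?U \<union> bx a b c d))"
      using B by (intro acyclic_Un) (auto simp del: set_map)
    moreover have "(\<Union>(b, d)\<in>set xs. bx a b c d) = ?U \<union> bx a b c d" using xs by auto
    ultimately show ?thesis by simp
  qed
qed simp

lemma exists_max_element:
  fixes f :: "'a \<Rightarrow> real"
  assumes "xs \<noteq> []"
  shows "\<exists>x ys. (\<forall>y\<in>set xs. f y \<le> f x) \<and> set xs = insert x (set ys) \<and> length xs = Suc (length ys)"
proof -
  obtain x where x: "x \<in> set xs" "f x = Max (f ` set xs)"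
    using Max_in[of "f ` set xs"] assms by fastforce
  then have "\<forall>y\<in>set xs. f y \<le> f x" by simp
  moreover have "set xs = insert x (set (remove1 x xs))"
  proof (rule Set.set_eqI)
    fix y
    show "y \<in> set xs \<longleftrightarrow> y \<in> insert x (set (remove1 x xs))"
      using x(1) set_remove1_subset[of x xs] by (cases "y = x") auto
  qed
  moreover have "length xs = Suc (length (remove1 x xs))"
    using x(1) length_pos_if_in_set[of x xs] by (simp add: length_remove1)
  ultimately show ?thesis by blast
qed

text \<open>The boxes share their left side. The one with the highest lower side meets each other
  one in a box with that same lower side, so its intersection with the union is a family with a
  common corner, hence acyclic or empty.\<close>

lemma hvan_left_justified_boxes:
  "hvan (top_of_set (\<Union>(b, c, d)\<in>set xs. bx a b c d)) {} 0"
proof (induction "length xs" arbitrary: xs)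
  case (Suc n)
  then have "xs \<noteq> []" by auto
  then obtain x ys where x: "\<And>y. y \<in> set xs \<Longrightarrow> fst (snd y) \<le> fst (snd x)"
    "set xs = insert x (set ys)" "length xs = Suc (length ys)"
    using exists_max_element[of xs "\<lambda>x. fst (snd x)"] by blast
  obtain b c d where bcd: "x = (b, c, d)" by (cases x) auto
  let ?U = "\<Union>(b, c, d)\<in>set ys. bx a b c d"
  have eq: "(\<Union>(b, c, d)\<in>set xs. bx a b c d) = ?U \<union> bx a b c d"
    using x(2) bcd by auto
  have U: "hvan (top_of_set ?U) {} 0" using Suc x by auto
  have oU: "open ?U" by auto
  \<comment> \<open>Empty intersections are discarded, because \<open>acyclic_corner_boxes\<close>
    asks for nondegenerate boxes.\<close>
  define zs where "zs = filter (\<lambda>(b', d'). a < b' \<and> c < d') (map (\<lambda>(b', c', d'). (min b' b, min d' d)) ys)"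
  have Int: "?U \<inter> bx a b c d = (\<Union>(b, d)\<in>set zs. bx a b c d)"
  proof -
    have "bx a b' c' d' \<inter> bx a b c d = bx a (min b' b) c (min d' d)" if "(b', c', d') \<in> set ys" for b' c' d'
      using x(1)[of "(b', c', d')"] that x(2) bcd by (auto simp: bx_Int max_def)
    then have "?U \<inter> bx a b c d = (\<Union>(b', c', d')\<in>set ys. bx a (min b' b) c (min d' d))"
      by fastforce
    also have "\<dots> = (\<Union>(b, d)\<in>set zs. bx a b c d)"
      by (force simp: zs_def bx_def)
    finally show ?thesis .
  qed
  show ?case
  proof (cases "zs = []")
    case True
    then have "?U \<inter> bx a b c d = {}" using Int by simp
    then have "hvan (top_of_set (?U \<inter> bx a b c d)) {} (0 - 1)" by (intro hvan_empty) simp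
    then show ?thesis unfolding eq using oU U hvan_bx by (intro hvan_Un) auto
  next
    case False
    then have A: "acyclic_space (top_of_set (?U \<inter> bx a b c d))"
      unfolding Int by (rule acyclic_corner_boxes) (auto simp: zs_def)
    then have "bx a b c d \<noteq> {}" by (auto simp: acyclic_space_def)
    then show ?thesis unfolding eq using oU U A acyclic_bx by (intro hvan_Un_acyclic) auto
  qed
qed (simp add: hvan_empty)

text \<open>The box with the rightmost left side meets all others in boxes with that same left side.
  Their union has bound 0 by the previous case, so attaching the box keeps the bound 1.\<close>

lemma hvan_boxes:
  "hvan (top_of_set (\<Union>(a, b, c, d)\<in>set xs. bx a b c d)) {} 1"
proof (induction "length xs" arbitrary: xs)
  case (Suc n)
  then have "xs \<noteq> []" by auto
  then obtain x ys where x: "\<And>y. y \<in> set xs \<Longrightarrow> fst y \<le> fst x"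
    "set xs = insert x (set ys)" "length xs = Suc (length ys)"
    using exists_max_element[of xs "\<lambda>x. fst x"] by blast
  obtain a b c d where abcd: "x = (a, b, c, d)" by (cases x) auto
  let ?U = "\<Union>(a, b, c, d)\<in>set ys. bx a b c d"
  have eq: "(\<Union>(a, b, c, d)\<in>set xs. bx a b c d) = ?U \<union> bx a b c d"
    using x(2) abcd by auto
  have U: "hvan (top_of_set ?U) {} 1" using Suc x by auto
  have oU: "open ?U" by auto
  define zs where "zs = map (\<lambda>(a', b', c', d'). (min b' b, max c' c, min d' d)) ys"
  have "bx a' b' c' d' \<inter> bx a b c d = bx a (min b' b) (max c' c) (min d' d)"
    if "(a', b', c', d') \<in> set ys" for a' b' c' d'
    using x(1)[of "(a', b', c', d')"] that x(2) abcd by (auto simp: bx_Int max_def)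
  then have "?U \<inter> bx a b c d = (\<Union>(a', b', c', d')\<in>set ys. bx a (min b' b) (max c' c) (min d' d))"
    by fastforce
  also have "\<dots> = (\<Union>(b, c, d)\<in>set zs. bx a b c d)"
    by (force simp: zs_def)
  finally have "hvan (top_of_set (?U \<inter> bx a b c d)) {} 0"
    using hvan_left_justified_boxes by simp
  moreover have "hvan (top_of_set (bx a b c d)) {} 1" using hvan_bx by (rule hvan_mono) simp
  ultimately show ?case unfolding eq using oU U by (intro hvan_Un) auto
qed (simp add: hvan_empty)

section \<open>Inclusion and exclusion\<close>

lemma sum_Pow_insert:
  assumes "finite P" "m \<notin> P"
  shows "(\<Sum>J\<in>Pow (insert m P). f J) = (\<Sum>J\<in>Pow P. f J) + (\<Sum>J\<in>Pow P. f (insert m J))"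
proof -
  have "(\<Sum>J\<in>Pow (insert m P). f J) = (\<Sum>J\<in>Pow P \<union> insert m ` Pow P. f J)"
    by (simp add: Pow_insert)
  also have "\<dots> = (\<Sum>J\<in>Pow P. f J) + (\<Sum>J\<in>insert m ` Pow P. f J)"
    using assms by (intro sum.union_disjoint) auto
  also have "(\<Sum>J\<in>insert m ` Pow P. f J) = (\<Sum>J\<in>Pow P. f (insert m J))"
    using assms by (subst sum.reindex) (auto simp: inj_on_def insert_ident subset_iff)
  finally show ?thesis .
qed

text \<open>The Euler characteristic of the nerve of the family: \<open>J\<close> spans a simplex of
  dimension \<open>card J - 1\<close>, whence the sign.\<close>

definition nerve_euler :: "('i \<Rightarrow> 'a set) \<Rightarrow> 'i set \<Rightarrow> int" where
  "nerve_euler Q P = (\<Sum>J\<in>Pow P. if J \<noteq> {} \<and> \<Inter>(Q ` J) \<noteq> {} then - ((-1) ^ card J) else 0)"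

text \<open>The new simplices are \<open>{m}\<close> and the sets \<open>insert m J\<close>; the
  latter are the simplices of the nerve of the traces on \<open>Q m\<close>, with opposite sign
  because their dimension is one higher.\<close>

lemma nerve_euler_insert:
  assumes "finite P" "m \<notin> P"
  shows "nerve_euler Q (insert m P)
    = nerve_euler Q P + (if Q m = {} then 0 else 1) - nerve_euler (\<lambda>p. Q p \<inter> Q m) P"
proof -
  let ?f = "\<lambda>J. if J \<noteq> {} \<and> \<Inter>(Q ` J) \<noteq> {} then - ((-1) ^ card J) else (0::int)"
  let ?g = "\<lambda>J. if J \<noteq> {} \<and> \<Inter>((\<lambda>p. Q p \<inter> Q m) ` J) \<noteq> {} then - ((-1) ^ card J) else (0::int)"
  have eq: "?f (insert m J) = (if J = {} then (if Q m = {} then 0 else 1) else 0) - ?g J" if "J \<in> Pow P" for J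
  proof (cases "J = {}")
    case False
    have "finite J" "m \<notin> J" using that assms finite_subset by auto
    moreover have "\<Inter>((\<lambda>p. Q p \<inter> Q m) ` J) = Q m \<inter> \<Inter>(Q ` J)" using False by auto
    ultimately show ?thesis using False by auto
  qed auto
  have "(\<Sum>J\<in>Pow P. ?f (insert m J))
      = (\<Sum>J\<in>Pow P. (if J = {} then (if Q m = {} then 0 else 1) else 0) - ?g J)"
    by (rule sum.cong[OF refl eq])
  also have "\<dots> = (if Q m = {} then 0 else 1) - nerve_euler (\<lambda>p. Q p \<inter> Q m) P"
    using assms by (simp add: sum_subtractf sum.delta nerve_euler_def)
  finally show ?thesis
    using sum_Pow_insert[OF assms, of ?f] by (simp add: nerve_euler_def)
qed

text \<open>The nerve theorem on the level of Euler numbers, adding one member at a time. The empty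
  space counts as contractible, so the hypothesis can be put on all intersections, and empty ones
  contribute 0.\<close>

lemma has_euler_nerve:
  assumes "finite P" "\<And>p. p \<in> P \<Longrightarrow> openin X (Q p)"
    and "\<And>J. J \<subseteq> P \<Longrightarrow> J \<noteq> {} \<Longrightarrow> contractible_space (subtopology X (\<Inter>(Q ` J)))"
  shows "has_euler (subtopology X (\<Union>(Q ` P))) {} (nerve_euler Q P)"
  using assms
proof (induction P arbitrary: Q rule: finite_induct)
  case empty
  then show ?case by (auto simp: nerve_euler_def intro: has_euler_empty)
next
  case (insert m P)
  let ?U = "\<Union>(Q ` P)"
  have oU: "openin X ?U" and oV: "openin X (Q m)" using insert.prems by auto
  have 1: "has_euler (subtopology X ?U) {} (nerve_euler Q P)"
    using insert.prems by (intro insert.IH) (auto simp: subset_insertI2)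
  have 2: "has_euler (subtopology X (\<Union>((\<lambda>p. Q p \<inter> Q m) ` P))) {} (nerve_euler (\<lambda>p. Q p \<inter> Q m) P)"
  proof (rule insert.IH)
    fix J assume J: "J \<subseteq> P" "J \<noteq> {}"
    then have "\<Inter>((\<lambda>p. Q p \<inter> Q m) ` J) = \<Inter>(Q ` insert m J)" by auto
    then show "contractible_space (subtopology X (\<Inter>((\<lambda>p. Q p \<inter> Q m) ` J)))"
      using insert.prems(2)[of "insert m J"] J by auto
  qed (use insert.prems in auto)
  have 3: "has_euler (subtopology X (Q m)) {} (if Q m = {} then 0 else 1)"
  proof (cases "Q m = {}")
    case True
    then show ?thesis by (auto intro: has_euler_empty)
  next
    case False
    have "topspace (subtopology X (Q m)) = Q m" using oV by (auto dest: openin_subset)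
    moreover have "contractible_space (subtopology X (Q m))" using insert.prems(2)[of "{m}"] by simp
    ultimately have "has_euler (subtopology X (Q m)) {} 1" using False by (metis has_euler_contractible)
    then show ?thesis using False by simp
  qed
  have "?U \<inter> Q m = \<Union>((\<lambda>p. Q p \<inter> Q m) ` P)" by auto
  then have "has_euler (subtopology X (?U \<union> Q m)) {}
      (nerve_euler Q P + (if Q m = {} then 0 else 1) - nerve_euler (\<lambda>p. Q p \<inter> Q m) P)"
    using 1 2 3 oU oV by (intro has_euler_Un) auto
  then show ?case using nerve_euler_insert[OF insert.hyps, of Q] by (simp add: Un_commute)
qed

text \<open>The last hypothesis is the input of \<open>hvan_Un\<close> at each step: one degree less
  on the intersection of the new member with the union of the earlier ones.\<close>

lemma hvan_UN:
  assumes "finite P" "\<And>p. p \<in> P \<Longrightarrow> openin X (Q p)"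
    and "\<And>p. p \<in> P \<Longrightarrow> hvan (subtopology X (Q p)) {} d"
    and "\<And>p P'. p \<in> P \<Longrightarrow> P' \<subseteq> P \<Longrightarrow> hvan (subtopology X ((\<Union>q\<in>P'. Q q) \<inter> Q p)) {} (d - 1)"
  shows "hvan (subtopology X (\<Union>(Q ` P))) {} d"
  using assms
proof (induction P rule: finite_induct)
  case empty
  then show ?case by (simp add: hvan_def trivial_relative_homology_group_empty)
next
  case (insert m P)
  have "hvan (subtopology X ((\<Union>(Q ` P)) \<union> Q m)) {} d"
    using insert.prems
    by (intro hvan_Un insert.IH) (auto simp: subset_insertI2)
  then show ?case by (simp add: Un_commute)
qed

text \<open>If every nonempty intersection has a corner set of \<open>k\<close> elements and each corner lies in some
  \<open>Q m\<close> that does not affect which intersections have it as a corner, then adding and removing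
  \<open>m\<close> cancels all terms.\<close>

lemma nerve_euler_eq_0:
  assumes fin: "finite P" and k: "k > 0"
    and R: "\<And>J. J \<subseteq> P \<Longrightarrow> J \<noteq> {} \<Longrightarrow> \<Inter>(Q ` J) \<noteq> {} \<Longrightarrow> finite (R J) \<and> card (R J) = k"
    and ex: "\<And>J x. J \<subseteq> P \<Longrightarrow> J \<noteq> {} \<Longrightarrow> \<Inter>(Q ` J) \<noteq> {} \<Longrightarrow> x \<in> R J \<Longrightarrow> \<exists>m\<in>P. x \<in> Q m"
    and single: "\<And>m x. m \<in> P \<Longrightarrow> x \<in> Q m \<Longrightarrow> x \<notin> R {m}"
    and ins: "\<And>J m x. J \<subseteq> P \<Longrightarrow> J \<noteq> {} \<Longrightarrow> m \<in> P \<Longrightarrow> x \<in> Q m \<Longrightarrow>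
       \<Inter>(Q ` J) \<noteq> {} \<and> x \<in> R J \<longleftrightarrow> \<Inter>(Q ` insert m J) \<noteq> {} \<and> x \<in> R (insert m J)"
  shows "nerve_euler Q P = 0"
proof -
  define K where "K = {J \<in> Pow P. J \<noteq> {} \<and> \<Inter>(Q ` J) \<noteq> {}}"
  have finK: "finite K" using fin by (simp add: K_def)
  define C where "C = (\<Union>J\<in>K. R J)"
  have finC: "finite C" using finK R by (auto simp: C_def K_def)
  have "nerve_euler Q P = (\<Sum>J\<in>K. - ((-1) ^ card J))"
    unfolding nerve_euler_def K_def using fin by (subst sum.inter_filter) auto
  \<comment> \<open>Double counting: each term is taken \<open>k\<close> times, once per corner.
    After the exchange of sums the corner \<open>x\<close> is fixed and the sets \<open>J\<close>
    that have it can be paired.\<close>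
  then have "int k * nerve_euler Q P = (\<Sum>J\<in>K. (\<Sum>x\<in>R J. - ((-1) ^ card J)))"
    using R by (simp add: K_def sum_distrib_left)
  also have "\<dots> = (\<Sum>J\<in>K. (\<Sum>x\<in>C. if x \<in> R J then - ((-1) ^ card J) else 0))"
  proof (rule sum.cong[OF refl])
    fix J assume "J \<in> K"
    then have "{x \<in> C. x \<in> R J} = R J" by (auto simp: C_def)
    then have "(\<Sum>x\<in>R J. - ((-1) ^ card J)) = (\<Sum>x\<in>{x \<in> C. x \<in> R J}. - ((-1) ^ card J) :: int)" by metis
    also have "\<dots> = (\<Sum>x\<in>C. if x \<in> R J then - ((-1) ^ card J) else (0::int))"
      by (rule sum.inter_filter[OF finC])
    finally show "(\<Sum>x\<in>R J. - ((-1) ^ card J)) = (\<Sum>x\<in>C. if x \<in> R J then - ((-1) ^ card J) else (0::int))" .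
  qed
  also have "\<dots> = (\<Sum>x\<in>C. (\<Sum>J\<in>K. if x \<in> R J then - ((-1) ^ card J) else 0))"
    by (rule sum.swap)
  also have "\<dots> = 0"
  proof (rule sum.neutral, rule ballI)
    fix x assume "x \<in> C"
    then obtain J where "J \<in> K" "x \<in> R J" unfolding C_def by blast
    then obtain m where m: "m \<in> P" "x \<in> Q m" using ex[of J x] by (auto simp: K_def)
    let ?K0 = "{J \<in> K. x \<in> R J \<and> m \<notin> J}" and ?K1 = "{J \<in> K. x \<in> R J \<and> m \<in> J}"
    have K1: "?K1 = insert m ` ?K0"
    proof (intro equalityI subsetI)
      fix J assume J: "J \<in> ?K1"
      \<comment> \<open>Here \<open>single\<close> excludes \<open>{m}\<close>, so that removing
        \<open>m\<close> never produces the empty index set.\<close>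
      have "J \<noteq> {m}" using J single m by auto
      then have ne: "J - {m} \<noteq> {}" using J by auto
      have "insert m (J - {m}) = J" using J by auto
      then have "J - {m} \<in> ?K0"
        using J ins[OF _ ne m] ne by (auto simp: K_def)
      then show "J \<in> insert m ` ?K0" using \<open>insert m (J - {m}) = J\<close> by (metis imageI)
    next
      fix J assume "J \<in> insert m ` ?K0"
      then obtain J' where J': "J' \<in> ?K0" "J = insert m J'" by auto
      then have "\<Inter>(Q ` insert m J') \<noteq> {} \<and> x \<in> R (insert m J')"
        using ins[of J' m x] m by (auto simp: K_def)
      then show "J \<in> ?K1" using J' m by (auto simp: K_def)
    qed
    have inj: "inj_on (insert m) ?K0" by (auto simp: inj_on_def)
    have "(\<Sum>J\<in>K. if x \<in> R J then - ((-1) ^ card J) else 0) = (\<Sum>J\<in>?K0 \<union> ?K1. - ((-1) ^ card J) :: int)"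
    proof -
      have "{J \<in> K. x \<in> R J} = ?K0 \<union> ?K1" by auto
      then show ?thesis using sum.inter_filter[OF finK, of "\<lambda>J. - ((-1) ^ card J) :: int" "\<lambda>J. x \<in> R J"] by metis
    qed
    also have "\<dots> = (\<Sum>J\<in>?K0. - ((-1) ^ card J)) + (\<Sum>J\<in>?K1. - ((-1) ^ card J))"
      using finK by (intro sum.union_disjoint) auto
    also have "(\<Sum>J\<in>?K1. - ((-1) ^ card J) :: int) = (\<Sum>J\<in>?K0. - ((-1) ^ card (insert m J)))"
      unfolding K1 using inj by (simp add: sum.reindex)
    also have "\<dots> = (\<Sum>J\<in>?K0. (-1) ^ card J)"
    proof (rule sum.cong[OF refl])
      fix J assume "J \<in> ?K0"
      then have "finite J" "m \<notin> J" using fin finite_subset by (auto simp: K_def)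
      then show "- ((-1) ^ card (insert m J)) = (-1 :: int) ^ card J" by simp
    qed
    finally show "(\<Sum>J\<in>K. if x \<in> R J then - ((-1) ^ card J) else (0::int)) = 0"
      by (simp add: sum_negf)
  qed
  finally show ?thesis using k by simp
qed

section \<open>Compact surfaces with product charts\<close>

text \<open>A continuous injective function takes values at interior points strictly between those
  at the ends, so its extrema sit at the ends. It may be decreasing, hence the end points correspond
  only as a set.\<close>

lemma inj_image_interval:
  fixes f :: "real \<Rightarrow> real"
  assumes "a < b" and cont: "continuous_on {a..b} f" and inj: "inj_on f {a..b}"
  obtains p q where "p < q" "f ` {a..b} = {p..q}" "f ` {a<..<b} = {p<..<q}" "f ` {a, b} = {p, q}"
proof -
  obtain p q where pq: "f ` {a..b} = {p..q}" "p \<le> q"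
    using continuous_image_closed_interval[OF _ cont] \<open>a < b\<close> by auto
  have fab': "f a \<in> {p..q}" "f b \<in> {p..q}" unfolding pq(1)[symmetric] using \<open>a < b\<close> by auto
  have mid: "x = a \<or> x = b" if "x \<in> {a..b}" "f x = p \<or> f x = q" for x
  proof (rule ccontr)
    assume "\<not> (x = a \<or> x = b)"
    then have x: "a < x" "x < b" using that by auto
    from fab' continuous_inj_imp_mono[OF x cont inj] that(2) show False by auto
  qed
  have "p \<in> f ` {a..b}" "q \<in> f ` {a..b}" unfolding pq(1) using pq(2) by auto
  then obtain x y where xy: "x \<in> {a..b}" "f x = p" "y \<in> {a..b}" "f y = q" by blast
  have fab: "f a \<noteq> f b" using inj_onD[OF inj, of a b] \<open>a < b\<close> by auto
  from fab fab' have "p < q" by auto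
  then have "x \<noteq> y" using xy by auto
  then have eq: "f ` {a, b} = {p, q}" using mid[of x] mid[of y] xy by auto
  have "{a<..<b} = {a..b} - {a, b}" "{p<..<q} = {p..q} - {p, q}" by auto
  moreover have "f ` ({a..b} - {a, b}) = f ` {a..b} - f ` {a, b}"
    using inj \<open>a < b\<close> by (intro inj_on_image_set_diff) auto
  ultimately have "f ` {a<..<b} = {p<..<q}" using pq eq by simp
  with that \<open>p < q\<close> pq eq show ?thesis by blast
qed

definition cbx :: "real \<Rightarrow> real \<Rightarrow> real \<Rightarrow> real \<Rightarrow> (real \<times> real) set" where
  "cbx a b c d = {a..b} \<times> {c..d}"

lemma bx_eq_iff:
  assumes "bx a b c d = bx a' b' c' d'" "a < b" "c < d"
  shows "a = a' \<and> b = b' \<and> c = c' \<and> d = d'"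
proof -
  have "{a<..<b} \<times> {c<..<d} = {a'<..<b'} \<times> {c'<..<d'}" using assms by (simp add: bx_def)
  then have "{a<..<b} = {a'<..<b'}" "{c<..<d} = {c'<..<d'}"
    using assms(2,3) by (auto simp: times_eq_iff greaterThanLessThan_empty_iff)
  then show ?thesis using assms(2,3) by (metis cInf_greaterThanLessThan cSup_greaterThanLessThan greaterThanLessThan_empty_iff not_le)
qed

lemma closed_box_enlarge:
  assumes "open U" "cbx a b c d \<subseteq> U" "a < b" "c < d"
  obtains e where "e > 0" "bx (a - e) (b + e) (c - e) (d + e) \<subseteq> U"
proof -
  have "compact (cbx a b c d)" unfolding cbx_def by (intro compact_Times compact_Icc)
  then obtain e where e: "e > 0" "(\<Union>x\<in>cbx a b c d. ball x e) \<subseteq> U"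
    using compact_subset_open_imp_ball_epsilon_subset assms by metis
  \<comment> \<open>Half of \<open>e\<close>, because the distance to the nearest point of the
    closed box is at most the sum of two components, each less than \<open>e/2\<close>.\<close>
  have "bx (a - e/2) (b + e/2) (c - e/2) (d + e/2) \<subseteq> U"
  proof
    fix z assume z: "z \<in> bx (a - e/2) (b + e/2) (c - e/2) (d + e/2)"
    obtain x y where xy: "z = (x, y)" by (cases z)
    let ?x = "min b (max a x)" and ?y = "min d (max c y)"
    have "dist ?x x < e/2" "dist ?y y < e/2"
      using z assms(3,4) e(1) by (auto simp: xy mem_bx dist_real_def min_def max_def)
    then have "dist (?x, ?y) (x, y) < e"
      unfolding dist_Pair_Pair using sqrt_sum_squares_le_sum[of "dist ?x x" "dist ?y y"] by (simp add: add_strict_mono)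
    moreover have "(?x, ?y) \<in> cbx a b c d" using assms(3,4) by (auto simp: cbx_def)
    ultimately show "z \<in> U" using e(2) xy by (auto simp: subset_iff)
  qed
  then show ?thesis using that[of "e/2"] e(1) by simp
qed

lemma point_box:
  assumes "open U" "(x, y) \<in> U"
  obtains e where "e > 0" "cbx (x - e) (x + e) (y - e) (y + e) \<subseteq> U"
proof -
  obtain e where e: "e > 0" "ball (x, y) e \<subseteq> U" using assms open_contains_ball by metis
  have "cbx (x - e/3) (x + e/3) (y - e/3) (y + e/3) \<subseteq> ball (x, y) e"
  proof
    fix z assume z: "z \<in> cbx (x - e/3) (x + e/3) (y - e/3) (y + e/3)"
    obtain u v where uv: "z = (u, v)" by (cases z)
    have "x - e/3 \<le> u" "u \<le> x + e/3" "y - e/3 \<le> v" "v \<le> y + e/3" using z by (auto simp: uv cbx_def)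
    then have "dist x u \<le> e/3" "dist y v \<le> e/3" unfolding dist_real_def by linarith+
    then have "dist (x, y) (u, v) < e"
      unfolding dist_Pair_Pair using sqrt_sum_squares_le_sum[of "dist x u" "dist y v"] e(1) by simp
    then show "z \<in> ball (x, y) e" using uv by simp
  qed
  then show ?thesis using that[of "e/3"] e by auto
qed

text \<open>\<open>trans\<close> is imposed on boxes inside the overlap, with either form allowed on
  each box: if the overlap or the level sets in it are disconnected, a single pair of functions need
  not exist.\<close>

locale grid_atlas =
  fixes X :: "'a topology" and GA :: "('a set \<times> ('a \<Rightarrow> real \<times> real)) set"
  assumes compact: "compact_space X" and Hausdorff: "Hausdorff_space X"
    and cover: "topspace X \<subseteq> \<Union>(fst ` GA)"
    and openin_dom: "(W, h) \<in> GA \<Longrightarrow> openin X W"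
    and chart_homeo: "(W, h) \<in> GA \<Longrightarrow> homeomorphic_map (subtopology X W) (top_of_set (h ` W)) h"
    and open_im: "(W, h) \<in> GA \<Longrightarrow> open (h ` W)"
    and trans: "\<lbrakk>(W, h) \<in> GA; (W', h') \<in> GA; a < b; c < d; bx a b c d \<subseteq> h ` (W \<inter> W')\<rbrakk> \<Longrightarrow>
      \<exists>\<alpha> \<beta>. (\<forall>x y. (x, y) \<in> bx a b c d \<longrightarrow> h' (inv_into W h (x, y)) = (\<alpha> x, \<beta> y)) \<or>
            (\<forall>x y. (x, y) \<in> bx a b c d \<longrightarrow> h' (inv_into W h (x, y)) = (\<beta> y, \<alpha> x))"
begin

lemma dom_subset: "(W, h) \<in> GA \<Longrightarrow> W \<subseteq> topspace X"
  using openin_dom openin_subset by blast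

lemma inj_chart: "(W, h) \<in> GA \<Longrightarrow> inj_on h W"
  using homeomorphic_imp_injective_map[OF chart_homeo] dom_subset by (simp add: Int_absorb1)

lemma homeo_restrict:
  assumes g: "(W, h) \<in> GA" and S: "S \<subseteq> W"
  shows "homeomorphic_map (subtopology X S) (top_of_set (h ` S)) h"
proof -
  have "homeomorphic_map (subtopology (subtopology X W) S) (subtopology (top_of_set (h ` W)) (h ` S)) h"
    by (rule homeomorphic_map_subtopologies[OF chart_homeo[OF g]]) (use S dom_subset[OF g] in auto)
  moreover have "subtopology (subtopology X W) S = subtopology X S"
    using S by (simp add: subtopology_subtopology Int_absorb1)
  moreover have "subtopology (top_of_set (h ` W)) (h ` S) = top_of_set (h ` S)"
    using S by (simp add: subtopology_subtopology Int_absorb1 image_mono)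
  ultimately show ?thesis by simp
qed

lemma open_image:
  assumes g: "(W, h) \<in> GA" and "openin X S" "S \<subseteq> W"
  shows "open (h ` S)"
proof -
  have "openin (subtopology X W) S" unfolding openin_subtopology using assms by blast
  then have "openin (top_of_set (h ` W)) (h ` S)"
    using homeomorphic_imp_open_map[OF chart_homeo[OF g]] by (auto simp: open_map_def)
  then show ?thesis using open_im[OF g] openin_open_trans by blast
qed

lemma openin_preimage:
  assumes g: "(W, h) \<in> GA" and "open S"
  shows "openin X (W \<inter> h -` S)"
proof -
  have "continuous_map (subtopology X W) (top_of_set (h ` W)) h"
    using homeomorphic_imp_continuous_map[OF chart_homeo[OF g]] .
  then have "continuous_map (subtopology X W) euclidean h" by (simp add: continuous_map_in_subtopology)
  then have "openin (subtopology X W) {x \<in> topspace (subtopology X W). h x \<in> S}"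
    by (rule openin_continuous_map_preimage) (use \<open>open S\<close> in simp)
  moreover have "{x \<in> topspace (subtopology X W). h x \<in> S} = W \<inter> h -` S" using dom_subset[OF g] by auto
  ultimately show ?thesis using openin_trans_full[OF _ openin_dom[OF g]] by simp
qed

text \<open>\<open>Q\<close>, \<open>C\<close> and \<open>R\<close> are the open box, the closed box
  and the four corners as subsets of the surface, so that they can be compared between
  charts.\<close>

definition grid_box where
  "grid_box W h a b c d Q C R \<longleftrightarrow> a < b \<and> c < d \<and> cbx a b c d \<subseteq> h ` W \<and> Q = W \<inter> h -` bx a b c d \<and>
     C = W \<inter> h -` cbx a b c d \<and> R = W \<inter> h -` ({a, b} \<times> {c, d})"

lemma grid_box_subset: "grid_box W h a b c d Q C R \<Longrightarrow> Q \<subseteq> C \<and> R \<subseteq> C \<and> C \<subseteq> W \<and> Q \<inter> R = {}"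
  by (auto simp: grid_box_def bx_def cbx_def)

lemma grid_box_openin: "(W, h) \<in> GA \<Longrightarrow> grid_box W h a b c d Q C R \<Longrightarrow> openin X Q"
  using openin_preimage[OF _ open_bx] by (auto simp: grid_box_def)

lemma grid_box_image: "grid_box W h a b c d Q C R \<Longrightarrow> h ` Q = bx a b c d"
proof -
  assume n: "grid_box W h a b c d Q C R"
  have "bx a b c d \<subseteq> cbx a b c d" by (auto simp: bx_def cbx_def)
  then have "bx a b c d \<subseteq> h ` W" "Q = W \<inter> h -` bx a b c d" using n unfolding grid_box_def by blast+
  then show ?thesis by blast
qed

text \<open>\<open>C\<close> is homeomorphic to a compact rectangle, and compact sets in a Hausdorff
  space are closed. The complement of \<open>C\<close> is used as a neighbourhood in
  \<open>fine_cover\<close>.\<close>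

lemma grid_box_closedin:
  assumes g: "(W, h) \<in> GA" and n: "grid_box W h a b c d Q C R"
  shows "closedin X C"
proof -
  have sub: "cbx a b c d \<subseteq> h ` W" and C: "C = W \<inter> h -` cbx a b c d" using n by (auto simp: grid_box_def)
  have hC: "h ` C = cbx a b c d" using sub C by auto
  have "compact (cbx a b c d)" unfolding cbx_def by (intro compact_Times compact_Icc)
  then have "compact_space (top_of_set (h ` C))" unfolding hC by (simp add: compact_space_subtopology)
  then have "compact_space (subtopology X C)"
    using homeo_restrict[OF g, of C] C homeomorphic_compact_space homeomorphic_map_imp_homeomorphic_space by blast
  moreover have "C \<subseteq> topspace X" using C dom_subset[OF g] by auto
  ultimately have "compactin X C" by (simp add: compactin_subspace)
  then show ?thesis using compactin_imp_closedin[OF Hausdorff] by blast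
qed

lemma small_nice:
  assumes g: "(W, h) \<in> GA" and S: "openin X S" "p \<in> S" "p \<in> W"
  obtains a b c d Q C R where "grid_box W h a b c d Q C R" "p \<in> Q" "C \<subseteq> S"
proof -
  have "open (h ` (W \<inter> S))" using g S openin_dom[OF g] by (intro open_image) auto
  moreover obtain x y where xy: "h p = (x, y)" by (cases "h p")
  moreover have "h p \<in> h ` (W \<inter> S)" using S by auto
  ultimately obtain e where e: "e > 0" "cbx (x - e) (x + e) (y - e) (y + e) \<subseteq> h ` (W \<inter> S)"
    using point_box by metis
  let ?c = "cbx (x - e) (x + e) (y - e) (y + e)"
  let ?b = "bx (x - e) (x + e) (y - e) (y + e)"
  have "grid_box W h (x - e) (x + e) (y - e) (y + e) (W \<inter> h -` ?b) (W \<inter> h -` ?c)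
      (W \<inter> h -` ({x - e, x + e} \<times> {y - e, y + e}))"
    using e by (auto simp: grid_box_def)
  moreover have "p \<in> W \<inter> h -` ?b" using S xy e by (auto simp: mem_bx)
  moreover have "W \<inter> h -` ?c \<subseteq> S"
  proof
    fix w assume w: "w \<in> W \<inter> h -` ?c"
    then obtain w' where "w' \<in> W \<inter> S" "h w = h w'" using e by auto
    then show "w \<in> S" using inj_chart[OF g] w by (auto simp: inj_on_def)
  qed
  ultimately show ?thesis using that by blast
qed

text \<open>A coordinate change of product form maps each side interval onto an interval and its
  ends to ends, so open box, closed box and corners go to those of a box in the other chart.\<close>

lemma grid_box_transport:
  assumes g: "(W, h) \<in> GA" and g': "(W', h') \<in> GA" and n: "grid_box W h a b c d Q C R" and C: "C \<subseteq> W'"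
  shows "\<exists>a b c d. grid_box W' h' a b c d Q C R"
proof -
  have ab: "a < b" "c < d" and sub: "cbx a b c d \<subseteq> h ` W" and Ceq: "C = W \<inter> h -` cbx a b c d"
    and Qeq: "Q = W \<inter> h -` bx a b c d" and Req: "R = W \<inter> h -` ({a, b} \<times> {c, d})"
    using n by (auto simp: grid_box_def)
  have "open (h ` (W \<inter> W'))" using g openin_dom[OF g] openin_dom[OF g'] by (intro open_image) auto
  moreover have "cbx a b c d \<subseteq> h ` (W \<inter> W')"
  proof
    fix z assume z: "z \<in> cbx a b c d"
    then obtain w where "w \<in> W" "z = h w" using sub by blast
    then show "z \<in> h ` (W \<inter> W')" using z Ceq C by blast
  qed
  \<comment> \<open>\<open>trans\<close> speaks of open boxes while the corners lie on the boundary,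
    hence a slightly larger box inside the overlap.\<close>
  ultimately obtain e where e: "e > 0" and big: "bx (a - e) (b + e) (c - e) (d + e) \<subseteq> h ` (W \<inter> W')"
    by (rule closed_box_enlarge[OF _ _ ab])
  let ?B = "bx (a - e) (b + e) (c - e) (d + e)"
  define t where "t z = h' (inv_into W h z)" for z
  have inv: "inv_into W h z \<in> W \<inter> W'" "h (inv_into W h z) = z" if "z \<in> ?B" for z
  proof -
    obtain w where w: "w \<in> W \<inter> W'" "z = h w" using big \<open>z \<in> ?B\<close> by auto
    then have "inv_into W h z = w" using inj_chart[OF g] by simp
    with w show "inv_into W h z \<in> W \<inter> W'" "h (inv_into W h z) = z" by auto
  qed
  have ht: "t (h w) = h' w" if "w \<in> W" for w
    using that inj_chart[OF g] by (simp add: t_def)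
  have pre: "W \<inter> h -` S = W' \<inter> h' -` T" if S: "S \<subseteq> cbx a b c d" and T: "t ` S = T" for S T
  proof (intro equalityI subsetI)
    fix w assume w: "w \<in> W \<inter> h -` S"
    then have "w \<in> C" using S Ceq by blast
    moreover have "t (h w) \<in> T" using w T by blast
    ultimately show "w \<in> W' \<inter> h' -` T" using w C ht by auto
  next
    fix w assume w: "w \<in> W' \<inter> h' -` T"
    then obtain z where z: "z \<in> S" "h' w = t z" using T by auto
    have "z \<in> ?B" using z S e by (auto simp: cbx_def bx_def)
    then have "inv_into W h z = w" using inv[of z] z w inj_chart[OF g'] by (auto simp: t_def inj_on_def)
    then show "w \<in> W \<inter> h -` S" using inv[OF \<open>z \<in> ?B\<close>] z by auto
  qed
  have "continuous_on ?B t"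
  proof -
    have 1: "homeomorphic_map (subtopology X (W \<inter> W')) (top_of_set (h ` (W \<inter> W'))) h"
      using homeo_restrict[OF g] by simp
    have 2: "continuous_map (subtopology X (W \<inter> W')) (top_of_set (h' ` (W \<inter> W'))) h'"
      using homeo_restrict[OF g'] homeomorphic_imp_continuous_map by blast
    from 1 obtain k where k: "homeomorphic_maps (subtopology X (W \<inter> W')) (top_of_set (h ` (W \<inter> W'))) h k"
      using homeomorphic_map_maps by blast
    then have "continuous_map (top_of_set (h ` (W \<inter> W'))) (subtopology X (W \<inter> W')) k"
      unfolding homeomorphic_maps_def by blast
    from continuous_map_compose[OF this 2]
    have "continuous_on (h ` (W \<inter> W')) (h' \<circ> k)" by simp
    then have "continuous_on ?B (h' \<circ> k)" using big continuous_on_subset by blast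
    moreover have "(h' \<circ> k) z = t z" if z: "z \<in> ?B" for z
    proof -
      obtain w where w: "w \<in> W \<inter> W'" "z = h w" using big z by auto
      then have "k z = w" using k dom_subset[OF g] by (auto simp: homeomorphic_maps_def)
      then show ?thesis using w inj_chart[OF g] by (simp add: t_def)
    qed
    ultimately show ?thesis by (metis continuous_on_eq)
  qed
  have injt: "inj_on t ?B"
  proof (rule inj_onI)
    fix z z' assume "z \<in> ?B" "z' \<in> ?B" "t z = t z'"
    then show "z = z'" using inv inj_chart[OF g'] by (metis IntD2 inj_onD t_def)
  qed
  have mB: "(x, y) \<in> ?B" if "x \<in> {a..b}" "y \<in> {c..d}" for x y using that e by (auto simp: mem_bx)
  have int: "a \<in> {a..b}" "c \<in> {c..d}" using ab by auto
  obtain \<alpha> \<beta> where "(\<forall>x y. (x, y) \<in> ?B \<longrightarrow> t (x, y) = (\<alpha> x, \<beta> y)) \<or>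
            (\<forall>x y. (x, y) \<in> ?B \<longrightarrow> t (x, y) = (\<beta> y, \<alpha> x))"
    using trans[OF g g' _ _ big] ab e unfolding t_def by auto
  then consider (1) "\<And>x y. (x, y) \<in> ?B \<Longrightarrow> t (x, y) = (\<alpha> x, \<beta> y)"
    | (2) "\<And>x y. (x, y) \<in> ?B \<Longrightarrow> t (x, y) = (\<beta> y, \<alpha> x)" by blast
  then have "continuous_on {a..b} \<alpha> \<and> continuous_on {c..d} \<beta> \<and> inj_on \<alpha> {a..b} \<and> inj_on \<beta> {c..d}"
  proof cases
    case 1
    have c: "continuous_on {a..b} (\<lambda>x. fst (t (x, c)))" "continuous_on {c..d} (\<lambda>y. snd (t (a, y)))"
      using mB int by (intro continuous_on_fst continuous_on_snd continuous_on_compose2[OF \<open>continuous_on ?B t\<close>] continuous_intros; auto)+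
    have "continuous_on {a..b} \<alpha>" using c(1) by (rule continuous_on_eq) (use 1 mB int in simp)
    moreover have "continuous_on {c..d} \<beta>" using c(2) by (rule continuous_on_eq) (use 1 mB int in simp)
    moreover have "x = x'" if "x \<in> {a..b}" "x' \<in> {a..b}" "\<alpha> x = \<alpha> x'" for x x'
      using inj_onD[OF injt, of "(x, c)" "(x', c)"] 1 mB[OF that(1) int(2)] mB[OF that(2) int(2)] that by simp
    moreover have "y = y'" if "y \<in> {c..d}" "y' \<in> {c..d}" "\<beta> y = \<beta> y'" for y y'
      using inj_onD[OF injt, of "(a, y)" "(a, y')"] 1 mB[OF int(1) that(1)] mB[OF int(1) that(2)] that by simp
    ultimately show ?thesis unfolding inj_on_def by blast
  next
    case 2
    have c: "continuous_on {a..b} (\<lambda>x. snd (t (x, c)))" "continuous_on {c..d} (\<lambda>y. fst (t (a, y)))"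
      using mB int by (intro continuous_on_fst continuous_on_snd continuous_on_compose2[OF \<open>continuous_on ?B t\<close>] continuous_intros; auto)+
    have "continuous_on {a..b} \<alpha>" using c(1) by (rule continuous_on_eq) (use 2 mB int in simp)
    moreover have "continuous_on {c..d} \<beta>" using c(2) by (rule continuous_on_eq) (use 2 mB int in simp)
    moreover have "x = x'" if "x \<in> {a..b}" "x' \<in> {a..b}" "\<alpha> x = \<alpha> x'" for x x'
      using inj_onD[OF injt, of "(x, c)" "(x', c)"] 2 mB[OF that(1) int(2)] mB[OF that(2) int(2)] that by simp
    moreover have "y = y'" if "y \<in> {c..d}" "y' \<in> {c..d}" "\<beta> y = \<beta> y'" for y y'
      using inj_onD[OF injt, of "(a, y)" "(a, y')"] 2 mB[OF int(1) that(1)] mB[OF int(1) that(2)] that by simp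
    ultimately show ?thesis unfolding inj_on_def by blast
  qed
  then obtain p q r s where
      pq: "p < q" "\<alpha> ` {a..b} = {p..q}" "\<alpha> ` {a<..<b} = {p<..<q}" "\<alpha> ` {a, b} = {p, q}"
    and rs: "r < s" "\<beta> ` {c..d} = {r..s}" "\<beta> ` {c<..<d} = {r<..<s}" "\<beta> ` {c, d} = {r, s}"
    using inj_image_interval[OF ab(1)] inj_image_interval[OF ab(2)] by metis
  have sub': "{a<..<b} \<times> {c<..<d} \<subseteq> cbx a b c d" "{a, b} \<times> {c, d} \<subseteq> cbx a b c d"
    using ab by (auto simp: cbx_def)
  have CB: "cbx a b c d \<subseteq> ?B" using e by (auto simp: cbx_def bx_def)
  have sub2: "t ` cbx a b c d \<subseteq> h' ` W'" using CB inv by (auto simp: t_def)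
  consider (1) "\<And>x y. (x, y) \<in> ?B \<Longrightarrow> t (x, y) = (\<alpha> x, \<beta> y)"
    | (2) "\<And>x y. (x, y) \<in> ?B \<Longrightarrow> t (x, y) = (\<beta> y, \<alpha> x)"
    using \<open>(\<forall>x y. (x, y) \<in> ?B \<longrightarrow> t (x, y) = (\<alpha> x, \<beta> y)) \<or>
            (\<forall>x y. (x, y) \<in> ?B \<longrightarrow> t (x, y) = (\<beta> y, \<alpha> x))\<close> by blast
  then show ?thesis
  proof cases
    case 1
    have im: "t ` (I \<times> J) = \<alpha> ` I \<times> \<beta> ` J" if "I \<times> J \<subseteq> cbx a b c d" for I J
    proof -
      have "t (x, y) = (\<alpha> x, \<beta> y)" if "x \<in> I" "y \<in> J" for x y
        using 1 CB \<open>I \<times> J \<subseteq> cbx a b c d\<close> that by blast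
      then show ?thesis by (force simp: image_iff)
    qed
    have "grid_box W' h' p q r s Q C R"
      unfolding grid_box_def Qeq Ceq Req
    proof (intro conjI pre)
      show "t ` cbx a b c d = cbx p q r s" using im[of "{a..b}" "{c..d}"] pq rs by (simp add: cbx_def)
      then show "cbx p q r s \<subseteq> h' ` W'" using sub2 by simp
      show "t ` bx a b c d = bx p q r s" using im[OF sub'(1)] pq rs by (simp add: bx_def)
      show "t ` ({a, b} \<times> {c, d}) = {p, q} \<times> {r, s}" unfolding im[OF sub'(2)] pq(4) rs(4) ..
    qed (use pq rs sub' in \<open>auto simp: bx_def\<close>)
    then show ?thesis by blast
  next
    case 2
    have im: "t ` (I \<times> J) = \<beta> ` J \<times> \<alpha> ` I" if "I \<times> J \<subseteq> cbx a b c d" for I J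
    proof -
      have "t (x, y) = (\<beta> y, \<alpha> x)" if "x \<in> I" "y \<in> J" for x y
        using 2 CB \<open>I \<times> J \<subseteq> cbx a b c d\<close> that by blast
      then show ?thesis by (force simp: image_iff)
    qed
    have "grid_box W' h' r s p q Q C R"
      unfolding grid_box_def Qeq Ceq Req
    proof (intro conjI pre)
      show "t ` cbx a b c d = cbx r s p q" using im[of "{a..b}" "{c..d}"] pq rs by (simp add: cbx_def)
      then show "cbx r s p q \<subseteq> h' ` W'" using sub2 by simp
      show "t ` bx a b c d = bx r s p q" using im[OF sub'(1)] pq rs by (simp add: bx_def)
      show "t ` ({a, b} \<times> {c, d}) = {r, s} \<times> {p, q}" unfolding im[OF sub'(2)] pq(4) rs(4) ..
    qed (use pq rs sub' in \<open>auto simp: bx_def\<close>)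
    then show ?thesis by blast
  qed
qed

lemma grid_box_unique:
  assumes "grid_box W h a b c d Q C R" "grid_box W h a' b' c' d' Q C' R'"
  shows "R = R'" "a = a'" "b = b'" "c = c'" "d = d'"
proof -
  have "bx a b c d = bx a' b' c' d'" using assms grid_box_image by metis
  then have "a = a' \<and> b = b' \<and> c = c' \<and> d = d'" using assms(1) by (intro bx_eq_iff) (auto simp: grid_box_def)
  then show "R = R'" "a = a'" "b = b'" "c = c'" "d = d'" using assms by (auto simp: grid_box_def)
qed

lemma grid_box_card:
  assumes g: "(W, h) \<in> GA" and n: "grid_box W h a b c d Q C R"
  shows "finite R \<and> card R = 4"
proof -
  have ab: "a < b" "c < d" and R: "R = W \<inter> h -` ({a, b} \<times> {c, d})" and sub: "cbx a b c d \<subseteq> h ` W"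
    using n by (auto simp: grid_box_def)
  have "{a, b} \<times> {c, d} \<subseteq> cbx a b c d" using ab by (auto simp: cbx_def)
  then have "h ` R = {a, b} \<times> {c, d}" using sub R by auto
  moreover have "inj_on h R" using inj_chart[OF g] R by (auto simp: inj_on_def)
  ultimately have "bij_betw h R ({a, b} \<times> {c, d})" by (simp add: bij_betw_def)
  moreover have "card ({a, b} \<times> {c, d}) = 4" using ab by (simp add: card_cartesian_product)
  ultimately show ?thesis by (metis bij_betw_finite bij_betw_same_card finite.emptyI finite.insertI finite_cartesian_product)
qed

text \<open>A corner of the intersection need not be a corner of either box, hence the explicit
  coordinates for the last argument.\<close>

lemma grid_box_Int:
  assumes n: "grid_box W h a b c d Q C R" "grid_box W h a' b' c' d' Q' C' R'" and ne: "Q \<inter> Q' \<noteq> {}"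
  shows "grid_box W h (max a a') (min b b') (max c c') (min d d') (Q \<inter> Q') (C \<inter> C')
    (W \<inter> h -` ({max a a', min b b'} \<times> {max c c', min d d'}))"
proof -
  obtain w where w: "w \<in> Q \<inter> Q'" using ne by auto
  obtain x y where "h w = (x, y)" by (cases "h w")
  then have "max a a' < min b b'" "max c c' < min d d'"
    using w n by (auto simp: grid_box_def mem_bx)
  moreover have "cbx (max a a') (min b b') (max c c') (min d d') \<subseteq> cbx a b c d" by (auto simp: cbx_def)
  moreover have "Q \<inter> Q' = W \<inter> h -` (bx a b c d \<inter> bx a' b' c' d')" using n by (auto simp: grid_box_def)
  moreover have "C \<inter> C' = W \<inter> h -` (cbx (max a a') (min b b') (max c c') (min d d'))"
    using n by (auto simp: grid_box_def cbx_def)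
  ultimately show ?thesis using n by (auto simp: grid_box_def bx_Int)
qed

text \<open>A substitute for a Lebesgue number: all boxes that meet a given one are visible in its
  chart. The cover is built in two stages, finitely many boxes with closures \<open>C1 i\<close>,
  and then boxes so small that each lies in one of the first stage and in a neighbourhood
  \<open>S p\<close> adapted to all \<open>C1 i\<close>.\<close>

lemma fine_cover:
  obtains P :: "'a set" and W h and a b c d :: "'a \<Rightarrow> real" and Q C R where "finite P"
    "\<And>p. p \<in> P \<Longrightarrow> (W p, h p) \<in> GA"
    "\<And>p. p \<in> P \<Longrightarrow> grid_box (W p) (h p) (a p) (b p) (c p) (d p) (Q p) (C p) (R p)"
    "topspace X = (\<Union>p\<in>P. Q p)"
    "\<And>p q. p \<in> P \<Longrightarrow> q \<in> P \<Longrightarrow> C p \<inter> C q \<noteq> {} \<Longrightarrow> C q \<subseteq> W p"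
proof -
  have sub: "\<exists>F\<subseteq>topspace X. finite F \<and> topspace X \<subseteq> (\<Union>p\<in>F. N p)"
    if N: "\<And>p. p \<in> topspace X \<Longrightarrow> openin X (N p) \<and> p \<in> N p" for N :: "'a \<Rightarrow> 'a set"
  proof -
    have "\<exists>\<F>. finite \<F> \<and> \<F> \<subseteq> N ` topspace X \<and> topspace X \<subseteq> \<Union>\<F>"
      using compact N unfolding compact_space_alt by (auto dest!: spec[of _ "N ` topspace X"])
    then show ?thesis by (metis (no_types, lifting) finite_subset_image)
  qed
  have "\<exists>W h a b c d Q C R. (W, h) \<in> GA \<and> grid_box W h a b c d Q C R \<and> p \<in> Q" if p: "p \<in> topspace X" for p
  proof -
    obtain g where "g \<in> GA" "p \<in> fst g" using cover p by blast
    then obtain W h where g: "(W, h) \<in> GA" "p \<in> W" by (cases g) simp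
    obtain a b c d Q C R where "grid_box W h a b c d Q C R" "p \<in> Q"
      using small_nice[OF g(1) openin_topspace p g(2)] .
    then show ?thesis using g(1) by blast
  qed
  then obtain W1 h1 a1 b1 c1 d1 Q1 C1 R1 where 1: "\<And>p. p \<in> topspace X \<Longrightarrow>
      (W1 p, h1 p) \<in> GA \<and> grid_box (W1 p) (h1 p) (a1 p) (b1 p) (c1 p) (d1 p) (Q1 p) (C1 p) (R1 p) \<and> p \<in> Q1 p"
    by metis
  have C1W1: "C1 p \<subseteq> W1 p" if "p \<in> topspace X" for p
    using 1[OF that] grid_box_subset[of "W1 p" "h1 p" "a1 p" "b1 p" "c1 p" "d1 p" "Q1 p" "C1 p" "R1 p"] by blast
  have oQ1: "openin X (Q1 p) \<and> p \<in> Q1 p" if "p \<in> topspace X" for p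
    using 1[OF that] grid_box_openin[of "W1 p" "h1 p" "a1 p" "b1 p" "c1 p" "d1 p" "Q1 p" "C1 p" "R1 p"] by blast
  from sub[of Q1] oQ1 obtain F where F: "F \<subseteq> topspace X" "finite F" "topspace X \<subseteq> (\<Union>p\<in>F. Q1 p)" by blast
  \<comment> \<open>For each \<open>i\<close> the set \<open>S p\<close> lies in \<open>W1 i\<close>
    if \<open>p \<in> C1 i\<close>, and avoids \<open>C1 i\<close> otherwise. So if
    \<open>S p\<close> meets \<open>C1 i\<close> at all, it is contained in
    \<open>W1 i\<close>.\<close>
  define S where "S p = (\<Inter>i\<in>F. if p \<in> C1 i then W1 i else topspace X - C1 i)" for p
  \<comment> \<open>For empty \<open>F\<close> the set \<open>S p\<close> is the whole type, hence
    the intersection with the space.\<close>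
  have openS: "openin X (topspace X \<inter> S p)" for p
  proof (cases "F = {}")
    case False
    define N where "N i = (if p \<in> C1 i then W1 i else topspace X - C1 i)" for i
    have oN: "openin X (N i)" if "i \<in> F" for i
    proof -
      have g: "(W1 i, h1 i) \<in> GA" and n: "grid_box (W1 i) (h1 i) (a1 i) (b1 i) (c1 i) (d1 i) (Q1 i) (C1 i) (R1 i)"
        using 1[of i] F that by auto
      show ?thesis using openin_dom[OF g] grid_box_closedin[OF g n] by (auto simp: N_def)
    qed
    have "openin X (\<Inter>(N ` F))"
      by (rule openin_Inter) (use F False oN in auto)
    then have "openin X (S p)" by (simp add: S_def N_def)
    then show ?thesis by blast
  qed (simp add: S_def)
  have "\<exists>i a b c d Q C R. i \<in> F \<and> grid_box (W1 i) (h1 i) a b c d Q C R \<and> p \<in> Q \<and> C \<subseteq> Q1 i \<inter> S p"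
    if p: "p \<in> topspace X" for p
  proof -
    obtain i where i: "i \<in> F" "p \<in> Q1 i" using F p by auto
    have 1: "(W1 i, h1 i) \<in> GA" "grid_box (W1 i) (h1 i) (a1 i) (b1 i) (c1 i) (d1 i) (Q1 i) (C1 i) (R1 i)"
      using 1 i F by auto
    have "openin X (Q1 i \<inter> (topspace X \<inter> S p))" using grid_box_openin[OF 1] openS by blast
    moreover have "p \<in> S p"
      unfolding S_def
    proof (rule INT_I)
      fix j assume "j \<in> F"
      then have "C1 j \<subseteq> W1 j" using C1W1 F(1) by blast
      then show "p \<in> (if p \<in> C1 j then W1 j else topspace X - C1 j)" using p by auto
    qed
    moreover have "p \<in> W1 i" using i grid_box_subset[OF 1(2)] by auto
    ultimately obtain a b c d Q C R where "grid_box (W1 i) (h1 i) a b c d Q C R" "p \<in> Q" "C \<subseteq> Q1 i \<inter> (topspace X \<inter> S p)"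
      using small_nice[OF 1(1), of "Q1 i \<inter> (topspace X \<inter> S p)" p] i p by blast
    then show ?thesis using i by blast
  qed
  then obtain i a b c d Q C R where 2: "\<And>p. p \<in> topspace X \<Longrightarrow> i p \<in> F \<and>
      grid_box (W1 (i p)) (h1 (i p)) (a p) (b p) (c p) (d p) (Q p) (C p) (R p) \<and> p \<in> Q p \<and> C p \<subseteq> Q1 (i p) \<inter> S p"
    by metis
  have o: "openin X (Q p)" "Q p \<subseteq> topspace X" if "p \<in> topspace X" for p
  proof -
    have i: "i p \<in> topspace X" using 2[OF that] F(1) by blast
    have "grid_box (W1 (i p)) (h1 (i p)) (a p) (b p) (c p) (d p) (Q p) (C p) (R p)" using 2[OF that] by blast
    then show "openin X (Q p)" using 1[OF i] by (intro grid_box_openin) auto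
    then show "Q p \<subseteq> topspace X" by (rule openin_subset)
  qed
  obtain P where P: "P \<subseteq> topspace X" "finite P" "topspace X \<subseteq> (\<Union>p\<in>P. Q p)"
    using sub[of Q] 2 o by metis
  show ?thesis
  proof (rule that[of P "\<lambda>p. W1 (i p)" "\<lambda>p. h1 (i p)"])
    show "topspace X = (\<Union>p\<in>P. Q p)" using P o by blast
    fix p q assume p: "p \<in> P" and q: "q \<in> P" and ne: "C p \<inter> C q \<noteq> {}"
    have pt: "p \<in> topspace X" and qt: "q \<in> topspace X" using p q P by auto
    have ip: "i p \<in> F" using 2[OF pt] by blast
    then have "i p \<in> topspace X" using F by blast
    then have "Q1 (i p) \<subseteq> C1 (i p)"
      using 1[of "i p"] grid_box_subset[of "W1 (i p)" "h1 (i p)" "a1 (i p)" "b1 (i p)" "c1 (i p)" "d1 (i p)" "Q1 (i p)" "C1 (i p)" "R1 (i p)"]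
      by blast
    then obtain x where x: "x \<in> C1 (i p)" "x \<in> S q" using ne 2[OF pt] 2[OF qt] by blast
    have Sq: "S q \<subseteq> (if q \<in> C1 (i p) then W1 (i p) else topspace X - C1 (i p))"
      unfolding S_def using ip by (rule INF_lower)
    then have "q \<in> C1 (i p)" using x by (auto split: if_splits)
    then show "C q \<subseteq> W1 (i p)" using Sq 2[OF qt] by auto
  qed (use P 1 2 F in blast)+
qed

theorem has_euler_grid: "has_euler X {} 0" "hvan X {} 2"
proof -
  obtain P :: "'a set" and W h and a b c d :: "'a \<Rightarrow> real" and Q C R where fin: "finite P"
    and GA: "\<And>p. p \<in> P \<Longrightarrow> (W p, h p) \<in> GA"
    and grid_box: "\<And>p. p \<in> P \<Longrightarrow> grid_box (W p) (h p) (a p) (b p) (c p) (d p) (Q p) (C p) (R p)"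
    and top: "topspace X = (\<Union>p\<in>P. Q p)"
    and star: "\<And>p q. p \<in> P \<Longrightarrow> q \<in> P \<Longrightarrow> C p \<inter> C q \<noteq> {} \<Longrightarrow> C q \<subseteq> W p"
    by (rule fine_cover) blast
  have oQ: "openin X (Q p)" if "p \<in> P" for p
    using grid_box_openin[OF GA[OF that] grid_box[OF that]] .
  have QC: "Q p \<subseteq> C p" if "p \<in> P" for p
    using grid_box_subset[OF grid_box[OF that]] by blast
  have grid_box': "\<exists>a b c d. grid_box (W p) (h p) a b c d (Q q) (C q) (R q)"
    if "p \<in> P" "q \<in> P" "C p \<inter> C q \<noteq> {}" for p q
    using grid_box_transport[OF GA[OF that(2)] GA[OF that(1)] grid_box[OF that(2)]] star that by blast
  \<comment> \<open>A single chart sees the whole intersection once \<open>C p\<close> meets every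
    \<open>C q\<close>. The index \<open>p\<close> need not belong to \<open>J\<close>; below it is
    also taken to be the \<open>m\<close> that is to be added.\<close>
  have niceJ: "\<exists>a b c d R. grid_box (W p) (h p) a b c d (\<Inter>(Q ` J)) (\<Inter>(C ` J)) R"
    if J: "finite J" "J \<noteq> {}" "J \<subseteq> P" "p \<in> P" "\<And>q. q \<in> J \<Longrightarrow> C p \<inter> C q \<noteq> {}" "\<Inter>(Q ` J) \<noteq> {}" for J p
    using J
  proof (induction J rule: finite_ne_induct)
    case (singleton q)
    then show ?case using grid_box'[of p q] by auto
  next
    case (insert q J)
    have "\<exists>a b c d R. grid_box (W p) (h p) a b c d (\<Inter>(Q ` J)) (\<Inter>(C ` J)) R"
      by (rule insert.IH) (use insert.prems in auto)
    then obtain a b c d R' where n1: "grid_box (W p) (h p) a b c d (\<Inter>(Q ` J)) (\<Inter>(C ` J)) R'" by blast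
    obtain a' b' c' d' where n2: "grid_box (W p) (h p) a' b' c' d' (Q q) (C q) (R q)"
      using insert.prems grid_box'[of p q] by auto
    have "Q q \<inter> \<Inter>(Q ` J) \<noteq> {}" using insert.prems by auto
    from grid_box_Int[OF n2 n1 this] show ?case unfolding image_insert Inter_insert by blast
  qed
  have meet: "C p \<inter> C q \<noteq> {}" if J: "J \<subseteq> P" "p \<in> J" "q \<in> J" "\<Inter>(Q ` J) \<noteq> {}" for J p q
  proof -
    obtain x where "x \<in> \<Inter>(Q ` J)" using J(4) by blast
    then have "x \<in> Q p" "x \<in> Q q" using J by auto
    moreover have "p \<in> P" "q \<in> P" using J by auto
    ultimately show ?thesis using QC by blast
  qed
  \<comment> \<open>The corners of an intersection, read off in some chart. Transport and
    \<open>grid_box_unique\<close> make the result the same for all charts of the cover in which the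
    intersection is a box.\<close>
  define RJ where "RJ J = (SOME R. \<exists>p\<in>P. \<exists>a b c d. grid_box (W p) (h p) a b c d (\<Inter>(Q ` J)) (\<Inter>(C ` J)) R)" for J
  have RJ: "RJ J = R" if p: "p \<in> P" and n: "grid_box (W p) (h p) a b c d (\<Inter>(Q ` J)) (\<Inter>(C ` J)) R" for J p a b c d R
  proof -
    have "\<exists>R. \<exists>p\<in>P. \<exists>a b c d. grid_box (W p) (h p) a b c d (\<Inter>(Q ` J)) (\<Inter>(C ` J)) R" using p n by blast
    then have "\<exists>p\<in>P. \<exists>a b c d. grid_box (W p) (h p) a b c d (\<Inter>(Q ` J)) (\<Inter>(C ` J)) (RJ J)"
      unfolding RJ_def by (rule someI_ex)
    then obtain q a' b' c' d' where q: "q \<in> P" "grid_box (W q) (h q) a' b' c' d' (\<Inter>(Q ` J)) (\<Inter>(C ` J)) (RJ J)" by blast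
    have "\<Inter>(C ` J) \<subseteq> W p" using grid_box_subset[OF n] by blast
    then obtain a'' b'' c'' d'' where "grid_box (W p) (h p) a'' b'' c'' d'' (\<Inter>(Q ` J)) (\<Inter>(C ` J)) (RJ J)"
      using grid_box_transport[OF GA[OF q(1)] GA[OF p] q(2)] by blast
    then show ?thesis using grid_box_unique(1)[OF _ n] by blast
  qed
  have finJ: "finite J" if "J \<subseteq> P" for J using fin that finite_subset by blast
  have niceJ': "\<exists>p\<in>P. \<exists>a b c d. grid_box (W p) (h p) a b c d (\<Inter>(Q ` J)) (\<Inter>(C ` J)) (RJ J)"
    if J: "J \<subseteq> P" "J \<noteq> {}" "\<Inter>(Q ` J) \<noteq> {}" for J
  proof -
    obtain p where p: "p \<in> J" using J by auto
    then have pP: "p \<in> P" using J by auto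
    obtain a b c d R where n: "grid_box (W p) (h p) a b c d (\<Inter>(Q ` J)) (\<Inter>(C ` J)) R"
      using niceJ[OF finJ[OF J(1)] J(2,1) pP meet[OF J(1) p _ J(3)] J(3)] by blast
    then show ?thesis using RJ[OF pP n] pP by blast
  qed
  have "nerve_euler Q P = 0"
  proof (rule nerve_euler_eq_0[OF fin, of 4 Q RJ])
    fix J assume J: "J \<subseteq> P" "J \<noteq> {}" "\<Inter>(Q ` J) \<noteq> {}"
    obtain p a b c d where p: "p \<in> P" and n: "grid_box (W p) (h p) a b c d (\<Inter>(Q ` J)) (\<Inter>(C ` J)) (RJ J)"
      using niceJ'[OF J] by blast
    show "finite (RJ J) \<and> card (RJ J) = 4" using grid_box_card[OF GA[OF p] n] .
    fix x assume "x \<in> RJ J"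
    then have "x \<in> topspace X" using grid_box_subset[OF n] dom_subset[OF GA[OF p]] by blast
    then show "\<exists>m\<in>P. x \<in> Q m" using top by auto
  next
    fix m x assume m: "m \<in> P" "x \<in> Q m"
    have "grid_box (W m) (h m) (a m) (b m) (c m) (d m) (\<Inter>(Q ` {m})) (\<Inter>(C ` {m})) (R m)"
      using grid_box[OF m(1)] by simp
    then have "RJ {m} = R m" by (rule RJ[OF m(1)])
    then show "x \<notin> RJ {m}" using grid_box_subset[OF grid_box[OF m(1)]] m(2) by blast
  next
    fix J m x assume J: "J \<subseteq> P" "J \<noteq> {}" and m: "m \<in> P" "x \<in> Q m"
    \<comment> \<open>The point \<open>x\<close> is common to \<open>C m\<close> and all
      \<open>C q\<close> with \<open>q \<in> J\<close>, so the chart of \<open>m\<close> shows both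
      \<open>Q m\<close> and the intersection over \<open>J\<close> as boxes.\<close>
    have key: "\<exists>a b c d a' b' c' d'.
        grid_box (W m) (h m) a b c d (\<Inter>(Q ` J)) (\<Inter>(C ` J)) (RJ J) \<and>
        grid_box (W m) (h m) a' b' c' d' (Q m) (C m) (R m)"
      if xC: "x \<in> \<Inter>(C ` J)" and ne: "\<Inter>(Q ` J) \<noteq> {}"
    proof -
      have "x \<in> C m" using m QC by blast
      then have "C m \<inter> C q \<noteq> {}" if "q \<in> J" for q using xC that by blast
      then obtain a b c d R where "grid_box (W m) (h m) a b c d (\<Inter>(Q ` J)) (\<Inter>(C ` J)) R"
        using niceJ[OF finJ[OF J(1)] J(2,1) m(1) _ ne] by blast
      then show ?thesis using RJ[OF m(1)] grid_box[OF m(1)] by blast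
    qed
    have ins: "RJ (insert m J) = W m \<inter> h m -` ({max a a', min b b'} \<times> {max c c', min d d'})"
      if "grid_box (W m) (h m) a b c d (\<Inter>(Q ` J)) (\<Inter>(C ` J)) (RJ J)"
        "grid_box (W m) (h m) a' b' c' d' (Q m) (C m) (R m)" "\<Inter>(Q ` insert m J) \<noteq> {}" for a b c d a' b' c' d'
    proof -
      have "\<Inter>(Q ` J) \<inter> Q m \<noteq> {}" using that(3) by auto
      from grid_box_Int[OF that(1,2) this]
      show ?thesis by (intro RJ[OF m(1)]) (simp add: Int_commute)
    qed
    show "\<Inter>(Q ` J) \<noteq> {} \<and> x \<in> RJ J \<longleftrightarrow> \<Inter>(Q ` insert m J) \<noteq> {} \<and> x \<in> RJ (insert m J)"
    proof
      \<comment> \<open>Near a corner \<open>x\<close> of the first box that is interior to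
        \<open>Q m\<close> the two boxes overlap, and the two sides through \<open>x\<close> remain
        sides of the intersection.\<close>
      assume L: "\<Inter>(Q ` J) \<noteq> {} \<and> x \<in> RJ J"
      then have neJ: "\<Inter>(Q ` J) \<noteq> {}" and xR: "x \<in> RJ J" by simp_all
      obtain p a b c d where n0: "grid_box (W p) (h p) a b c d (\<Inter>(Q ` J)) (\<Inter>(C ` J)) (RJ J)"
        using niceJ'[OF J neJ] by blast
      have "x \<in> \<Inter>(C ` J)" using grid_box_subset[OF n0] xR by blast
      then obtain a b c d a' b' c' d' where n: "grid_box (W m) (h m) a b c d (\<Inter>(Q ` J)) (\<Inter>(C ` J)) (RJ J)"
        "grid_box (W m) (h m) a' b' c' d' (Q m) (C m) (R m)" using key[OF _ neJ] by blast
      obtain u v where uv: "h m x = (u, v)" by (cases "h m x")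
      have 1: "u \<in> {a, b}" "v \<in> {c, d}" "a' < u" "u < b'" "c' < v" "v < d'" "a < b" "c < d" "x \<in> W m"
        using n L m uv by (auto simp: grid_box_def mem_bx)
      then have ne: "bx (max a a') (min b b') (max c c') (min d d') \<noteq> {}" by (auto simp: bx_eq_empty)
      have "h m ` \<Inter>(Q ` J) = bx a b c d" using grid_box_image[OF n(1)] .
      moreover obtain z where "z \<in> bx a b c d" "z \<in> bx a' b' c' d'"
        using ne unfolding bx_Int[symmetric] by blast
      ultimately obtain w where w: "w \<in> \<Inter>(Q ` J)" "h m w \<in> bx a' b' c' d'"
        by (metis (no_types, lifting) imageE)
      moreover have "w \<in> W m" using w(1) grid_box_subset[OF n(1)] by blast
      ultimately have "w \<in> Q m" using n(2) by (auto simp: grid_box_def)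
      then have ne: "\<Inter>(Q ` insert m J) \<noteq> {}" using w by auto
      moreover have "x \<in> RJ (insert m J)" unfolding ins[OF n ne] using 1 uv by auto
      ultimately show "\<Inter>(Q ` insert m J) \<noteq> {} \<and> x \<in> RJ (insert m J)" by simp
    next
      \<comment> \<open>Conversely, the sides of the intersection through \<open>x\<close> cannot be
        sides of \<open>Q m\<close>, to which \<open>x\<close> is interior, so they are sides of the
        box of \<open>J\<close>.\<close>
      assume L: "\<Inter>(Q ` insert m J) \<noteq> {} \<and> x \<in> RJ (insert m J)"
      then have neI: "\<Inter>(Q ` insert m J) \<noteq> {}" and xR: "x \<in> RJ (insert m J)" by blast+
      have "insert m J \<subseteq> P" "insert m J \<noteq> {}" using J m by auto
      from niceJ'[OF this neI] obtain p a b c d where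
        n0: "grid_box (W p) (h p) a b c d (\<Inter>(Q ` insert m J)) (\<Inter>(C ` insert m J)) (RJ (insert m J))"
        by blast
      have "x \<in> \<Inter>(C ` insert m J)" using grid_box_subset[OF n0] xR by blast
      then have xC: "x \<in> \<Inter>(C ` J)" by simp
      have ne: "\<Inter>(Q ` J) \<noteq> {}" using neI by auto
      obtain a b c d a' b' c' d' where n: "grid_box (W m) (h m) a b c d (\<Inter>(Q ` J)) (\<Inter>(C ` J)) (RJ J)"
        "grid_box (W m) (h m) a' b' c' d' (Q m) (C m) (R m)" using key[OF xC ne] by blast
      obtain u v where uv: "h m x = (u, v)" by (cases "h m x")
      have x: "u \<in> {max a a', min b b'}" "v \<in> {max c c', min d d'}" "x \<in> W m"
        using ins[OF n neI] xR uv by auto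
      have "a' < u" "u < b'" "c' < v" "v < d'" using n m uv by (auto simp: grid_box_def mem_bx)
      then have "u \<in> {a, b}" "v \<in> {c, d}" using x by (auto simp: max_def min_def split: if_splits)
      then show "\<Inter>(Q ` J) \<noteq> {} \<and> x \<in> RJ J" using ne n(1) x uv by (auto simp: grid_box_def)
    qed
  qed simp
  moreover have "has_euler (subtopology X (\<Union>(Q ` P))) {} (nerve_euler Q P)"
  proof (rule has_euler_nerve[OF fin oQ])
    fix J assume J: "J \<subseteq> P" "J \<noteq> {}"
    show "contractible_space (subtopology X (\<Inter>(Q ` J)))"
    proof (cases "\<Inter>(Q ` J) = {}")
      case True
      then show ?thesis by (simp add: contractible_space_empty)
    next
      case False
      then obtain p a b c d where p: "p \<in> P" "grid_box (W p) (h p) a b c d (\<Inter>(Q ` J)) (\<Inter>(C ` J)) (RJ J)"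
        using niceJ'[OF J] by blast
      have "\<Inter>(Q ` J) \<subseteq> W p" using grid_box_subset[OF p(2)] by blast
      from homeo_restrict[OF GA[OF p(1)] this]
      have "subtopology X (\<Inter>(Q ` J)) homeomorphic_space top_of_set (bx a b c d)"
        using grid_box_image[OF p(2)] homeomorphic_map_imp_homeomorphic_space by metis
      then show ?thesis using contractible_bx homeomorphic_space_contractibility
        by (metis contractible_space_top_of_set)
    qed
  qed
  ultimately show "has_euler X {} 0" using top by (metis subtopology_topspace)
  \<comment> \<open>In the chart of \<open>p\<close> the trace of any union of members on
    \<open>Q p\<close> is a finite union of open boxes of the plane, to which
    \<open>hvan_boxes\<close> applies.\<close>
  have hvQ: "hvan (subtopology X ((\<Union>q\<in>P'. Q q) \<inter> Q p)) {} 1" if p: "p \<in> P" and P': "P' \<subseteq> P" for p P'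
  proof -
    define P'' where "P'' = {q \<in> P'. Q q \<inter> Q p \<noteq> {}}"
    have "\<exists>t. h p ` (Q q \<inter> Q p) = (case t of (a, b, c, d) \<Rightarrow> bx a b c d)" if q: "q \<in> P''" for q
    proof -
      have "q \<in> P" "Q q \<inter> Q p \<noteq> {}" using q P' by (auto simp: P''_def)
      then obtain a' b' c' d' where "grid_box (W p) (h p) a' b' c' d' (Q q) (C q) (R q)"
        using grid_box'[of p q] p QC by blast
      from grid_box_image[OF grid_box_Int[OF this grid_box[OF p] \<open>Q q \<inter> Q p \<noteq> {}\<close>]]
      show ?thesis by (metis case_prod_conv)
    qed
    then obtain t where t: "\<And>q. q \<in> P'' \<Longrightarrow> h p ` (Q q \<inter> Q p) = (case t q of (a, b, c, d) \<Rightarrow> bx a b c d)" by metis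
    have "finite P''" using fin P' by (auto simp: P''_def intro: finite_subset)
    then obtain xs where xs: "set xs = t ` P''" using finite_list by (metis finite_imageI)
    have "h p ` ((\<Union>q\<in>P'. Q q) \<inter> Q p) = (\<Union>q\<in>P''. h p ` (Q q \<inter> Q p))" by (auto simp: P''_def)
    also have "\<dots> = (\<Union>(a, b, c, d)\<in>set xs. bx a b c d)" using xs t by simp
    finally have im: "h p ` ((\<Union>q\<in>P'. Q q) \<inter> Q p) = (\<Union>(a, b, c, d)\<in>set xs. bx a b c d)" .
    have "(\<Union>q\<in>P'. Q q) \<inter> Q p \<subseteq> W p" using grid_box_subset[OF grid_box[OF p]] by blast
    from homeo_restrict[OF GA[OF p] this]
    have "subtopology X ((\<Union>q\<in>P'. Q q) \<inter> Q p) homeomorphic_space top_of_set (\<Union>(a, b, c, d)\<in>set xs. bx a b c d)"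
      unfolding im by (rule homeomorphic_map_imp_homeomorphic_space)
    then have "top_of_set (\<Union>(a, b, c, d)\<in>set xs. bx a b c d) homeomorphic_space
        subtopology X ((\<Union>q\<in>P'. Q q) \<inter> Q p)"
      by (rule homeomorphic_space_sym[THEN iffD1])
    then show ?thesis by (rule hvan_homeomorphic[OF hvan_boxes])
  qed
  have "hvan (subtopology X (\<Union>(Q ` P))) {} 2"
  proof (rule hvan_UN[OF fin oQ])
    fix p assume p: "p \<in> P"
    have "hvan (subtopology X ((\<Union>q\<in>{p}. Q q) \<inter> Q p)) {} 1" using p by (intro hvQ) auto
    then show "hvan (subtopology X (Q p)) {} 2" by (auto intro: hvan_mono)
  qed (use hvQ in auto)
  then show "hvan X {} 2" using top by (metis subtopology_topspace)
qed

end

section \<open>Lipschitz line fields in the plane and the product coordinates given by their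
  leaves\<close>

section \<open>Leaves of a Lipschitz slope field\<close>

text \<open>\<open>8 * r * L \<le> 1\<close> makes the Picard operator on \<open>{-r..r}\<close> a
  contraction by 1/2. The bound 1/4 keeps leaves close to horizontal, hence transverse to those of a
  second field close to vertical. All bounds are global, so that every leaf exists over the whole
  interval.\<close>

definition slope :: "(real \<times> real \<Rightarrow> real) \<Rightarrow> real \<Rightarrow> real \<Rightarrow> bool" where
  "slope u r L \<longleftrightarrow> 0 < r \<and> 0 \<le> L \<and> 8 * r * L \<le> 1 \<and>
     (\<forall>z z'. \<bar>u z - u z'\<bar> \<le> L * dist z z') \<and> (\<forall>z. \<bar>u z\<bar> \<le> 1/4)"

definition is_leaf :: "(real \<times> real \<Rightarrow> real) \<Rightarrow> real \<Rightarrow> (real \<Rightarrow> real) \<Rightarrow> bool" where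
  "is_leaf u r y \<longleftrightarrow> (\<forall>x\<in>{-r..r}. (y has_real_derivative u (x, y x)) (at x within {-r..r}))"

lemma slopeD:
  assumes "slope u r L"
  shows "0 < r" "0 \<le> L" "8 * r * L \<le> 1" "\<bar>u z - u z'\<bar> \<le> L * dist z z'" "\<bar>u z\<bar> \<le> 1/4"
  using assms unfolding slope_def by blast+

lemma slope_continuous: "slope u r L \<Longrightarrow> continuous_on S u"
proof -
  assume s: "slope u r L"
  have "L-lipschitz_on S u"
    using slopeD[OF s] by (intro lipschitz_onI) (auto simp: dist_real_def)
  then show ?thesis by (rule lipschitz_on_continuous_on)
qed

text \<open>Gronwall's estimate. It is proved for the square of \<open>D\<close>, which unlike the
  absolute value is differentiable at the zeros of \<open>D\<close>; the two cases run forwards and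
  backwards from \<open>s\<close>.\<close>

lemma ode_bound:
  fixes D D' :: "real \<Rightarrow> real"
  assumes der: "\<And>x. x \<in> {a..b} \<Longrightarrow> (D has_real_derivative D' x) (at x within {a..b})"
    and bd: "\<And>x. x \<in> {a..b} \<Longrightarrow> \<bar>D' x\<bar> \<le> K * \<bar>D x\<bar>" and "s \<in> {a..b}" "t \<in> {a..b}"
  shows "\<bar>D t\<bar> \<le> \<bar>D s\<bar> * exp (K * \<bar>t - s\<bar>)"
proof -
  have cont: "continuous_on {a..b} D" using der by (rule DERIV_continuous_on)
  have at: "(D has_real_derivative D' x) (at x)" if "a < x" "x < b" for x
    using der[of x] that by (simp add: at_within_Icc_at)
  have dd: "\<bar>D x * D' x\<bar> \<le> K * (D x)\<^sup>2" if "x \<in> {a..b}" for x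
    using mult_left_mono[OF bd[OF that], of "\<bar>D x\<bar>"]
    by (simp add: abs_mult power2_eq_square mult.left_commute)
  show ?thesis
  proof (cases "s \<le> t")
    case True
    define E where "E x = (D x)\<^sup>2 * exp (- (2 * K * x))" for x
    have "E t \<le> E s"
    proof (rule DERIV_nonpos_imp_decreasing_open[OF True])
      fix x assume x: "s < x" "x < t"
      then have x': "a < x" "x < b" using assms(3,4) by auto
      have "(E has_real_derivative (2 * D x * D' x - 2 * K * (D x)\<^sup>2) * exp (- (2 * K * x))) (at x)"
        unfolding E_def by (auto intro!: derivative_eq_intros at[OF x'] simp: algebra_simps power2_eq_square)
      moreover have "(2 * D x * D' x - 2 * K * (D x)\<^sup>2) * exp (- (2 * K * x)) \<le> 0"
        using dd[of x] x' by (intro mult_nonpos_nonneg) auto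
      ultimately show "\<exists>y. (E has_real_derivative y) (at x) \<and> y \<le> 0" by blast
    next
      show "continuous_on {s..t} E" unfolding E_def
        using assms(3,4) by (auto intro!: continuous_intros continuous_on_subset[OF cont])
    qed
    then have "(D t)\<^sup>2 * exp (- (2 * K * t)) * exp (2 * K * t) \<le> (D s)\<^sup>2 * exp (- (2 * K * s)) * exp (2 * K * t)"
      unfolding E_def by (intro mult_right_mono) auto
    then have "(D t)\<^sup>2 \<le> (D s)\<^sup>2 * (exp (- (2 * K * s)) * exp (2 * K * t))" by (simp add: mult.assoc flip: exp_add)
    also have "exp (- (2 * K * s)) * exp (2 * K * t) = (exp (K * (t - s)))\<^sup>2"
      by (simp add: power2_eq_square algebra_simps flip: exp_add)
    finally have "(D t)\<^sup>2 \<le> (\<bar>D s\<bar> * exp (K * (t - s)))\<^sup>2" by (simp add: power_mult_distrib)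
    then have "\<bar>D t\<bar>\<^sup>2 \<le> (\<bar>D s\<bar> * exp (K * (t - s)))\<^sup>2" by simp
    then have "\<bar>D t\<bar> \<le> \<bar>D s\<bar> * exp (K * (t - s))" by (rule power2_le_imp_le) simp
    then show ?thesis using True by simp
  next
    case False
    define E where "E x = (D x)\<^sup>2 * exp (2 * K * x)" for x
    have "E t \<le> E s"
    proof (rule DERIV_nonneg_imp_increasing_open[of t s])
      fix x assume x: "t < x" "x < s"
      then have x': "a < x" "x < b" using assms(3,4) by auto
      have "(E has_real_derivative (2 * D x * D' x + 2 * K * (D x)\<^sup>2) * exp (2 * K * x)) (at x)"
        unfolding E_def by (auto intro!: derivative_eq_intros at[OF x'] simp: algebra_simps power2_eq_square)
      moreover have "(2 * D x * D' x + 2 * K * (D x)\<^sup>2) * exp (2 * K * x) \<ge> 0"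
        using dd[of x] x' by (intro mult_nonneg_nonneg) auto
      ultimately show "\<exists>y. (E has_real_derivative y) (at x) \<and> y \<ge> 0" by blast
    next
      show "continuous_on {t..s} E" unfolding E_def
        using assms(3,4) by (auto intro!: continuous_intros continuous_on_subset[OF cont])
    qed (use False in simp)
    then have "(D t)\<^sup>2 * exp (2 * K * t) * exp (- (2 * K * t)) \<le> (D s)\<^sup>2 * exp (2 * K * s) * exp (- (2 * K * t))"
      unfolding E_def by (intro mult_right_mono) auto
    then have "(D t)\<^sup>2 \<le> (D s)\<^sup>2 * (exp (2 * K * s) * exp (- (2 * K * t)))" by (simp add: mult.assoc flip: exp_add)
    also have "exp (2 * K * s) * exp (- (2 * K * t)) = (exp (K * (s - t)))\<^sup>2"
      by (simp add: power2_eq_square algebra_simps flip: exp_add)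
    finally have "(D t)\<^sup>2 \<le> (\<bar>D s\<bar> * exp (K * (s - t)))\<^sup>2" by (simp add: power_mult_distrib)
    then have "\<bar>D t\<bar>\<^sup>2 \<le> (\<bar>D s\<bar> * exp (K * (s - t)))\<^sup>2" by simp
    then have "\<bar>D t\<bar> \<le> \<bar>D s\<bar> * exp (K * (s - t))" by (rule power2_le_imp_le) simp
    then show ?thesis using False by simp
  qed
qed

lemma leaf_exists:
  assumes s: "slope u r L" and x0: "x0 \<in> {-r..r}"
  shows "\<exists>y. is_leaf u r y \<and> y x0 = y0"
proof -
  note sD = slopeD[OF s]
  define F where "F y x = integral {-r..x} (\<lambda>s. u (s, apply_bcontfun y s))" for y :: "real \<Rightarrow>\<^sub>C real" and x
  define cl where "cl x = max (-r) (min r x)" for x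
  have cl: "cl x \<in> {-r..r}" for x using sD(1) by (auto simp: cl_def)
  have cl_id: "x \<in> {-r..r} \<Longrightarrow> cl x = x" for x by (auto simp: cl_def)
  have contu: "continuous_on A (\<lambda>s. u (s, apply_bcontfun y s))" for y A
    by (intro continuous_on_compose2[OF slope_continuous[OF s, of UNIV]] continuous_intros) auto
  have derF: "((F y) has_real_derivative u (x, apply_bcontfun y x)) (at x within {-r..r})"
    if "x \<in> {-r..r}" for y x
    unfolding F_def using contu that by (intro integral_has_real_derivative)
  have boundF: "\<bar>F y x\<bar> \<le> r" if x: "x \<in> {-r..r}" for y x
  proof -
    have "norm (F y x) \<le> 1/4 * (x - (-r))"
      unfolding F_def using x sD(5) contu by (intro integral_bound) auto
    then show ?thesis using x sD(1) by auto
  qed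
  \<comment> \<open>The argument is clamped to \<open>{-r..r}\<close>, so that the operator acts on
    bounded continuous functions on the line, a complete space. Subtracting \<open>F y x0\<close>
    puts the initial value at \<open>x0\<close>.\<close>
  define T where "T y = Bcontfun (\<lambda>x. y0 + F y (cl x) - F y x0)" for y
  have memb: "(\<lambda>x. y0 + F y (cl x) - F y x0) \<in> bcontfun" for y
  proof (rule bcontfun_normI)
    have "continuous_on {-r..r} (F y)" using derF[of _ y] by (rule DERIV_continuous_on)
    moreover have "continuous_on UNIV cl"
      unfolding cl_def by (intro continuous_on_max continuous_on_min continuous_on_const continuous_on_id)
    ultimately have c: "continuous_on UNIV (\<lambda>x. F y (cl x))"
      using continuous_on_compose2[of "{-r..r}" "F y" UNIV cl] cl by blast
    show "continuous_on UNIV (\<lambda>x. y0 + F y (cl x) - F y x0)"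
      by (intro continuous_on_diff continuous_on_add continuous_on_const c)
    fix x
    show "norm (y0 + F y (cl x) - F y x0) \<le> \<bar>y0\<bar> + r + r"
      unfolding real_norm_def using boundF[OF cl, of y x] boundF[OF x0, of y] by linarith
  qed
  have T: "apply_bcontfun (T y) x = y0 + F y (cl x) - F y x0" for y x
    unfolding T_def using Bcontfun_inverse[OF memb[of y]] by simp
  have diffF: "\<bar>F y x - F y' x\<bar> \<le> 2 * r * L * dist y y'" if x: "x \<in> {-r..r}" for y y' x
  proof -
    have "F y x - F y' x = integral {-r..x} (\<lambda>s. u (s, apply_bcontfun y s) - u (s, apply_bcontfun y' s))"
      unfolding F_def using contu by (intro integral_diff[symmetric] integrable_continuous_interval)
    also have "norm \<dots> \<le> L * dist y y' * (x - (-r))"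
    proof (rule integral_bound)
      fix t
      have "\<bar>u (t, apply_bcontfun y t) - u (t, apply_bcontfun y' t)\<bar> \<le> L * dist (apply_bcontfun y t) (apply_bcontfun y' t)"
        using sD(4)[of "(t, apply_bcontfun y t)" "(t, apply_bcontfun y' t)"] by (simp add: dist_Pair_Pair)
      also have "\<dots> \<le> L * dist y y'" using sD(2) dist_bounded by (intro mult_left_mono)
      finally show "norm (u (t, apply_bcontfun y t) - u (t, apply_bcontfun y' t)) \<le> L * dist y y'" by simp
    qed (use x contu in \<open>auto intro!: continuous_intros\<close>)
    also have "\<dots> \<le> L * dist y y' * (2 * r)" using x sD by (intro mult_left_mono) auto
    finally show ?thesis by (simp add: mult_ac)
  qed
  have "\<exists>!y. T y = y"
  proof (rule banach_fix_type[of "1/2"])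
    show "\<forall>y y'. dist (T y) (T y') \<le> 1/2 * dist y y'"
    proof (intro allI, rule dist_bound)
      fix y y' x
      \<comment> \<open>Two integrals change, one ending at \<open>cl x\<close> and one at
        \<open>x0\<close>, each by at most \<open>2 * r * L\<close> times the distance; halving the
        distance then takes the factor 8.\<close>
      have "dist (T y x) (T y' x) \<le> 2 * (2 * r * L * dist y y')"
        using diffF[OF cl, of y x y'] diffF[OF x0, of y y'] by (simp add: T dist_real_def)
      also have "\<dots> = (8 * r * L) * (dist y y' / 2)" by simp
      also have "\<dots> \<le> 1 * (dist y y' / 2)" using sD(3) by (intro mult_right_mono) auto
      finally show "dist (T y x) (T y' x) \<le> 1/2 * dist y y'" by simp
    qed
  qed auto
  then obtain y where y: "T y = y" by blast
  have yx: "apply_bcontfun y x = y0 + F y x - F y x0" if "x \<in> {-r..r}" for x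
    using T[of y x] y cl_id[OF that] by simp
  have "is_leaf u r (apply_bcontfun y)"
    unfolding is_leaf_def
  proof
    fix x assume x: "x \<in> {-r..r}"
    have D: "((\<lambda>x. y0 + F y x - F y x0) has_real_derivative u (x, apply_bcontfun y x)) (at x within {-r..r})"
      by (auto intro!: derivative_eq_intros derF[OF x])
    show "(apply_bcontfun y has_real_derivative u (x, apply_bcontfun y x)) (at x within {-r..r})"
      unfolding has_field_derivative_def
      by (rule has_derivative_transform[OF x yx D[unfolded has_field_derivative_def]])
  qed
  then show ?thesis using yx[OF x0] by (intro exI[of _ "apply_bcontfun y"]) simp
qed

lemma leaf_close:
  assumes s: "slope u r L" and y: "is_leaf u r y" "is_leaf u r y'" and x: "x \<in> {-r..r}" "x' \<in> {-r..r}"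
  shows "\<bar>y x - y' x\<bar> \<le> \<bar>y x' - y' x'\<bar> * exp (L * \<bar>x - x'\<bar>)"
proof (rule ode_bound[of "-r" r "\<lambda>x. y x - y' x" "\<lambda>x. u (x, y x) - u (x, y' x)"])
  fix t assume t: "t \<in> {-r..r}"
  then show "((\<lambda>x. y x - y' x) has_real_derivative u (t, y t) - u (t, y' t)) (at t within {-r..r})"
    using y by (auto simp: is_leaf_def intro!: derivative_eq_intros)
  show "\<bar>u (t, y t) - u (t, y' t)\<bar> \<le> L * \<bar>y t - y' t\<bar>"
    using slopeD(4)[OF s, of "(t, y t)" "(t, y' t)"] by (simp add: dist_Pair_Pair dist_real_def)
qed (use x in auto)

lemma leaf_unique:
  assumes "slope u r L" "is_leaf u r y" "is_leaf u r y'" "x \<in> {-r..r}" "x' \<in> {-r..r}" "y x' = y' x'"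
  shows "y x = y' x"
  using leaf_close[OF assms(1-5)] assms(6) by simp

lemma leaf_lipschitz:
  assumes s: "slope u r L" and y: "is_leaf u r y" and x: "x \<in> {-r..r}" "x' \<in> {-r..r}"
  shows "\<bar>y x - y x'\<bar> \<le> 1/4 * \<bar>x - x'\<bar>"
proof -
  have "norm (y x - y x') \<le> 1/4 * norm (x - x')"
  proof (rule field_differentiable_bound[of "{-r..r}" y "\<lambda>x. u (x, y x)"])
    fix t assume "t \<in> {-r..r}"
    then show "(y has_real_derivative u (t, y t)) (at t within {-r..r})" using y by (simp add: is_leaf_def)
    show "norm (u (t, y t)) \<le> 1/4" using slopeD(5)[OF s] by simp
  qed (use x in auto)
  then show ?thesis by simp
qed

definition leaf_at :: "(real \<times> real \<Rightarrow> real) \<Rightarrow> real \<Rightarrow> real \<times> real \<Rightarrow> real \<Rightarrow> real" where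
  "leaf_at u r z = (SOME y. is_leaf u r y \<and> y (fst z) = snd z)"

text \<open>A first integral of the slope field: the crossing of the vertical axis serves as the
  name of a leaf.\<close>

definition lab :: "(real \<times> real \<Rightarrow> real) \<Rightarrow> real \<Rightarrow> real \<times> real \<Rightarrow> real" where
  "lab u r z = leaf_at u r z 0"

lemma leaf_at:
  assumes "slope u r L" "x \<in> {-r..r}"
  shows "is_leaf u r (leaf_at u r (x, y))" "leaf_at u r (x, y) x = y"
  using someI_ex[OF leaf_exists[OF assms, of y]] by (simp_all add: leaf_at_def)

lemma lab_leaf:
  assumes "slope u r L" "is_leaf u r y" "x \<in> {-r..r}"
  shows "lab u r (x, y x) = y 0"
  unfolding lab_def
  using leaf_at(2)[OF assms(1,3), of "y x"] slopeD(1)[OF assms(1)]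
  by (auto intro: leaf_unique[OF assms(1) leaf_at(1)[OF assms(1,3)] assms(2) _ assms(3)])

lemma lab_near:
  assumes "slope u r L" "x \<in> {-r..r}"
  shows "\<bar>lab u r (x, y) - y\<bar> \<le> 1/4 * \<bar>x\<bar>"
  using leaf_lipschitz[OF assms(1) leaf_at(1)[OF assms, of y], of 0 x] leaf_at(2)[OF assms, of y]
    assms slopeD(1)[OF assms(1)] by (simp add: lab_def)

lemma lab_eq:
  assumes s: "slope u r L" and x: "x \<in> {-r..r}" "x' \<in> {-r..r}" and eq: "lab u r (x, y) = lab u r (x', y')"
  shows "leaf_at u r (x, y) x' = y'"
proof -
  have "0 \<in> {-r..r}" using slopeD(1)[OF s] by simp
  then have "leaf_at u r (x, y) x' = leaf_at u r (x', y') x'"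
    using eq by (intro leaf_unique[OF s leaf_at(1)[OF s x(1)] leaf_at(1)[OF s x(2)] x(2)]) (auto simp: lab_def)
  then show ?thesis using leaf_at(2)[OF s x(2)] by simp
qed

text \<open>The leaves through two points are compared at one abscissa, where they differ by at most
  the sum of the coordinate differences, and the difference is carried to 0 by
  \<open>leaf_close\<close>.\<close>

lemma lab_continuous:
  assumes s: "slope u r L"
  shows "continuous_on ({-r..r} \<times> UNIV) (lab u r)"
proof -
  note r = slopeD(1)[OF s]
  have "(2 * exp (L * r))-lipschitz_on ({-r..r} \<times> UNIV) (lab u r)"
  proof (rule lipschitz_onI)
    fix z z' assume z: "z \<in> {-r..r} \<times> (UNIV :: real set)" "z' \<in> {-r..r} \<times> (UNIV :: real set)"
    obtain x y x' y' where xy: "z = (x, y)" "z' = (x', y')" by (cases z, cases z')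
    have x: "x \<in> {-r..r}" "x' \<in> {-r..r}" using z xy by auto
    let ?y = "leaf_at u r z" and ?y' = "leaf_at u r z'"
    have l: "is_leaf u r ?y" "?y x = y" "is_leaf u r ?y'" "?y' x' = y'"
      using leaf_at[OF s x(1)] leaf_at[OF s x(2)] xy by auto
    have "\<bar>?y 0 - ?y' 0\<bar> \<le> \<bar>?y x' - ?y' x'\<bar> * exp (L * \<bar>0 - x'\<bar>)"
      using l x r by (intro leaf_close[OF s]) auto
    also have "\<dots> \<le> (\<bar>x - x'\<bar> + \<bar>y - y'\<bar>) * exp (L * r)"
    proof (rule mult_mono)
      have "\<bar>?y x' - y\<bar> \<le> 1/4 * \<bar>x - x'\<bar>"
        using leaf_lipschitz[OF s l(1) x(2,1)] l(2) by (simp add: abs_minus_commute)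
      moreover have "\<bar>?y x' - y'\<bar> \<le> \<bar>?y x' - y\<bar> + \<bar>y - y'\<bar>"
        using dist_triangle[of "?y x'" y' y] by (simp add: dist_real_def)
      moreover have "1/4 * \<bar>x - x'\<bar> \<le> \<bar>x - x'\<bar>" by simp
      ultimately have "\<bar>?y x' - y'\<bar> \<le> \<bar>x - x'\<bar> + \<bar>y - y'\<bar>" by (meson add_right_mono order_trans)
      then show "\<bar>?y x' - ?y' x'\<bar> \<le> \<bar>x - x'\<bar> + \<bar>y - y'\<bar>" using l(4) by simp
      show "exp (L * \<bar>0 - x'\<bar>) \<le> exp (L * r)" using x slopeD(2)[OF s] by (auto intro!: mult_left_mono)
    qed auto
    also have "\<dots> \<le> (2 * dist z z') * exp (L * r)"
      using dist_fst_le[of z z'] dist_snd_le[of z z'] xy by (intro mult_right_mono) (auto simp: dist_real_def)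
    finally show "dist (lab u r z) (lab u r z') \<le> 2 * exp (L * r) * dist z z'"
      by (simp add: lab_def dist_real_def mult_ac)
  qed simp
  then show ?thesis by (rule lipschitz_on_continuous_on)
qed

text \<open>A curve tangent to the slope field, whatever its parametrization, stays in one leaf.\<close>

lemma lab_const_on_curve:
  fixes a b :: "real \<Rightarrow> real"
  assumes s: "slope u r L" and le: "t0 \<le> t1"
    and a: "\<And>t. t \<in> {t0..t1} \<Longrightarrow> (a has_real_derivative a' t) (at t within {t0..t1})"
    and b: "\<And>t. t \<in> {t0..t1} \<Longrightarrow> (b has_real_derivative u (a t, b t) * a' t) (at t within {t0..t1})"
    and ran: "\<And>t. t \<in> {t0..t1} \<Longrightarrow> a t \<in> {-r..r}"
    and bd: "\<And>t. t \<in> {t0..t1} \<Longrightarrow> \<bar>a' t\<bar> \<le> M"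
  shows "lab u r (a t1, b t1) = lab u r (a t0, b t0)"
proof -
  have t0: "t0 \<in> {t0..t1}" "t1 \<in> {t0..t1}" using le by auto
  let ?y = "leaf_at u r (a t0, b t0)"
  have l: "is_leaf u r ?y" "?y (a t0) = b t0" using leaf_at[OF s ran[OF t0(1)]] by auto
  \<comment> \<open>As functions of \<open>t\<close>, the curve and the leaf through its starting
    point solve the same equation, with the factor \<open>a' t\<close> bounded by \<open>M\<close>,
    and their initial difference is 0. The curve may stop or turn back where
    \<open>a' t = 0\<close>.\<close>
  have "\<bar>b t1 - ?y (a t1)\<bar> \<le> \<bar>b t0 - ?y (a t0)\<bar> * exp (L * M * \<bar>t1 - t0\<bar>)"
  proof (rule ode_bound[of t0 t1 "\<lambda>t. b t - ?y (a t)" "\<lambda>t. u (a t, b t) * a' t - u (a t, ?y (a t)) * a' t"])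
    fix t assume t: "t \<in> {t0..t1}"
    have "(?y has_real_derivative u (a t, ?y (a t))) (at (a t) within a ` {t0..t1})"
      using l(1) ran t unfolding is_leaf_def by (blast intro: DERIV_subset)
    from DERIV_image_chain[OF this a[OF t]]
    have "((\<lambda>t. ?y (a t)) has_real_derivative u (a t, ?y (a t)) * a' t) (at t within {t0..t1})"
      by (simp add: o_def)
    then show "((\<lambda>t. b t - ?y (a t)) has_real_derivative u (a t, b t) * a' t - u (a t, ?y (a t)) * a' t) (at t within {t0..t1})"
      using b[OF t] by (auto intro!: derivative_eq_intros)
    have "\<bar>u (a t, b t) - u (a t, ?y (a t))\<bar> \<le> L * \<bar>b t - ?y (a t)\<bar>"
      using slopeD(4)[OF s, of "(a t, b t)" "(a t, ?y (a t))"] by (simp add: dist_Pair_Pair dist_real_def)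
    then have "\<bar>u (a t, b t) - u (a t, ?y (a t))\<bar> * \<bar>a' t\<bar> \<le> L * \<bar>b t - ?y (a t)\<bar> * M"
      using bd[OF t] slopeD(2)[OF s] by (intro mult_mono) auto
    then show "\<bar>u (a t, b t) * a' t - u (a t, ?y (a t)) * a' t\<bar> \<le> L * M * \<bar>b t - ?y (a t)\<bar>"
      unfolding left_diff_distrib[symmetric] abs_mult by (simp add: mult_ac)
  qed (use t0 in auto)
  then have "?y (a t1) = b t1" using l by simp
  then have "lab u r (a t1, b t1) = ?y 0" using lab_leaf[OF s l(1) ran[OF t0(2)]] by simp
  then show ?thesis by (simp add: lab_def)
qed

section \<open>Pairs of transverse slope fields\<close>

definition sq :: "real \<Rightarrow> (real \<times> real) set" where
  "sq r = {-r<..<r} \<times> {-r<..<r}"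

text \<open>The second field has the directions \<open>(v z, 1)\<close>; exchanging the coordinates
  turns it into a slope field of the same kind.\<close>

definition slopes :: "(real \<times> real \<Rightarrow> real) \<Rightarrow> (real \<times> real \<Rightarrow> real) \<Rightarrow> real \<Rightarrow> real \<Rightarrow> bool" where
  "slopes u v r L \<longleftrightarrow> slope u r L \<and> slope (v \<circ> prod.swap) r L"

text \<open>The first component is constant along leaves of the steep field, the second along leaves
  of the flat one.\<close>

definition labs :: "(real \<times> real \<Rightarrow> real) \<Rightarrow> (real \<times> real \<Rightarrow> real) \<Rightarrow> real \<Rightarrow> real \<times> real \<Rightarrow> real \<times> real" where
  "labs u v r z = (lab (v \<circ> prod.swap) r (prod.swap z), lab u r z)"

lemma open_sq [simp]: "open (sq r)" by (simp add: sq_def open_Times)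

lemma swap_sq: "prod.swap z \<in> sq r \<longleftrightarrow> z \<in> sq r"
  by (cases z) (auto simp: sq_def)

lemma slopes_flip: "slopes u v r L \<Longrightarrow> slopes (v \<circ> prod.swap) (u \<circ> prod.swap) r L"
  by (simp add: slopes_def comp_assoc)

lemma labs_flip: "labs (v \<circ> prod.swap) (u \<circ> prod.swap) r (prod.swap z) = prod.swap (labs u v r z)"
  by (simp add: labs_def comp_assoc)

lemma labs_continuous:
  assumes s: "slopes u v r L"
  shows "continuous_on (sq r) (labs u v r)"
proof -
  have "continuous_on (sq r) (lab u r)"
    using lab_continuous[of u r L] s by (rule_tac continuous_on_subset) (auto simp: slopes_def sq_def)
  moreover have "continuous_on (sq r) (\<lambda>z. lab (v \<circ> prod.swap) r (prod.swap z))"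
  proof (rule continuous_on_compose2[OF lab_continuous continuous_on_swap])
    show "slope (v \<circ> prod.swap) r L" using s by (simp add: slopes_def)
  qed (auto simp: sq_def)
  ultimately show ?thesis unfolding labs_def by (intro continuous_on_Pair)
qed

text \<open>Points on a common flat leaf satisfy
  \<open>\<bar>y - y'\<bar> \<le> 1/4 * \<bar>x - x'\<bar>\<close>, points on a common steep leaf
  the same with \<open>x\<close> and \<open>y\<close> exchanged; together these force
  equality.\<close>

lemma labs_inj:
  assumes s: "slopes u v r L"
  shows "inj_on (labs u v r) (sq r)"
proof (rule inj_onI)
  fix z z' assume z: "z \<in> sq r" "z' \<in> sq r" and eq: "labs u v r z = labs u v r z'"
  obtain x y x' y' where xy: "z = (x, y)" "z' = (x', y')" by (cases z, cases z')
  have r: "x \<in> {-r..r}" "x' \<in> {-r..r}" "y \<in> {-r..r}" "y' \<in> {-r..r}" using z xy by (auto simp: sq_def)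
  have su: "slope u r L" and sv: "slope (v \<circ> prod.swap) r L" using s by (auto simp: slopes_def)
  have "leaf_at u r (x, y) x' = y'" using eq xy by (intro lab_eq[OF su r(1,2)]) (simp add: labs_def)
  then have 1: "\<bar>y - y'\<bar> \<le> 1/4 * \<bar>x - x'\<bar>"
    using leaf_lipschitz[OF su leaf_at(1)[OF su r(1), of y] r(1,2)] leaf_at(2)[OF su r(1), of y] by simp
  have "leaf_at (v \<circ> prod.swap) r (y, x) y' = x'" using eq xy by (intro lab_eq[OF sv r(3,4)]) (simp add: labs_def)
  then have 2: "\<bar>x - x'\<bar> \<le> 1/4 * \<bar>y - y'\<bar>"
    using leaf_lipschitz[OF sv leaf_at(1)[OF sv r(3), of x] r(3,4)] leaf_at(2)[OF sv r(3), of x] by simp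
  have "p \<le> 0" if "p \<le> 1/4 * q" "q \<le> 1/4 * p" for p q :: real using that by simp
  from this[OF 1 2] this[OF 2 1] show "z = z'" using xy by simp
qed

text \<open>Invariance of domain takes the place of the inverse function theorem, since the labels
  are only known to be continuous.\<close>

lemma labs_homeomorphism:
  assumes s: "slopes u v r L"
  obtains g where "homeomorphism (sq r) (labs u v r ` sq r) (labs u v r) g"
  using invariance_of_domain_homeomorphism[OF open_sq labs_continuous[OF s] _ labs_inj[OF s]] by auto

lemma labs_open_image: "slopes u v r L \<Longrightarrow> open (labs u v r ` sq r)"
  using invariance_of_domain[OF labs_continuous open_sq labs_inj] by blast

lemma labs_zero:
  assumes s: "slopes u v r L"
  shows "labs u v r (0, 0) = (0, 0)"
proof -
  have su: "slope u r L" and sv: "slope (v \<circ> prod.swap) r L" using s by (auto simp: slopes_def)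
  then have "0 \<in> {-r..r}" using slopeD(1)[OF su] by auto
  then show ?thesis using lab_near[OF su, of 0 0] lab_near[OF sv, of 0 0] by (simp add: labs_def)
qed

definition label_region where
  "label_region u v r a b c d = {z \<in> sq r. labs u v r z \<in> bx a b c d}"

lemma open_label_region:
  assumes s: "slopes u v r L"
  shows "open (label_region u v r a b c d)"
proof -
  have "label_region u v r a b c d = sq r \<inter> labs u v r -` bx a b c d" by (auto simp: label_region_def)
  then show ?thesis using continuous_open_preimage[OF labs_continuous[OF s] open_sq open_bx] by simp
qed

lemma connected_label_region:
  assumes s: "slopes u v r L" and sub: "bx a b c d \<subseteq> labs u v r ` sq r"
  shows "connected (label_region u v r a b c d)"
proof -
  obtain g where g: "homeomorphism (sq r) (labs u v r ` sq r) (labs u v r) g" using labs_homeomorphism[OF s] .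
  have "label_region u v r a b c d = g ` bx a b c d"
  proof (intro equalityI subsetI)
    fix z assume z: "z \<in> label_region u v r a b c d"
    then have "z = g (labs u v r z)" using homeomorphism_apply1[OF g, of z] by (simp add: label_region_def)
    then show "z \<in> g ` bx a b c d" using z unfolding label_region_def by blast
  next
    fix z assume "z \<in> g ` bx a b c d"
    then obtain w where w: "w \<in> bx a b c d" "z = g w" by auto
    then have "w \<in> labs u v r ` sq r" using sub by auto
    then show "z \<in> label_region u v r a b c d"
      using w homeomorphism_apply2[OF g] homeomorphism_image2[OF g] by (auto simp: label_region_def)
  qed
  moreover have "connected (bx a b c d)"
    by (simp add: bx_def convex_connected convex_Times)
  moreover have "continuous_on (bx a b c d) g"
    using homeomorphism_cont2[OF g] sub continuous_on_subset by blast
  ultimately show ?thesis by (simp add: connected_continuous_image)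
qed

lemma leaf_continuous:
  assumes "is_leaf u r y"
  shows "continuous_on {-r..r} y"
  by (rule DERIV_continuous_on[of "{-r..r}" y "\<lambda>x. u (x, y x)"]) (use assms in \<open>simp add: is_leaf_def\<close>)

text \<open>Along the leaf the second label is constant and the first is continuous and injective,
  so it stays between its end values. Keeping \<open>c\<close> and \<open>d\<close> within
  \<open>r/2\<close> prevents the leaf from leaving the square on the way, because it departs from
  \<open>y 0\<close> by less than \<open>r/2\<close>.\<close>

lemma leaf_in_region:
  assumes s: "slopes u v r L" and y: "is_leaf u r y" and c: "- (r/2) \<le> c" "d \<le> r/2"
    and z: "(x0, y x0) \<in> label_region u v r a b c d" "(x1, y x1) \<in> label_region u v r a b c d"
    and t: "x0 \<le> t" "t \<le> x1"
  shows "(t, y t) \<in> label_region u v r a b c d"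
proof -
  have su: "slope u r L" and sv: "slope (v \<circ> prod.swap) r L" using s by (auto simp: slopes_def)
  note r = slopeD(1)[OF su]
  have x: "x0 \<in> {-r<..<r}" "x1 \<in> {-r<..<r}" using z by (auto simp: label_region_def sq_def)
  have lab: "lab u r (s, y s) = y 0" if "s \<in> {-r..r}" for s using lab_leaf[OF su y that] .
  have y0: "c < y 0" "y 0 < d"
    using z(1) lab[of x0] x by (auto simp: label_region_def labs_def mem_bx)
  have sqr: "(s, y s) \<in> sq r" if "s \<in> {x0..x1}" for s
  proof -
    have s: "s \<in> {-r<..<r}" using that x by auto
    then have "\<bar>y s - y 0\<bar> \<le> 1/4 * \<bar>s - 0\<bar>" using r by (intro leaf_lipschitz[OF su y]) auto
    moreover have "\<bar>s - 0\<bar> < r" using s by auto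
    ultimately have "\<bar>y s - y 0\<bar> < r/2" using r by simp
    then have "y s - y 0 < r/2 \<and> - (y s - y 0) < r/2" by (simp only: abs_less_iff)
    then have "- r < y s" "y s < r" using y0 c by linarith+
    then show ?thesis using s by (auto simp: sq_def)
  qed
  define f where "f s = fst (labs u v r (s, y s))" for s
  have H: "labs u v r (s, y s) = (f s, y 0)" if "s \<in> {x0..x1}" for s
    using lab[of s] that x by (auto simp: labs_def f_def)
  have "continuous_on {x0..x1} y" by (rule continuous_on_subset[OF leaf_continuous[OF y]]) (use x in auto)
  then have "continuous_on {x0..x1} (\<lambda>s. labs u v r (s, y s))"
    using sqr by (intro continuous_on_compose2[OF labs_continuous[OF s]] continuous_on_Pair continuous_on_id) auto
  then have cont: "continuous_on {x0..x1} f" unfolding f_def by (rule continuous_on_fst)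
  have inj: "inj_on f {x0..x1}"
  proof (rule inj_onI)
    fix s s' assume ss: "s \<in> {x0..x1}" "s' \<in> {x0..x1}" "f s = f s'"
    then have "labs u v r (s, y s) = labs u v r (s', y s')" using H by simp
    then show "s = s'" using inj_onD[OF labs_inj[OF s]] sqr ss by blast
  qed
  have ends: "a < f x0" "f x0 < b" "a < f x1" "f x1 < b"
    using z H[of x0] H[of x1] t by (auto simp: label_region_def mem_bx)
  have "a < f t \<and> f t < b"
  proof (cases "t = x0 \<or> t = x1")
    case False
    then have "x0 < t" "t < x1" using t by auto
    then show ?thesis using continuous_inj_imp_mono[OF _ _ cont inj, of t] ends by auto
  qed (use ends in auto)
  then show ?thesis using H[of t] sqr[of t] t y0 by (auto simp: label_region_def mem_bx)
qed

lemma linear_slope_vector: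
  fixes f :: "real \<times> real \<Rightarrow> real \<times> real"
  assumes "linear f"
  shows "f (1, c) = f (1, 0) + c *\<^sub>R f (0, 1)"
proof -
  have "f ((1, 0) + c *\<^sub>R (0, 1)) = f (1, 0) + c *\<^sub>R f (0, 1)"
    by (simp only: linear_add[OF assms] linear_cmul[OF assms])
  then show ?thesis by simp
qed

text \<open>By \<open>leaf_in_region\<close> the whole arc between the two points lies in the
  region, where \<sigma> maps it to a curve tangent to \<open>u'\<close>. Compactness of the arc
  bounds the speed, as \<open>lab_const_on_curve\<close> demands.\<close>

lemma lab_const_along_leaf:
  fixes \<sigma> :: "real \<times> real \<Rightarrow> real \<times> real"
  assumes s: "slopes u v r L" and s': "slope u' r' L'" and cd: "- (r/2) \<le> c" "d \<le> r/2"
    and der: "\<And>z. z \<in> label_region u v r a b c d \<Longrightarrow> (\<sigma> has_derivative T z) (at z)"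
    and cont: "\<And>w. continuous_on (label_region u v r a b c d) (\<lambda>z. T z w)"
    and ran: "\<And>z. z \<in> label_region u v r a b c d \<Longrightarrow> \<sigma> z \<in> sq r'"
    and tan: "\<And>z. z \<in> label_region u v r a b c d \<Longrightarrow> snd (T z (1, u z)) = u' (\<sigma> z) * fst (T z (1, u z))"
    and z: "z \<in> label_region u v r a b c d" "z' \<in> label_region u v r a b c d"
    and eq: "snd (labs u v r z) = snd (labs u v r z')"
  shows "lab u' r' (\<sigma> z) = lab u' r' (\<sigma> z')"
proof -
  let ?D = "label_region u v r a b c d"
  have su: "slope u r L" using s by (auto simp: slopes_def)
  have main: "lab u' r' (\<sigma> (x1, y1)) = lab u' r' (\<sigma> (x0, y0))"
    if z: "(x0, y0) \<in> ?D" "(x1, y1) \<in> ?D" and eq: "lab u r (x0, y0) = lab u r (x1, y1)" and le: "x0 \<le> x1"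
    for x0 y0 x1 y1
  proof -
    have x: "x0 \<in> {-r..r}" "x1 \<in> {-r..r}" using z by (auto simp: label_region_def sq_def)
    define y where "y = leaf_at u r (x0, y0)"
    have y: "is_leaf u r y" "y x0 = y0" "y x1 = y1"
      using leaf_at[OF su x(1)] lab_eq[OF su x eq] by (auto simp: y_def)
    have D: "(t, y t) \<in> ?D" if "t \<in> {x0..x1}" for t
      using leaf_in_region[OF s y(1) cd, of x0 a b x1 t] y z that by auto
    have cy: "continuous_on {x0..x1} y"
      by (rule continuous_on_subset[OF leaf_continuous[OF y(1)]]) (use x in auto)
    then have cg: "continuous_on {x0..x1} (\<lambda>t. (t, y t))" by (intro continuous_on_Pair continuous_on_id)
    have Dim: "(\<lambda>t. (t, y t)) ` {x0..x1} \<subseteq> ?D" using D by auto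
    define N where "N t = T (t, y t) (1, u (t, y t))" for t
    have lin: "linear (T z)" if "z \<in> ?D" for z using der[OF that] has_derivative_linear by blast
    have N: "N t = T (t, y t) (1, 0) + u (t, y t) *\<^sub>R T (t, y t) (0, 1)" if "t \<in> {x0..x1}" for t
      unfolding N_def by (rule linear_slope_vector[OF lin[OF D[OF that]]])
    have "continuous_on {x0..x1} (\<lambda>t. T (t, y t) (1, 0) + u (t, y t) *\<^sub>R T (t, y t) (0, 1))"
    proof (intro continuous_on_add continuous_on_scaleR)
      show "continuous_on {x0..x1} (\<lambda>t. T (t, y t) (1, 0))" "continuous_on {x0..x1} (\<lambda>t. T (t, y t) (0, 1))"
        by (rule continuous_on_compose2[OF cont cg Dim])+
      show "continuous_on {x0..x1} (\<lambda>t. u (t, y t))"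
        using continuous_on_compose2[OF slope_continuous[OF su, of UNIV] cg] by simp
    qed
    then have cN: "continuous_on {x0..x1} N" by (rule continuous_on_eq) (use N in simp)
    have "compact ((\<lambda>t. fst (N t)) ` {x0..x1})"
      using cN by (intro compact_continuous_image continuous_on_fst compact_Icc)
    then have "bounded ((\<lambda>t. fst (N t)) ` {x0..x1})" by (rule compact_imp_bounded)
    then obtain M where "\<forall>t\<in>{x0..x1}. \<bar>fst (N t)\<bar> \<le> M" unfolding bounded_iff by auto
    then have M: "\<bar>fst (N t)\<bar> \<le> M" if "t \<in> {x0..x1}" for t using that by blast
    have dg: "((\<lambda>t. \<sigma> (t, y t)) has_derivative (\<lambda>h. h *\<^sub>R N t)) (at t within {x0..x1})" if t: "t \<in> {x0..x1}" for t
    proof -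
      have "t \<in> {-r..r}" using t x by auto
      then have "(y has_real_derivative u (t, y t)) (at t within {-r..r})" using y(1) unfolding is_leaf_def by blast
      then have "(y has_real_derivative u (t, y t)) (at t within {x0..x1})" by (rule DERIV_subset) (use x in auto)
      then have "(y has_derivative (\<lambda>h. h * u (t, y t))) (at t within {x0..x1})"
        by (simp add: has_field_derivative_def mult_commute_abs)
      then have "((\<lambda>t. (t, y t)) has_derivative (\<lambda>h. (h, h * u (t, y t)))) (at t within {x0..x1})"
        by (intro has_derivative_Pair has_derivative_ident)
      from has_derivative_compose[OF this der[OF D[OF t]]]
      have "((\<lambda>t. \<sigma> (t, y t)) has_derivative (\<lambda>h. T (t, y t) (h, h * u (t, y t)))) (at t within {x0..x1})" .
      moreover have "T (t, y t) (h, h * u (t, y t)) = h *\<^sub>R N t" for h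
        unfolding N_def using linear_cmul[OF lin[OF D[OF t]], of h "(1, u (t, y t))"] by simp
      ultimately show ?thesis by simp
    qed
    have "lab u' r' (fst (\<sigma> (x1, y x1)), snd (\<sigma> (x1, y x1))) = lab u' r' (fst (\<sigma> (x0, y x0)), snd (\<sigma> (x0, y x0)))"
    proof (rule lab_const_on_curve[OF s' le])
      fix t assume t: "t \<in> {x0..x1}"
      from has_derivative_fst[OF dg[OF t]] has_derivative_snd[OF dg[OF t]]
      show "((\<lambda>t. fst (\<sigma> (t, y t))) has_real_derivative fst (N t)) (at t within {x0..x1})"
        and "((\<lambda>t. snd (\<sigma> (t, y t))) has_real_derivative u' (fst (\<sigma> (t, y t)), snd (\<sigma> (t, y t))) * fst (N t)) (at t within {x0..x1})"
        using tan[OF D[OF t]] by (simp_all add: has_field_derivative_def mult_commute_abs N_def)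
      show "fst (\<sigma> (t, y t)) \<in> {-r'..r'}" using ran[OF D[OF t]] by (cases "\<sigma> (t, y t)") (auto simp: sq_def)
      show "\<bar>fst (N t)\<bar> \<le> M" using M[OF t] .
    qed
    then show ?thesis using y by simp
  qed
  obtain x0 y0 x1 y1 where xy: "z = (x0, y0)" "z' = (x1, y1)" by (cases z, cases z')
  have "lab u r (x0, y0) = lab u r (x1, y1)" using eq xy by (simp add: labs_def)
  then show ?thesis using main[of x0 y0 x1 y1] main[of x1 y1 x0 y0] z xy by (cases "x0 \<le> x1") auto
qed

lemma label_region_flip:
  "z \<in> label_region (v \<circ> prod.swap) (u \<circ> prod.swap) r c d a b \<longleftrightarrow> prod.swap z \<in> label_region u v r a b c d"
  using labs_flip[of v u r "prod.swap z"]
  by (cases "labs u v r (prod.swap z)") (auto simp: label_region_def swap_sq mem_bx)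

lemma lab_const_along_coleaf:
  fixes \<sigma> :: "real \<times> real \<Rightarrow> real \<times> real"
  assumes s: "slopes u v r L" and s': "slope u' r' L'" and ab: "- (r/2) \<le> a" "b \<le> r/2"
    and der: "\<And>z. z \<in> label_region u v r a b c d \<Longrightarrow> (\<sigma> has_derivative T z) (at z)"
    and cont: "\<And>w. continuous_on (label_region u v r a b c d) (\<lambda>z. T z w)"
    and ran: "\<And>z. z \<in> label_region u v r a b c d \<Longrightarrow> \<sigma> z \<in> sq r'"
    and tan: "\<And>z. z \<in> label_region u v r a b c d \<Longrightarrow> snd (T z (v z, 1)) = u' (\<sigma> z) * fst (T z (v z, 1))"
    and z: "z \<in> label_region u v r a b c d" "z' \<in> label_region u v r a b c d"
    and eq: "fst (labs u v r z) = fst (labs u v r z')"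
  shows "lab u' r' (\<sigma> z) = lab u' r' (\<sigma> z')"
proof -
  let ?D = "label_region (v \<circ> prod.swap) (u \<circ> prod.swap) r c d a b"
  have dsw: "(prod.swap has_derivative prod.swap) (at z within A)" for z :: "real \<times> real" and A
    unfolding prod.swap_def by (intro has_derivative_Pair has_derivative_snd has_derivative_fst has_derivative_ident)
  have "lab u' r' ((\<sigma> \<circ> prod.swap) (prod.swap z)) = lab u' r' ((\<sigma> \<circ> prod.swap) (prod.swap z'))"
  proof (rule lab_const_along_leaf[OF slopes_flip[OF s] s' ab, of c d "\<sigma> \<circ> prod.swap" "\<lambda>z w. T (prod.swap z) (prod.swap w)"])
    fix z assume "z \<in> ?D"
    then have z: "prod.swap z \<in> label_region u v r a b c d" by (simp add: label_region_flip)
    show "(\<sigma> \<circ> prod.swap has_derivative (\<lambda>w. T (prod.swap z) (prod.swap w))) (at z)"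
      using has_derivative_compose[OF dsw der[OF z]] by (simp add: o_def)
    show "(\<sigma> \<circ> prod.swap) z \<in> sq r'" using ran[OF z] by simp
    show "snd (T (prod.swap z) (prod.swap (1, (v \<circ> prod.swap) z))) =
        u' ((\<sigma> \<circ> prod.swap) z) * fst (T (prod.swap z) (prod.swap (1, (v \<circ> prod.swap) z)))"
      using tan[OF z] by simp
  next
    fix w
    show "continuous_on ?D (\<lambda>z. T (prod.swap z) (prod.swap w))"
      by (rule continuous_on_compose2[OF cont]) (auto simp: label_region_flip intro!: continuous_on_swap)
  qed (use z eq in \<open>simp_all add: label_region_flip labs_flip\<close>)
  then show ?thesis by simp
qed

text \<open>The union of the two lines. Which of the two fields a direction belongs to is not
  recorded, because a coordinate change may exchange them.\<close>

definition null_dir where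
  "null_dir u v z w \<longleftrightarrow> snd w = u z * fst w \<or> fst w = v z * (snd w :: real)"

lemma function_of_label:
  assumes "\<And>z z'. z \<in> D \<Longrightarrow> z' \<in> D \<Longrightarrow> l z = l z' \<Longrightarrow> F z = F z'"
  shows "\<exists>\<beta>. \<forall>z\<in>D. F z = \<beta> (l z)"
proof (intro exI ballI)
  fix z assume z: "z \<in> D"
  let ?w = "SOME w. w \<in> D \<and> l w = l z"
  have "?w \<in> D \<and> l ?w = l z" by (rule someI[of _ z]) (use z in simp)
  then show "F z = (\<lambda>y. F (SOME w. w \<in> D \<and> l w = y)) (l z)" using assms[of z ?w] z by simp
qed

text \<open>The derivative maps the pair of lines at \<open>z\<close> to the pair at
  \<open>\<tau> z\<close>, and by connectedness it either keeps or exchanges the two fields on the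
  whole region. Leaves then go to leaves, so each new label depends on one old label only.\<close>

lemma product_transition:
  fixes \<tau> :: "real \<times> real \<Rightarrow> real \<times> real"
  assumes s: "slopes u v r L" and s': "slopes u' v' r' L'"
    and ab: "- (r/2) \<le> a" "b \<le> r/2" and cd: "- (r/2) \<le> c" "d \<le> r/2"
    and sub: "bx a b c d \<subseteq> labs u v r ` sq r"
    and der: "\<And>z. z \<in> label_region u v r a b c d \<Longrightarrow> (\<tau> has_derivative T z) (at z)"
    and cont: "\<And>w. continuous_on (label_region u v r a b c d) (\<lambda>z. T z w)"
    and ran: "\<And>z. z \<in> label_region u v r a b c d \<Longrightarrow> \<tau> z \<in> sq r'"
    and inj: "\<And>z w. z \<in> label_region u v r a b c d \<Longrightarrow> w \<noteq> 0 \<Longrightarrow> T z w \<noteq> 0"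
    and null: "\<And>z w. z \<in> label_region u v r a b c d \<Longrightarrow> null_dir u v z w \<Longrightarrow> null_dir u' v' (\<tau> z) (T z w)"
  shows "\<exists>\<alpha> \<beta>. (\<forall>z\<in>label_region u v r a b c d. labs u' v' r' (\<tau> z) = (\<alpha> (fst (labs u v r z)), \<beta> (snd (labs u v r z)))) \<or>
    (\<forall>z\<in>label_region u v r a b c d. labs u' v' r' (\<tau> z) = (\<beta> (snd (labs u v r z)), \<alpha> (fst (labs u v r z))))"
proof -
  let ?D = "label_region u v r a b c d"
  have su: "slope u r L" and sv: "slope (v \<circ> prod.swap) r L"
    and su': "slope u' r' L'" and sv': "slope (v' \<circ> prod.swap) r' L'"
    using s s' by (auto simp: slopes_def)
  have b4: "\<bar>u z\<bar> \<le> 1/4" "\<bar>v z\<bar> \<le> 1/4" "\<bar>u' z\<bar> \<le> 1/4" "\<bar>v' z\<bar> \<le> 1/4" for z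
    using slopeD(5)[OF su] slopeD(5)[OF sv, of "prod.swap z"] slopeD(5)[OF su'] slopeD(5)[OF sv', of "prod.swap z"] by auto
  have lin: "linear (T z)" if "z \<in> ?D" for z using der[OF that] has_derivative_linear by blast
  define N where "N z = T z (1, u z)" for z
  define M where "M z = T z (v z, 1)" for z
  have N0: "N z \<noteq> 0" "null_dir u' v' (\<tau> z) (N z)" and M0: "M z \<noteq> 0" "null_dir u' v' (\<tau> z) (M z)" if "z \<in> ?D" for z
    using inj[OF that] null[OF that] by (auto simp: N_def M_def null_dir_def zero_prod_def)
  have less: "snd w = u' z * fst w \<Longrightarrow> w \<noteq> 0 \<Longrightarrow> \<bar>snd w\<bar> < \<bar>fst w\<bar>"
    "fst w = v' z * snd w \<Longrightarrow> w \<noteq> 0 \<Longrightarrow> \<bar>fst w\<bar> < \<bar>snd w\<bar>" for z w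
  proof -
    have *: "\<bar>q\<bar> < \<bar>p\<bar>" if "q = t * p" "\<bar>t\<bar> \<le> 1/4" "(p, q) \<noteq> 0 \<or> (q, p) \<noteq> 0" for p q t :: real
    proof -
      have "p \<noteq> 0" using that by (auto simp: zero_prod_def)
      have "\<bar>t\<bar> * \<bar>p\<bar> \<le> 1/4 * \<bar>p\<bar>" by (rule mult_right_mono) (use that in auto)
      then have "\<bar>q\<bar> \<le> 1/4 * \<bar>p\<bar>" using that(1) by (simp only: abs_mult)
      moreover have "1/4 * \<bar>p\<bar> < \<bar>p\<bar>" using \<open>p \<noteq> 0\<close> by simp
      ultimately show ?thesis by (rule le_less_trans)
    qed
    show "snd w = u' z * fst w \<Longrightarrow> w \<noteq> 0 \<Longrightarrow> \<bar>snd w\<bar> < \<bar>fst w\<bar>"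
      using *[OF _ b4(3), of "snd w" z "fst w"] by (cases w) auto
    show "fst w = v' z * snd w \<Longrightarrow> w \<noteq> 0 \<Longrightarrow> \<bar>fst w\<bar> < \<bar>snd w\<bar>"
      using *[OF _ b4(4), of "fst w" z "snd w"] by (cases w) auto
  qed
  have par: "u z * v z \<noteq> 1" for z
  proof -
    have "\<bar>u z * v z\<bar> \<le> 1/4 * (1/4)" unfolding abs_mult by (rule mult_mono) (use b4 in auto)
    then show ?thesis by auto
  qed
  \<comment> \<open>Injectivity of \<open>T z\<close> keeps the images of the two directions
    independent. So once the image of one is known to lie in one field, the image of the other must
    lie in the other field.\<close>
  have indep: "fst (M z) * snd (N z) \<noteq> fst (N z) * snd (M z)" if z: "z \<in> ?D" for z
  proof
    assume eq: "fst (M z) * snd (N z) = fst (N z) * snd (M z)"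
    note l = lin[OF z]
    have "T z (p *\<^sub>R (v z, 1) - q *\<^sub>R (1, u z)) = p *\<^sub>R M z - q *\<^sub>R N z" for p q
      by (simp only: linear_diff[OF l] linear_cmul[OF l] N_def M_def)
    then have *: "p *\<^sub>R M z - q *\<^sub>R N z = 0 \<Longrightarrow> p *\<^sub>R (v z, 1) - q *\<^sub>R (1, u z) = 0" for p q
      using inj[OF z] by metis
    have v0: "p *\<^sub>R (v z, 1) - q *\<^sub>R (1, u z) = 0 \<Longrightarrow> p = 0 \<and> q = 0" for p q
    proof -
      assume E: "p *\<^sub>R (v z, 1) - q *\<^sub>R (1, u z) = 0"
      have "p * v z = q" using arg_cong[OF E, of fst] by simp
      moreover have "p = q * u z" using arg_cong[OF E, of snd] by simp
      ultimately have "p * v z = q" "p = q * u z" .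
      then have "p * v z * u z = p" by metis
      then have "p * (u z * v z) = p * 1" by (simp only: mult_ac mult_1_right)
      then have "p = 0" using par[of z] unfolding mult_cancel_left by blast
      then show "p = 0 \<and> q = 0" using \<open>p * v z = q\<close> by simp
    qed
    have "fst (N z) *\<^sub>R M z - fst (M z) *\<^sub>R N z = 0" "snd (N z) *\<^sub>R M z - snd (M z) *\<^sub>R N z = 0"
      using eq by (auto simp: prod_eq_iff mult.commute)
    then have "fst (N z) = 0" "snd (N z) = 0" using * v0 by blast+
    then show False using N0(1)[OF z] by (simp add: prod_eq_iff)
  qed
  have cN: "continuous_on ?D N"
  proof -
    have "continuous_on ?D (\<lambda>z. T z (1, 0) + u z *\<^sub>R T z (0, 1))"
      by (intro continuous_on_add continuous_on_scaleR cont slope_continuous[OF su])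
    moreover have "T z (1, 0) + u z *\<^sub>R T z (0, 1) = N z" if "z \<in> ?D" for z
      unfolding N_def by (rule linear_slope_vector[OF lin[OF that], symmetric])
    ultimately show ?thesis by (rule continuous_on_eq)
  qed
  \<comment> \<open>Positive where the image of the flat direction is flat, negative where it is
    steep. Slopes of at most 1/4 keep it away from 0, so its sign is constant on a connected
    region.\<close>
  define G where "G z = \<bar>fst (N z)\<bar> - \<bar>snd (N z)\<bar>" for z
  have "connected (G ` ?D)"
    unfolding G_def by (intro connected_continuous_image continuous_intros cN connected_label_region[OF s sub])
  moreover have "G z \<noteq> 0" if "z \<in> ?D" for z
    using N0[OF that] less[of "N z" "\<tau> z"] unfolding G_def null_dir_def by auto
  ultimately have "(\<forall>z\<in>?D. G z > 0) \<or> (\<forall>z\<in>?D. G z < 0)"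
    using connectedD_interval[of "G ` ?D" _ _ 0] by (smt (verit) imageE imageI)
  moreover have dsw: "(prod.swap \<circ> \<tau> has_derivative (\<lambda>w. prod.swap (T z w))) (at z)" if "z \<in> ?D" for z
    using has_derivative_Pair[OF has_derivative_snd[OF der[OF that]] has_derivative_fst[OF der[OF that]]]
    by (simp add: prod.swap_def o_def)
  moreover have csw: "continuous_on ?D (\<lambda>z. prod.swap (T z w))" for w
    using cont by (rule continuous_on_swap[THEN continuous_on_compose2]) auto
  moreover have rsw: "(prod.swap \<circ> \<tau>) z \<in> sq r'" if "z \<in> ?D" for z
    using ran[OF that] by (simp add: swap_sq)
  ultimately show ?thesis
  proof (elim disjE)
    assume G: "\<forall>z\<in>?D. G z > 0"
    have N1: "snd (N z) = u' (\<tau> z) * fst (N z)" if "z \<in> ?D" for z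
      using G N0[OF that] less(2)[of "N z" "\<tau> z"] that unfolding null_dir_def G_def by force
    have M1: "fst (M z) = v' (\<tau> z) * snd (M z)" if "z \<in> ?D" for z
      using M0(2)[OF that] indep[OF that] N1[OF that] unfolding null_dir_def by auto
    have M1': "snd (prod.swap (T z (v z, 1))) = (v' \<circ> prod.swap) ((prod.swap \<circ> \<tau>) z) * fst (prod.swap (T z (v z, 1)))"
      if "z \<in> ?D" for z using M1[OF that] by (simp add: M_def)
    have "\<exists>\<beta>. \<forall>z\<in>?D. lab u' r' (\<tau> z) = \<beta> (snd (labs u v r z))"
      by (rule function_of_label, rule lab_const_along_leaf[OF s su' cd der cont ran N1[unfolded N_def]]; assumption)
    then obtain \<beta> where \<beta>: "\<forall>z\<in>?D. lab u' r' (\<tau> z) = \<beta> (snd (labs u v r z))" by blast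
    have "\<exists>\<alpha>. \<forall>z\<in>?D. lab (v' \<circ> prod.swap) r' ((prod.swap \<circ> \<tau>) z) = \<alpha> (fst (labs u v r z))"
      by (rule function_of_label, rule lab_const_along_coleaf[OF s sv' ab dsw csw rsw M1']; assumption)
    then obtain \<alpha> where \<alpha>: "\<forall>z\<in>?D. lab (v' \<circ> prod.swap) r' ((prod.swap \<circ> \<tau>) z) = \<alpha> (fst (labs u v r z))" by blast
    show ?thesis using \<alpha> \<beta> by (intro exI[of _ \<alpha>] exI[of _ \<beta>] disjI1) (simp add: labs_def)
  next
    assume G: "\<forall>z\<in>?D. G z < 0"
    have N1: "fst (N z) = v' (\<tau> z) * snd (N z)" if "z \<in> ?D" for z
      using G N0[OF that] less(1)[of "N z" "\<tau> z"] that unfolding null_dir_def G_def by force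
    have M1: "snd (M z) = u' (\<tau> z) * fst (M z)" if "z \<in> ?D" for z
      using M0(2)[OF that] indep[OF that] N1[OF that] unfolding null_dir_def by auto
    have N1': "snd (prod.swap (T z (1, u z))) = (v' \<circ> prod.swap) ((prod.swap \<circ> \<tau>) z) * fst (prod.swap (T z (1, u z)))"
      if "z \<in> ?D" for z using N1[OF that] by (simp add: N_def)
    have "\<exists>\<beta>. \<forall>z\<in>?D. lab (v' \<circ> prod.swap) r' ((prod.swap \<circ> \<tau>) z) = \<beta> (snd (labs u v r z))"
      by (rule function_of_label, rule lab_const_along_leaf[OF s sv' cd dsw csw rsw N1']; assumption)
    then obtain \<beta> where \<beta>: "\<forall>z\<in>?D. lab (v' \<circ> prod.swap) r' ((prod.swap \<circ> \<tau>) z) = \<beta> (snd (labs u v r z))" by blast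
    have "\<exists>\<alpha>. \<forall>z\<in>?D. lab u' r' (\<tau> z) = \<alpha> (fst (labs u v r z))"
      by (rule function_of_label, rule lab_const_along_coleaf[OF s su' ab der cont ran M1[unfolded M_def]]; assumption)
    then obtain \<alpha> where \<alpha>: "\<forall>z\<in>?D. lab u' r' (\<tau> z) = \<alpha> (fst (labs u v r z))" by blast
    show ?thesis using \<alpha> \<beta> by (intro exI[of _ \<alpha>] exI[of _ \<beta>] disjI2) (simp add: labs_def)
  qed
qed

section \<open>From an indefinite quadratic form with Lipschitz coefficients to a pair of slope
  fields\<close>

section \<open>Local Lipschitz continuity\<close>

text \<open>A two-point estimate near \<open>z\<close>, stable under arithmetic and composition;
  this is the regularity on which uniqueness of leaves rests.\<close>

definition llip :: "('a::metric_space \<Rightarrow> 'b::metric_space) \<Rightarrow> 'a \<Rightarrow> bool" where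
  "llip f z \<longleftrightarrow> (\<exists>e>0. \<exists>L\<ge>0. \<forall>x\<in>cball z e. \<forall>y\<in>cball z e. dist (f x) (f y) \<le> L * dist x y)"

lemma llipE:
  assumes "llip f z"
  obtains e L where "e > 0" "L \<ge> 0" "\<And>x y. dist z x \<le> e \<Longrightarrow> dist z y \<le> e \<Longrightarrow> dist (f x) (f y) \<le> L * dist x y"
proof -
  from assms obtain e L where "e > 0" "L \<ge> 0" "\<forall>x\<in>cball z e. \<forall>y\<in>cball z e. dist (f x) (f y) \<le> L * dist x y"
    unfolding llip_def by blast
  then show ?thesis by (intro that[of e L]) simp_all
qed

lemma llipI:
  assumes "e > 0" "L \<ge> 0" "\<And>x y. dist z x \<le> e \<Longrightarrow> dist z y \<le> e \<Longrightarrow> dist (f x) (f y) \<le> L * dist x y"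
  shows "llip f z"
  unfolding llip_def using assms by (intro exI[of _ e] exI[of _ L] conjI ballI) simp_all

lemma llip_const: "llip (\<lambda>_. c) z"
  by (rule llipI[of 1 0]) auto

lemma llip_add:
  fixes f g :: "'a::metric_space \<Rightarrow> 'b::real_normed_vector"
  assumes "llip f z" "llip g z"
  shows "llip (\<lambda>x. f x + g x) z"
proof -
  obtain e L where f: "e > 0" "L \<ge> 0" "\<And>x y. dist z x \<le> e \<Longrightarrow> dist z y \<le> e \<Longrightarrow> dist (f x) (f y) \<le> L * dist x y"
    using llipE[OF assms(1)] by blast
  obtain e' L' where g: "e' > 0" "L' \<ge> 0" "\<And>x y. dist z x \<le> e' \<Longrightarrow> dist z y \<le> e' \<Longrightarrow> dist (g x) (g y) \<le> L' * dist x y"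
    using llipE[OF assms(2)] by blast
  show ?thesis
  proof (rule llipI[of "min e e'" "L + L'"])
    fix x y assume "dist z x \<le> min e e'" "dist z y \<le> min e e'"
    then have "dist (f x) (f y) + dist (g x) (g y) \<le> L * dist x y + L' * dist x y"
      using f(3)[of x y] g(3)[of x y] by (intro add_mono) auto
    then show "dist (f x + g x) (f y + g y) \<le> (L + L') * dist x y"
      using dist_triangle_add[of "f x" "g x" "f y" "g y"] by (simp add: distrib_right)
  qed (use f g in auto)
qed

lemma llip_compose:
  assumes "llip f z" "llip g (f z)"
  shows "llip (\<lambda>x. g (f x)) z"
proof -
  obtain e L where f: "e > 0" "L \<ge> 0" "\<And>x y. dist z x \<le> e \<Longrightarrow> dist z y \<le> e \<Longrightarrow> dist (f x) (f y) \<le> L * dist x y"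
    using llipE[OF assms(1)] by blast
  obtain e' L' where g: "e' > 0" "L' \<ge> 0"
    "\<And>x y. dist (f z) x \<le> e' \<Longrightarrow> dist (f z) y \<le> e' \<Longrightarrow> dist (g x) (g y) \<le> L' * dist x y"
    using llipE[OF assms(2)] by blast
  define d where "d = min e (e' / (L + 1))"
  have d: "d > 0" "d \<le> e" "L * d \<le> e'"
  proof -
    show "d > 0" "d \<le> e" using f g by (auto simp: d_def)
    have "L * d \<le> (L + 1) * (e' / (L + 1))" using f g by (intro mult_mono) (auto simp: d_def)
    then show "L * d \<le> e'" using f by simp
  qed
  have near: "dist (f z) (f x) \<le> e'" if "dist z x \<le> d" for x
  proof -
    have "dist (f z) (f x) \<le> L * dist z x" using that d f by (intro f(3)) auto
    also have "\<dots> \<le> L * d" using that f by (intro mult_left_mono)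
    finally show ?thesis using d by linarith
  qed
  show ?thesis
  proof (rule llipI[of d "L' * L"])
    fix x y assume xy: "dist z x \<le> d" "dist z y \<le> d"
    have "dist (g (f x)) (g (f y)) \<le> L' * dist (f x) (f y)" using near xy by (intro g(3))
    also have "\<dots> \<le> L' * (L * dist x y)" using xy d g by (intro mult_left_mono f(3)) auto
    finally show "dist (g (f x)) (g (f y)) \<le> L' * L * dist x y" by (simp add: mult.assoc)
  qed (use d f g in auto)
qed

lemma llip_mult:
  fixes f g :: "'a::metric_space \<Rightarrow> real"
  assumes "llip f z" "llip g z"
  shows "llip (\<lambda>x. f x * g x) z"
proof -
  obtain e L where f: "e > 0" "L \<ge> 0" "\<And>x y. dist z x \<le> e \<Longrightarrow> dist z y \<le> e \<Longrightarrow> dist (f x) (f y) \<le> L * dist x y"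
    using llipE[OF assms(1)] by blast
  obtain e' L' where g: "e' > 0" "L' \<ge> 0" "\<And>x y. dist z x \<le> e' \<Longrightarrow> dist z y \<le> e' \<Longrightarrow> dist (g x) (g y) \<le> L' * dist x y"
    using llipE[OF assms(2)] by blast
  define d where "d = min e e'"
  have d: "d > 0" "d \<le> e" "d \<le> e'" using f g by (auto simp: d_def)
  define M where "M = \<bar>f z\<bar> + L * d"
  define M' where "M' = \<bar>g z\<bar> + L' * d"
  have M: "\<bar>f x\<bar> \<le> M" "\<bar>g x\<bar> \<le> M'" if x: "dist z x \<le> d" for x
  proof -
    have "dist (f z) (f x) \<le> L * dist z x" "dist (g z) (g x) \<le> L' * dist z x"
      using x d by (auto intro!: f(3) g(3))
    moreover have "L * dist z x \<le> L * d" "L' * dist z x \<le> L' * d" using x f g by (auto intro!: mult_left_mono)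
    ultimately show "\<bar>f x\<bar> \<le> M" "\<bar>g x\<bar> \<le> M'" unfolding M_def M'_def dist_real_def by linarith+
  qed
  have M0: "M \<ge> 0" "M' \<ge> 0" using f g d by (auto simp: M_def M'_def)
  show ?thesis
  proof (rule llipI[of d "M * L' + M' * L"])
    fix x y assume xy: "dist z x \<le> d" "dist z y \<le> d"
    have "f x * g x - f y * g y = f x * (g x - g y) + g y * (f x - f y)" by (simp add: algebra_simps)
    then have "\<bar>f x * g x - f y * g y\<bar> \<le> \<bar>f x\<bar> * \<bar>g x - g y\<bar> + \<bar>g y\<bar> * \<bar>f x - f y\<bar>"
      using abs_triangle_ineq[of "f x * (g x - g y)" "g y * (f x - f y)"] by (simp only: abs_mult)
    also have "\<dots> \<le> M * (L' * dist x y) + M' * (L * dist x y)"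
      using M xy d M0 f(3)[of x y] g(3)[of x y] by (intro add_mono mult_mono) (auto simp: dist_real_def)
    finally show "dist (f x * g x) (f y * g y) \<le> (M * L' + M' * L) * dist x y"
      by (simp add: dist_real_def algebra_simps)
  qed (use d M0 f g in auto)
qed

lemma llip_inverse_id:
  fixes z :: real
  assumes "z \<noteq> 0"
  shows "llip inverse z"
proof (rule llipI[of "\<bar>z\<bar>/2" "4 / z\<^sup>2"])
  fix x y assume xy: "dist z x \<le> \<bar>z\<bar>/2" "dist z y \<le> \<bar>z\<bar>/2"
  have b: "\<bar>x\<bar> \<ge> \<bar>z\<bar>/2" "\<bar>y\<bar> \<ge> \<bar>z\<bar>/2" using xy unfolding dist_real_def by linarith+
  then have ne: "x \<noteq> 0" "y \<noteq> 0" using assms by auto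
  have "\<bar>z\<bar>/2 * (\<bar>z\<bar>/2) \<le> \<bar>x\<bar> * \<bar>y\<bar>" using b by (intro mult_mono) auto
  then have "z\<^sup>2 / 4 \<le> \<bar>x\<bar> * \<bar>y\<bar>" by (simp add: power2_eq_square abs_mult_self_eq)
  moreover have "0 < z\<^sup>2 / 4" using assms by simp
  ultimately have "\<bar>x - y\<bar> / (\<bar>x\<bar> * \<bar>y\<bar>) \<le> \<bar>x - y\<bar> / (z\<^sup>2 / 4)" by (intro divide_left_mono) (use ne in auto)
  moreover have "\<bar>inverse x - inverse y\<bar> = \<bar>x - y\<bar> / (\<bar>x\<bar> * \<bar>y\<bar>)"
    using ne by (simp add: inverse_diff_inverse abs_mult abs_inverse divide_inverse abs_minus_commute)
  ultimately show "dist (inverse x) (inverse y) \<le> 4 / z\<^sup>2 * dist x y"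
    by (simp add: dist_real_def mult.commute)
qed (use assms in auto)

lemma llip_divide:
  fixes f g :: "'a::metric_space \<Rightarrow> real"
  assumes "llip f z" "llip g z" "g z \<noteq> 0"
  shows "llip (\<lambda>x. f x / g x) z"
  unfolding divide_inverse
  using assms by (intro llip_mult llip_compose[of g z inverse] llip_inverse_id)

lemma llip_sum:
  fixes f :: "'i \<Rightarrow> 'a::metric_space \<Rightarrow> real"
  assumes "\<And>i. i \<in> I \<Longrightarrow> llip (f i) z"
  shows "llip (\<lambda>x. \<Sum>i\<in>I. f i x) z"
  using assms
proof (induction I rule: infinite_finite_induct)
  case (insert i I)
  then show ?case by (simp add: llip_add)
qed (simp_all add: llip_const)

lemma llip_diff:
  fixes f g :: "'a::metric_space \<Rightarrow> real"
  assumes "llip f z" "llip g z"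
  shows "llip (\<lambda>x. f x - g x) z"
  using llip_add[OF assms(1) llip_mult[OF llip_const[of "-1"] assms(2)]] by simp

lemma llip_transform:
  assumes h: "llip h z" and S: "open S" "z \<in> S" and eq: "\<And>y. y \<in> S \<Longrightarrow> k y = h y"
  shows "llip k z"
proof -
  obtain e L where f: "e > 0" "L \<ge> 0" "\<And>x y. dist z x \<le> e \<Longrightarrow> dist z y \<le> e \<Longrightarrow> dist (h x) (h y) \<le> L * dist x y"
    using llipE[OF h] by blast
  obtain r where r: "r > 0" "cball z r \<subseteq> S" using S open_contains_cball by blast
  show ?thesis
  proof (rule llipI[of "min e r" L])
    fix x y assume xy: "dist z x \<le> min e r" "dist z y \<le> min e r"
    then have "x \<in> S" "y \<in> S" using r(2) by (auto simp: subset_iff)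
    then show "dist (k x) (k y) \<le> L * dist x y" using f(3)[of x y] xy eq by simp
  qed (use f r in auto)
qed

lemma llip_nth:
  fixes u :: "'e::metric_space \<Rightarrow> real^'n"
  assumes "llip u z" shows "llip (\<lambda>z. u z $ i) z"
proof -
  obtain e L where f: "e > 0" "L \<ge> 0" "\<And>x y. dist z x \<le> e \<Longrightarrow> dist z y \<le> e \<Longrightarrow> dist (u x) (u y) \<le> L * dist x y"
    using llipE[OF assms] by blast
  show ?thesis
    by (rule llipI[OF f(1,2)]) (rule order_trans[OF dist_vec_nth_le f(3)])
qed

lemma llip_snd:
  assumes "llip u z" shows "llip (\<lambda>z. snd (u z)) z"
proof -
  obtain e L where f: "e > 0" "L \<ge> 0" "\<And>x y. dist z x \<le> e \<Longrightarrow> dist z y \<le> e \<Longrightarrow> dist (u x) (u y) \<le> L * dist x y"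
    using llipE[OF assms] by blast
  show ?thesis
    by (rule llipI[OF f(1,2)]) (rule order_trans[OF dist_snd_le f(3)])
qed

section \<open>Smooth functions\<close>

lemma smooth_on_continuous: "smooth_on S f \<Longrightarrow> continuous_on S f"
  unfolding smooth_on_def using Ck_on.simps(1) by blast

lemma smooth_on_has_derivative:
  assumes "smooth_on S f" "open S" "x \<in> S"
  shows "(f has_derivative frechet_derivative f (at x)) (at x)"
proof -
  have "Ck_on (Suc 0) S f" using assms(1) unfolding smooth_on_def by blast
  then have "f differentiable_on S" by simp
  then have "f differentiable (at x within S)" using assms(3) unfolding differentiable_on_def by blast
  then have "f differentiable (at x)" unfolding at_within_open[OF assms(3,2)] .
  then show ?thesis by (rule frechet_derivative_works[THEN iffD1])
qed

lemma smooth_on_frechet: "smooth_on S f \<Longrightarrow> smooth_on S (\<lambda>x. frechet_derivative f (at x) v)"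
  unfolding smooth_on_def
proof
  fix k assume "\<forall>k. Ck_on k S f"
  then have "Ck_on (Suc k) S f" by blast
  then show "Ck_on k S (\<lambda>x. frechet_derivative f (at x) v)" by simp
qed

text \<open>The mean value inequality on a closed ball. Continuity is available for directional
  derivatives, so the operator norm is bounded by the sum of their bounds in the directions of
  \<open>Basis\<close>.\<close>

lemma smooth_on_llip:
  fixes f :: "'a::euclidean_space \<Rightarrow> 'b::real_normed_vector"
  assumes f: "smooth_on S f" and S: "open S" "x \<in> S"
  shows "llip f x"
proof -
  obtain e where e: "e > 0" "cball x e \<subseteq> S" using S open_contains_cball by blast
  let ?D = "\<lambda>y v. frechet_derivative f (at y) v"
  have "\<exists>M. \<forall>y\<in>cball x e. norm (?D y v) \<le> M" for v
  proof -
    have "continuous_on (cball x e) (\<lambda>y. ?D y v)"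
      using smooth_on_continuous[OF smooth_on_frechet[OF f]] e(2) by (rule continuous_on_subset)
    then have "bounded ((\<lambda>y. ?D y v) ` cball x e)"
      by (intro compact_imp_bounded compact_continuous_image compact_cball)
    then show ?thesis unfolding bounded_iff by auto
  qed
  then obtain M where M: "\<And>v y. y \<in> cball x e \<Longrightarrow> norm (?D y v) \<le> M v" by metis
  have M0: "M v \<ge> 0" for v
    using order_trans[OF norm_ge_zero M[of x v]] e(1) by simp
  define L where "L = (\<Sum>b\<in>Basis. M b)"
  have der: "(f has_derivative ?D y) (at y)" if "y \<in> cball x e" for y
    using smooth_on_has_derivative[OF f S(1)] that e(2) by blast
  have on: "onorm (?D y) \<le> L" if y: "y \<in> cball x e" for y
  proof (rule onorm_bound)
    show "0 \<le> L" using M0 by (simp add: L_def sum_nonneg)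
    fix w :: 'a
    interpret bounded_linear "?D y" using der[OF y] by (rule has_derivative_bounded_linear)
    have "?D y w = ?D y (\<Sum>b\<in>Basis. (w \<bullet> b) *\<^sub>R b)" by (simp add: euclidean_representation)
    also have "\<dots> = (\<Sum>b\<in>Basis. (w \<bullet> b) *\<^sub>R ?D y b)" by (simp add: sum scaleR)
    also have "norm \<dots> \<le> (\<Sum>b\<in>Basis. norm w * M b)"
    proof (rule sum_norm_le)
      fix b :: 'a assume b: "b \<in> Basis"
      show "norm ((w \<bullet> b) *\<^sub>R ?D y b) \<le> norm w * M b"
        using Basis_le_norm[OF b, of w] M[OF y, of b] by (auto intro: mult_mono)
    qed
    finally show "norm (?D y w) \<le> L * norm w" by (simp add: L_def sum_distrib_left mult.commute)
  qed
  show ?thesis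
  proof (rule llipI[of e L])
    fix y z assume "dist x y \<le> e" "dist x z \<le> e"
    then have "norm (f y - f z) \<le> L * norm (y - z)"
      using der on by (intro differentiable_bound[of "cball x e" f ?D]) (auto intro: has_derivative_at_withinI)
    then show "dist (f y) (f z) \<le> L * dist y z" by (simp add: dist_norm)
  qed (use e M0 in \<open>auto simp: L_def sum_nonneg\<close>)
qed

section \<open>Null directions of an indefinite quadratic form\<close>

text \<open>The root near 0 of \<open>\<alpha> + u + \<gamma> * u\<^sup>2\<close>, in the
  rationalized form that remains valid for \<open>\<gamma> = 0\<close>.\<close>

definition slope_root :: "real \<Rightarrow> real \<Rightarrow> real" where
  "slope_root \<alpha> \<gamma> = - 2 * \<alpha> / (1 + sqrt (1 - 4 * \<alpha> * \<gamma>))"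

lemma small_coeffs_disc:
  fixes \<alpha> \<gamma> :: real
  assumes "\<bar>\<alpha>\<bar> \<le> 1/8" "\<bar>\<gamma>\<bar> \<le> 1/8"
  shows "1 - 4 * \<alpha> * \<gamma> \<ge> 1/4"
proof -
  have "\<bar>\<alpha> * \<gamma>\<bar> \<le> 1/8 * (1/8)" unfolding abs_mult using assms by (intro mult_mono) auto
  then show ?thesis by (simp add: abs_le_iff)
qed

lemma slope_root_bound:
  assumes "\<bar>\<alpha>\<bar> \<le> 1/8" "\<bar>\<gamma>\<bar> \<le> 1/8"
  shows "\<bar>slope_root \<alpha> \<gamma>\<bar> \<le> 1/4"
proof -
  define s where "s = sqrt (1 - 4 * \<alpha> * \<gamma>)"
  have s: "s \<ge> 0" using small_coeffs_disc[OF assms] by (simp add: s_def)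
  have "\<bar>slope_root \<alpha> \<gamma>\<bar> = 2 * \<bar>\<alpha>\<bar> / (1 + s)"
    using s by (simp add: slope_root_def s_def abs_mult)
  also have "\<dots> \<le> 2 * \<bar>\<alpha>\<bar> / 1" using s by (intro divide_left_mono) auto
  finally show ?thesis using assms by simp
qed

text \<open>Both square roots are at least 1/2, so their sum is at least 1 and they differ by no
  more than the radicands. In the constant 3, the numerator contributes 2 and the denominator
  1.\<close>

lemma slope_root_lipschitz:
  assumes "\<bar>\<alpha>\<bar> \<le> 1/8" "\<bar>\<gamma>\<bar> \<le> 1/8" "\<bar>\<alpha>'\<bar> \<le> 1/8" "\<bar>\<gamma>'\<bar> \<le> 1/8"
  shows "\<bar>slope_root \<alpha> \<gamma> - slope_root \<alpha>' \<gamma>'\<bar> \<le> 3 * (\<bar>\<alpha> - \<alpha>'\<bar> + \<bar>\<gamma> - \<gamma>'\<bar>)"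
proof -
  define s where "s = sqrt (1 - 4 * \<alpha> * \<gamma>)"
  define s' where "s' = sqrt (1 - 4 * \<alpha>' * \<gamma>')"
  have sq: "s\<^sup>2 = 1 - 4 * \<alpha> * \<gamma>" "s'\<^sup>2 = 1 - 4 * \<alpha>' * \<gamma>'"
    using small_coeffs_disc[OF assms(1,2)] small_coeffs_disc[OF assms(3,4)] by (auto simp: s_def s'_def)
  have h: "s \<ge> 1/2" "s' \<ge> 1/2"
    using small_coeffs_disc[OF assms(1,2)] small_coeffs_disc[OF assms(3,4)]
    unfolding s_def s'_def by (intro real_le_rsqrt; simp add: power2_eq_square)+
  have "(s - s') * (s + s') = s\<^sup>2 - s'\<^sup>2" by (simp add: power2_eq_square algebra_simps)
  also have "\<dots> = - (4 * \<alpha> * (\<gamma> - \<gamma>') + 4 * \<gamma>' * (\<alpha> - \<alpha>'))" unfolding sq by (simp add: algebra_simps)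
  finally have eq: "(s - s') * (s + s') = - (4 * \<alpha> * (\<gamma> - \<gamma>') + 4 * \<gamma>' * (\<alpha> - \<alpha>'))" .
  have "\<bar>s - s'\<bar> * \<bar>s + s'\<bar> = \<bar>4 * \<alpha> * (\<gamma> - \<gamma>') + 4 * \<gamma>' * (\<alpha> - \<alpha>')\<bar>"
    unfolding abs_mult[symmetric] eq abs_minus_cancel ..
  also have "\<dots> \<le> 4 * \<bar>\<alpha>\<bar> * \<bar>\<gamma> - \<gamma>'\<bar> + 4 * \<bar>\<gamma>'\<bar> * \<bar>\<alpha> - \<alpha>'\<bar>"
    using abs_triangle_ineq[of "4 * \<alpha> * (\<gamma> - \<gamma>')" "4 * \<gamma>' * (\<alpha> - \<alpha>')"] by (simp add: abs_mult)
  also have "\<dots> \<le> 1 * \<bar>\<gamma> - \<gamma>'\<bar> + 1 * \<bar>\<alpha> - \<alpha>'\<bar>"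
    using assms by (intro add_mono mult_right_mono) auto
  finally have "\<bar>s - s'\<bar> * \<bar>s + s'\<bar> \<le> \<bar>\<gamma> - \<gamma>'\<bar> + \<bar>\<alpha> - \<alpha>'\<bar>" by simp
  moreover have "\<bar>s - s'\<bar> * 1 \<le> \<bar>s - s'\<bar> * \<bar>s + s'\<bar>" using h by (intro mult_left_mono) auto
  ultimately have ss: "\<bar>s - s'\<bar> \<le> \<bar>\<alpha> - \<alpha>'\<bar> + \<bar>\<gamma> - \<gamma>'\<bar>" by simp
  have i: "\<bar>inverse (1 + s) - inverse (1 + s')\<bar> \<le> \<bar>s - s'\<bar>"
  proof -
    have "1 \<le> (1 + s) * (1 + s')" using h by (simp add: algebra_simps)
    then have q: "1 \<le> \<bar>(1 + s) * (1 + s')\<bar>" by simp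
    have "1 + s \<noteq> 0" "1 + s' \<noteq> 0" using h by auto
    then have "inverse (1 + s) - inverse (1 + s') = (s' - s) / ((1 + s) * (1 + s'))"
      by (simp add: field_simps)
    then have "\<bar>inverse (1 + s) - inverse (1 + s')\<bar> = \<bar>s' - s\<bar> / \<bar>(1 + s) * (1 + s')\<bar>"
      by (simp only: abs_divide)
    also have "\<dots> \<le> \<bar>s' - s\<bar> / 1" using q by (intro divide_left_mono) auto
    finally show ?thesis by (simp add: abs_minus_commute)
  qed
  have "slope_root \<alpha> \<gamma> - slope_root \<alpha>' \<gamma>'
      = - (2 * inverse (1 + s) * (\<alpha> - \<alpha>') + 2 * \<alpha>' * (inverse (1 + s) - inverse (1 + s')))"
    by (simp add: slope_root_def s_def s'_def divide_inverse algebra_simps)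
  then have "\<bar>slope_root \<alpha> \<gamma> - slope_root \<alpha>' \<gamma>'\<bar>
      = \<bar>2 * inverse (1 + s) * (\<alpha> - \<alpha>') + 2 * \<alpha>' * (inverse (1 + s) - inverse (1 + s'))\<bar>"
    by (simp only: abs_minus_cancel)
  also have "\<dots> \<le> \<bar>2 * inverse (1 + s) * (\<alpha> - \<alpha>')\<bar> + \<bar>2 * \<alpha>' * (inverse (1 + s) - inverse (1 + s'))\<bar>"
    by (rule abs_triangle_ineq)
  also have "\<dots> \<le> 2 * \<bar>\<alpha> - \<alpha>'\<bar> + 1 * \<bar>s - s'\<bar>"
  proof (rule add_mono)
    have inv: "0 \<le> inverse (1 + s)" "inverse (1 + s) \<le> 1" using h by (auto simp: inverse_le_1_iff)
    have "\<bar>2 * inverse (1 + s) * (\<alpha> - \<alpha>')\<bar> = 2 * (inverse (1 + s) * \<bar>\<alpha> - \<alpha>'\<bar>)"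
      using inv(1) by (simp only: abs_mult abs_of_nonneg abs_numeral mult.assoc)
    also have "\<dots> \<le> 2 * (1 * \<bar>\<alpha> - \<alpha>'\<bar>)" using inv(2) by (intro mult_left_mono mult_right_mono) auto
    finally show "\<bar>2 * inverse (1 + s) * (\<alpha> - \<alpha>')\<bar> \<le> 2 * \<bar>\<alpha> - \<alpha>'\<bar>" by simp
    have "\<bar>2 * \<alpha>'\<bar> \<le> 1" using assms(3) by simp
    then show "\<bar>2 * \<alpha>' * (inverse (1 + s) - inverse (1 + s'))\<bar> \<le> 1 * \<bar>s - s'\<bar>"
      unfolding abs_mult[of "2 * \<alpha>'"] by (rule mult_mono[OF _ i]) auto
  qed
  finally have "\<bar>slope_root \<alpha> \<gamma> - slope_root \<alpha>' \<gamma>'\<bar> \<le> 2 * \<bar>\<alpha> - \<alpha>'\<bar> + 1 * \<bar>s - s'\<bar>" .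
  moreover have "X \<le> 3 * (p + q)" if "X \<le> 2 * p + 1 * m" "m \<le> p + q" "0 \<le> q" for X p q m :: real
    using that by simp
  ultimately show ?thesis using ss abs_ge_zero by blast
qed

lemma slope_root_null:
  assumes "\<bar>\<alpha>\<bar> \<le> 1/8" "\<bar>\<gamma>\<bar> \<le> 1/8"
  shows "\<alpha> * x\<^sup>2 + x * y + \<gamma> * y\<^sup>2 = 0 \<longleftrightarrow> y = slope_root \<alpha> \<gamma> * x \<or> x = slope_root \<gamma> \<alpha> * y"
proof -
  define s where "s = sqrt (1 - 4 * \<alpha> * \<gamma>)"
  have sq: "s\<^sup>2 = 1 - 4 * \<alpha> * \<gamma>" using small_coeffs_disc[OF assms] by (simp add: s_def)
  have h: "s \<ge> 0" using small_coeffs_disc[OF assms] by (simp add: s_def)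
  define k where "k = 1 + s"
  have k: "k > 0" using h by (simp add: k_def)
  have r: "slope_root \<alpha> \<gamma> = - (2 * \<alpha>) / k" "slope_root \<gamma> \<alpha> = - (2 * \<gamma>) / k"
    by (simp_all add: slope_root_def s_def k_def mult.assoc mult.commute[of \<gamma>])
  have kk: "k\<^sup>2 + 4 * \<alpha> * \<gamma> = 2 * k"
    using sq by (simp add: k_def power2_eq_square algebra_simps)
  \<comment> \<open>Up to the positive factor \<open>2 * k\<close> the form is a product of two
    linear factors; \<open>kk\<close> is the quadratic equation satisfied by
    \<open>k\<close>.\<close>
  have "(k * y + 2 * \<alpha> * x) * (k * x + 2 * \<gamma> * y)
      = (k\<^sup>2 + 4 * \<alpha> * \<gamma>) * (x * y) + 2 * k * (\<alpha> * x\<^sup>2 + \<gamma> * y\<^sup>2)"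
    by (simp add: power2_eq_square algebra_simps)
  also have "\<dots> = 2 * k * (\<alpha> * x\<^sup>2 + x * y + \<gamma> * y\<^sup>2)" unfolding kk by (simp add: algebra_simps)
  finally have "\<alpha> * x\<^sup>2 + x * y + \<gamma> * y\<^sup>2 = 0 \<longleftrightarrow> k * y + 2 * \<alpha> * x = 0 \<or> k * x + 2 * \<gamma> * y = 0"
    using k by (metis mult_eq_0_iff less_irrefl zero_less_mult_iff zero_less_numeral)
  also have "k * y + 2 * \<alpha> * x = 0 \<longleftrightarrow> y = slope_root \<alpha> \<gamma> * x" using k by (auto simp: r field_simps)
  also have "k * x + 2 * \<gamma> * y = 0 \<longleftrightarrow> x = slope_root \<gamma> \<alpha> * y" using k by (auto simp: r field_simps)
  finally show ?thesis .
qed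

definition clampr :: "real \<Rightarrow> real \<Rightarrow> real" where
  "clampr r x = max (-r) (min r x)"

lemma clampr: "r \<ge> 0 \<Longrightarrow> clampr r x \<in> {-r..r}" "\<bar>clampr r x - clampr r y\<bar> \<le> \<bar>x - y\<bar>" "x \<in> {-r..r} \<Longrightarrow> clampr r x = x"
  by (auto simp: clampr_def max_def min_def)

lemma dist_clampr: "dist (clampr r x, clampr r y) (clampr r x', clampr r y') \<le> dist (x, y) (x', y')"
  unfolding dist_Pair_Pair dist_real_def by (intro real_sqrt_le_mono add_mono power_mono clampr) auto

text \<open>The coefficients vanish at the origin and are Lipschitz, hence small on a small square.
  They are extended to the plane by clamping because \<open>slope\<close> asks for global
  bounds.\<close>

lemma null_slopes_exist:
  fixes \<alpha> \<gamma> :: "real \<times> real \<Rightarrow> real"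
  assumes \<alpha>: "llip \<alpha> (0, 0)" "\<alpha> (0, 0) = 0" and \<gamma>: "llip \<gamma> (0, 0)" "\<gamma> (0, 0) = 0" and e: "e > 0"
  obtains u v r L where "slopes u v r L" "r \<le> e"
    "\<And>z w. z \<in> sq r \<Longrightarrow> null_dir u v z w \<longleftrightarrow> \<alpha> z * (fst w)\<^sup>2 + fst w * snd w + \<gamma> z * (snd w)\<^sup>2 = 0"
proof -
  obtain e1 L1 where 1: "e1 > 0" "L1 \<ge> 0"
    "\<And>x y. dist (0, 0) x \<le> e1 \<Longrightarrow> dist (0, 0) y \<le> e1 \<Longrightarrow> dist (\<alpha> x) (\<alpha> y) \<le> L1 * dist x y"
    using llipE[OF \<alpha>(1)] by blast
  obtain e2 L2 where 2: "e2 > 0" "L2 \<ge> 0"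
    "\<And>x y. dist (0, 0) x \<le> e2 \<Longrightarrow> dist (0, 0) y \<le> e2 \<Longrightarrow> dist (\<gamma> x) (\<gamma> y) \<le> L2 * dist x y"
    using llipE[OF \<gamma>(1)] by blast
  define L where "L = 3 * (L1 + L2)"
  have L0: "L \<ge> 0" using 1 2 by (simp add: L_def)
  \<comment> \<open>The last bound gives \<open>16 * r * L \<le> 1\<close>. This keeps the
    coefficients at most 1/8, as \<open>slope_root\<close> requires, and implies
    \<open>8 * r * L \<le> 1\<close>. The halves of \<open>e1\<close> and \<open>e2\<close> allow
    for distances up to \<open>2 * r\<close> inside the square.\<close>
  define r where "r = min e (min (e1/2) (min (e2/2) (1 / (16 * (L + 1)))))"
  have r: "r > 0" "r \<le> e" "2 * r \<le> e1" "2 * r \<le> e2" "r \<le> 1 / (16 * (L + 1))"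
    using e 1 2 L0 by (auto simp: r_def)
  have rL1: "16 * r * (L + 1) \<le> 1" using r(5) L0 by (simp add: field_simps)
  have rL: "16 * r * L \<le> 1" using rL1 r(1) by (simp add: algebra_simps)
  have near: "dist (0, 0) (x, y) \<le> 2 * r" if "x \<in> {-r..r}" "y \<in> {-r..r}" for x y :: real
  proof -
    have "dist (0, 0) (x, y) \<le> \<bar>x\<bar> + \<bar>y\<bar>"
      using sqrt_sum_squares_le_sum_abs[of x y] by (simp add: dist_Pair_Pair dist_real_def)
    then show ?thesis using that by auto
  qed
  let ?c = "\<lambda>z. (clampr r (fst z), clampr r (snd z))"
  define a where "a z = \<alpha> (?c z)" for z
  define g where "g z = \<gamma> (?c z)" for z
  have c: "dist (0, 0) (?c z) \<le> 2 * r" for z using near clampr(1)[of r] r(1) by simp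
  have ca: "dist (0, 0) (?c z) \<le> e1" "dist (0, 0) (?c z) \<le> e2" for z using c[of z] r by auto
  have aL: "\<bar>a z - a z'\<bar> \<le> L1 * dist z z'" and gL: "\<bar>g z - g z'\<bar> \<le> L2 * dist z z'" for z z'
  proof -
    have d: "dist (?c z) (?c z') \<le> dist z z'" using dist_clampr[of r "fst z" "snd z" "fst z'" "snd z'"] by simp
    have "\<bar>a z - a z'\<bar> \<le> L1 * dist (?c z) (?c z')" using 1(3)[OF ca(1) ca(1)] by (simp add: a_def dist_real_def)
    also have "\<dots> \<le> L1 * dist z z'" using d 1 by (intro mult_left_mono)
    finally show "\<bar>a z - a z'\<bar> \<le> L1 * dist z z'" .
    have "\<bar>g z - g z'\<bar> \<le> L2 * dist (?c z) (?c z')" using 2(3)[OF ca(2) ca(2)] by (simp add: g_def dist_real_def)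
    also have "\<dots> \<le> L2 * dist z z'" using d 2 by (intro mult_left_mono)
    finally show "\<bar>g z - g z'\<bar> \<le> L2 * dist z z'" .
  qed
  have small: "\<bar>a z\<bar> \<le> 1/8" "\<bar>g z\<bar> \<le> 1/8" for z
  proof -
    have "L1 * (2 * r) \<le> L * (2 * r)" "L2 * (2 * r) \<le> L * (2 * r)"
      using 1 2 r by (auto intro!: mult_right_mono simp: L_def)
    moreover have "L * (2 * r) \<le> 1/8" using rL by (simp add: mult.commute mult.left_commute)
    moreover have "\<bar>a z\<bar> \<le> L1 * dist (0, 0) (?c z)" "\<bar>g z\<bar> \<le> L2 * dist (0, 0) (?c z)"
      using 1(3)[of "(0, 0)" "?c z"] 2(3)[of "(0, 0)" "?c z"] ca[of z] 1(1) 2(1) \<alpha>(2) \<gamma>(2)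
      by (auto simp: a_def g_def dist_real_def)
    moreover have "L1 * dist (0, 0) (?c z) \<le> L1 * (2 * r)" "L2 * dist (0, 0) (?c z) \<le> L2 * (2 * r)"
      using c[of z] 1 2 by (auto intro!: mult_left_mono)
    ultimately show "\<bar>a z\<bar> \<le> 1/8" "\<bar>g z\<bar> \<le> 1/8" by linarith+
  qed
  define u where "u z = slope_root (a z) (g z)" for z
  define v where "v z = slope_root (g z) (a z)" for z
  have uL: "\<bar>u z - u z'\<bar> \<le> L * dist z z'" "\<bar>v z - v z'\<bar> \<le> L * dist z z'" for z z'
  proof -
    have s: "3 * (\<bar>a z - a z'\<bar> + \<bar>g z - g z'\<bar>) \<le> L * dist z z'"
      using aL[of z z'] gL[of z z'] by (simp add: L_def algebra_simps)
    show "\<bar>u z - u z'\<bar> \<le> L * dist z z'"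
      using slope_root_lipschitz[OF small[of z] small[of z']] s unfolding u_def by simp
    show "\<bar>v z - v z'\<bar> \<le> L * dist z z'"
      using slope_root_lipschitz[OF small(2)[of z] small(1)[of z] small(2)[of z'] small(1)[of z']] s
      unfolding v_def by (simp add: add.commute)
  qed
  have rL8: "8 * r * L \<le> 1" using rL mult_nonneg_nonneg[of r L] r(1) L0 by simp
  have "slope u r L" unfolding slope_def
    using uL slope_root_bound[OF small] r(1) L0 rL8 by (auto simp: u_def)
  moreover have "slope (v \<circ> prod.swap) r L" unfolding slope_def
  proof (intro conjI allI)
    fix z z' :: "real \<times> real"
    have "dist (prod.swap z) (prod.swap z') = dist z z'"
      by (cases z, cases z') (simp add: dist_Pair_Pair add.commute)
    then show "\<bar>(v \<circ> prod.swap) z - (v \<circ> prod.swap) z'\<bar> \<le> L * dist z z'" using uL(2)[of "prod.swap z" "prod.swap z'"] by simp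
    show "\<bar>(v \<circ> prod.swap) z\<bar> \<le> 1/4" using slope_root_bound[OF small(2,1)] by (simp add: v_def)
  qed (use r L0 rL8 in auto)
  ultimately have "slopes u v r L" by (simp add: slopes_def)
  moreover have "null_dir u v z w \<longleftrightarrow> \<alpha> z * (fst w)\<^sup>2 + fst w * snd w + \<gamma> z * (snd w)\<^sup>2 = 0" if z: "z \<in> sq r" for z w
  proof -
    have "?c z = z" using z by (cases z) (auto simp: sq_def clampr)
    then have "a z = \<alpha> z" "g z = \<gamma> z" by (simp_all add: a_def g_def)
    then show ?thesis
      using slope_root_null[OF small(1)[of z] small(2)[of z], of "fst w" "snd w"] by (simp add: null_dir_def u_def v_def)
  qed
  ultimately show ?thesis using that r(2) by blast
qed

definition qform :: "real \<Rightarrow> real \<Rightarrow> real \<Rightarrow> real^2 \<Rightarrow> real" where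
  "qform a b d w = a * (w $ 1)\<^sup>2 + 2 * b * (w $ 1) * (w $ 2) + d * (w $ 2)\<^sup>2"

definition bform :: "real \<Rightarrow> real \<Rightarrow> real \<Rightarrow> real^2 \<Rightarrow> real^2 \<Rightarrow> real" where
  "bform a b d s t = a * (s $ 1) * (t $ 1) + b * (s $ 1 * t $ 2 + s $ 2 * t $ 1) + d * (s $ 2) * (t $ 2)"

definition det2 :: "real^2 \<Rightarrow> real^2 \<Rightarrow> real" where
  "det2 s t = s $ 1 * t $ 2 - s $ 2 * t $ 1"

lemma qform_lincomb:
  "qform a b d (x *\<^sub>R s + y *\<^sub>R t) = qform a b d s * x\<^sup>2 + 2 * bform a b d s t * (x * y) + qform a b d t * y\<^sup>2"
  by (simp add: qform_def bform_def power2_eq_square algebra_simps)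

text \<open>How the discriminant changes when \<open>s\<close>, \<open>t\<close> become the basis.
  For independent null vectors of an indefinite form it shows that the mixed coefficient does not
  vanish.\<close>

lemma bform_square: "(bform a b d s t)\<^sup>2 - qform a b d s * qform a b d t = (b\<^sup>2 - a * d) * (det2 s t)\<^sup>2"
  by (simp add: qform_def bform_def det2_def power2_eq_square algebra_simps)

lemma null_basis:
  assumes "b\<^sup>2 - a * d > 0"
  obtains s t where "qform a b d s = 0" "qform a b d t = 0" "det2 s t \<noteq> 0"
proof (cases "a = 0")
  case True
  have b: "b \<noteq> 0" using assms True by auto
  show ?thesis
    by (rule that[of "vector [1, 0]" "vector [- d, 2 * b]"])
       (use True b in \<open>auto simp: qform_def det2_def vector_2 power2_eq_square algebra_simps\<close>)
next
  case False
  define q where "q = sqrt (b\<^sup>2 - a * d)"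
  have q: "q\<^sup>2 = b\<^sup>2 - a * d" "q > 0" using assms by (simp_all add: q_def)
  have n: "qform a b d (vector [- b + e * q, a]) = 0" if "e\<^sup>2 = 1" for e
  proof -
    have "qform a b d (vector [- b + e * q, a]) = a * (e\<^sup>2 * q\<^sup>2 - b\<^sup>2 + a * d)"
      by (simp add: qform_def vector_2 power2_eq_square algebra_simps)
    then show ?thesis using q that by simp
  qed
  show ?thesis
    by (rule that[of "vector [- b + 1 * q, a]" "vector [- b + (-1) * q, a]"], rule n, simp, rule n, simp)
       (use False q(2) in \<open>auto simp: det2_def vector_2 algebra_simps\<close>)
qed

lemma llip_isCont: "llip f z \<Longrightarrow> isCont f z"
proof -
  assume "llip f z"
  then obtain e L where f: "e > 0" "L \<ge> 0" "\<And>x y. dist z x \<le> e \<Longrightarrow> dist z y \<le> e \<Longrightarrow> dist (f x) (f y) \<le> L * dist x y"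
    using llipE by blast
  have "L-lipschitz_on (cball z e) f" using f by (intro lipschitz_onI) auto
  then have "continuous_on (cball z e) f" by (rule lipschitz_on_continuous_on)
  then have "continuous_on (ball z e) f" by (rule continuous_on_subset) auto
  then have "\<forall>x\<in>ball z e. isCont f x" by (simp add: continuous_on_eq_continuous_at)
  moreover have "z \<in> ball z e" using f(1) by simp
  ultimately show ?thesis by (rule bspec)
qed

definition aff :: "real^2 \<Rightarrow> real^2 \<Rightarrow> real^2 \<Rightarrow> real \<times> real \<Rightarrow> real^2" where
  "aff z0 s t z = z0 + (fst z *\<^sub>R s + snd z *\<^sub>R t)"

text \<open>Cramer's rule for the components with respect to \<open>s\<close> and
  \<open>t\<close>.\<close>

definition linv :: "real^2 \<Rightarrow> real^2 \<Rightarrow> real^2 \<Rightarrow> real \<times> real" where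
  "linv s t x = (det2 x t / det2 s t, det2 s x / det2 s t)"

definition affinv :: "real^2 \<Rightarrow> real^2 \<Rightarrow> real^2 \<Rightarrow> real^2 \<Rightarrow> real \<times> real" where
  "affinv z0 s t x = linv s t (x - z0)"

lemma linv_left: "det2 s t \<noteq> 0 \<Longrightarrow> linv s t (x *\<^sub>R s + y *\<^sub>R t) = (x, y)"
  by (simp add: linv_def det2_def field_simps)

lemma linv_right:
  assumes "det2 s t \<noteq> 0"
  shows "fst (linv s t x) *\<^sub>R s + snd (linv s t x) *\<^sub>R t = x"
proof -
  have "det2 x t * s $ i + det2 s x * t $ i = det2 s t * x $ i" for i
    using exhaust_2[of i] by (auto simp: det2_def algebra_simps)
  then have "(fst (linv s t x) *\<^sub>R s + snd (linv s t x) *\<^sub>R t) $ i = x $ i" for i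
    using assms by (simp add: linv_def flip: add_divide_distrib)
  then show ?thesis by (simp add: vec_eq_iff)
qed

lemma affinv_aff: "det2 s t \<noteq> 0 \<Longrightarrow> affinv z0 s t (aff z0 s t z) = z"
  by (cases z) (simp add: affinv_def aff_def linv_left)

lemma aff_affinv: "det2 s t \<noteq> 0 \<Longrightarrow> aff z0 s t (affinv z0 s t x) = x"
  by (simp add: affinv_def aff_def linv_right)

lemma linear_linv: "linear (linv s t)"
  by (rule linearI) (simp_all add: linv_def det2_def add_divide_distrib diff_divide_distrib algebra_simps)

lemma linear_det2: "linear (\<lambda>z. fst z *\<^sub>R s + snd z *\<^sub>R (t :: real^2))"
  by (rule linearI) (simp_all add: algebra_simps)

lemma linv_eq_0: "det2 s t \<noteq> 0 \<Longrightarrow> linv s t x = 0 \<longleftrightarrow> x = 0"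
  using linv_right[of s t x] linear_0[OF linear_linv[of s t]] by auto

lemma continuous_affinv: "continuous_on S (affinv z0 s t)"
proof -
  have "bounded_linear (linv s t)" using linear_linv linear_conv_bounded_linear by blast
  then show ?thesis
    unfolding affinv_def by (rule bounded_linear.continuous_on) (intro continuous_on_diff continuous_on_id continuous_on_const)
qed

lemma continuous_aff: "continuous_on S (aff z0 s t)"
  unfolding aff_def by (intro continuous_intros)

lemma aff_derivative: "(aff z0 s t has_derivative (\<lambda>w. fst w *\<^sub>R s + snd w *\<^sub>R t)) (at z)"
proof -
  have "((\<lambda>z. fst z *\<^sub>R s + snd z *\<^sub>R t) has_derivative (\<lambda>w. fst w *\<^sub>R s + snd w *\<^sub>R t)) (at z)"
    by (intro linear_imp_has_derivative linear_det2)
  then have "((\<lambda>z. z0 + (fst z *\<^sub>R s + snd z *\<^sub>R t)) has_derivative (\<lambda>w. fst w *\<^sub>R s + snd w *\<^sub>R t)) (at z)"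
    using has_derivative_add[OF has_derivative_const[of z0]] by fastforce
  then show ?thesis unfolding aff_def .
qed

lemma affinv_derivative: "(affinv z0 s t has_derivative linv s t) (at x)"
proof -
  have "((\<lambda>x. x - z0) has_derivative (\<lambda>w. w)) (at x)" by (auto intro!: derivative_eq_intros)
  from has_derivative_compose[OF this linear_imp_has_derivative[OF linear_linv]]
  show ?thesis unfolding affinv_def .
qed

lemma llip_aff: "llip (aff z0 s t) z"
proof (rule llipI[of 1 "norm s + norm t"])
  fix x y :: "real \<times> real"
  have "aff z0 s t x - aff z0 s t y = (fst x - fst y) *\<^sub>R s + (snd x - snd y) *\<^sub>R t"
    by (simp add: aff_def algebra_simps)
  then have "dist (aff z0 s t x) (aff z0 s t y) \<le> \<bar>fst x - fst y\<bar> * norm s + \<bar>snd x - snd y\<bar> * norm t"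
    unfolding dist_norm using norm_triangle_ineq[of "(fst x - fst y) *\<^sub>R s" "(snd x - snd y) *\<^sub>R t"] by simp
  also have "\<dots> \<le> dist x y * norm s + dist x y * norm t"
    using dist_fst_le[of x y] dist_snd_le[of x y] by (intro add_mono mult_right_mono) (auto simp: dist_real_def)
  finally show "dist (aff z0 s t x) (aff z0 s t y) \<le> (norm s + norm t) * dist x y" by (simp add: algebra_simps)
qed auto

text \<open>With two null vectors at \<open>z0\<close> as axes, the coefficients of the squares
  vanish at the origin while the mixed coefficient \<open>2 * B\<close> does not. Dividing by it
  gives the normal form of \<open>null_slopes_exist\<close>.\<close>

lemma adapted_exists:
  fixes a b d :: "real^2 \<Rightarrow> real"
  assumes U: "open U" "z0 \<in> U" and lip: "llip a z0" "llip b z0" "llip d z0" and disc: "(b z0)\<^sup>2 - a z0 * d z0 > 0"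
  obtains s t u v r L where "det2 s t \<noteq> 0" "slopes u v r L" "aff z0 s t ` sq r \<subseteq> U"
    "\<forall>z\<in>sq r. \<forall>w. null_dir u v z w \<longleftrightarrow>
       qform (a (aff z0 s t z)) (b (aff z0 s t z)) (d (aff z0 s t z)) (fst w *\<^sub>R s + snd w *\<^sub>R t) = 0"
proof -
  obtain s t where st: "qform (a z0) (b z0) (d z0) s = 0" "qform (a z0) (b z0) (d z0) t = 0" "det2 s t \<noteq> 0"
    using null_basis[OF disc] .
  let ?P = "aff z0 s t"
  have P0: "?P (0, 0) = z0" by (simp add: aff_def)
  have comp: "llip (\<lambda>z. f (?P z)) (0, 0)" if "llip f z0" for f :: "real^2 \<Rightarrow> real"
    by (rule llip_compose[OF llip_aff]) (simp add: P0 that)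
  note c = comp[OF lip(1)] comp[OF lip(2)] comp[OF lip(3)]
  define Q where "Q x z = qform (a (?P z)) (b (?P z)) (d (?P z)) x" for x z
  define B where "B z = bform (a (?P z)) (b (?P z)) (d (?P z)) s t" for z
  have lQ: "llip (Q x) (0, 0)" for x
    unfolding Q_def qform_def by (intro llip_add llip_mult llip_const c)
  have lB: "llip B (0, 0)"
    unfolding B_def bform_def by (intro llip_add llip_mult llip_const c)
  have Q0: "Q s (0, 0) = 0" "Q t (0, 0) = 0" using st P0 by (simp_all add: Q_def)
  have B0: "B (0, 0) \<noteq> 0"
    using bform_square[of "a z0" "b z0" "d z0" s t] st disc by (auto simp: B_def P0)
  have l2: "llip (\<lambda>z. 2 * B z) (0, 0)" by (intro llip_mult llip_const lB)
  have "isCont B (0, 0)" using lB by (rule llip_isCont)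
  then have ev1: "eventually (\<lambda>z. B z \<noteq> 0) (at (0, 0))"
    using B0 unfolding isCont_def by (intro tendsto_imp_eventually_ne)
  have "isCont ?P (0, 0)" by (rule llip_isCont[OF llip_aff])
  then have "(?P \<longlongrightarrow> z0) (at (0, 0))" by (simp add: isCont_def P0)
  then have ev2: "eventually (\<lambda>z. ?P z \<in> U) (at (0, 0))" using U by (rule topological_tendstoD)
  obtain e where e: "e > 0" "\<And>z. z \<noteq> (0, 0) \<Longrightarrow> dist z (0, 0) < e \<Longrightarrow> B z \<noteq> 0 \<and> ?P z \<in> U"
    using eventually_conj[OF ev1 ev2] unfolding eventually_at by auto
  then have e': "B z \<noteq> 0 \<and> ?P z \<in> U" if "dist z (0, 0) < e" for z
    using that B0 P0 U by (cases "z = (0, 0)") auto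
  obtain u v r L where uv: "slopes u v r L" "r \<le> e/2"
    "\<And>z w. z \<in> sq r \<Longrightarrow> null_dir u v z w \<longleftrightarrow>
       Q s z / (2 * B z) * (fst w)\<^sup>2 + fst w * snd w + Q t z / (2 * B z) * (snd w)\<^sup>2 = 0"
  proof (rule null_slopes_exist[of "\<lambda>z. Q s z / (2 * B z)" "\<lambda>z. Q t z / (2 * B z)" "e/2"])
    show "llip (\<lambda>z. Q s z / (2 * B z)) (0, 0)" "llip (\<lambda>z. Q t z / (2 * B z)) (0, 0)"
      using B0 by (intro llip_divide lQ l2; simp)+
  qed (use Q0 e in auto)
  have near: "dist z (0, 0) < e" if "z \<in> sq r" for z
  proof -
    obtain x y where xy: "z = (x, y)" by (cases z)
    have "\<bar>x\<bar> + \<bar>y\<bar> < e" using that uv(2) xy by (auto simp: sq_def)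
    then show ?thesis
      using sqrt_sum_squares_le_sum_abs[of x y] xy by (simp add: dist_Pair_Pair dist_real_def)
  qed
  show ?thesis
  proof (rule that[OF st(3) uv(1)])
    show "?P ` sq r \<subseteq> U" using near e' by blast
    show "\<forall>z\<in>sq r. \<forall>w. null_dir u v z w \<longleftrightarrow>
       qform (a (?P z)) (b (?P z)) (d (?P z)) (fst w *\<^sub>R s + snd w *\<^sub>R t) = 0"
    proof (intro ballI allI)
    fix z w assume z: "z \<in> sq r"
    have B: "B z \<noteq> 0" using near[OF z] e' by blast
    have "qform (a (?P z)) (b (?P z)) (d (?P z)) (fst w *\<^sub>R s + snd w *\<^sub>R t)
        = 2 * B z * (Q s z / (2 * B z) * (fst w)\<^sup>2 + fst w * snd w + Q t z / (2 * B z) * (snd w)\<^sup>2)"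
      unfolding qform_lincomb Q_def[symmetric] B_def[symmetric] using B by (simp add: field_simps)
    then show "null_dir u v z w \<longleftrightarrow> qform (a (?P z)) (b (?P z)) (d (?P z)) (fst w *\<^sub>R s + snd w *\<^sub>R t) = 0"
      using uv(3)[OF z, of w] B by simp
    qed
  qed
qed

section \<open>Surfaces with a field of null cones and the charts formed by their leaves\<close>

section \<open>Manifolds with a field of null cones\<close>

lemma smooth_atlasD:
  assumes "smooth_atlas A" "c \<in> A" "d \<in> A"
  shows "inj_on (snd c) (fst c)" "open (snd c ` fst c)" "open (snd c ` (fst c \<inter> fst d))"
    "smooth_on (snd c ` (fst c \<inter> fst d)) (coord_rep c d (\<lambda>x. x))"
  using assms by (auto simp: smooth_atlas_def)

lemma chart_inv:
  assumes "smooth_atlas A" "c \<in> A" "p \<in> fst c"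
  shows "chart_inv c (snd c p) = p"
  by (rule inv_into_f_f[OF smooth_atlasD(1)[OF assms(1,2,2)] assms(3)])

lemma coord_rep_chart: "smooth_atlas A \<Longrightarrow> c \<in> A \<Longrightarrow> p \<in> fst c \<Longrightarrow> coord_rep c d F (snd c p) = snd d (F p)"
  by (simp add: coord_rep_def chart_inv)

lemma openin_chart:
  assumes A: "smooth_atlas A" and c: "c \<in> A" and S: "S \<subseteq> fst c"
  shows "openin (mfd_topology A) S \<longleftrightarrow> open (snd c ` S)"
proof
  assume "openin (mfd_topology A) S"
  then have "open (snd c ` (fst c \<inter> S))" using c by (simp add: openin_mfd_topology[OF A])
  then show "open (snd c ` S)" using S by (simp add: Int_absorb1)
next
  assume o: "open (snd c ` S)"
  have "open (snd d ` (fst d \<inter> S))" if d: "d \<in> A" for d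
  proof -
    have cont: "continuous_on (snd d ` (fst d \<inter> fst c)) (coord_rep d c (\<lambda>x. x))"
      using smooth_atlasD(4)[OF A d c] by (rule smooth_on_continuous)
    have "snd d ` (fst d \<inter> S) = snd d ` (fst d \<inter> fst c) \<inter> coord_rep d c (\<lambda>x. x) -` (snd c ` S)"
    proof (intro equalityI subsetI)
      fix x assume "x \<in> snd d ` (fst d \<inter> S)"
      then obtain p where p: "p \<in> fst d" "p \<in> S" "x = snd d p" by auto
      then show "x \<in> snd d ` (fst d \<inter> fst c) \<inter> coord_rep d c (\<lambda>x. x) -` (snd c ` S)"
        using S coord_rep_chart[OF A d p(1), of c "\<lambda>x. x"] by auto
    next
      fix x assume x: "x \<in> snd d ` (fst d \<inter> fst c) \<inter> coord_rep d c (\<lambda>x. x) -` (snd c ` S)"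
      then obtain p where p: "p \<in> fst d" "p \<in> fst c" "x = snd d p" by auto
      then have "snd c p \<in> snd c ` S" using x coord_rep_chart[OF A d p(1), of c "\<lambda>x. x"] by auto
      then have "p \<in> S" using smooth_atlasD(1)[OF A c c] p S by (auto simp: inj_on_def)
      then show "x \<in> snd d ` (fst d \<inter> S)" using p by auto
    qed
    then show ?thesis using continuous_open_preimage[OF cont smooth_atlasD(3)[OF A d c] o] by simp
  qed
  then show "openin (mfd_topology A) S"
    using S c by (auto simp: openin_mfd_topology[OF A] points_def)
qed

lemma coord_rep_inj_derivative:
  assumes A: "smooth_atlas A" and c: "c \<in> A" "d \<in> A" and p: "p \<in> fst c" "p \<in> fst d" and w: "w \<noteq> 0"
  shows "frechet_derivative (coord_rep c d (\<lambda>x. x)) (at (snd c p)) w \<noteq> 0"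
proof
  let ?D = "frechet_derivative (coord_rep c d (\<lambda>x. x)) (at (snd c p))"
  let ?E = "frechet_derivative (coord_rep d c (\<lambda>x. x)) (at (snd d p))"
  let ?U = "snd c ` (fst c \<inter> fst d)"
  assume 0: "?D w = 0"
  have D: "(coord_rep c d (\<lambda>x. x) has_derivative ?D) (at (snd c p))"
    by (rule smooth_on_has_derivative[OF smooth_atlasD(4,3)[OF A c]]) (use p in blast)
  have E: "(coord_rep d c (\<lambda>x. x) has_derivative ?E) (at (coord_rep c d (\<lambda>x. x) (snd c p)))"
    unfolding coord_rep_chart[OF A c(1) p(1)]
    by (rule smooth_on_has_derivative[OF smooth_atlasD(4,3)[OF A c(2,1)]]) (use p in blast)
  have "((\<lambda>x. coord_rep d c (\<lambda>x. x) (coord_rep c d (\<lambda>x. x) x)) has_derivative (\<lambda>w. ?E (?D w))) (at (snd c p))"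
    by (rule has_derivative_compose[OF D E])
  moreover have "coord_rep d c (\<lambda>x. x) (coord_rep c d (\<lambda>x. x) x) = x" if "x \<in> ?U" for x
  proof -
    obtain q where q: "q \<in> fst c" "q \<in> fst d" "x = snd c q" using \<open>x \<in> ?U\<close> by auto
    then show ?thesis by (simp add: coord_rep_chart[OF A c(1)] coord_rep_chart[OF A c(2)])
  qed
  ultimately have "((\<lambda>x. x) has_derivative (\<lambda>w. ?E (?D w))) (at (snd c p))"
    using smooth_atlasD(3)[OF A c] p by (elim has_derivative_transform_within_open) auto
  then have "(\<lambda>w. ?E (?D w)) = (\<lambda>w. w)" using has_derivative_ident has_derivative_unique by blast
  then have "?E (?D w) = w" by metis
  moreover have "linear ?E" using E has_derivative_linear by blast
  ultimately show False using 0 w linear_0 by metis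
qed

text \<open>A chart \<open>c\<close> followed by affine coordinates adapted at \<open>z0\<close> and
  by the labels of the leaves. The domain is cut down so that the image is a box, and
  \<open>\<delta> \<le> r / 2\<close> provides the restriction under which leaf arcs stay in a
  region.\<close>

definition grid_chart where
  "grid_chart A null W h c z0 s t u v r L \<delta> \<longleftrightarrow> c \<in> A \<and> det2 s t \<noteq> 0 \<and> slopes u v r L \<and> 0 < \<delta> \<and> \<delta> \<le> r / 2 \<and>
     bx (-\<delta>) \<delta> (-\<delta>) \<delta> \<subseteq> labs u v r ` sq r \<and> aff z0 s t ` sq r \<subseteq> snd c ` fst c \<and>
     (\<forall>z\<in>sq r. \<forall>w. null_dir u v z w \<longleftrightarrow> null c (aff z0 s t z) (fst w *\<^sub>R s + snd w *\<^sub>R t)) \<and>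
     W = {p \<in> fst c. affinv z0 s t (snd c p) \<in> label_region u v r (-\<delta>) \<delta> (-\<delta>) \<delta>} \<and>
     h = (\<lambda>p. labs u v r (affinv z0 s t (snd c p)))"

definition null_form where
  "null_form null c z U a b d \<longleftrightarrow> open U \<and> z \<in> U \<and> U \<subseteq> snd c ` fst c \<and> llip a z \<and> llip b z \<and> llip d z \<and>
     (b z)\<^sup>2 - a z * d z > (0::real) \<and> (\<forall>y\<in>U. \<forall>w. null c y w \<longleftrightarrow> qform (a y) (b y) (d y) w = 0)"

text \<open>Only the zero sets of the forms are compared between charts; the forms themselves may
  differ by a factor.\<close>

locale null_field =
  fixes A :: "('a, real^2) chart set" and null :: "('a, real^2) chart \<Rightarrow> real^2 \<Rightarrow> real^2 \<Rightarrow> bool"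
  assumes A: "smooth_manifold A" and cpt: "compact_space (mfd_topology A)"
    and local_form: "\<And>c z. c \<in> A \<Longrightarrow> z \<in> snd c ` fst c \<Longrightarrow>
      \<exists>U a b d. null_form null c z U a b d"
    and null_trans: "\<And>c d p w. c \<in> A \<Longrightarrow> d \<in> A \<Longrightarrow> p \<in> fst c \<Longrightarrow> p \<in> fst d \<Longrightarrow> null c (snd c p) w \<Longrightarrow>
      null d (snd d p) (frechet_derivative (coord_rep c d (\<lambda>x. x)) (at (snd c p)) w)"
begin

lemma atlas: "smooth_atlas A" using A by (simp add: smooth_manifold_def)

lemma grid_chart_exists:
  assumes c: "c \<in> A" "p \<in> fst c"
  shows "\<exists>W h z0 s t u v r L \<delta>. grid_chart A null W h c z0 s t u v r L \<delta> \<and> p \<in> W"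
proof -
  let ?z = "snd c p"
  have "?z \<in> snd c ` fst c" using c by auto
  then obtain U a b d where nf: "null_form null c ?z U a b d" using local_form[OF c(1)] by blast
  then have U: "open U" "?z \<in> U" "U \<subseteq> snd c ` fst c" and l: "llip a ?z" "llip b ?z" "llip d ?z"
    and disc: "(b ?z)\<^sup>2 - a ?z * d ?z > 0" by (simp_all add: null_form_def)
  have null: "null c y w \<longleftrightarrow> qform (a y) (b y) (d y) w = 0" if "y \<in> U" for y w
    using nf that unfolding null_form_def by metis
  obtain s t u v r L where st: "det2 s t \<noteq> 0" and sl: "slopes u v r L" and im: "aff ?z s t ` sq r \<subseteq> U"
    and nd: "\<forall>z\<in>sq r. \<forall>w. null_dir u v z w \<longleftrightarrow>
       qform (a (aff ?z s t z)) (b (aff ?z s t z)) (d (aff ?z s t z)) (fst w *\<^sub>R s + snd w *\<^sub>R t) = 0"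
    by (rule adapted_exists[OF U(1,2) l disc])
  have r: "r > 0" using sl slopeD(1) by (auto simp: slopes_def)
  have z0: "(0, 0) \<in> sq r" using r by (simp add: sq_def)
  have "(0, 0) \<in> labs u v r ` sq r" using labs_zero[OF sl] z0 by (metis imageI)
  then obtain e where e: "e > 0" "cbx (0 - e) (0 + e) (0 - e) (0 + e) \<subseteq> labs u v r ` sq r"
    using point_box[OF labs_open_image[OF sl]] by blast
  define \<delta> where "\<delta> = min e (r/2)"
  have \<delta>: "\<delta> > 0" "\<delta> \<le> r/2" "bx (-\<delta>) \<delta> (-\<delta>) \<delta> \<subseteq> labs u v r ` sq r"
  proof -
    have "bx (-\<delta>) \<delta> (-\<delta>) \<delta> \<subseteq> cbx (0 - e) (0 + e) (0 - e) (0 + e)" by (auto simp: bx_def cbx_def \<delta>_def)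
    then show "bx (-\<delta>) \<delta> (-\<delta>) \<delta> \<subseteq> labs u v r ` sq r" using e by blast
  qed (use e r in \<open>auto simp: \<delta>_def\<close>)
  have "affinv ?z s t ?z = (0, 0)" using affinv_aff[OF st, of ?z "(0, 0)"] by (simp add: aff_def)
  then have p: "affinv ?z s t ?z \<in> label_region u v r (-\<delta>) \<delta> (-\<delta>) \<delta>"
    using z0 labs_zero[OF sl] \<delta> by (simp add: label_region_def mem_bx)
  have "grid_chart A null {p \<in> fst c. affinv ?z s t (snd c p) \<in> label_region u v r (-\<delta>) \<delta> (-\<delta>) \<delta>}
      (\<lambda>p. labs u v r (affinv ?z s t (snd c p))) c ?z s t u v r L \<delta>"
    unfolding grid_chart_def
  proof (intro conjI ballI allI)
    show "aff ?z s t ` sq r \<subseteq> snd c ` fst c" using im U(3) by (rule order_trans)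
    fix z w assume z: "z \<in> sq r"
    then have "aff ?z s t z \<in> U" using im by blast
    then show "null_dir u v z w \<longleftrightarrow> null c (aff ?z s t z) (fst w *\<^sub>R s + snd w *\<^sub>R t)"
      using nd z null by blast
  qed (fact c st sl \<delta> refl)+
  then show ?thesis using p c by blast
qed

lemma grid_chartD:
  assumes g: "grid_chart A null W h c z0 s t u v r L \<delta>"
  shows "W \<subseteq> fst c" "inj_on h W" "h ` W = bx (-\<delta>) \<delta> (-\<delta>) \<delta>" "openin (mfd_topology A) W"
    "\<And>S. S \<subseteq> W \<Longrightarrow> openin (mfd_topology A) S \<Longrightarrow> open (h ` S)"
    "\<And>V. open V \<Longrightarrow> openin (mfd_topology A) {p \<in> W. h p \<in> V}"
proof -
  let ?K = "affinv z0 s t" and ?P = "aff z0 s t"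
  let ?D = "label_region u v r (-\<delta>) \<delta> (-\<delta>) \<delta>"
  have c: "c \<in> A" and st: "det2 s t \<noteq> 0" and sl: "slopes u v r L" and sub: "bx (-\<delta>) \<delta> (-\<delta>) \<delta> \<subseteq> labs u v r ` sq r"
    and im: "?P ` sq r \<subseteq> snd c ` fst c"
    and W: "W = {p \<in> fst c. ?K (snd c p) \<in> ?D}" and h: "h = (\<lambda>p. labs u v r (?K (snd c p)))"
    using g by (auto simp: grid_chart_def)
  note KP = affinv_aff[OF st] and PK = aff_affinv[OF st]
  have injc: "inj_on (snd c) (fst c)" using smooth_atlasD(1)[OF atlas c c] .
  show Wc: "W \<subseteq> fst c" using W by auto
  show "inj_on h W"
  proof (rule inj_onI)
    fix p q assume pq: "p \<in> W" "q \<in> W" "h p = h q"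
    then have "?K (snd c p) = ?K (snd c q)"
      using inj_onD[OF labs_inj[OF sl], of "?K (snd c p)" "?K (snd c q)"] W h by (auto simp: label_region_def)
    then have "snd c p = snd c q" using PK by metis
    then show "p = q" using inj_onD[OF injc] pq Wc by blast
  qed
  have DW: "\<exists>p\<in>W. snd c p = ?P z" if z: "z \<in> ?D" for z
  proof -
    have "?P z \<in> snd c ` fst c" using im z by (auto simp: label_region_def)
    then obtain p where "p \<in> fst c" "snd c p = ?P z" by auto
    moreover then have "?K (snd c p) = z" using KP by simp
    ultimately show ?thesis using W z by auto
  qed
  show "h ` W = bx (-\<delta>) \<delta> (-\<delta>) \<delta>"
  proof (intro equalityI subsetI)
    fix y assume "y \<in> bx (-\<delta>) \<delta> (-\<delta>) \<delta>"
    then obtain z where z: "z \<in> sq r" "y = labs u v r z" "z \<in> ?D" using sub by (auto simp: label_region_def)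
    then obtain p where p: "p \<in> W" "snd c p = ?P z" using DW by blast
    have "h p = y" using z p h KP by simp
    then show "y \<in> h ` W" using p by blast
  qed (auto simp: W h label_region_def)
  have pre: "openin (mfd_topology A) {p \<in> fst c. ?K (snd c p) \<in> V}" if V: "open V" "V \<subseteq> ?D" for V
  proof -
    have "snd c ` {p \<in> fst c. ?K (snd c p) \<in> V} = ?K -` V"
    proof (intro equalityI subsetI)
      fix x assume x: "x \<in> ?K -` V"
      then obtain p where "p \<in> W" "snd c p = ?P (?K x)" using DW[of "?K x"] V by auto
      then show "x \<in> snd c ` {p \<in> fst c. ?K (snd c p) \<in> V}" using PK x Wc by (intro image_eqI[of _ _ p]) auto
    qed auto
    moreover have "open (?K -` V)" using V(1) continuous_affinv by (rule open_vimage)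
    ultimately show ?thesis by (subst openin_chart[OF atlas c]) auto
  qed
  show "openin (mfd_topology A) W" unfolding W by (rule pre[OF open_label_region[OF sl] order_refl])
  show "openin (mfd_topology A) {p \<in> W. h p \<in> V}" if "open V" for V
  proof -
    have "open (sq r \<inter> labs u v r -` V)"
      by (rule continuous_open_preimage[OF labs_continuous[OF sl] open_sq \<open>open V\<close>])
    then have "open (?D \<inter> (sq r \<inter> labs u v r -` V))" by (rule open_Int[OF open_label_region[OF sl]])
    from pre[OF this] have "openin (mfd_topology A) {p \<in> fst c. ?K (snd c p) \<in> ?D \<inter> (sq r \<inter> labs u v r -` V)}" by blast
    moreover have "{p \<in> fst c. ?K (snd c p) \<in> ?D \<inter> (sq r \<inter> labs u v r -` V)} = {p \<in> W. h p \<in> V}"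
      by (auto simp: W h label_region_def)
    ultimately show ?thesis by simp
  qed
  show "open (h ` S)" if S: "S \<subseteq> W" "openin (mfd_topology A) S" for S
  proof -
    have "open (snd c ` S)" using S Wc openin_chart[OF atlas c, of S] by auto
    then have "open (?P -` (snd c ` S))" using continuous_aff by (rule open_vimage)
    moreover have "?P -` (snd c ` S) = (\<lambda>p. ?K (snd c p)) ` S"
    proof (intro equalityI subsetI)
      fix z assume "z \<in> ?P -` (snd c ` S)"
      then obtain p where "p \<in> S" "?P z = snd c p" by auto
      then show "z \<in> (\<lambda>p. ?K (snd c p)) ` S" using KP by (metis imageI)
    qed (use PK in auto)
    ultimately have o: "open ((\<lambda>p. ?K (snd c p)) ` S)" by simp
    have sub: "(\<lambda>p. ?K (snd c p)) ` S \<subseteq> sq r" using S W by (auto simp: label_region_def)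
    have "open (labs u v r ` ((\<lambda>p. ?K (snd c p)) ` S))"
      using continuous_on_subset[OF labs_continuous[OF sl] sub] o inj_on_subset[OF labs_inj[OF sl] sub]
      by (rule invariance_of_domain)
    then show ?thesis by (simp add: h image_image)
  qed
qed

text \<open>In adapted coordinates the coordinate change is \<open>\<tau>\<close> with derivative
  \<open>T\<close>. It preserves null directions by \<open>null_trans\<close>, so
  \<open>product_transition\<close> applies on the region whose labels fill the given box.\<close>

lemma grid_chart_trans:
  assumes g: "grid_chart A null W h c z0 s t u v r L \<delta>" and g': "grid_chart A null W' h' c' z0' s' t' u' v' r' L' \<delta>'"
    and ab: "a < b" "e < d" and sub: "bx a b e d \<subseteq> h ` (W \<inter> W')"
  shows "\<exists>\<alpha> \<beta>. (\<forall>x y. (x, y) \<in> bx a b e d \<longrightarrow> h' (inv_into W h (x, y)) = (\<alpha> x, \<beta> y)) \<or>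
            (\<forall>x y. (x, y) \<in> bx a b e d \<longrightarrow> h' (inv_into W h (x, y)) = (\<beta> y, \<alpha> x))"
proof -
  let ?K = "affinv z0 s t" and ?P = "aff z0 s t" and ?K' = "affinv z0' s' t'" and ?P' = "aff z0' s' t'"
  let ?D = "label_region u v r a b e d"
  have c: "c \<in> A" and st: "det2 s t \<noteq> 0" and sl: "slopes u v r L" and \<delta>: "\<delta> \<le> r/2"
    and subr: "bx (-\<delta>) \<delta> (-\<delta>) \<delta> \<subseteq> labs u v r ` sq r"
    and nd: "\<And>z w. z \<in> sq r \<Longrightarrow> null_dir u v z w \<longleftrightarrow> null c (?P z) (fst w *\<^sub>R s + snd w *\<^sub>R t)"
    and W: "W = {p \<in> fst c. ?K (snd c p) \<in> label_region u v r (-\<delta>) \<delta> (-\<delta>) \<delta>}"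
    and h: "h = (\<lambda>p. labs u v r (?K (snd c p)))"
    using g by (auto simp: grid_chart_def)
  have c': "c' \<in> A" and st': "det2 s' t' \<noteq> 0" and sl': "slopes u' v' r' L'"
    and nd': "\<And>z w. z \<in> sq r' \<Longrightarrow> null_dir u' v' z w \<longleftrightarrow> null c' (?P' z) (fst w *\<^sub>R s' + snd w *\<^sub>R t')"
    and W': "W' = {p \<in> fst c'. ?K' (snd c' p) \<in> label_region u' v' r' (-\<delta>') \<delta>' (-\<delta>') \<delta>'}"
    and h': "h' = (\<lambda>p. labs u' v' r' (?K' (snd c' p)))"
    using g' by (auto simp: grid_chart_def)
  have bb: "bx a b e d \<subseteq> bx (-\<delta>) \<delta> (-\<delta>) \<delta>" using sub grid_chartD(3)[OF g] by blast
  have abd: "-\<delta> \<le> a" "b \<le> \<delta>" "-\<delta> \<le> e" "d \<le> \<delta>"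
  proof -
    have "{a<..<b} \<subseteq> {-\<delta><..<\<delta>}" "{e<..<d} \<subseteq> {-\<delta><..<\<delta>}"
      using bb ab unfolding bx_def times_subset_iff by (auto simp: greaterThanLessThan_empty_iff)
    then show "-\<delta> \<le> a" "b \<le> \<delta>" "-\<delta> \<le> e" "d \<le> \<delta>"
      using ab by (auto simp: greaterThanLessThan_subseteq_greaterThanLessThan)
  qed
  let ?f = "coord_rep c c' (\<lambda>x. x)"
  define \<tau> where "\<tau> z = ?K' (?f (?P z))" for z
  define T where "T z w = linv s' t' (frechet_derivative ?f (at (?P z)) (fst w *\<^sub>R s + snd w *\<^sub>R t))" for z w
  have pt: "\<exists>p\<in>W \<inter> W'. snd c p = ?P z \<and> h p = labs u v r z \<and> \<tau> z = ?K' (snd c' p)" if z: "z \<in> ?D" for z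
  proof -
    have "labs u v r z \<in> h ` (W \<inter> W')" using z sub by (auto simp: label_region_def)
    then obtain p where p: "p \<in> W" "p \<in> W'" "labs u v r z = h p" by auto
    then have "?K (snd c p) \<in> sq r" using W by (auto simp: label_region_def)
    moreover have "z \<in> sq r" using z by (auto simp: label_region_def)
    ultimately have "z = ?K (snd c p)"
      using inj_onD[OF labs_inj[OF sl], of z "?K (snd c p)"] p(3) h by simp
    then have Pz: "?P z = snd c p" using aff_affinv[OF st] by simp
    moreover have "?f (?P z) = snd c' p"
      unfolding Pz by (rule coord_rep_chart[OF atlas c]) (use p(1) W in auto)
    ultimately show ?thesis using p by (auto simp: \<tau>_def intro!: bexI[of _ p])
  qed
  have "\<exists>\<alpha> \<beta>. (\<forall>z\<in>?D. labs u' v' r' (\<tau> z) = (\<alpha> (fst (labs u v r z)), \<beta> (snd (labs u v r z)))) \<or>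
    (\<forall>z\<in>?D. labs u' v' r' (\<tau> z) = (\<beta> (snd (labs u v r z)), \<alpha> (fst (labs u v r z))))"
  proof (rule product_transition[OF sl sl', where T = T])
    show "- (r/2) \<le> a" "b \<le> r/2" "- (r/2) \<le> e" "d \<le> r/2" using abd \<delta> by auto
    show "bx a b e d \<subseteq> labs u v r ` sq r" using bb subr by blast
    have PU: "?P z \<in> snd c ` (fst c \<inter> fst c')" if z: "z \<in> ?D" for z
    proof -
      obtain p where "p \<in> W \<inter> W'" "snd c p = ?P z" using pt[OF z] by blast
      then show ?thesis using W W' by (intro image_eqI[of _ _ p]) auto
    qed
    fix w
    have "continuous_on ?D (\<lambda>z. frechet_derivative ?f (at (?P z)) (fst w *\<^sub>R s + snd w *\<^sub>R t))"
      by (rule continuous_on_compose2[OF smooth_on_continuous[OF smooth_on_frechet[OF smooth_atlasD(4)[OF atlas c c']]] continuous_aff])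
         (use PU in blast)
    then show "continuous_on ?D (\<lambda>z. T z w)"
      unfolding T_def using linear_continuous_on[OF linear_conv_bounded_linear[THEN iffD1, OF linear_linv]]
      by (rule_tac continuous_on_compose2[of UNIV "linv s' t'"]) auto
    fix z assume z: "z \<in> ?D"
    obtain p where p: "p \<in> W" "p \<in> W'" "snd c p = ?P z" "h p = labs u v r z" "\<tau> z = ?K' (snd c' p)"
      using pt[OF z] by blast
    have pc: "p \<in> fst c" "p \<in> fst c'" using p W W' by auto
    have zs: "z \<in> sq r" using z by (auto simp: label_region_def)
    show ran: "\<tau> z \<in> sq r'" using p W' by (auto simp: label_region_def)
    have df: "(?f has_derivative frechet_derivative ?f (at (?P z))) (at (?P z))"
      by (rule smooth_on_has_derivative[OF smooth_atlasD(4,3)[OF atlas c c'] PU[OF z]])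
    show "(\<tau> has_derivative T z) (at z)"
      unfolding \<tau>_def T_def
      by (rule has_derivative_compose[OF has_derivative_compose[OF aff_derivative df] affinv_derivative])
    fix w
    have inj0: "fst w *\<^sub>R s + snd w *\<^sub>R t \<noteq> 0" if "w \<noteq> 0"
      using linv_left[OF st, of "fst w" "snd w"] that linear_0[OF linear_linv[of s t]] by auto
    show "T z w \<noteq> 0" if "w \<noteq> 0"
      unfolding T_def linv_eq_0[OF st']
      using coord_rep_inj_derivative[OF atlas c c' pc inj0[OF that]] p(3) by simp
    have "?P' (\<tau> z) = snd c' p" using p(5) aff_affinv[OF st'] by simp
    moreover have "fst (T z w) *\<^sub>R s' + snd (T z w) *\<^sub>R t' = frechet_derivative ?f (at (?P z)) (fst w *\<^sub>R s + snd w *\<^sub>R t)"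
      unfolding T_def using linv_right[OF st'] by simp
    ultimately show "null_dir u' v' (\<tau> z) (T z w)" if "null_dir u v z w"
      using nd'[OF ran, of "T z w"] nd[OF zs, of w] that null_trans[OF c c' pc, of "fst w *\<^sub>R s + snd w *\<^sub>R t"] p(3) by simp
  qed
  moreover have "\<exists>z\<in>?D. labs u v r z = (x, y) \<and> h' (inv_into W h (x, y)) = labs u' v' r' (\<tau> z)"
    if xy: "(x, y) \<in> bx a b e d" for x y
  proof -
    obtain z where z: "z \<in> sq r" "labs u v r z = (x, y)" using xy bb subr by (metis imageE subsetD)
    then have zD: "z \<in> ?D" using xy by (simp add: label_region_def)
    obtain p where p: "p \<in> W" "h p = labs u v r z" "\<tau> z = ?K' (snd c' p)" using pt[OF zD] by blast
    then have "inv_into W h (x, y) = p" using z grid_chartD(2)[OF g] by (metis inv_into_f_f)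
    then show ?thesis using zD z p h' by auto
  qed
  ultimately show ?thesis by (metis fst_conv snd_conv)
qed

theorem has_euler_null_field: "has_euler (mfd_topology A) {} 0" "hvan (mfd_topology A) {} 2"
proof -
  define GA where "GA = {(W, h). \<exists>c z0 s t u v r L \<delta>. grid_chart A null W h c z0 s t u v r L \<delta>}"
  have gaE: "(W, h) \<in> GA \<Longrightarrow> \<exists>c z0 s t u v r L \<delta>. grid_chart A null W h c z0 s t u v r L \<delta>" for W h
    by (simp add: GA_def)
  interpret grid_atlas "mfd_topology A" GA
  proof
    show "compact_space (mfd_topology A)" by (rule cpt)
    show "Hausdorff_space (mfd_topology A)" using A by (simp add: smooth_manifold_def)
    show "topspace (mfd_topology A) \<subseteq> \<Union>(fst ` GA)"
    proof
      fix p assume "p \<in> topspace (mfd_topology A)"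
      then obtain c where "c \<in> A" "p \<in> fst c" by (auto simp: topspace_mfd_topology[OF atlas] points_def)
      from grid_chart_exists[OF this] obtain W h z0 s t u v r L \<delta> where
        g: "grid_chart A null W h c z0 s t u v r L \<delta>" and "p \<in> W" by blast
      have "(W, h) \<in> GA" unfolding GA_def mem_Collect_eq prod.case by (intro exI) (rule g)
      with \<open>p \<in> W\<close> have "(W, h) \<in> GA" "p \<in> W" by simp_all
      then show "p \<in> \<Union>(fst ` GA)" by force
    qed
  next
    fix W h assume "(W, h) \<in> GA"
    then obtain c z0 s t u v r L \<delta> where g: "grid_chart A null W h c z0 s t u v r L \<delta>" using gaE by blast
    show oW: "openin (mfd_topology A) W" using grid_chartD(4)[OF g] .
    show "open (h ` W)" using grid_chartD(3)[OF g] by simp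
    have WX: "topspace (subtopology (mfd_topology A) W) = W" using openin_subset[OF oW] by auto
    show "homeomorphic_map (subtopology (mfd_topology A) W) (top_of_set (h ` W)) h"
    proof (rule bijective_open_imp_homeomorphic_map)
      show "continuous_map (subtopology (mfd_topology A) W) (top_of_set (h ` W)) h"
        unfolding continuous_map_in_subtopology
      proof
        show "continuous_map (subtopology (mfd_topology A) W) euclidean h"
          unfolding continuous_map_def WX
        proof (intro conjI allI impI)
          fix V :: "(real \<times> real) set" assume "openin euclidean V"
          then have "openin (mfd_topology A) {p \<in> W. h p \<in> V}" using grid_chartD(6)[OF g] by simp
          then show "openin (subtopology (mfd_topology A) W) {p \<in> W. h p \<in> V}"
            by (auto simp: openin_open_subtopology[OF oW])
        qed simp
      qed (simp add: WX)
      show "open_map (subtopology (mfd_topology A) W) (top_of_set (h ` W)) h"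
        unfolding open_map_def
      proof (intro allI impI)
        fix S assume "openin (subtopology (mfd_topology A) W) S"
        then have "openin (mfd_topology A) S" "S \<subseteq> W" by (auto simp: openin_open_subtopology[OF oW])
        then have "open (h ` S)" "h ` S \<subseteq> h ` W" using grid_chartD(5)[OF g] by blast+
        then show "openin (top_of_set (h ` W)) (h ` S)" by (simp add: open_subset)
      qed
    qed (use WX grid_chartD(2)[OF g] in auto)
  next
    fix W h W' h' a b c d
    assume ga: "(W, h) \<in> GA" "(W', h') \<in> GA" and ab: "a < b" "c < d" "bx a b c d \<subseteq> h ` (W \<inter> W')"
    obtain c1 z0 s t u v r L \<delta> where g: "grid_chart A null W h c1 z0 s t u v r L \<delta>" using gaE[OF ga(1)] by blast
    obtain c' z0' s' t' u' v' r' L' \<delta>' where g': "grid_chart A null W' h' c' z0' s' t' u' v' r' L' \<delta>'"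
      using gaE[OF ga(2)] by blast
    show "\<exists>\<alpha> \<beta>. (\<forall>x y. (x, y) \<in> bx a b c d \<longrightarrow> h' (inv_into W h (x, y)) = (\<alpha> x, \<beta> y)) \<or>
            (\<forall>x y. (x, y) \<in> bx a b c d \<longrightarrow> h' (inv_into W h (x, y)) = (\<beta> y, \<alpha> x))"
      by (rule grid_chart_trans[OF g g' ab])
  qed
  show "has_euler (mfd_topology A) {} 0" "hvan (mfd_topology A) {} 2" using has_euler_grid .
qed

end

section \<open>Linear algebra of the two fundamental forms\<close>

section \<open>Pencils of quadratic forms in a Euclidean plane\<close>

definition gm :: "real^3^3 \<Rightarrow> real^3 \<Rightarrow> real^3 \<Rightarrow> real" where
  "gm G u v = u \<bullet> (G *v v)"

definition rows3 :: "real^3 \<Rightarrow> real^3 \<Rightarrow> real^3 \<Rightarrow> real^3^3" where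
  "rows3 a b c = vector [a, b, c]"

definition vol3 :: "real^3 \<Rightarrow> real^3 \<Rightarrow> real^3 \<Rightarrow> real" where
  "vol3 a b c = det (rows3 a b c)"

lemma vol3_expand:
  "vol3 a b c = a $ 1 * b $ 2 * c $ 3 + a $ 2 * b $ 3 * c $ 1 + a $ 3 * b $ 1 * c $ 2
     - a $ 1 * b $ 3 * c $ 2 - a $ 2 * b $ 1 * c $ 3 - a $ 3 * b $ 2 * c $ 1"
  by (simp add: vol3_def rows3_def det_3 vector_3)

lemma llip_vol3:
  fixes a b n :: "'e::metric_space \<Rightarrow> real^3"
  assumes "\<And>k. llip (\<lambda>z. a z $ k) z" "\<And>k. llip (\<lambda>z. b z $ k) z" "\<And>k. llip (\<lambda>z. n z $ k) z"
  shows "llip (\<lambda>z. vol3 (a z) (b z) (n z)) z"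
  unfolding vol3_expand by (intro llip_diff llip_add llip_mult assms)

text \<open>In the application \<open>a\<close>, \<open>b\<close> and \<open>u\<close>,
  \<open>v\<close> come from a coordinate basis by \<phi> and \<psi>, and \<open>x\<close>,
  \<open>y\<close> are the components of a tangent vector: this is the form whose zeros are the
  principal directions.\<close>

lemma vol3_lincomb:
  "vol3 (x *\<^sub>R a + y *\<^sub>R b) (x *\<^sub>R u + y *\<^sub>R v) n
    = qform (vol3 a u n) ((vol3 a v n + vol3 b u n) / 2) (vol3 b v n) (vector [x, y])"
  by (simp add: vol3_expand qform_def power2_eq_square field_simps vector_2)

text \<open>A Pluecker relation: for fixed \<open>n\<close> the volume is an alternating form on the
  plane obtained by dividing out \<open>n\<close>.\<close>

lemma vol3_pluecker: "vol3 a b n * vol3 c d n - vol3 a c n * vol3 b d n + vol3 a d n * vol3 b c n = 0"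
  by (simp add: vol3_expand algebra_simps)

lemma gm_bilinear:
  "gm G (x *\<^sub>R u + y *\<^sub>R v) w = x * gm G u w + y * gm G v w"
  "gm G w (x *\<^sub>R u + y *\<^sub>R v) = x * gm G w u + y * gm G w v"
  by (simp_all add: gm_def inner_add_left inner_add_right matrix_vector_right_distrib matrix_vector_mult_scaleR)

locale pos_matrix =
  fixes G :: "real^3^3"
  assumes sym: "gm G u v = gm G v u" and pos: "u \<noteq> 0 \<Longrightarrow> gm G u u > 0"
begin

lemma gm_zero [simp]: "gm G 0 v = 0" "gm G v 0 = 0"
  by (simp_all add: gm_def)

lemma gm_nonneg: "gm G u u \<ge> 0"
  using pos[of u] by (cases "u = 0") auto

lemma gm_eq_0: "gm G u u = 0 \<longleftrightarrow> u = 0"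
  using pos[of u] by (cases "u = 0") auto

lemma det_nonzero: "det G \<noteq> 0"
proof
  assume "det G = 0"
  then have "\<not> invertible G" by (simp add: invertible_det_nz)
  then obtain x where "x \<noteq> 0" "G *v x = 0" by (metis invertible_left_inverse matrix_left_invertible_ker)
  then have "gm G x x = 0" by (simp add: gm_def)
  then show False using \<open>x \<noteq> 0\<close> gm_eq_0 by simp
qed

abbreviation gram2 :: "real^3 \<Rightarrow> real^3 \<Rightarrow> real^3 \<Rightarrow> real^3 \<Rightarrow> real" where
  "gram2 u v u' v' \<equiv> gm G u u' * gm G v v' - gm G u v' * gm G v u'"

lemma rows3_mult: "rows3 u v n ** G = rows3 (G *v u) (G *v v) (G *v n)"
proof -
  have s: "G $ i $ j = G $ j $ i" for i j
  proof -
    have e: "gm G (axis i 1) (axis j 1) = G $ i $ j" for i j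
      by (simp add: gm_def inner_axis' matrix_vector_mul_component inner_axis)
    show ?thesis using sym[of "axis i 1" "axis j 1"] by (simp add: e)
  qed
  have "(rows3 u v n ** G) $ i $ j = rows3 (G *v u) (G *v v) (G *v n) $ i $ j" for i j
    using exhaust_3[of i]
    by (auto simp: rows3_def matrix_matrix_mult_def matrix_vector_mult_def vector_3 s[of _ j] mult.commute intro!: sum.cong)
  then show ?thesis by (simp add: vec_eq_iff)
qed

text \<open>The product of the matrices of the two triples is a Gram matrix from which
  \<open>n\<close>, a unit vector orthogonal to the others, splits off. The factor
  \<open>det G\<close> comes from lowering the second triple.\<close>

lemma vol3_gram:
  assumes n: "gm G n n = 1" and o: "gm G u n = 0" "gm G v n = 0" "gm G u' n = 0" "gm G v' n = 0"
  shows "vol3 (G *v u) (G *v v) (G *v n) * vol3 (G *v u') (G *v v') (G *v n) = det G * gram2 u v u' v'"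
proof -
  have vol: "vol3 (G *v a) (G *v b) (G *v n) = vol3 a b n * det G" for a b
    unfolding vol3_def rows3_mult[symmetric] by (rule det_mul)
  let ?P = "rows3 (G *v u) (G *v v) (G *v n) ** transpose (rows3 u' v' n)"
  have ent: "(rows3 a b c ** transpose (rows3 a' b' c')) $ i $ j = rows3 a b c $ i \<bullet> rows3 a' b' c' $ j" for a b c a' b' c' i j
    by (simp add: matrix_matrix_mult_def transpose_def inner_vec_def)
  have g: "(G *v a) \<bullet> b = gm G b a" for a b by (simp add: gm_def inner_commute)
  have "det ?P = gram2 u v u' v'"
    unfolding det_3 ent using n o sym[of n u'] sym[of n v']
    by (simp add: rows3_def vector_3 g sym[of u' u] sym[of v' u] sym[of u' v] sym[of v' v] sym[of n u] sym[of n v])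
  moreover have "det ?P = vol3 (G *v u) (G *v v) (G *v n) * vol3 u' v' n"
    by (simp add: det_mul det_transpose vol3_def)
  ultimately have A: "vol3 (G *v u) (G *v v) (G *v n) * vol3 u' v' n = gram2 u v u' v'" by simp
  show ?thesis unfolding vol[of u' v'] A[symmetric] by (simp only: mult_ac)
qed

lemma gram2_nonneg: "gram2 u v u v \<ge> 0"
proof (cases "u = 0")
  case False
  have a: "gm G u u > 0" using pos False by blast
  let ?w = "gm G u u *\<^sub>R v + (- gm G u v) *\<^sub>R u"
  have "gm G ?w ?w = gm G u u * gram2 u v u v"
    unfolding gm_bilinear sym[of v u] by (simp add: algebra_simps)
  then show ?thesis using gm_nonneg[of ?w] a by (simp add: zero_le_mult_iff sym[of v u])
qed simp

lemma gram2_eq_0: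
  assumes "gram2 u v u v = 0"
  obtains x y where "x \<noteq> 0 \<or> y \<noteq> 0" "x *\<^sub>R u + y *\<^sub>R v = 0"
proof (cases "u = 0")
  case True
  then show ?thesis using that[of 1 0] by simp
next
  case False
  have a: "gm G u u > 0" using pos False by blast
  let ?w = "(- gm G u v) *\<^sub>R u + gm G u u *\<^sub>R v"
  have "gm G ?w ?w = gm G u u * gram2 u v u v"
    unfolding gm_bilinear sym[of v u] by (simp add: algebra_simps)
  then have "?w = 0" using assms gm_eq_0 by simp
  then show ?thesis using that[of "- gm G u v" "gm G u u"] a by simp
qed

text \<open>Both vectors lie in the plane orthogonal to \<open>n\<close>, so their volume with
  \<open>n\<close> vanishes exactly when the Gram determinant does, the equality case of the
  Cauchy-Schwarz inequality.\<close>

lemma dependent_iff_vol3: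
  assumes n: "gm G n n = 1" and o: "gm G u n = 0" "gm G v n = 0"
  shows "(\<exists>x y. (x \<noteq> 0 \<or> y \<noteq> 0) \<and> x *\<^sub>R u + y *\<^sub>R v = 0) \<longleftrightarrow> vol3 (G *v u) (G *v v) (G *v n) = 0"
proof
  assume "vol3 (G *v u) (G *v v) (G *v n) = 0"
  then have "gram2 u v u v = 0" using vol3_gram[OF n o o] det_nonzero by simp
  then show "\<exists>x y. (x \<noteq> 0 \<or> y \<noteq> 0) \<and> x *\<^sub>R u + y *\<^sub>R v = 0" using gram2_eq_0 by metis
next
  assume "\<exists>x y. (x \<noteq> 0 \<or> y \<noteq> 0) \<and> x *\<^sub>R u + y *\<^sub>R v = 0"
  then obtain x y where xy: "x \<noteq> 0 \<or> y \<noteq> 0" "x *\<^sub>R u + y *\<^sub>R v = 0" by blast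
  have "x * gm G u u + y * gm G v u = 0" "x * gm G u v + y * gm G v v = 0"
    using gm_bilinear(1)[of G x u y v u] gm_bilinear(1)[of G x u y v v] xy(2) by simp_all
  then have e: "x * gm G u u + y * gm G u v = 0" "x * gm G u v + y * gm G v v = 0" by (simp_all add: sym[of v u])
  have "x * gram2 u v u v = (x * gm G u u + y * gm G u v) * gm G v v - (x * gm G u v + y * gm G v v) * gm G u v"
    "y * gram2 u v u v = (x * gm G u v + y * gm G v v) * gm G u u - (x * gm G u u + y * gm G u v) * gm G u v"
    by (simp_all add: algebra_simps sym[of v u])
  then have "x * gram2 u v u v = 0" "y * gram2 u v u v = 0" unfolding e by simp_all
  then have "gram2 u v u v = 0" using xy(1) by auto
  then have "vol3 (G *v u) (G *v v) (G *v n) * vol3 (G *v u) (G *v v) (G *v n) = 0"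
    using vol3_gram[OF n o o] by simp
  then show "vol3 (G *v u) (G *v v) (G *v n) = 0" by simp
qed

text \<open>In the first case the Pluecker relation rewrites the discriminant as a square minus
  \<open>W p1 p2 * W q1 q2\<close>, and this product is negative. In the second case both pairs are
  dependent. The first kernel vector is then a zero of the form, and its mixed value with the second
  one is half of \<open>W u v\<close>, which is not 0 because \<open>u\<close> and \<open>v\<close>
  are nonzero and orthogonal.\<close>

lemma pencil_indefinite:
  fixes p1 p2 q1 q2 n :: "real^3"
  defines "W a b \<equiv> vol3 (G *v a) (G *v b) (G *v n)"
  assumes n: "gm G n n = 1" and o: "gm G p1 n = 0" "gm G p2 n = 0" "gm G q1 n = 0" "gm G q2 n = 0"
    and S: "gm G p1 q2 = gm G p2 q1"
    and ker: "\<And>x y. x *\<^sub>R p1 + y *\<^sub>R p2 = 0 \<Longrightarrow> x *\<^sub>R q1 + y *\<^sub>R q2 = 0 \<Longrightarrow> x = 0 \<and> y = 0"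
    and neg: "gram2 p1 p2 q1 q2 < 0 \<or> gram2 p1 p2 p1 p2 = 0 \<and> gram2 q1 q2 q1 q2 = 0"
  shows "((W p1 q2 + W p2 q1) / 2)\<^sup>2 - W p1 q1 * W p2 q2 > 0"
  using neg
proof
  assume neg: "gram2 p1 p2 q1 q2 < 0"
  have pp: "W p1 p2 * W p1 p2 = det G * gram2 p1 p2 p1 p2" and qq: "W q1 q2 * W q1 q2 = det G * gram2 q1 q2 q1 q2"
    and pq: "W p1 p2 * W q1 q2 = det G * gram2 p1 p2 q1 q2"
    using vol3_gram[OF n] o by (simp_all add: W_def)
  have "W p1 p2 \<noteq> 0" using pq neg det_nonzero by auto
  then have "det G * gram2 p1 p2 p1 p2 > 0" unfolding pp[symmetric] by (auto simp: zero_less_mult_iff linorder_neq_iff)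
  then have "det G > 0" using gram2_nonneg[of p1 p2] by (simp add: zero_less_mult_iff)
  then have "W p1 p2 * W q1 q2 < 0" unfolding pq using neg by (simp add: mult_pos_neg)
  moreover have "((W p1 q2 + W p2 q1) / 2)\<^sup>2 - W p1 q1 * W p2 q2
      = ((W p1 q2 - W p2 q1) / 2)\<^sup>2 - W p1 p2 * W q1 q2"
    using vol3_pluecker[of "G *v p1" "G *v p2" "G *v n" "G *v q1" "G *v q2"]
    unfolding W_def by (simp add: power2_eq_square field_simps)
  moreover have "((W p1 q2 - W p2 q1) / 2)\<^sup>2 \<ge> 0" by simp
  ultimately show ?thesis by linarith
next
  assume z: "gram2 p1 p2 p1 p2 = 0 \<and> gram2 q1 q2 q1 q2 = 0"
  obtain x1 x2 where x: "x1 \<noteq> 0 \<or> x2 \<noteq> 0" "x1 *\<^sub>R p1 + x2 *\<^sub>R p2 = 0" using gram2_eq_0 z by metis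
  obtain y1 y2 where y: "y1 \<noteq> 0 \<or> y2 \<noteq> 0" "y1 *\<^sub>R q1 + y2 *\<^sub>R q2 = 0" using gram2_eq_0 z by metis
  define u where "u = y1 *\<^sub>R p1 + y2 *\<^sub>R p2"
  define v where "v = x1 *\<^sub>R q1 + x2 *\<^sub>R q2"
  have "u \<noteq> 0" using ker[of y1 y2] y by (auto simp: u_def)
  moreover have "v \<noteq> 0" using ker[of x1 x2] x by (auto simp: v_def)
  \<comment> \<open>The symmetry \<open>S\<close> allows the coefficients to be moved to the other
    side, where \<open>x1\<close>, \<open>x2\<close> annihilate the first factor.\<close>
  moreover have uv: "gm G u v = 0"
  proof -
    have "gm G u v = gm G (x1 *\<^sub>R p1 + x2 *\<^sub>R p2) (y1 *\<^sub>R q1 + y2 *\<^sub>R q2)"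
      unfolding u_def v_def gm_bilinear using S by (simp add: algebra_simps)
    then show ?thesis using x by simp
  qed
  ultimately have "gram2 u v u v \<noteq> 0" using gm_eq_0 by simp
  moreover have "gm G u n = 0" "gm G v n = 0" using o by (simp_all add: u_def v_def gm_bilinear)
  ultimately have Wuv: "W u v \<noteq> 0"
    using vol3_gram[OF n, of u v u v] det_nonzero unfolding W_def by (metis mult_eq_0_iff)
  define X where "X = (vector [x1, x2] :: real^2)"
  define Y where "Y = (vector [y1, y2] :: real^2)"
  let ?b = "(W p1 q2 + W p2 q1) / 2"
  have bil: "W (s *\<^sub>R p1 + t *\<^sub>R p2) (s' *\<^sub>R q1 + t' *\<^sub>R q2)
      = s * s' * W p1 q1 + s * t' * W p1 q2 + t * s' * W p2 q1 + t * t' * W p2 q2" for s t s' t'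
    unfolding W_def by (simp add: vol3_expand matrix_vector_right_distrib matrix_vector_mult_scaleR algebra_simps)
  have W0: "W 0 b = 0" "W a 0 = 0" for a b by (simp_all add: W_def vol3_expand)
  have qX: "qform (W p1 q1) ?b (W p2 q2) X = 0"
  proof -
    have "qform (W p1 q1) ?b (W p2 q2) X = W (x1 *\<^sub>R p1 + x2 *\<^sub>R p2) (x1 *\<^sub>R q1 + x2 *\<^sub>R q2)"
      unfolding bil by (simp add: qform_def X_def vector_2 power2_eq_square field_simps)
    then show ?thesis using x W0 by simp
  qed
  have bXY: "2 * bform (W p1 q1) ?b (W p2 q2) X Y = W u v"
  proof -
    have "2 * bform (W p1 q1) ?b (W p2 q2) X Y
        = W (x1 *\<^sub>R p1 + x2 *\<^sub>R p2) (y1 *\<^sub>R q1 + y2 *\<^sub>R q2) + W (y1 *\<^sub>R p1 + y2 *\<^sub>R p2) (x1 *\<^sub>R q1 + x2 *\<^sub>R q2)"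
      unfolding bil by (simp add: bform_def X_def Y_def vector_2 field_simps)
    then show ?thesis using x W0 by (simp add: u_def v_def)
  qed
  have "bform (W p1 q1) ?b (W p2 q2) X Y \<noteq> 0" using bXY Wuv by auto
  then have "0 < (bform (W p1 q1) ?b (W p2 q2) X Y)\<^sup>2" by simp
  also have "\<dots> = (?b\<^sup>2 - W p1 q1 * W p2 q2) * (det2 X Y)\<^sup>2"
    using bform_square[of "W p1 q1" ?b "W p2 q2" X Y] qX by simp
  finally show ?thesis by (simp add: zero_less_mult_iff)
qed

end

section \<open>Riemannian geometry in charts: second derivatives, Christoffel symbols, derivatives
  of the normal\<close>

section \<open>Symmetry of second derivatives\<close>

text \<open>The second difference of \<open>f\<close> over a small parallelogram equals
  \<open>h * h\<close> times a mixed derivative at one of its points, for either order of the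
  directions, by the mean value theorem applied twice.\<close>

lemma second_derivative_symmetric_real:
  fixes f :: "'a::real_normed_vector \<Rightarrow> real"
  assumes S: "open S" "x \<in> S"
    and D: "\<And>y. y \<in> S \<Longrightarrow> (f has_derivative D y) (at y)"
    and E: "\<And>y v. y \<in> S \<Longrightarrow> ((\<lambda>y. D y v) has_derivative E y v) (at y)"
    and cont: "\<And>v w. continuous_on S (\<lambda>y. E y v w)"
  shows "E x u v = E x v u"
proof (rule ccontr)
  assume ne: "E x u v \<noteq> E x v u"
  define \<epsilon> where "\<epsilon> = \<bar>E x u v - E x v u\<bar> / 2"
  have \<epsilon>: "\<epsilon> > 0" using ne by (simp add: \<epsilon>_def)
  have iso: "isCont (\<lambda>y. E y a b) x" for a b
    using cont[of a b] S continuous_on_eq_continuous_at by blast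
  obtain d1 where d1: "d1 > 0" "\<And>y. dist y x < d1 \<Longrightarrow> dist (E y u v) (E x u v) < \<epsilon>"
    using iso[of u v] \<epsilon> unfolding continuous_at_eps_delta by blast
  obtain d2 where d2: "d2 > 0" "\<And>y. dist y x < d2 \<Longrightarrow> dist (E y v u) (E x v u) < \<epsilon>"
    using iso[of v u] \<epsilon> unfolding continuous_at_eps_delta by blast
  obtain d3 where d3: "d3 > 0" "ball x d3 \<subseteq> S" using S open_contains_ball by blast
  define d where "d = min d1 (min d2 d3)"
  have d: "d > 0" "d \<le> d1" "d \<le> d2" "d \<le> d3" using d1 d2 d3 by (auto simp: d_def)
  \<comment> \<open>With this choice the parallelogram spanned by \<open>h *\<^sub>R u\<close> and
    \<open>h *\<^sub>R v\<close> at \<open>x\<close> lies in the ball of radius \<open>d\<close>;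
    the summand 1 covers zero vectors.\<close>
  define h where "h = d / (norm u + norm v + 1)"
  have nuv: "norm u + norm v + 1 > 0" by (simp add: add_nonneg_pos)
  have h: "h > 0" using d nuv by (simp add: h_def)
  have near: "dist (x + s *\<^sub>R a + t *\<^sub>R b) x < d" if "0 \<le> s" "s \<le> h" "0 \<le> t" "t \<le> h" "{a, b} = {u, v}" for s t a b
  proof -
    have "dist (x + s *\<^sub>R a + t *\<^sub>R b) x = norm (s *\<^sub>R a + t *\<^sub>R b)" by (simp add: dist_norm add.assoc)
    also have "\<dots> \<le> s * norm a + t * norm b"
      using norm_triangle_ineq[of "s *\<^sub>R a" "t *\<^sub>R b"] that by simp
    also have "\<dots> \<le> h * norm a + h * norm b" using that by (intro add_mono mult_right_mono) auto
    also have "\<dots> = h * (norm u + norm v)" using that(5) by (auto simp: doubleton_eq_iff algebra_simps)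
    also have "\<dots> < h * (norm u + norm v + 1)" using h by simp
    also have "\<dots> = d" using nuv by (simp add: h_def)
    finally show ?thesis .
  qed
  have main: "\<exists>y. dist y x < d \<and> f (x + h *\<^sub>R a + h *\<^sub>R b) - f (x + h *\<^sub>R a) - f (x + h *\<^sub>R b) + f x = h * h * E y a b"
    if ab: "{a, b} = {u, v}" for a b
  proof -
    have inS: "x + s *\<^sub>R a + t *\<^sub>R b \<in> S" if "0 \<le> s" "s \<le> h" "0 \<le> t" "t \<le> h" for s t
    proof -
      have "x + s *\<^sub>R a + t *\<^sub>R b \<in> ball x d3" using near[OF that ab] d by (simp add: dist_commute)
      then show ?thesis using d3 by blast
    qed
    define \<phi> where "\<phi> s = f (x + s *\<^sub>R a + h *\<^sub>R b) - f (x + s *\<^sub>R a)" for s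
    have line: "((\<lambda>s. f (x + s *\<^sub>R a + t *\<^sub>R b)) has_real_derivative D (x + s *\<^sub>R a + t *\<^sub>R b) a) (at s)"
      if "0 \<le> s" "s \<le> h" "0 \<le> t" "t \<le> h" for s t
    proof -
      have "((\<lambda>s. x + s *\<^sub>R a + t *\<^sub>R b) has_derivative (\<lambda>r. r *\<^sub>R a)) (at s)"
        by (auto intro!: derivative_eq_intros)
      from has_derivative_compose[OF this D[OF inS[OF that]]]
      have "((\<lambda>s. f (x + s *\<^sub>R a + t *\<^sub>R b)) has_derivative (\<lambda>r. D (x + s *\<^sub>R a + t *\<^sub>R b) (r *\<^sub>R a))) (at s)" .
      moreover have "D (x + s *\<^sub>R a + t *\<^sub>R b) (r *\<^sub>R a) = D (x + s *\<^sub>R a + t *\<^sub>R b) a * r" for r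
        using linear_cmul[OF has_derivative_linear[OF D[OF inS[OF that]]], of r a] by simp
      ultimately show ?thesis by (simp add: has_field_derivative_def)
    qed
    have "\<exists>s>0. s < h \<and> \<phi> h - \<phi> 0 = (h - 0) * (D (x + s *\<^sub>R a + h *\<^sub>R b) a - D (x + s *\<^sub>R a) a)"
    proof (rule MVT2[OF h])
      fix s assume "0 \<le> s" "s \<le> h"
      then show "(\<phi> has_real_derivative D (x + s *\<^sub>R a + h *\<^sub>R b) a - D (x + s *\<^sub>R a) a) (at s)"
        unfolding \<phi>_def using line[of s h] line[of s 0] h by (auto intro!: derivative_eq_intros)
    qed
    then obtain s where s: "0 < s" "s < h"
      "\<phi> h - \<phi> 0 = h * (D (x + s *\<^sub>R a + h *\<^sub>R b) a - D (x + s *\<^sub>R a) a)" by auto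
    have "\<exists>t>0. t < h \<and> D (x + s *\<^sub>R a + h *\<^sub>R b) a - D (x + s *\<^sub>R a + 0 *\<^sub>R b) a = (h - 0) * E (x + s *\<^sub>R a + t *\<^sub>R b) a b"
    proof (rule MVT2[OF h])
      fix t assume t: "0 \<le> t" "t \<le> h"
      have st: "x + s *\<^sub>R a + t *\<^sub>R b \<in> S" using inS[of s t] s t by auto
      have "((\<lambda>t. x + s *\<^sub>R a + t *\<^sub>R b) has_derivative (\<lambda>r. r *\<^sub>R b)) (at t)"
        by (auto intro!: derivative_eq_intros)
      from has_derivative_compose[OF this E[OF st, of a]]
      have "((\<lambda>t. D (x + s *\<^sub>R a + t *\<^sub>R b) a) has_derivative (\<lambda>r. E (x + s *\<^sub>R a + t *\<^sub>R b) a (r *\<^sub>R b))) (at t)" .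
      moreover have "E (x + s *\<^sub>R a + t *\<^sub>R b) a (r *\<^sub>R b) = E (x + s *\<^sub>R a + t *\<^sub>R b) a b * r" for r
        using linear_cmul[OF has_derivative_linear[OF E[OF st, of a]], of r b] by simp
      ultimately show "((\<lambda>t. D (x + s *\<^sub>R a + t *\<^sub>R b) a) has_real_derivative E (x + s *\<^sub>R a + t *\<^sub>R b) a b) (at t)"
        by (simp add: has_field_derivative_def)
    qed
    then obtain t where t: "0 < t" "t < h"
      "D (x + s *\<^sub>R a + h *\<^sub>R b) a - D (x + s *\<^sub>R a) a = h * E (x + s *\<^sub>R a + t *\<^sub>R b) a b" by auto
    have "\<phi> h - \<phi> 0 = h * h * E (x + s *\<^sub>R a + t *\<^sub>R b) a b" using s(3) t(3) by simp
    moreover have "dist (x + s *\<^sub>R a + t *\<^sub>R b) x < d" using near[OF _ _ _ _ ab] s t by simp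
    ultimately show ?thesis by (intro exI[of _ "x + s *\<^sub>R a + t *\<^sub>R b"]) (simp add: \<phi>_def)
  qed
  obtain y where y: "dist y x < d" "f (x + h *\<^sub>R u + h *\<^sub>R v) - f (x + h *\<^sub>R u) - f (x + h *\<^sub>R v) + f x = h * h * E y u v"
    using main[of u v] by auto
  obtain z where z: "dist z x < d" "f (x + h *\<^sub>R v + h *\<^sub>R u) - f (x + h *\<^sub>R v) - f (x + h *\<^sub>R u) + f x = h * h * E z v u"
    using main[of v u] by auto
  have eq: "x + h *\<^sub>R v + h *\<^sub>R u = x + h *\<^sub>R u + h *\<^sub>R v" by simp
  have "h * h * E y u v = f (x + h *\<^sub>R u + h *\<^sub>R v) - f (x + h *\<^sub>R u) - f (x + h *\<^sub>R v) + f x"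
    by (rule y(2)[symmetric])
  also have "\<dots> = f (x + h *\<^sub>R u + h *\<^sub>R v) - f (x + h *\<^sub>R v) - f (x + h *\<^sub>R u) + f x" by simp
  also have "\<dots> = h * h * E z v u" using z(2) unfolding eq .
  finally have "h * h * E y u v = h * h * E z v u" .
  then have "E y u v = E z v u" using h by simp
  moreover have "\<bar>E y u v - E x u v\<bar> < \<epsilon>" "\<bar>E z v u - E x v u\<bar> < \<epsilon>"
    using d1(2)[of y] d2(2)[of z] y z d by (auto simp: dist_real_def)
  moreover have "\<bar>E x u v - E x v u\<bar> \<le> \<bar>E y u v - E x u v\<bar> + \<bar>E y u v - E x v u\<bar>"
    using abs_triangle_ineq4[of "E y u v - E x v u" "E y u v - E x u v"] by simp
  moreover have False if "p < r / 2" "q < r / 2" "r \<le> p + q" for p q r :: real using that by linarith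
  ultimately show False unfolding \<epsilon>_def by metis
qed

lemma smooth_second_derivative_symmetric:
  fixes f :: "'a::real_normed_vector \<Rightarrow> 'b::euclidean_space"
  assumes f: "smooth_on S f" and S: "open S" "x \<in> S"
  shows "frechet_derivative (\<lambda>y. frechet_derivative f (at y) u) (at x) v
       = frechet_derivative (\<lambda>y. frechet_derivative f (at y) v) (at x) u"
proof (rule euclidean_eqI)
  fix b :: 'b
  let ?D = "\<lambda>y w. frechet_derivative f (at y) w"
  let ?E = "\<lambda>y w. frechet_derivative (\<lambda>y. ?D y w) (at y)"
  show "?E x u v \<bullet> b = ?E x v u \<bullet> b"
  proof (rule second_derivative_symmetric_real[OF S, of "\<lambda>y. f y \<bullet> b" "\<lambda>y w. ?D y w \<bullet> b" "\<lambda>y w w'. ?E y w w' \<bullet> b"])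
    fix y w assume y: "y \<in> S"
    show "((\<lambda>y. f y \<bullet> b) has_derivative (\<lambda>w. ?D y w \<bullet> b)) (at y)"
      by (rule has_derivative_inner_left[OF smooth_on_has_derivative[OF f S(1) y]])
    show "((\<lambda>y. ?D y w \<bullet> b) has_derivative (\<lambda>w'. ?E y w w' \<bullet> b)) (at y)"
      by (rule has_derivative_inner_left[OF smooth_on_has_derivative[OF smooth_on_frechet[OF f] S(1) y]])
  next
    fix w w'
    show "continuous_on S (\<lambda>y. ?E y w w' \<bullet> b)"
      by (intro continuous_on_inner continuous_on_const smooth_on_continuous[OF smooth_on_frechet[OF smooth_on_frechet[OF f]]])
  qed
qed

section \<open>The metric and its Levi-Civita connection in charts\<close>

lemma linear_axis_expand:
  fixes h :: "real^'n \<Rightarrow> 'b::real_vector"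
  assumes "linear h"
  shows "h x = (\<Sum>i\<in>UNIV. x $ i *\<^sub>R h (axis i 1))"
proof -
  have "h x = h (\<Sum>i\<in>UNIV. x $ i *\<^sub>R axis i 1)"
    using basis_expansion[of x] by (simp add: scalar_mult_eq_scaleR)
  then show ?thesis by (simp add: linear_sum[OF assms] linear_cmul[OF assms])
qed

lemma has_derivative_frechet_eq: "(h has_derivative h') (at x) \<Longrightarrow> frechet_derivative h (at x) = h'"
  by (rule frechet_derivative_at[symmetric])

locale riemannian_atlas =
  fixes B :: "('b, real^3) chart set" and g :: "('b, real^3) metric"
  assumes B: "smooth_atlas B" and g: "riemannian_metric B g"
begin

abbreviation mc :: "('b, real^3) chart \<Rightarrow> real^3 \<Rightarrow> real^3 \<Rightarrow> real^3 \<Rightarrow> real" where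
  "mc \<equiv> metric_coord B g"

abbreviation dom :: "('b, real^3) chart \<Rightarrow> (real^3) set" where
  "dom d \<equiv> snd d ` fst d"

definition dm :: "('b, real^3) chart \<Rightarrow> real^3 \<Rightarrow> real^3 \<Rightarrow> real^3 \<Rightarrow> real^3 \<Rightarrow> real" where
  "dm d y a u v = frechet_derivative (\<lambda>y. mc d y u v) (at y) a"

text \<open>Christoffel symbols of the first kind; unlike \<open>christoffel\<close> they need no inverse matrix.\<close>

definition chr1 :: "('b, real^3) chart \<Rightarrow> real^3 \<Rightarrow> real^3 \<Rightarrow> real^3 \<Rightarrow> real^3 \<Rightarrow> real" where
  "chr1 d y a b w = (dm d y a b w + dm d y b a w - dm d y w a b) / 2"

definition chr :: "('b, real^3) chart \<Rightarrow> real^3 \<Rightarrow> real^3 \<Rightarrow> real^3 \<Rightarrow> real^3" where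
  "chr d y a b = (\<chi> k. \<Sum>i\<in>UNIV. \<Sum>j\<in>UNIV. christoffel B g d k i j y * a $ i * b $ j)"

lemma open_dom: "d \<in> B \<Longrightarrow> open (dom d)"
  using smooth_atlasD(2)[OF B] by blast

lemma mc_smooth: "d \<in> B \<Longrightarrow> smooth_on (dom d) (\<lambda>y. mc d y u v)"
  using g by (simp add: riemannian_metric_def)

lemma mc_bilinear: "d \<in> B \<Longrightarrow> y \<in> dom d \<Longrightarrow> bilinear (mc d y)"
  using g unfolding riemannian_metric_def by blast

lemma mc_sym: "d \<in> B \<Longrightarrow> y \<in> dom d \<Longrightarrow> mc d y u v = mc d y v u"
  using g unfolding riemannian_metric_def by blast

lemma mc_pos: "d \<in> B \<Longrightarrow> y \<in> dom d \<Longrightarrow> u \<noteq> 0 \<Longrightarrow> mc d y u u > 0"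
  using g unfolding riemannian_metric_def by blast

lemma mc_linear:
  assumes "d \<in> B" "y \<in> dom d"
  shows "linear (\<lambda>u. mc d y u v)" "linear (mc d y u)"
  using mc_bilinear[OF assms] by (auto simp: bilinear_def)

lemma mc_expand:
  assumes "d \<in> B" "y \<in> dom d"
  shows "mc d y u v = (\<Sum>i\<in>UNIV. \<Sum>j\<in>UNIV. u $ i * v $ j * mc d y (axis i 1) (axis j 1))"
proof -
  have "mc d y u v = (\<Sum>i\<in>UNIV. u $ i *\<^sub>R mc d y (axis i 1) v)"
    by (rule linear_axis_expand[OF mc_linear(1)[OF assms]])
  also have "\<dots> = (\<Sum>i\<in>UNIV. \<Sum>j\<in>UNIV. u $ i * v $ j * mc d y (axis i 1) (axis j 1))"
    by (subst linear_axis_expand[OF mc_linear(2)[OF assms], of _ v])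
       (simp add: sum_distrib_left mult.assoc)
  finally show ?thesis .
qed

lemma mc_gm:
  assumes "d \<in> B" "y \<in> dom d"
  shows "gm (metric_matrix B g d y) u v = mc d y u v"
proof -
  have "gm (metric_matrix B g d y) u v
      = (\<Sum>i\<in>UNIV. u $ i * (\<Sum>j\<in>UNIV. mc d y (axis i 1) (axis j 1) * v $ j))"
    by (simp add: gm_def inner_vec_def matrix_vector_mult_def metric_matrix_def)
  also have "\<dots> = (\<Sum>i\<in>UNIV. \<Sum>j\<in>UNIV. u $ i * v $ j * mc d y (axis i 1) (axis j 1))"
    by (simp add: sum_distrib_left mult_ac)
  finally show ?thesis by (simp only: mc_expand[OF assms, of u v])
qed

lemma pos_metric_matrix:
  assumes "d \<in> B" "y \<in> dom d"
  shows "pos_matrix (metric_matrix B g d y)"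
proof
  show "gm (metric_matrix B g d y) u v = gm (metric_matrix B g d y) v u" for u v
    unfolding mc_gm[OF assms] by (rule mc_sym[OF assms])
  show "gm (metric_matrix B g d y) u u > 0" if "u \<noteq> 0" for u
    unfolding mc_gm[OF assms] by (rule mc_pos[OF assms that])
qed

lemma mc_derivative:
  assumes "d \<in> B" "y \<in> dom d"
  shows "((\<lambda>y. mc d y u v) has_derivative (\<lambda>a. dm d y a u v)) (at y)"
  unfolding dm_def by (rule smooth_on_has_derivative[OF mc_smooth open_dom]) (use assms in auto)

lemma dm_linear1: "d \<in> B \<Longrightarrow> y \<in> dom d \<Longrightarrow> linear (\<lambda>a. dm d y a u v)"
  using mc_derivative has_derivative_linear by blast

lemma dm_eqI:
  assumes d: "d \<in> B" "y \<in> dom d" and h: "(h has_derivative h') (at y)" and eq: "\<And>y. y \<in> dom d \<Longrightarrow> h y = mc d y u v"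
  shows "dm d y a u v = h' a"
proof -
  have "((\<lambda>y. mc d y u v) has_derivative h') (at y)"
    by (rule has_derivative_transform_within_open[OF h open_dom[OF d(1)] d(2)]) (rule eq)
  then show ?thesis using mc_derivative[OF d] has_derivative_unique by metis
qed

lemma dm_sym: "d \<in> B \<Longrightarrow> y \<in> dom d \<Longrightarrow> dm d y a u v = dm d y a v u"
  by (rule dm_eqI[OF _ _ mc_derivative]) (auto intro: mc_sym)

lemma dm_linear2:
  assumes d: "d \<in> B" "y \<in> dom d"
  shows "linear (\<lambda>u. dm d y a u v)"
proof (rule linearI)
  show "dm d y a (u + u') v = dm d y a u v + dm d y a u' v" for u u'
    by (rule dm_eqI[OF d has_derivative_add[OF mc_derivative[OF d] mc_derivative[OF d]]])
       (simp add: linear_add[OF mc_linear(1)[OF d(1)]])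
  show "dm d y a (c *\<^sub>R u) v = c *\<^sub>R dm d y a u v" for c u
    by (rule dm_eqI[OF d has_derivative_scaleR_right[OF mc_derivative[OF d]]])
       (simp add: linear_cmul[OF mc_linear(1)[OF d(1)]])
qed

lemma dm_linear3: "d \<in> B \<Longrightarrow> y \<in> dom d \<Longrightarrow> linear (dm d y a u)"
  using dm_linear2[of d y a u] dm_sym[of d y a] by (simp add: linear_iff)

lemma dm_expand23:
  assumes d: "d \<in> B" "y \<in> dom d"
  shows "dm d y a u v = (\<Sum>i\<in>UNIV. \<Sum>j\<in>UNIV. u $ i * v $ j * dm d y a (axis i 1) (axis j 1))"
proof -
  have "dm d y a u v = (\<Sum>i\<in>UNIV. u $ i *\<^sub>R dm d y a (axis i 1) v)"
    by (rule linear_axis_expand[OF dm_linear2[OF d]])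
  also have "\<dots> = (\<Sum>i\<in>UNIV. \<Sum>j\<in>UNIV. u $ i * v $ j * dm d y a (axis i 1) (axis j 1))"
    by (subst linear_axis_expand[OF dm_linear3[OF d], of _ _ v]) (simp add: sum_distrib_left mult.assoc)
  finally show ?thesis .
qed

lemma chr1_linear:
  assumes d: "d \<in> B" "y \<in> dom d"
  shows "linear (\<lambda>a. chr1 d y a b w)" "linear (\<lambda>b. chr1 d y a b w)" "linear (chr1 d y a b)"
  using dm_linear1[OF d] dm_linear2[OF d] dm_linear3[OF d]
  unfolding chr1_def linear_iff by (simp_all add: field_simps)

lemma chr1_expand12:
  assumes d: "d \<in> B" "y \<in> dom d"
  shows "chr1 d y a b w = (\<Sum>i\<in>UNIV. \<Sum>j\<in>UNIV. a $ i * b $ j * chr1 d y (axis i 1) (axis j 1) w)"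
proof -
  have "chr1 d y a b w = (\<Sum>i\<in>UNIV. a $ i *\<^sub>R chr1 d y (axis i 1) b w)"
    by (rule linear_axis_expand[OF chr1_linear(1)[OF d]])
  also have "\<dots> = (\<Sum>i\<in>UNIV. \<Sum>j\<in>UNIV. a $ i * b $ j * chr1 d y (axis i 1) (axis j 1) w)"
    by (subst linear_axis_expand[OF chr1_linear(2)[OF d], of _ b]) (simp add: sum_distrib_left mult.assoc)
  finally show ?thesis .
qed

text \<open>Lowering the index cancels the inverse matrix in \<open>christoffel\<close> and leaves
  the symbols of the first kind.\<close>

lemma metric_chr:
  assumes d: "d \<in> B" "y \<in> dom d"
  shows "metric_matrix B g d y *v chr d y a b = (\<chi> m. chr1 d y a b (axis m 1))"
proof -
  let ?G = "metric_matrix B g d y"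
  interpret pos_matrix ?G by (rule pos_metric_matrix[OF d])
  have c: "christoffel B g d k i j y = (\<Sum>m\<in>UNIV. matrix_inv ?G $ k $ m * chr1 d y (axis i 1) (axis j 1) (axis m 1))" for k i j
    by (simp add: christoffel_def chr1_def dm_def metric_matrix_def sum_distrib_left algebra_simps add_divide_distrib diff_divide_distrib)
  have "chr d y a b = matrix_inv ?G *v (\<chi> m. chr1 d y a b (axis m 1))"
  proof (rule vec_eq_iff[THEN iffD2], rule allI)
    fix k
    have "chr d y a b $ k = (\<Sum>i\<in>UNIV. \<Sum>j\<in>UNIV. \<Sum>m\<in>UNIV.
        matrix_inv ?G $ k $ m * (a $ i * b $ j * chr1 d y (axis i 1) (axis j 1) (axis m 1)))"
      by (simp add: chr_def c sum_distrib_left sum_distrib_right mult_ac)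
    also have "\<dots> = (\<Sum>m\<in>UNIV. \<Sum>i\<in>UNIV. \<Sum>j\<in>UNIV.
        matrix_inv ?G $ k $ m * (a $ i * b $ j * chr1 d y (axis i 1) (axis j 1) (axis m 1)))"
      by (subst sum.swap[where B = UNIV], subst (2) sum.swap) (rule refl)
    also have "\<dots> = (\<Sum>m\<in>UNIV. matrix_inv ?G $ k $ m * chr1 d y a b (axis m 1))"
      by (simp add: chr1_expand12[OF d, of a b] sum_distrib_left)
    finally show "chr d y a b $ k = (matrix_inv ?G *v (\<chi> m. chr1 d y a b (axis m 1))) $ k"
      by (simp add: matrix_vector_mult_def)
  qed
  moreover have "?G ** matrix_inv ?G = mat 1"
  proof -
    have "invertible ?G" using det_nonzero by (simp add: invertible_det_nz)
    then show ?thesis unfolding invertible_def matrix_inv_def by (rule someI2_ex) simp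
  qed
  ultimately show ?thesis by (simp add: matrix_vector_mul_assoc)
qed

lemma mc_chr:
  assumes d: "d \<in> B" "y \<in> dom d"
  shows "mc d y (chr d y a b) w = chr1 d y a b w"
proof -
  have "mc d y (chr d y a b) w = gm (metric_matrix B g d y) w (chr d y a b)"
    unfolding mc_gm[OF d] by (rule mc_sym[OF d])
  also have "\<dots> = (\<Sum>m\<in>UNIV. w $ m *\<^sub>R chr1 d y a b (axis m 1))"
    unfolding gm_def metric_chr[OF d] by (simp add: inner_vec_def)
  finally show ?thesis using linear_axis_expand[OF chr1_linear(3)[OF d], of a b w] by simp
qed

text \<open>The metric is given as smooth for fixed vectors only; expansion in the standard basis
  makes the composite a finite sum of products.\<close>

lemma mc_product_rule:
  fixes Y u v :: "'e::real_normed_vector \<Rightarrow> real^3"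
  assumes d: "d \<in> B" "Y z \<in> dom d" and Y: "(Y has_derivative Y') (at z)"
    and u: "(u has_derivative u') (at z)" and v: "(v has_derivative v') (at z)"
  shows "((\<lambda>z. mc d (Y z) (u z) (v z)) has_derivative
    (\<lambda>w. dm d (Y z) (Y' w) (u z) (v z) + mc d (Y z) (u' w) (v z) + mc d (Y z) (u z) (v' w))) (at z)"
proof -
  let ?m = "\<lambda>i j z. mc d (Y z) (axis i 1) (axis j 1)"
  have nth: "((\<lambda>z. h z $ i) has_derivative (\<lambda>w. h' w $ i)) (at z)" if "(h has_derivative h') (at z)"
    for h' and i :: 3 and h :: "'e \<Rightarrow> real^3"
    by (rule bounded_linear.has_derivative[OF bounded_linear_vec_nth that])
  have m: "(?m i j has_derivative (\<lambda>w. dm d (Y z) (Y' w) (axis i 1) (axis j 1))) (at z)" for i j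
    by (rule has_derivative_compose[OF Y mc_derivative[OF d]])
  have s: "((\<lambda>z. \<Sum>i\<in>UNIV. \<Sum>j\<in>UNIV. u z $ i * v z $ j * ?m i j z) has_derivative
     (\<lambda>w. \<Sum>i\<in>UNIV. \<Sum>j\<in>UNIV. u z $ i * v z $ j * dm d (Y z) (Y' w) (axis i 1) (axis j 1)
        + (u z $ i * v' w $ j + u' w $ i * v z $ j) * ?m i j z)) (at z)"
    by (intro has_derivative_sum has_derivative_mult nth u v m)
  have "isCont Y z" using Y by (rule has_derivative_continuous)
  then have "(Y \<longlongrightarrow> Y z) (at z)" by (simp add: isCont_def)
  then have "eventually (\<lambda>z. Y z \<in> dom d) (at z)" by (rule topological_tendstoD[OF _ open_dom[OF d(1)] d(2)])
  then have ev: "eventually (\<lambda>z. (\<Sum>i\<in>UNIV. \<Sum>j\<in>UNIV. u z $ i * v z $ j * ?m i j z) = mc d (Y z) (u z) (v z)) (at z)"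
    by eventually_elim (simp only: mc_expand[OF d(1), symmetric])
  have "((\<lambda>z. mc d (Y z) (u z) (v z)) has_derivative
     (\<lambda>w. \<Sum>i\<in>UNIV. \<Sum>j\<in>UNIV. u z $ i * v z $ j * dm d (Y z) (Y' w) (axis i 1) (axis j 1)
        + (u z $ i * v' w $ j + u' w $ i * v z $ j) * ?m i j z)) (at z)"
    by (rule has_derivative_transform_eventually[OF s ev]) (simp_all only: mc_expand[OF d, symmetric] UNIV_I)
  moreover have "(\<Sum>i\<in>UNIV. \<Sum>j\<in>UNIV. u z $ i * v z $ j * dm d (Y z) (Y' w) (axis i 1) (axis j 1)
        + (u z $ i * v' w $ j + u' w $ i * v z $ j) * ?m i j z)
      = dm d (Y z) (Y' w) (u z) (v z) + mc d (Y z) (u' w) (v z) + mc d (Y z) (u z) (v' w)" for w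
    unfolding mc_expand[OF d, of "u' w"] mc_expand[OF d, of "u z" "v' w"] dm_expand23[OF d, of _ "u z"]
    by (simp add: sum.distrib distrib_right)
  ultimately show ?thesis by simp
qed

end

section \<open>Tangent vectors and chart changes\<close>

lemma coord_rep_self_derivative:
  assumes A: "smooth_atlas A" "c \<in> A" and p: "p \<in> fst c"
  shows "frechet_derivative (coord_rep c c (\<lambda>x. x)) (at (snd c p)) = (\<lambda>w. w)"
proof (rule has_derivative_frechet_eq)
  have eq: "x = coord_rep c c (\<lambda>x. x) x" if "x \<in> snd c ` fst c" for x
    using that by (auto simp: coord_rep_chart[OF A])
  show "(coord_rep c c (\<lambda>x. x) has_derivative (\<lambda>w. w)) (at (snd c p))"
    by (rule has_derivative_transform_within_open[OF has_derivative_ident smooth_atlasD(2)[OF A A(2)] _ eq])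
       (use p in auto)
qed

lemma coord_change_derivative:
  assumes "smooth_atlas A" "c \<in> A" "d \<in> A" "p \<in> fst c" "p \<in> fst d"
  shows "(coord_rep c d (\<lambda>x. x) has_derivative frechet_derivative (coord_rep c d (\<lambda>x. x)) (at (snd c p))) (at (snd c p))"
  by (rule smooth_on_has_derivative[OF smooth_atlasD(4,3)[OF assms(1-3)]]) (use assms in auto)

lemma chain_chart:
  assumes A: "smooth_atlas A" and c: "c \<in> A" "c' \<in> A" "p \<in> fst c" "p \<in> fst c'"
    and h: "((\<lambda>z. h (chart_inv c' z)) has_derivative h') (at (snd c' p))"
  shows "((\<lambda>z. h (chart_inv c z)) has_derivative
     (\<lambda>w. h' (frechet_derivative (coord_rep c c' (\<lambda>x. x)) (at (snd c p)) w))) (at (snd c p))"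
proof -
  let ?s = "coord_rep c c' (\<lambda>x. x)"
  have e: "?s (snd c p) = snd c' p" by (rule coord_rep_chart[OF A c(1,3)])
  have 1: "((\<lambda>z. h (chart_inv c' (?s z))) has_derivative (\<lambda>w. h' (frechet_derivative ?s (at (snd c p)) w))) (at (snd c p))"
    by (rule has_derivative_compose[OF coord_change_derivative[OF A c]]) (simp add: e h)
  have eq: "h (chart_inv c' (?s z)) = h (chart_inv c z)" if "z \<in> snd c ` (fst c \<inter> fst c')" for z
    using that by (auto simp: coord_rep_chart[OF A c(1)] chart_inv[OF A c(1)] chart_inv[OF A c(2)])
  show ?thesis
    by (rule has_derivative_transform_within_open[OF 1 smooth_atlasD(3)[OF A c(1,2)] _ eq]) (use c in auto)
qed

lemma coord_change_trans:
  assumes A: "smooth_atlas A" and c: "c \<in> A" "d \<in> A" "e \<in> A" "p \<in> fst c" "p \<in> fst d" "p \<in> fst e"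
  shows "frechet_derivative (coord_rep c e (\<lambda>x. x)) (at (snd c p)) w
    = frechet_derivative (coord_rep d e (\<lambda>x. x)) (at (snd d p)) (frechet_derivative (coord_rep c d (\<lambda>x. x)) (at (snd c p)) w)"
proof -
  have "((\<lambda>z. snd e (chart_inv d z)) has_derivative frechet_derivative (coord_rep d e (\<lambda>x. x)) (at (snd d p))) (at (snd d p))"
    using coord_change_derivative[OF A c(2,3,5,6)] by (simp add: coord_rep_def)
  from has_derivative_frechet_eq[OF chain_chart[OF A c(1,2,4,5) this]]
  show ?thesis by (simp add: coord_rep_def)
qed

lemma coord_vec_tangent:
  assumes A: "smooth_atlas A" and c: "c \<in> A" "p \<in> fst c"
  shows "coord_vec A c p w \<in> tangent_space A p"
  unfolding tangent_space_def mem_Collect_eq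
proof (intro conjI allI impI ballI)
  show "coord_vec A c p w d = 0" if "\<not> (d \<in> A \<and> p \<in> fst d)" for d
    using that unfolding coord_vec_def by (rule if_not_P)
  show "coord_vec A c p w e = frechet_derivative (coord_rep d e (\<lambda>x. x)) (at (snd d p)) (coord_vec A c p w d)"
    if d: "d \<in> A" "e \<in> A" "p \<in> fst d \<and> p \<in> fst e" for d e
    using coord_change_trans[OF A c(1) d(1,2) c(2)] d by (simp add: coord_vec_def)
qed

lemma coord_vec_self:
  assumes "smooth_atlas A" "c \<in> A" "p \<in> fst c"
  shows "coord_vec A c p w c = w"
  using assms by (simp add: coord_vec_def coord_rep_self_derivative)

lemma coord_vec_change:
  assumes A: "smooth_atlas A" and c: "c \<in> A" "c' \<in> A" "p \<in> fst c" "p \<in> fst c'"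
  shows "coord_vec A c' p (frechet_derivative (coord_rep c c' (\<lambda>x. x)) (at (snd c p)) w) = coord_vec A c p w"
proof
  fix e
  show "coord_vec A c' p (frechet_derivative (coord_rep c c' (\<lambda>x. x)) (at (snd c p)) w) e = coord_vec A c p w e"
    using coord_change_trans[OF A c(1,2) _ c(3,4), of e w] by (simp add: coord_vec_def)
qed

lemma tangent_eq_coord_vec:
  assumes "X \<in> tangent_space A p" "d \<in> A" "p \<in> fst d"
  shows "X = coord_vec A d p (X d)"
proof
  fix e
  have X: "\<forall>c. \<not> (c \<in> A \<and> p \<in> fst c) \<longrightarrow> X c = 0"
    "\<forall>c\<in>A. \<forall>d\<in>A. p \<in> fst c \<and> p \<in> fst d \<longrightarrow>
       X d = frechet_derivative (coord_rep c d (\<lambda>x. x)) (at (snd c p)) (X c)"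
    using assms(1) unfolding tangent_space_def mem_Collect_eq by (rule conjunct1, rule conjunct2)
  show "X e = coord_vec A d p (X d) e"
  proof (cases "e \<in> A \<and> p \<in> fst e")
    case True
    then show ?thesis using X(2)[rule_format, OF assms(2), of e] assms(3) by (simp add: coord_vec_def)
  next
    case False
    show ?thesis unfolding coord_vec_def if_not_P[OF False] by (rule X(1)[rule_format, OF False])
  qed
qed

lemma chart_at: "p \<in> points A \<Longrightarrow> chart_at A p \<in> A \<and> p \<in> fst (chart_at A p)"
  unfolding chart_at_def points_def by (rule someI_ex) auto

lemma (in riemannian_atlas) metric_tangent:
  assumes "X \<in> tangent_space B q" "Y \<in> tangent_space B q" "d \<in> B" "q \<in> fst d"
  shows "g q X Y = mc d (snd d q) (X d) (Y d)"
  unfolding metric_coord_def Let_def chart_inv[OF B assms(3,4)]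
    tangent_eq_coord_vec[OF assms(1,3,4), symmetric] tangent_eq_coord_vec[OF assms(2-4), symmetric] ..

section \<open>The fundamental forms of a front in charts\<close>

text \<open>The product rule for a family of linear maps, needed to differentiate the transformation
  law of the normal. That \<open>D\<close> is linear in the vector follows from uniqueness of
  derivatives.\<close>

lemma has_derivative_linear_field:
  fixes u :: "'e::real_normed_vector \<Rightarrow> real^3"
    and L :: "'h::real_normed_vector \<Rightarrow> real^3 \<Rightarrow> 'k::real_normed_vector"
  assumes W: "open W" "Y z \<in> W" and L: "\<And>y. y \<in> W \<Longrightarrow> linear (L y)"
    and D: "\<And>u. ((\<lambda>y. L y u) has_derivative (\<lambda>a. D a u)) (at (Y z))"
    and Y: "(Y has_derivative Y') (at z)" and u: "(u has_derivative u') (at z)"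
  shows "((\<lambda>z. L (Y z) (u z)) has_derivative (\<lambda>w. D (Y' w) (u z) + L (Y z) (u' w))) (at z)"
proof -
  have D_expand: "D a v = (\<Sum>i\<in>UNIV. v $ i *\<^sub>R D a (axis i 1))" for a v
  proof -
    have s: "((\<lambda>y. \<Sum>i\<in>UNIV. v $ i *\<^sub>R L y (axis i 1)) has_derivative (\<lambda>a. \<Sum>i\<in>UNIV. v $ i *\<^sub>R D a (axis i 1))) (at (Y z))"
      by (intro has_derivative_sum has_derivative_scaleR_right D)
    have "((\<lambda>y. L y v) has_derivative (\<lambda>a. \<Sum>i\<in>UNIV. v $ i *\<^sub>R D a (axis i 1))) (at (Y z))"
      by (rule has_derivative_transform_within_open[OF s W]) (rule linear_axis_expand[OF L, symmetric])
    from has_derivative_unique[OF D this] show ?thesis by (rule fun_cong)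
  qed
  have nth: "((\<lambda>z. u z $ i) has_derivative (\<lambda>w. u' w $ i)) (at z)" for i
    by (rule bounded_linear.has_derivative[OF bounded_linear_vec_nth u])
  have m: "((\<lambda>z. L (Y z) (axis i 1)) has_derivative (\<lambda>w. D (Y' w) (axis i 1))) (at z)" for i
    by (rule has_derivative_compose[OF Y D])
  have s: "((\<lambda>z. \<Sum>i\<in>UNIV. u z $ i *\<^sub>R L (Y z) (axis i 1)) has_derivative
     (\<lambda>w. \<Sum>i\<in>UNIV. u z $ i *\<^sub>R D (Y' w) (axis i 1) + u' w $ i *\<^sub>R L (Y z) (axis i 1))) (at z)"
    by (intro has_derivative_sum has_derivative_scaleR nth m)
  have "isCont Y z" using Y by (rule has_derivative_continuous)
  then have "(Y \<longlongrightarrow> Y z) (at z)" by (simp add: isCont_def)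
  then have "eventually (\<lambda>z. Y z \<in> W) (at z)" by (rule topological_tendstoD[OF _ W])
  then have ev: "eventually (\<lambda>z. (\<Sum>i\<in>UNIV. u z $ i *\<^sub>R L (Y z) (axis i 1)) = L (Y z) (u z)) (at z)"
    by eventually_elim (rule linear_axis_expand[OF L, symmetric])
  have "((\<lambda>z. L (Y z) (u z)) has_derivative
     (\<lambda>w. \<Sum>i\<in>UNIV. u z $ i *\<^sub>R D (Y' w) (axis i 1) + u' w $ i *\<^sub>R L (Y z) (axis i 1))) (at z)"
    by (rule has_derivative_transform_eventually[OF s ev]) (simp_all only: linear_axis_expand[OF L[OF W(2)], symmetric] UNIV_I)
  moreover have "(\<Sum>i\<in>UNIV. u z $ i *\<^sub>R D (Y' w) (axis i 1) + u' w $ i *\<^sub>R L (Y z) (axis i 1))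
      = D (Y' w) (u z) + L (Y z) (u' w)" for w
    unfolding D_expand[of _ "u z"] linear_axis_expand[OF L[OF W(2)], of "u' w"] by (simp add: sum.distrib)
  ultimately show ?thesis by simp
qed

text \<open>\<open>tangent_map\<close> is defined through \<open>chart_at\<close>; by the chain rule
  any chart around \<open>p\<close> computes it.\<close>

lemma tangent_map_coord_vec:
  assumes A: "smooth_atlas A" and F: "smooth_map A B F" and c: "c \<in> A" "p \<in> fst c" and d: "d \<in> B" "F p \<in> fst d"
  shows "tangent_map A B F p (coord_vec A c p w) d = frechet_derivative (coord_rep c d F) (at (snd c p)) w"
proof -
  define k where "k = chart_at A p"
  have p: "p \<in> points A" using c by (auto simp: points_def)
  have k: "k \<in> A" "p \<in> fst k" using chart_at[OF p] unfolding k_def by simp_all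
  have "smooth_on (snd k ` (fst k \<inter> F -` fst d)) (coord_rep k d F)" "open (snd k ` (fst k \<inter> F -` fst d))"
    using F k(1) d(1) unfolding smooth_map_def by blast+
  then have "((\<lambda>z. snd d (F (chart_inv k z))) has_derivative frechet_derivative (coord_rep k d F) (at (snd k p))) (at (snd k p))"
    unfolding coord_rep_def[symmetric] by (rule smooth_on_has_derivative) (use k d in auto)
  from has_derivative_frechet_eq[OF chain_chart[where h = "\<lambda>p. snd d (F p)", OF A c(1) k(1) c(2) k(2) this]]
  have "frechet_derivative (coord_rep c d F) (at (snd c p)) w
    = frechet_derivative (coord_rep k d F) (at (snd k p)) (frechet_derivative (coord_rep c k (\<lambda>x. x)) (at (snd c p)) w)"
    unfolding coord_rep_def by simp
  then show ?thesis using d k by (simp add: tangent_map_def Let_def coord_vec_def flip: k_def)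
qed

context riemannian_atlas
begin

abbreviation cs :: "('b, real^3) chart \<Rightarrow> ('b, real^3) chart \<Rightarrow> real^3 \<Rightarrow> real^3" where
  "cs d e \<equiv> coord_rep d e (\<lambda>x. x)"

abbreviation cD :: "('b, real^3) chart \<Rightarrow> ('b, real^3) chart \<Rightarrow> real^3 \<Rightarrow> real^3 \<Rightarrow> real^3" where
  "cD d e y \<equiv> frechet_derivative (cs d e) (at y)"

text \<open>The Hessian of the coordinate change, the inhomogeneous term in the transformation law
  of the Christoffel symbols.\<close>

definition cH :: "('b, real^3) chart \<Rightarrow> ('b, real^3) chart \<Rightarrow> real^3 \<Rightarrow> real^3 \<Rightarrow> real^3 \<Rightarrow> real^3" where
  "cH d e y a b = frechet_derivative (\<lambda>y. cD d e y b) (at y) a"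

context
  fixes d e :: "('b, real^3) chart"
  assumes d: "d \<in> B" and e: "e \<in> B"
begin

lemma open_overlap: "open (snd d ` (fst d \<inter> fst e))"
  by (rule smooth_atlasD(3)[OF B d e])

lemma cs_derivative: "y \<in> snd d ` (fst d \<inter> fst e) \<Longrightarrow> (cs d e has_derivative cD d e y) (at y)"
  by (rule smooth_on_has_derivative[OF smooth_atlasD(4,3)[OF B d e]])

lemma cD_derivative: "y \<in> snd d ` (fst d \<inter> fst e) \<Longrightarrow> ((\<lambda>y. cD d e y b) has_derivative (\<lambda>a. cH d e y a b)) (at y)"
  unfolding cH_def by (rule smooth_on_has_derivative[OF smooth_on_frechet[OF smooth_atlasD(4)[OF B d e]] open_overlap])

lemma cH_sym: "y \<in> snd d ` (fst d \<inter> fst e) \<Longrightarrow> cH d e y a b = cH d e y b a"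
  unfolding cH_def by (rule smooth_second_derivative_symmetric[OF smooth_atlasD(4)[OF B d e] open_overlap])

lemma cs_in_dom: "y \<in> snd d ` (fst d \<inter> fst e) \<Longrightarrow> y \<in> dom d \<and> cs d e y \<in> dom e"
  by (auto simp: coord_rep_chart[OF B d])

lemma metric_change:
  assumes y: "y \<in> snd d ` (fst d \<inter> fst e)"
  shows "mc d y u v = mc e (cs d e y) (cD d e y u) (cD d e y v)"
proof -
  obtain q where q: "y = snd d q" "q \<in> fst d" "q \<in> fst e" using y by blast
  show ?thesis
    unfolding q(1) coord_rep_chart[OF B d q(2)] metric_coord_def Let_def chart_inv[OF B d q(2)] chart_inv[OF B e q(3)]
      coord_vec_change[OF B d e q(2,3)] ..
qed

lemma dm_change:
  assumes y: "y \<in> snd d ` (fst d \<inter> fst e)"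
  shows "dm d y a u v = dm e (cs d e y) (cD d e y a) (cD d e y u) (cD d e y v)
    + mc e (cs d e y) (cH d e y a u) (cD d e y v) + mc e (cs d e y) (cD d e y u) (cH d e y a v)"
proof -
  have 1: "((\<lambda>y. mc e (cs d e y) (cD d e y u) (cD d e y v)) has_derivative
    (\<lambda>a. dm e (cs d e y) (cD d e y a) (cD d e y u) (cD d e y v)
    + mc e (cs d e y) (cH d e y a u) (cD d e y v) + mc e (cs d e y) (cD d e y u) (cH d e y a v))) (at y)"
    by (rule mc_product_rule[OF e _ cs_derivative[OF y] cD_derivative[OF y] cD_derivative[OF y]])
      (use cs_in_dom[OF y] in blast)
  have "((\<lambda>y. mc d y u v) has_derivative
    (\<lambda>a. dm e (cs d e y) (cD d e y a) (cD d e y u) (cD d e y v)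
    + mc e (cs d e y) (cH d e y a u) (cD d e y v) + mc e (cs d e y) (cD d e y u) (cH d e y a v))) (at y)"
    by (rule has_derivative_transform_within_open[OF 1 open_overlap y]) (rule metric_change[symmetric])
  from has_derivative_unique[OF mc_derivative[OF d cs_in_dom[OF y, THEN conjunct1]] this] show ?thesis by (rule fun_cong)
qed

text \<open>Of the six Hessian terms produced by \<open>dm_change\<close>, four cancel by symmetry
  and the remaining two agree, which removes the factor 1/2.\<close>

lemma chr1_change:
  assumes y: "y \<in> snd d ` (fst d \<inter> fst e)"
  shows "chr1 d y a b w = chr1 e (cs d e y) (cD d e y a) (cD d e y b) (cD d e y w)
    + mc e (cs d e y) (cH d e y a b) (cD d e y w)"
proof -
  have m: "cs d e y \<in> dom e" using cs_in_dom[OF y] by blast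
  show ?thesis
    unfolding chr1_def dm_change[OF y] cH_sym[OF y, of b a] cH_sym[OF y, of w a] cH_sym[OF y, of w b]
      mc_sym[OF e m, of "cD d e y a"] mc_sym[OF e m, of "cD d e y b"]
    by (simp add: field_simps)
qed

lemma cD_surj:
  assumes q: "q \<in> fst d" "q \<in> fst e"
  shows "cD d e (snd d q) (cD e d (snd e q) x) = x"
  using coord_change_trans[OF B e d e q(2,1,2), of x] by (simp add: coord_rep_self_derivative[OF B e q(2)])

lemma chr_change:
  assumes y: "y \<in> snd d ` (fst d \<inter> fst e)"
  shows "cD d e y (chr d y a b) = chr e (cs d e y) (cD d e y a) (cD d e y b) + cH d e y a b"
proof -
  have m: "y \<in> dom d" "cs d e y \<in> dom e" using cs_in_dom[OF y] by blast+
  obtain q where q: "y = snd d q" "q \<in> fst d" "q \<in> fst e" using y by blast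
  \<comment> \<open>The difference of the two sides is paired with itself and shown to have length
    0. Its preimage \<open>w\<close> under the derivative of the coordinate change makes
    \<open>chr1_change\<close> applicable.\<close>
  define x where "x = cD d e y (chr d y a b) - (chr e (cs d e y) (cD d e y a) (cD d e y b) + cH d e y a b)"
  define w where "w = cD e d (snd e q) x"
  have w: "cD d e y w = x" unfolding w_def q(1) by (rule cD_surj[OF q(2,3)])
  have "mc e (cs d e y) (cD d e y (chr d y a b)) (cD d e y w)
      = mc e (cs d e y) (chr e (cs d e y) (cD d e y a) (cD d e y b)) (cD d e y w)
      + mc e (cs d e y) (cH d e y a b) (cD d e y w)"
    unfolding metric_change[OF y, symmetric] mc_chr[OF d m(1)] mc_chr[OF e m(2)] by (rule chr1_change[OF y])
  then have "mc e (cs d e y) x x = 0"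
    unfolding w
    using linear_diff[OF mc_linear(1)[OF e m(2), of x], of "cD d e y (chr d y a b)" "chr e (cs d e y) (cD d e y a) (cD d e y b) + cH d e y a b"]
      linear_add[OF mc_linear(1)[OF e m(2), of x], of "chr e (cs d e y) (cD d e y a) (cD d e y b)" "cH d e y a b"]
    unfolding x_def[symmetric] by linarith
  then have "x = 0" using mc_pos[OF e m(2), of x] by auto
  then show ?thesis unfolding x_def by simp
qed

end

lemma chr_zero: "chr d y 0 b = 0"
  by (simp add: chr_def vec_eq_iff)

end

locale front_surface = riemannian_atlas B g for B :: "('b, real^3) chart set" and g +
  fixes A :: "('a, real^2) chart set" and f :: "'a \<Rightarrow> 'b" and \<nu> :: "'a \<Rightarrow> ('b, real^3) tvec"
  assumes A: "smooth_atlas A" and f: "smooth_map A B f" and \<nu>: "unit_normal_on A B g (points A) f \<nu>"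
begin

definition cdom :: "('a, real^2) chart \<Rightarrow> ('b, real^3) chart \<Rightarrow> (real^2) set" where
  "cdom c d = snd c ` (fst c \<inter> f -` fst d)"

abbreviation pos :: "('a, real^2) chart \<Rightarrow> ('b, real^3) chart \<Rightarrow> real^2 \<Rightarrow> real^3" where
  "pos c d \<equiv> coord_rep c d f"

definition nrm :: "('a, real^2) chart \<Rightarrow> ('b, real^3) chart \<Rightarrow> real^2 \<Rightarrow> real^3" where
  "nrm c d z = \<nu> (chart_inv c z) d"

abbreviation lift :: "('a, real^2) chart \<Rightarrow> ('b, real^3) chart \<Rightarrow> real^2 \<Rightarrow> (real^3) \<times> (real^3)" where
  "lift c d \<equiv> \<lambda>z. (pos c d z, nrm c d z)"

definition phi :: "('a, real^2) chart \<Rightarrow> ('b, real^3) chart \<Rightarrow> real^2 \<Rightarrow> real^2 \<Rightarrow> real^3" where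
  "phi c d z w = frechet_derivative (pos c d) (at z) w"

text \<open>Smoothness of the normal is only known for the pair \<open>lift\<close>, hence the projection.\<close>

definition dn :: "('a, real^2) chart \<Rightarrow> ('b, real^3) chart \<Rightarrow> real^2 \<Rightarrow> real^2 \<Rightarrow> real^3" where
  "dn c d z w = snd (frechet_derivative (lift c d) (at z) w)"

definition psi :: "('a, real^2) chart \<Rightarrow> ('b, real^3) chart \<Rightarrow> real^2 \<Rightarrow> real^2 \<Rightarrow> real^3" where
  "psi c d z w = dn c d z w + chr d (pos c d z) (phi c d z w) (nrm c d z)"

definition tlift :: "'a \<Rightarrow> 'b \<times> ('b, real^3) tvec" where
  "tlift p = (f p, \<nu> p)"

definition tchart :: "('b, real^3) chart \<Rightarrow> ('b \<times> ('b, real^3) tvec, (real^3) \<times> (real^3)) chart" where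
  "tchart d = ({(p, v). p \<in> fst d \<and> v \<in> tangent_space B p}, \<lambda>(p, v). (snd d p, v d))"

lemma normal_tangent: "p \<in> points A \<Longrightarrow> \<nu> p \<in> tangent_space B (f p)"
  and normal_unit: "p \<in> points A \<Longrightarrow> g (f p) (\<nu> p) (\<nu> p) = 1"
  and normal_orthogonal: "p \<in> points A \<Longrightarrow> X \<in> tangent_space A p \<Longrightarrow> g (f p) (tangent_map A B f p X) (\<nu> p) = 0"
  and tlift_immersion: "immersion A (tangent_atlas B) tlift"
  using \<nu> unfolding unit_normal_on_def restrict_atlas_points tlift_def[abs_def] by blast+

lemma tangent_atlas_tchart: "tangent_atlas B = tchart ` B"
  unfolding tangent_atlas_def tchart_def ..

lemma in_points: "c \<in> A \<Longrightarrow> p \<in> fst c \<Longrightarrow> p \<in> points A"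
  by (auto simp: points_def)

lemma tlift_in_tchart: "p \<in> points A \<Longrightarrow> tlift p \<in> fst (tchart d) \<longleftrightarrow> f p \<in> fst d"
  using normal_tangent by (simp add: tlift_def tchart_def)

lemma coord_rep_tlift: "coord_rep c (tchart d) tlift = lift c d"
  by (simp add: coord_rep_def tchart_def tlift_def nrm_def fun_eq_iff)

context
  fixes c d assumes c: "c \<in> A" and d: "d \<in> B"
begin

lemma open_cdom: "open (cdom c d)" and pos_smooth: "smooth_on (cdom c d) (pos c d)"
  using f c d unfolding smooth_map_def cdom_def by blast+

lemma lift_smooth: "smooth_on (cdom c d) (lift c d)"
proof -
  have "fst c \<inter> tlift -` fst (tchart d) = fst c \<inter> f -` fst d"
    using tlift_in_tchart in_points[OF c] by blast
  moreover have "smooth_on (snd c ` (fst c \<inter> tlift -` fst (tchart d))) (coord_rep c (tchart d) tlift)"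
    using tlift_immersion c d unfolding immersion_def smooth_map_def tangent_atlas_tchart by blast
  ultimately show ?thesis unfolding cdom_def coord_rep_tlift by simp
qed

lemma cdomE:
  assumes "z \<in> cdom c d"
  obtains p where "p \<in> fst c" "f p \<in> fst d" "z = snd c p" "chart_inv c z = p" "pos c d z = snd d (f p)" "nrm c d z = \<nu> p d"
  using assms unfolding cdom_def nrm_def by (auto simp: coord_rep_chart[OF A c] chart_inv[OF A c])

lemma pos_derivative: "z \<in> cdom c d \<Longrightarrow> (pos c d has_derivative phi c d z) (at z)"
  unfolding phi_def by (rule smooth_on_has_derivative[OF pos_smooth open_cdom])

lemma nrm_derivative: "z \<in> cdom c d \<Longrightarrow> (nrm c d has_derivative dn c d z) (at z)"
  using has_derivative_snd[OF smooth_on_has_derivative[OF lift_smooth open_cdom]]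
  unfolding dn_def by simp

lemma lift_frechet: "z \<in> cdom c d \<Longrightarrow> frechet_derivative (lift c d) (at z) w = (phi c d z w, dn c d z w)"
  using has_derivative_frechet_eq[OF has_derivative_Pair[OF pos_derivative nrm_derivative]] by simp

lemma phi_linear: "z \<in> cdom c d \<Longrightarrow> linear (phi c d z)" and dn_linear: "z \<in> cdom c d \<Longrightarrow> linear (dn c d z)"
  using pos_derivative nrm_derivative has_derivative_linear by blast+

lemma pos_dom: "z \<in> cdom c d \<Longrightarrow> pos c d z \<in> dom d"
  using cdomE by (metis imageI)

lemma tangent_map_chart:
  assumes p: "p \<in> fst c" "f p \<in> fst d"
  shows "tangent_map A B f p (coord_vec A c p w) d = phi c d (snd c p) w"
  unfolding phi_def by (rule tangent_map_coord_vec[OF A f c p(1) d p(2)])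

lemma mem_cdom: "p \<in> fst c \<Longrightarrow> f p \<in> fst d \<Longrightarrow> snd c p \<in> cdom c d"
  unfolding cdom_def by blast

end

lemma cov_deriv_chart:
  assumes c: "c \<in> A" and d: "d \<in> B" and p: "p \<in> fst c" "f p \<in> fst d"
  shows "cov_deriv A B g f \<nu> p (coord_vec A c p w) d = psi c d (snd c p) w"
proof -
  define k where "k = chart_at A p"
  have k: "k \<in> A" "p \<in> fst k" using chart_at[OF in_points[OF c p(1)]] unfolding k_def by simp_all
  have h: "((\<lambda>z. \<nu> (chart_inv k z) d) has_derivative dn k d (snd k p)) (at (snd k p))"
    using nrm_derivative[OF k(1) d mem_cdom[OF k(1) d k(2) p(2)]] unfolding nrm_def[abs_def] .
  have "((\<lambda>z. \<nu> (chart_inv c z) d) has_derivative dn c d (snd c p)) (at (snd c p))"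
    using nrm_derivative[OF c d mem_cdom[OF c d p]] unfolding nrm_def[abs_def] .
  from has_derivative_unique[OF this chain_chart[where h = "\<lambda>p. \<nu> p d", OF A c k(1) p(1) k(2) h]]
  have "dn c d (snd c p) w = dn k d (snd k p) (coord_vec A c p w k)"
    using k by (simp add: coord_vec_def fun_eq_iff)
  then have "frechet_derivative (\<lambda>z. \<nu> (chart_inv k z) d) (at (snd k p)) (coord_vec A c p w k) = dn c d (snd c p) w"
    using has_derivative_frechet_eq[OF h] by simp
  moreover have "chr d (snd d (f p)) (phi c d (snd c p) w) (\<nu> p d) = chr d (pos c d (snd c p)) (phi c d (snd c p) w) (nrm c d (snd c p))"
    by (simp add: coord_rep_chart[OF A c p(1)] nrm_def chart_inv[OF A c p(1)])
  ultimately show ?thesis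
    using d p by (simp add: cov_deriv_def Let_def tangent_map_chart[OF c d p] psi_def flip: k_def chr_def)
qed

context
  fixes c d e z
  assumes c: "c \<in> A" and d: "d \<in> B" and e: "e \<in> B" and z: "z \<in> cdom c d" "z \<in> cdom c e"
begin

lemma pos_overlap: "pos c d z \<in> snd d ` (fst d \<inter> fst e)"
proof -
  obtain p where p: "p \<in> fst c" "f p \<in> fst d" "pos c d z = snd d (f p)" "chart_inv c z = p" using cdomE[OF c d z(1)] by metis
  obtain q where q: "f q \<in> fst e" "chart_inv c z = q" using cdomE[OF c e z(2)] by metis
  show ?thesis using p q by auto
qed

lemma pos_change: "pos c e z = cs d e (pos c d z)" and nrm_change: "nrm c e z = cD d e (pos c d z) (nrm c d z)"
proof -
  obtain p where p: "p \<in> fst c" "f p \<in> fst d" "pos c d z = snd d (f p)" "chart_inv c z = p" "nrm c d z = \<nu> p d" using cdomE[OF c d z(1)] by metis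
  obtain q where q: "f q \<in> fst e" "chart_inv c z = q" "pos c e z = snd e (f q)" "nrm c e z = \<nu> q e" using cdomE[OF c e z(2)] by metis
  have qp: "q = p" using p q by simp
  show "pos c e z = cs d e (pos c d z)" unfolding q p qp by (simp add: coord_rep_chart[OF B d p(2)])
  have "\<nu> p \<in> tangent_space B (f p)" by (rule normal_tangent[OF in_points[OF c p(1)]])
  then show "nrm c e z = cD d e (pos c d z) (nrm c d z)"
    unfolding q p qp tangent_space_def using d e p(2) q(1) qp by blast
qed

end

context
  fixes c d e z
  assumes c: "c \<in> A" and d: "d \<in> B" and e: "e \<in> B" and z: "z \<in> cdom c d" "z \<in> cdom c e"
begin

lemma phi_change: "phi c e z w = cD d e (pos c d z) (phi c d z w)"
proof -
  have 1: "((\<lambda>z. cs d e (pos c d z)) has_derivative (\<lambda>w. cD d e (pos c d z) (phi c d z w))) (at z)"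
    by (rule has_derivative_compose[OF pos_derivative[OF c d z(1)] cs_derivative[OF d e pos_overlap[OF c d e z]]])
  have "(pos c e has_derivative (\<lambda>w. cD d e (pos c d z) (phi c d z w))) (at z)"
    by (rule has_derivative_transform_within_open[OF 1 open_Int[OF open_cdom[OF c d] open_cdom[OF c e]] IntI[OF z]])
      (auto intro: pos_change[OF c d e, symmetric])
  from has_derivative_unique[OF pos_derivative[OF c e z(2)] this] show ?thesis by (rule fun_cong)
qed

lemma dn_change: "dn c e z w = cH d e (pos c d z) (phi c d z w) (nrm c d z) + cD d e (pos c d z) (dn c d z w)"
proof -
  have 1: "((\<lambda>z. cD d e (pos c d z) (nrm c d z)) has_derivative
    (\<lambda>w. cH d e (pos c d z) (phi c d z w) (nrm c d z) + cD d e (pos c d z) (dn c d z w))) (at z)"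
    by (rule has_derivative_linear_field[OF open_overlap[OF d e] pos_overlap[OF c d e z] _ cD_derivative[OF d e pos_overlap[OF c d e z]]
          pos_derivative[OF c d z(1)] nrm_derivative[OF c d z(1)]])
      (rule has_derivative_linear[OF cs_derivative[OF d e]])
  have "(nrm c e has_derivative
    (\<lambda>w. cH d e (pos c d z) (phi c d z w) (nrm c d z) + cD d e (pos c d z) (dn c d z w))) (at z)"
    by (rule has_derivative_transform_within_open[OF 1 open_Int[OF open_cdom[OF c d] open_cdom[OF c e]] IntI[OF z]])
      (auto intro: nrm_change[OF c d e, symmetric])
  from has_derivative_unique[OF nrm_derivative[OF c e z(2)] this] show ?thesis by (rule fun_cong)
qed

text \<open>The second derivatives of the coordinate change in \<open>dn_change\<close> and \<open>chr_change\<close> cancel.\<close>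

lemma psi_change: "psi c e z w = cD d e (pos c d z) (psi c d z w)"
  unfolding psi_def dn_change pos_change[OF c d e z] nrm_change[OF c d e z] phi_change
    linear_add[OF has_derivative_linear[OF cs_derivative[OF d e pos_overlap[OF c d e z]]]] chr_change[OF d e pos_overlap[OF c d e z]]
  by simp

end

lemma tangent_map_tangent:
  assumes c: "c \<in> A" "p \<in> fst c"
  shows "tangent_map A B f p (coord_vec A c p w) \<in> tangent_space B (f p)"
    and "cov_deriv A B g f \<nu> p (coord_vec A c p w) \<in> tangent_space B (f p)"
proof -
  let ?X = "coord_vec A c p w"
  have r: "pos c d (snd c p) = snd d (f p)" for d by (rule coord_rep_chart[OF A c])
  have "tangent_map A B f p ?X e = cD d e (snd d (f p)) (tangent_map A B f p ?X d)"
    "cov_deriv A B g f \<nu> p ?X e = cD d e (snd d (f p)) (cov_deriv A B g f \<nu> p ?X d)"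
    if d: "d \<in> B" "e \<in> B" "f p \<in> fst d \<and> f p \<in> fst e" for d e
  proof -
    have z: "snd c p \<in> cdom c d" "snd c p \<in> cdom c e" using mem_cdom[OF c(1) _ c(2)] d by blast+
    note p = d(3)[THEN conjunct1] d(3)[THEN conjunct2]
    show "tangent_map A B f p ?X e = cD d e (snd d (f p)) (tangent_map A B f p ?X d)"
      unfolding tangent_map_chart[OF c(1) d(1) c(2) p(1)] tangent_map_chart[OF c(1) d(2) c(2) p(2)] r[symmetric]
      by (rule phi_change[OF c(1) d(1,2) z])
    show "cov_deriv A B g f \<nu> p ?X e = cD d e (snd d (f p)) (cov_deriv A B g f \<nu> p ?X d)"
      unfolding cov_deriv_chart[OF c(1) d(1) c(2) p(1)] cov_deriv_chart[OF c(1) d(2) c(2) p(2)] r[symmetric]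
      by (rule psi_change[OF c(1) d(1,2) z])
  qed
  note change = this
  have zero: "tangent_map A B f p ?X d = 0" "cov_deriv A B g f \<nu> p ?X d = 0" if "\<not> (d \<in> B \<and> f p \<in> fst d)" for d
    unfolding tangent_map_def cov_deriv_def Let_def if_not_P[OF that] by (rule refl)+
  show "tangent_map A B f p ?X \<in> tangent_space B (f p)"
    unfolding tangent_space_def mem_Collect_eq
    by (intro conjI allI impI ballI) (erule zero(1), rule change(1))
  show "cov_deriv A B g f \<nu> p ?X \<in> tangent_space B (f p)"
    unfolding tangent_space_def mem_Collect_eq
    by (intro conjI allI impI ballI) (erule zero(2), rule change(2))
qed

context
  fixes c d assumes c: "c \<in> A" and d: "d \<in> B"
begin

lemma mc_phi_nrm: "z \<in> cdom c d \<Longrightarrow> mc d (pos c d z) (phi c d z w) (nrm c d z) = 0"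
  and mc_nrm_nrm: "z \<in> cdom c d \<Longrightarrow> mc d (pos c d z) (nrm c d z) (nrm c d z) = 1"
proof -
  assume "z \<in> cdom c d"
  then obtain p where p: "p \<in> fst c" "f p \<in> fst d" "z = snd c p" "pos c d z = snd d (f p)" "nrm c d z = \<nu> p d" using cdomE[OF c d] by metis
  note P = in_points[OF c p(1)]
  have "mc d (pos c d z) (phi c d z w) (nrm c d z) = g (f p) (tangent_map A B f p (coord_vec A c p w)) (\<nu> p)"
    unfolding p(4,5) metric_tangent[OF tangent_map_tangent(1)[OF c p(1)] normal_tangent[OF P] d p(2)] tangent_map_chart[OF c d p(1,2)]
    unfolding p(3) ..
  then show "mc d (pos c d z) (phi c d z w) (nrm c d z) = 0"
    using normal_orthogonal[OF P coord_vec_tangent[OF A c p(1)]] by simp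
  show "mc d (pos c d z) (nrm c d z) (nrm c d z) = 1"
    unfolding p(4,5) metric_tangent[OF normal_tangent[OF P] normal_tangent[OF P] d p(2), symmetric] by (rule normal_unit[OF P])
qed

lemma derivative_const_zero:
  assumes "(h has_derivative h') (at z)" "z \<in> cdom c d" "\<And>y. y \<in> cdom c d \<Longrightarrow> h y = (k::real)"
  shows "h' w = 0"
proof -
  have "(h has_derivative (\<lambda>_. 0)) (at z)"
    by (rule has_derivative_transform_within_open[OF has_derivative_const open_cdom[OF c d] assms(2)]) (simp add: assms(3))
  from has_derivative_unique[OF assms(1) this] show ?thesis by (rule fun_cong)
qed

lemma mc_psi:
  assumes z: "z \<in> cdom c d"
  shows "mc d (pos c d z) (psi c d z w) x = mc d (pos c d z) (dn c d z w) x + chr1 d (pos c d z) (phi c d z w) (nrm c d z) x"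
  unfolding psi_def linear_add[OF mc_linear(1)[OF d pos_dom[OF c d z]]] mc_chr[OF d pos_dom[OF c d z]] ..

text \<open>The unit length of the normal is differentiated. In \<open>chr1\<close> with the normal
  in the last two places two terms cancel, and half the derivative of the metric remains.\<close>

lemma mc_psi_nrm:
  assumes z: "z \<in> cdom c d"
  shows "mc d (pos c d z) (psi c d z w) (nrm c d z) = 0"
proof -
  note m = pos_dom[OF c d z]
  have "dm d (pos c d z) (phi c d z w) (nrm c d z) (nrm c d z) + mc d (pos c d z) (dn c d z w) (nrm c d z)
    + mc d (pos c d z) (nrm c d z) (dn c d z w) = 0"
    by (rule derivative_const_zero[OF mc_product_rule[where u = "nrm c d" and v = "nrm c d", OF d m pos_derivative[OF c d z] nrm_derivative[OF c d z] nrm_derivative[OF c d z]] z mc_nrm_nrm])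
  then show ?thesis unfolding mc_psi[OF z] chr1_def dm_sym[OF d m, of "nrm c d z" "nrm c d z"] mc_sym[OF d m, of "nrm c d z" "dn c d z w"]
    by simp
qed

text \<open>Differentiating the orthogonality of \<phi> and the normal expresses either side by
  second derivatives of the position and by derivatives of the metric, in a combination symmetric in
  \<open>a\<close> and \<open>b\<close>.\<close>

lemma mc_phi_psi_sym:
  assumes z: "z \<in> cdom c d"
  shows "mc d (pos c d z) (phi c d z a) (psi c d z b) = mc d (pos c d z) (phi c d z b) (psi c d z a)"
proof -
  note m = pos_dom[OF c d z]
  let ?H = "\<lambda>a b. frechet_derivative (\<lambda>z. phi c d z a) (at z) b"
  have H: "((\<lambda>z. phi c d z a) has_derivative ?H a) (at z)" for a
    unfolding phi_def by (rule smooth_on_has_derivative[OF smooth_on_frechet[OF pos_smooth[OF c d]] open_cdom[OF c d] z])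
  have Hs: "?H a b = ?H b a" for a b
    unfolding phi_def by (rule smooth_second_derivative_symmetric[OF pos_smooth[OF c d] open_cdom[OF c d] z])
  have e: "dm d (pos c d z) (phi c d z b) (phi c d z a) (nrm c d z) + mc d (pos c d z) (?H a b) (nrm c d z)
    + mc d (pos c d z) (phi c d z a) (dn c d z b) = 0" for a b
    by (rule derivative_const_zero[OF mc_product_rule[where u = "\<lambda>z. phi c d z a" and v = "nrm c d", OF d m pos_derivative[OF c d z] H nrm_derivative[OF c d z]] z mc_phi_nrm])
  show ?thesis
    using e[of a b] e[of b a]
    unfolding mc_sym[OF d m, of "phi c d z a" "psi c d z b"] mc_sym[OF d m, of "phi c d z b" "psi c d z a"] mc_psi[OF z] chr1_def Hs[of b a]
      mc_sym[OF d m, of "dn c d z b"] mc_sym[OF d m, of "dn c d z a"] dm_sym[OF d m, of "phi c d z b" "nrm c d z"] dm_sym[OF d m, of "phi c d z a" "nrm c d z"]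
      dm_sym[OF d m, of "nrm c d z" "phi c d z a"]
    by (simp add: field_simps)
qed

end

text \<open>If \<phi> kills \<open>w\<close>, the connection term of \<psi> vanishes, so
  \<open>dn\<close> kills \<open>w\<close> as well. This is transferred to all target charts
  \<open>e\<close>, because a tangent vector of the tangent bundle has an entry for each of them;
  the immersion property then applies.\<close>

lemma kernel_trivial:
  assumes c: "c \<in> A" and d: "d \<in> B" and z: "z \<in> cdom c d" and w: "phi c d z w = 0" "psi c d z w = 0"
  shows "w = 0"
proof -
  obtain p where p: "p \<in> fst c" "f p \<in> fst d" "z = snd c p" "pos c d z = snd d (f p)" "nrm c d z = \<nu> p d" using cdomE[OF c d z] by metis
  note P = in_points[OF c p(1)]
  have T: "tangent_map A (tangent_atlas B) tlift p (coord_vec A c p v) (tchart e) = (phi c e z v, dn c e z v)"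
    if e: "e \<in> B" "f p \<in> fst e" for e v
  proof -
    have "tangent_map A (tangent_atlas B) tlift p (coord_vec A c p v) (tchart e) = frechet_derivative (lift c e) (at (snd c p)) v"
      unfolding coord_rep_tlift[symmetric]
      by (rule tangent_map_coord_vec[OF A _ c p(1)])
        (use tlift_immersion e tlift_in_tchart[OF P] in \<open>auto simp: immersion_def tangent_atlas_tchart\<close>)
    then show ?thesis unfolding p(3) lift_frechet[OF c e(1) mem_cdom[OF c e(1) p(1) e(2)]] .
  qed
  have Z: "phi c e z w = 0 \<and> dn c e z w = 0" if e: "e \<in> B" "f p \<in> fst e" for e
  proof -
    have ze: "z \<in> cdom c e" using mem_cdom[OF c e(1) p(1) e(2)] p(3) by simp
    note l = linear_0[OF has_derivative_linear[OF cs_derivative[OF d e(1) pos_overlap[OF c d e(1) z ze]]]]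
    have "phi c e z w = 0" "psi c e z w = 0"
      unfolding phi_change[OF c d e(1) z ze] psi_change[OF c d e(1) z ze] w l by (rule refl)+
    then show ?thesis unfolding psi_def by (simp add: chr_zero)
  qed
  have "tangent_map A (tangent_atlas B) tlift p (coord_vec A c p w) = tangent_map A (tangent_atlas B) tlift p (coord_vec A c p 0)"
  proof
    fix k
    show "tangent_map A (tangent_atlas B) tlift p (coord_vec A c p w) k = tangent_map A (tangent_atlas B) tlift p (coord_vec A c p 0) k"
    proof (cases "k \<in> tangent_atlas B \<and> tlift p \<in> fst k")
      case True
      then obtain e where e: "k = tchart e" "e \<in> B" "f p \<in> fst e"
        unfolding tangent_atlas_tchart using tlift_in_tchart[OF P] by blast
      have ze: "z \<in> cdom c e" using mem_cdom[OF c e(2) p(1) e(3)] p(3) by simp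
      show ?thesis unfolding e(1) T[OF e(2,3)] linear_0[OF phi_linear[OF c e(2) ze]] linear_0[OF dn_linear[OF c e(2) ze]]
        using Z[OF e(2,3)] by simp
    next
      case False
      then show ?thesis unfolding tangent_map_def Let_def by (simp only: if_False)
    qed
  qed
  moreover have "inj_on (tangent_map A (tangent_atlas B) tlift p) (tangent_space A p)"
    using tlift_immersion P unfolding immersion_def by blast
  ultimately have "coord_vec A c p w = coord_vec A c p 0"
    using coord_vec_tangent[OF A c p(1)] by (metis inj_onD)
  then have "coord_vec A c p w c = coord_vec A c p 0 c" by simp
  then show ?thesis unfolding coord_vec_self[OF A c p(1)] .
qed

end

section \<open>Principal directions of a front and the effect of the curvature bound\<close>

section \<open>Principal directions\<close>

context front_surface
begin

definition gmat :: "('a, real^2) chart \<Rightarrow> ('b, real^3) chart \<Rightarrow> real^2 \<Rightarrow> real^3^3" where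
  "gmat c d z = metric_matrix B g d (pos c d z)"

context
  fixes c d z assumes c: "c \<in> A" and d: "d \<in> B" and z: "z \<in> cdom c d"
begin

lemma llip_pos: "llip (pos c d) z"
  by (rule smooth_on_llip[OF pos_smooth[OF c d] open_cdom[OF c d] z])

lemma llip_nrm: "llip (nrm c d) z"
  using llip_snd[OF smooth_on_llip[OF lift_smooth[OF c d] open_cdom[OF c d] z]] by simp

lemma llip_phi: "llip (\<lambda>z. phi c d z w) z"
  unfolding phi_def by (rule smooth_on_llip[OF smooth_on_frechet[OF pos_smooth[OF c d]] open_cdom[OF c d] z])

lemma llip_dn: "llip (\<lambda>z. dn c d z w) z"
  unfolding dn_def by (rule llip_snd[OF smooth_on_llip[OF smooth_on_frechet[OF lift_smooth[OF c d]] open_cdom[OF c d] z]])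

lemma llip_mc:
  assumes "llip u z" "llip v z"
  shows "llip (\<lambda>z. mc d (pos c d z) (u z) (v z)) z"
proof (rule llip_transform[OF _ open_cdom[OF c d] z])
  have m: "llip (\<lambda>z. mc d (pos c d z) (axis i 1) (axis j 1)) z" for i j
    by (rule llip_compose[OF llip_pos]) (rule smooth_on_llip[OF mc_smooth[OF d] open_dom[OF d] pos_dom[OF c d z]])
  show "llip (\<lambda>z. \<Sum>i\<in>UNIV. \<Sum>j\<in>UNIV. u z $ i * v z $ j * mc d (pos c d z) (axis i 1) (axis j 1)) z"
    by (intro llip_sum llip_mult llip_nth assms m)
qed (rule mc_expand[OF d pos_dom[OF c d]])

lemma llip_dm:
  assumes "llip a z" "llip u z" "llip v z"
  shows "llip (\<lambda>z. dm d (pos c d z) (a z) (u z) (v z)) z"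
proof (rule llip_transform[OF _ open_cdom[OF c d] z])
  have m: "llip (\<lambda>z. dm d (pos c d z) (axis k 1) (axis i 1) (axis j 1)) z" for i j k
    by (rule llip_compose[OF llip_pos]) (unfold dm_def, rule smooth_on_llip[OF smooth_on_frechet[OF mc_smooth[OF d]] open_dom[OF d] pos_dom[OF c d z]])
  show "llip (\<lambda>z. \<Sum>k\<in>UNIV. a z $ k * (\<Sum>i\<in>UNIV. \<Sum>j\<in>UNIV. u z $ i * v z $ j * dm d (pos c d z) (axis k 1) (axis i 1) (axis j 1))) z"
    by (intro llip_sum llip_mult llip_nth assms m)
  fix y assume y: "y \<in> cdom c d"
  show "dm d (pos c d y) (a y) (u y) (v y) = (\<Sum>k\<in>UNIV. a y $ k * (\<Sum>i\<in>UNIV. \<Sum>j\<in>UNIV. u y $ i * v y $ j * dm d (pos c d y) (axis k 1) (axis i 1) (axis j 1)))"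
    unfolding dm_expand23[OF d pos_dom[OF c d y], symmetric]
    using linear_axis_expand[OF dm_linear1[OF d pos_dom[OF c d y], of "u y" "v y"], of "a y"] by simp
qed

lemma llip_chr1:
  assumes "llip a z" "llip b z" "llip w z"
  shows "llip (\<lambda>z. chr1 d (pos c d z) (a z) (b z) (w z)) z"
  unfolding chr1_def divide_inverse by (intro llip_mult llip_add llip_diff llip_dm llip_const assms)

lemma pos_matrix_gmat: "pos_matrix (gmat c d z)"
  unfolding gmat_def by (rule pos_metric_matrix[OF d pos_dom[OF c d z]])

lemma gm_gmat: "gm (gmat c d z) u v = mc d (pos c d z) u v"
  unfolding gmat_def by (rule mc_gm[OF d pos_dom[OF c d z]])

lemma gmat_nth: "(gmat c d z *v u) $ k = mc d (pos c d z) (axis k 1) u"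
  unfolding gm_gmat[symmetric] gm_def by (simp add: inner_axis')

end

context
  fixes c d z assumes c: "c \<in> A" and d: "d \<in> B" and z: "z \<in> cdom c d"
begin

lemma llip_gmat:
  assumes "llip u z"
  shows "llip (\<lambda>z. (gmat c d z *v u z) $ k) z"
  by (rule llip_transform[OF llip_mc[OF c d z llip_const assms] open_cdom[OF c d] z]) (rule gmat_nth[OF c d])

text \<open>Pairing \<psi> with the axes produces Christoffel symbols of the first kind, so no
  inverse matrix enters the Lipschitz estimate.\<close>

lemma llip_gmat_psi: "llip (\<lambda>z. (gmat c d z *v psi c d z w) $ k) z"
proof (rule llip_transform[OF _ open_cdom[OF c d] z])
  show "llip (\<lambda>z. mc d (pos c d z) (dn c d z w) (axis k 1) + chr1 d (pos c d z) (phi c d z w) (nrm c d z) (axis k 1)) z"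
    by (intro llip_add llip_mc[OF c d z] llip_chr1[OF c d z] llip_dn[OF c d z] llip_const llip_phi[OF c d z] llip_nrm[OF c d z])
  show "(gmat c d y *v psi c d y w) $ k = mc d (pos c d y) (dn c d y w) (axis k 1) + chr1 d (pos c d y) (phi c d y w) (nrm c d y) (axis k 1)"
    if y: "y \<in> cdom c d" for y
    unfolding gmat_nth[OF c d y] mc_sym[OF d pos_dom[OF c d y], of "axis k 1"] by (rule mc_psi[OF c d y])
qed

lemma psi_linear: "linear (psi c d z)"
proof -
  have "linear (\<lambda>a. chr d y a b)" for y b
    by (rule linearI) (simp_all add: chr_def vec_eq_iff sum.distrib sum_distrib_left algebra_simps)
  then show ?thesis
    unfolding psi_def[abs_def]
    by (intro linear_compose_add dn_linear[OF c d z] linear_compose[OF phi_linear[OF c d z], unfolded o_def])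
qed

lemma phi_expand: "phi c d z w = w $ 1 *\<^sub>R phi c d z (axis 1 1) + w $ 2 *\<^sub>R phi c d z (axis 2 1)"
  using linear_axis_expand[OF phi_linear[OF c d z], of w] by (simp add: sum_2)

lemma psi_expand: "psi c d z w = w $ 1 *\<^sub>R psi c d z (axis 1 1) + w $ 2 *\<^sub>R psi c d z (axis 2 1)"
  using linear_axis_expand[OF psi_linear, of w] by (simp add: sum_2)

end

text \<open>Principal directions, with the zero vector included.\<close>

definition null :: "('a, real^2) chart \<Rightarrow> real^2 \<Rightarrow> real^2 \<Rightarrow> bool" where
  "null c z w \<longleftrightarrow> (let p = chart_inv c z; X = coord_vec A c p w in
     \<exists>x y. (x \<noteq> 0 \<or> y \<noteq> 0) \<and> lincomb x (tangent_map A B f p X) y (cov_deriv A B g f \<nu> p X) = (\<lambda>_. 0))"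

lemma null_trans:
  assumes "c \<in> A" "d \<in> A" "p \<in> fst c" "p \<in> fst d" "null c (snd c p) w"
  shows "null d (snd d p) (frechet_derivative (coord_rep c d (\<lambda>x. x)) (at (snd c p)) w)"
  using assms(5) unfolding null_def chart_inv[OF A assms(1,3)] chart_inv[OF A assms(2,4)] Let_def coord_vec_change[OF A assms(1-4)] .

text \<open>One target chart suffices: both vectors change by the same linear map, so a relation in
  the chart \<open>d\<close> persists in every other chart.\<close>

lemma null_chart:
  assumes c: "c \<in> A" and d: "d \<in> B" and z: "z \<in> cdom c d"
  shows "null c z w \<longleftrightarrow> (\<exists>x y. (x \<noteq> 0 \<or> y \<noteq> 0) \<and> x *\<^sub>R phi c d z w + y *\<^sub>R psi c d z w = 0)"
proof -
  obtain p where p: "p \<in> fst c" "f p \<in> fst d" "z = snd c p" "chart_inv c z = p" using cdomE[OF c d z] by metis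
  let ?X = "coord_vec A c p w"
  let ?l = "\<lambda>x y. lincomb x (tangent_map A B f p ?X) y (cov_deriv A B g f \<nu> p ?X)"
  have ch: "?l x y e = x *\<^sub>R phi c e z w + y *\<^sub>R psi c e z w" if e: "e \<in> B" "f p \<in> fst e" for x y e
    unfolding lincomb_def tangent_map_chart[OF c e(1) p(1) e(2)] cov_deriv_chart[OF c e(1) p(1) e(2)] p(3) ..
  have "?l x y = (\<lambda>_. 0) \<longleftrightarrow> x *\<^sub>R phi c d z w + y *\<^sub>R psi c d z w = 0" for x y
  proof
    assume "?l x y = (\<lambda>_. 0)"
    then have "?l x y d = 0" by simp
    then show "x *\<^sub>R phi c d z w + y *\<^sub>R psi c d z w = 0" unfolding ch[OF d p(2)] .
  next
    assume 0: "x *\<^sub>R phi c d z w + y *\<^sub>R psi c d z w = 0"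
    show "?l x y = (\<lambda>_. 0)"
    proof
      fix e
      show "?l x y e = 0"
      proof (cases "e \<in> B \<and> f p \<in> fst e")
        case True
        then have e: "e \<in> B" "f p \<in> fst e" by simp_all
        have ze: "z \<in> cdom c e" using mem_cdom[OF c e(1) p(1) e(2)] p(3) by simp
        have l: "linear (cD d e (pos c d z))"
          by (rule has_derivative_linear[OF cs_derivative[OF d e(1) pos_overlap[OF c d e(1) z ze]]])
        have "?l x y e = cD d e (pos c d z) (x *\<^sub>R phi c d z w + y *\<^sub>R psi c d z w)"
          unfolding ch[OF e] phi_change[OF c d e(1) z ze] psi_change[OF c d e(1) z ze] linear_add[OF l] linear_cmul[OF l] ..
        then show ?thesis unfolding 0 linear_0[OF l] .
      next
        case False
        then show ?thesis
          unfolding lincomb_def tangent_map_def cov_deriv_def Let_def if_not_P[OF False] by simp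
      qed
    qed
  qed
  then show ?thesis unfolding null_def p(4) Let_def by simp
qed

text \<open>The definition uses the chart \<open>chart_at A p\<close>. Passing to \<open>c\<close>
  multiplies both determinants by \<open>D\<^sup>2\<close>, and the minus signs of the second form
  cancel in a determinant of size 2.\<close>

lemma extrinsic_curvature_chart:
  fixes p c d
  defines "z \<equiv> snd c p"
  defines "P i \<equiv> phi c d z (axis i 1)" and "Q i \<equiv> psi c d z (axis i 1)" and "G \<equiv> gmat c d z"
  assumes c: "c \<in> A" and d: "d \<in> B" and p: "p \<in> fst c" "f p \<in> fst d" and K: "extrinsic_curvature A B g f \<nu> p \<noteq> 0"
  shows "pos_matrix.gram2 G (P 1) (P 2) (P 1) (P 2) \<noteq> 0"
    and "extrinsic_curvature A B g f \<nu> p = pos_matrix.gram2 G (P 1) (P 2) (Q 1) (Q 2) / pos_matrix.gram2 G (P 1) (P 2) (P 1) (P 2)"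
proof -
  have zc: "z \<in> cdom c d" unfolding z_def by (rule mem_cdom[OF c d p])
  define k where "k = chart_at A p"
  have k: "k \<in> A" "p \<in> fst k" using chart_at[OF in_points[OF c p(1)]] unfolding k_def by simp_all
  define t where "t i = coord_vec A k p (axis i 1) c" for i :: 2
  have t: "coord_vec A k p (axis i 1) = coord_vec A c p (t i)" for i
    unfolding t_def by (rule tangent_eq_coord_vec[OF coord_vec_tangent[OF A k] c p(1)])
  have r: "pos c d z = snd d (f p)" unfolding z_def by (rule coord_rep_chart[OF A c p(1)])
  have I: "fundamental_form_I A B g f p (coord_vec A c p v) (coord_vec A c p w) = gm G (phi c d z v) (phi c d z w)" for v w
    unfolding fundamental_form_I_def metric_tangent[OF tangent_map_tangent(1)[OF c p(1)] tangent_map_tangent(1)[OF c p(1)] d p(2)]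
      tangent_map_chart[OF c d p] G_def gm_gmat[OF c d zc] r unfolding z_def ..
  have II: "fundamental_form_II A B g f \<nu> p (coord_vec A c p v) (coord_vec A c p w) = - gm G (phi c d z v) (psi c d z w)" for v w
    unfolding fundamental_form_II_def metric_tangent[OF tangent_map_tangent(1)[OF c p(1)] tangent_map_tangent(2)[OF c p(1)] d p(2)]
      tangent_map_chart[OF c d p] cov_deriv_chart[OF c d p] G_def gm_gmat[OF c d zc] r unfolding z_def ..
  define D where "D = t 1 $ 1 * t 2 $ 2 - t 1 $ 2 * t 2 $ 1"
  have dI: "det (form_matrix A p (fundamental_form_I A B g f p)) = D\<^sup>2 * (gm G (P 1) (P 1) * gm G (P 2) (P 2) - gm G (P 1) (P 2) * gm G (P 2) (P 1))"
    unfolding form_matrix_def Let_def k_def[symmetric] t I det_2 vec_lambda_beta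
    unfolding D_def P_def phi_expand[OF c d zc, of "t 1"] phi_expand[OF c d zc, of "t 2"] gm_bilinear
    by (simp add: power2_eq_square algebra_simps)
  have dII: "det (form_matrix A p (fundamental_form_II A B g f \<nu> p)) = D\<^sup>2 * (gm G (P 1) (Q 1) * gm G (P 2) (Q 2) - gm G (P 1) (Q 2) * gm G (P 2) (Q 1))"
    unfolding form_matrix_def Let_def k_def[symmetric] t II det_2 vec_lambda_beta
    unfolding D_def P_def Q_def phi_expand[OF c d zc, of "t 1"] phi_expand[OF c d zc, of "t 2"] psi_expand[OF c d zc, of "t 1"] psi_expand[OF c d zc, of "t 2"] gm_bilinear
    by (simp add: power2_eq_square algebra_simps)
  interpret pos_matrix G unfolding G_def by (rule pos_matrix_gmat[OF c d zc])
  have e: "extrinsic_curvature A B g f \<nu> p = D\<^sup>2 * gram2 (P 1) (P 2) (Q 1) (Q 2) / (D\<^sup>2 * gram2 (P 1) (P 2) (P 1) (P 2))"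
    unfolding extrinsic_curvature_def dI dII ..
  \<comment> \<open>A quotient by 0 has the value 0, so a nonzero curvature excludes a degenerate
    first form.\<close>
  show "gram2 (P 1) (P 2) (P 1) (P 2) \<noteq> 0"
  proof
    assume 0: "gram2 (P 1) (P 2) (P 1) (P 2) = 0"
    show False using K unfolding e 0 by simp
  qed
  have "D\<^sup>2 \<noteq> 0"
  proof
    assume 0: "D\<^sup>2 = 0"
    show False using K unfolding e 0 by simp
  qed
  then show "extrinsic_curvature A B g f \<nu> p = gram2 (P 1) (P 2) (Q 1) (Q 2) / gram2 (P 1) (P 2) (P 1) (P 2)"
    unfolding e by (rule mult_divide_mult_cancel_left)
qed

end

text \<open>If \<open>h z\<close> were positive, \<open>h\<close> would be positive on an open set
  of the surface, and this set contains a point of \<open>R\<close>.\<close>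

lemma dense_le_extend:
  fixes h :: "real^2 \<Rightarrow> real"
  assumes A: "smooth_atlas A" and c: "c \<in> A" and R: "mfd_topology A closure_of R = points A"
    and U: "open U" "z \<in> U" "U \<subseteq> snd c ` fst c" and h: "isCont h z"
    and le: "\<And>p. p \<in> R \<Longrightarrow> p \<in> fst c \<Longrightarrow> snd c p \<in> U \<Longrightarrow> h (snd c p) \<le> 0"
  shows "h z \<le> 0"
proof (rule ccontr)
  assume "\<not> h z \<le> 0"
  then have z: "h z > 0" by simp
  obtain p where p: "p \<in> fst c" "z = snd c p" using U by blast
  have "\<exists>V. open V \<and> z \<in> V \<and> (\<forall>y\<in>V. h y \<in> {0<..})"
    using h[unfolded continuous_at_open, rule_format, of "{0<..}"] z by simp
  then obtain V where V: "open V" "z \<in> V" "\<And>y. y \<in> V \<Longrightarrow> h y > 0" by auto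
  let ?S = "{q \<in> fst c. snd c q \<in> U \<inter> V}"
  have "snd c ` ?S = U \<inter> V" using U(3) by blast
  then have S: "openin (mfd_topology A) ?S"
    using openin_chart[OF A c, of ?S] U V by (simp add: open_Int)
  have pS: "p \<in> ?S" using p U(2) V(2) by simp
  have "p \<in> mfd_topology A closure_of R"
    unfolding R using p(1) c by (auto simp: points_def)
  note this[unfolded in_closure_of, THEN conjunct2, rule_format, OF conjI[OF pS S]]
  then obtain q where "q \<in> R" "q \<in> ?S" by blast
  then show False using le[of q] V(3)[of "snd c q"] by simp
qed

text \<open>In the application \<open>p\<close> and \<open>q\<close> are the volumes of \<phi> and
  \<psi> on a basis, \<open>D1\<close>, \<open>D2\<close>, \<open>D3\<close> the Gram determinants
  and \<gamma> that of the metric. As \<open>D3 = K\<^sup>2 * D1\<close>, the two expressions are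
  \<open>\<gamma> * D1 * (1 + C * K)\<close> and \<open>\<gamma> * D1 * (K * (K + C))\<close>, so
  each bound on \<open>K\<close> gives one inequality.\<close>

lemma pinched_squares:
  fixes p q \<gamma> D1 D2 D3 K C :: real
  assumes w: "p\<^sup>2 = \<gamma> * D1" "p * q = \<gamma> * D2" "q\<^sup>2 = \<gamma> * D3" and D: "D1 > 0" "\<gamma> \<noteq> 0" "D2 = K * D1"
    and K: "K < 0" "- C \<le> K" "C * K \<le> - 1"
  shows "p\<^sup>2 + C * (p * q) \<le> 0" "q\<^sup>2 + C * (p * q) \<le> 0"
proof -
  have "\<gamma> * D1 \<ge> 0" unfolding w(1)[symmetric] by simp
  then have g0: "\<gamma> > 0" using D by (auto simp: zero_le_mult_iff)
  have "(\<gamma> * D2)\<^sup>2 = (\<gamma> * D1) * (\<gamma> * D3)" unfolding w[symmetric] by (simp add: power_mult_distrib)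
  then have "\<gamma>\<^sup>2 * D1 * (K\<^sup>2 * D1) = \<gamma>\<^sup>2 * D1 * D3" unfolding D(3) by (simp add: power2_eq_square mult_ac)
  then have D3: "D3 = K\<^sup>2 * D1" using g0 D by simp
  have "\<gamma> * D1 * (1 + C * K) \<le> 0" using g0 D K by (intro mult_nonneg_nonpos) auto
  then show "p\<^sup>2 + C * (p * q) \<le> 0" unfolding w D by (simp add: algebra_simps)
  have K2: "K * (K + C) \<le> 0" using K by (intro mult_nonpos_nonneg) auto
  have "\<gamma> * D1 * (K * (K + C)) \<le> 0" by (rule mult_nonneg_nonpos[OF _ K2]) (use g0 D in simp)
  then show "q\<^sup>2 + C * (p * q) \<le> 0" unfolding w D D3 by (simp add: algebra_simps power2_eq_square)
qed

text \<open>What survives of the curvature bound in the limit: unless \<open>p * q\<close> is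
  negative, both squares are forced to vanish, so \<phi> and \<psi> degenerate together.\<close>

lemma negative_or_zero:
  fixes p q \<gamma> D1 D2 D3 C :: real
  assumes w: "p\<^sup>2 = \<gamma> * D1" "p * q = \<gamma> * D2" "q\<^sup>2 = \<gamma> * D3" and D: "D1 \<ge> 0" "\<gamma> \<noteq> 0" and C: "C > 0"
    and le: "p\<^sup>2 + C * (p * q) \<le> 0" "q\<^sup>2 + C * (p * q) \<le> 0"
  shows "D2 < 0 \<or> D1 = 0 \<and> D3 = 0"
proof (cases "p * q < 0")
  case True
  then have "p \<noteq> 0" by auto
  then have "\<gamma> * D1 > 0" unfolding w(1)[symmetric] by simp
  then have "\<gamma> > 0" using D by (auto simp: zero_less_mult_iff)
  then show ?thesis using True unfolding w(2) by (auto simp: mult_less_0_iff)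
next
  case False
  then have "C * (p * q) \<ge> 0" using C by simp
  then have "p\<^sup>2 \<le> 0" "q\<^sup>2 \<le> 0" using le by linarith+
  then have "\<gamma> * D1 = 0" "\<gamma> * D3 = 0" unfolding w(1,3)[symmetric] by simp_all
  then show ?thesis using D(2) by simp
qed

text \<open>\<open>curv\<close> places the curvature between \<open>- C\<close> and
  \<open>- 1 / C\<close>, written without division.\<close>

locale bounded_front = front_surface B g A f \<nu>
  for B :: "('b, real^3) chart set" and g and A :: "('a, real^2) chart set" and f :: "'a \<Rightarrow> 'b" and \<nu> +
  fixes R :: "'a set" and C :: real
  assumes dense: "mfd_topology A closure_of R = points A" and C: "C > 0"
    and curv: "\<And>p. p \<in> R \<Longrightarrow> - C \<le> extrinsic_curvature A B g f \<nu> p \<and> C * extrinsic_curvature A B g f \<nu> p \<le> - 1"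
begin

text \<open>All three vectors are lowered by the metric. This multiplies the volume by the nonzero
  determinant of \<open>gmat\<close> and keeps its zeros, while the lowered \<psi> is Lipschitz by
  \<open>llip_gmat_psi\<close>.\<close>

definition vol :: "('a, real^2) chart \<Rightarrow> ('b, real^3) chart \<Rightarrow> real^2 \<Rightarrow> real^3 \<Rightarrow> real^3 \<Rightarrow> real" where
  "vol c d z u v = vol3 (gmat c d z *v u) (gmat c d z *v v) (gmat c d z *v nrm c d z)"

context
  fixes c d assumes c: "c \<in> A" and d: "d \<in> B"
begin

abbreviation P where "P z i \<equiv> phi c d z (axis i 1)"
abbreviation Q where "Q z i \<equiv> psi c d z (axis i 1)"

lemma frame_orthogonal:
  assumes z: "z \<in> cdom c d"
  shows "gm (gmat c d z) (nrm c d z) (nrm c d z) = 1" "gm (gmat c d z) (phi c d z w) (nrm c d z) = 0"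
    "gm (gmat c d z) (psi c d z w) (nrm c d z) = 0" "gm (gmat c d z) (P z 1) (Q z 2) = gm (gmat c d z) (P z 2) (Q z 1)"
  unfolding gm_gmat[OF c d z]
  by (rule mc_nrm_nrm[OF c d z] mc_phi_nrm[OF c d z] mc_psi_nrm[OF c d z] mc_phi_psi_sym[OF c d z])+

text \<open>Both bounds on the curvature, multiplied out so that they pass to the singular set by continuity.\<close>

lemma regular_bound:
  assumes p: "p \<in> R" "p \<in> fst c" "f p \<in> fst d"
  defines "z \<equiv> snd c p"
  shows "(vol c d z (P z 1) (P z 2))\<^sup>2 + C * (vol c d z (P z 1) (P z 2) * vol c d z (Q z 1) (Q z 2)) \<le> 0"
    and "(vol c d z (Q z 1) (Q z 2))\<^sup>2 + C * (vol c d z (P z 1) (P z 2) * vol c d z (Q z 1) (Q z 2)) \<le> 0"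
proof -
  have z: "z \<in> cdom c d" unfolding z_def by (rule mem_cdom[OF c d p(2,3)])
  interpret pos_matrix "gmat c d z" by (rule pos_matrix_gmat[OF c d z])
  let ?K = "extrinsic_curvature A B g f \<nu> p"
  let ?D1 = "gram2 (P z 1) (P z 2) (P z 1) (P z 2)" and ?D2 = "gram2 (P z 1) (P z 2) (Q z 1) (Q z 2)"
    and ?D3 = "gram2 (Q z 1) (Q z 2) (Q z 1) (Q z 2)" and ?g = "det (gmat c d z)"
  note o = frame_orthogonal[OF z]
  have K: "- C \<le> ?K" "C * ?K \<le> - 1" using curv[OF p(1)] by simp_all
  have "C * ?K < 0" using K(2) by linarith
  then have K0: "?K < 0" using C by (simp add: mult_less_0_iff)
  have D1: "?D1 \<noteq> 0" "?K = ?D2 / ?D1"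
    unfolding z_def by (rule extrinsic_curvature_chart[OF c d p(2,3) less_imp_neq[OF K0]])+
  have pos1: "?D1 > 0" using gram2_nonneg[of "P z 1" "P z 2"] D1(1) by linarith
  have w: "(vol c d z (P z 1) (P z 2))\<^sup>2 = ?g * ?D1" "vol c d z (P z 1) (P z 2) * vol c d z (Q z 1) (Q z 2) = ?g * ?D2"
    "(vol c d z (Q z 1) (Q z 2))\<^sup>2 = ?g * ?D3"
    unfolding vol_def power2_eq_square by (rule vol3_gram[OF o(1)]; rule o)+
  have D2: "?D2 = ?K * ?D1" by (rule nonzero_eq_divide_eq[OF D1(1), THEN iffD1, OF D1(2), symmetric])
  note pinched_squares[OF w pos1 det_nonzero D2 K0 K]
  then show "(vol c d z (P z 1) (P z 2))\<^sup>2 + C * (vol c d z (P z 1) (P z 2) * vol c d z (Q z 1) (Q z 2)) \<le> 0"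
    "(vol c d z (Q z 1) (Q z 2))\<^sup>2 + C * (vol c d z (P z 1) (P z 2) * vol c d z (Q z 1) (Q z 2)) \<le> 0"
    by this+
qed

lemma llip_vol:
  assumes z: "z \<in> cdom c d"
  shows "llip (\<lambda>z. vol c d z (P z i) (P z j)) z" "llip (\<lambda>z. vol c d z (P z i) (Q z j)) z" "llip (\<lambda>z. vol c d z (Q z i) (Q z j)) z"
  unfolding vol_def
  by (intro llip_vol3 llip_gmat[OF c d z] llip_gmat_psi[OF c d z] llip_phi[OF c d z] llip_nrm[OF c d z])+

lemma bound:
  assumes z: "z \<in> cdom c d"
  shows "(vol c d z (P z 1) (P z 2))\<^sup>2 + C * (vol c d z (P z 1) (P z 2) * vol c d z (Q z 1) (Q z 2)) \<le> 0"
    and "(vol c d z (Q z 1) (Q z 2))\<^sup>2 + C * (vol c d z (P z 1) (P z 2) * vol c d z (Q z 1) (Q z 2)) \<le> 0"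
proof -
  have sub: "cdom c d \<subseteq> snd c ` fst c" unfolding cdom_def by blast
  have mem: "f p \<in> fst d" if p: "p \<in> fst c" "snd c p \<in> cdom c d" for p
  proof -
    obtain q where "q \<in> fst c" "f q \<in> fst d" "chart_inv c (snd c p) = q" using cdomE[OF c d p(2)] by metis
    then show ?thesis using chart_inv[OF A c p(1)] by simp
  qed
  note cont = llip_isCont[OF llip_vol(1)[OF z]] llip_isCont[OF llip_vol(3)[OF z]]
  show "(vol c d z (P z 1) (P z 2))\<^sup>2 + C * (vol c d z (P z 1) (P z 2) * vol c d z (Q z 1) (Q z 2)) \<le> 0"
    by (rule dense_le_extend[OF A c dense open_cdom[OF c d] z sub])
      (auto intro!: continuous_intros cont intro: regular_bound(1) mem)
  show "(vol c d z (Q z 1) (Q z 2))\<^sup>2 + C * (vol c d z (P z 1) (P z 2) * vol c d z (Q z 1) (Q z 2)) \<le> 0"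
    by (rule dense_le_extend[OF A c dense open_cdom[OF c d] z sub])
      (auto intro!: continuous_intros cont intro: regular_bound(2) mem)
qed

text \<open>\<open>negative_or_zero\<close> supplies the two cases of
  \<open>pencil_indefinite\<close>; the separation of the kernels is the immersion property in the
  form of \<open>kernel_trivial\<close>.\<close>

lemma discriminant:
  assumes z: "z \<in> cdom c d"
  shows "((vol c d z (P z 1) (Q z 2) + vol c d z (P z 2) (Q z 1)) / 2)\<^sup>2 - vol c d z (P z 1) (Q z 1) * vol c d z (P z 2) (Q z 2) > 0"
proof -
  interpret pos_matrix "gmat c d z" by (rule pos_matrix_gmat[OF c d z])
  let ?D1 = "gram2 (P z 1) (P z 2) (P z 1) (P z 2)" and ?D2 = "gram2 (P z 1) (P z 2) (Q z 1) (Q z 2)"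
    and ?D3 = "gram2 (Q z 1) (Q z 2) (Q z 1) (Q z 2)" and ?g = "det (gmat c d z)"
  note o = frame_orthogonal[OF z]
  let ?p = "vol c d z (P z 1) (P z 2)" and ?q = "vol c d z (Q z 1) (Q z 2)"
  have w: "?p\<^sup>2 = ?g * ?D1" "?p * ?q = ?g * ?D2" "?q\<^sup>2 = ?g * ?D3"
    unfolding vol_def power2_eq_square by (rule vol3_gram[OF o(1)]; rule o)+
  have neg: "?D2 < 0 \<or> ?D1 = 0 \<and> ?D3 = 0"
    by (rule negative_or_zero[OF w gram2_nonneg det_nonzero C bound[OF z]])
  have ker: "x = 0 \<and> y = 0" if "x *\<^sub>R P z 1 + y *\<^sub>R P z 2 = 0" "x *\<^sub>R Q z 1 + y *\<^sub>R Q z 2 = 0" for x y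
  proof -
    let ?w = "vector [x, y] :: real^2"
    have "phi c d z ?w = 0" "psi c d z ?w = 0"
      unfolding phi_expand[OF c d z, of ?w] psi_expand[OF c d z, of ?w] vector_2 by (rule that)+
    then have "?w = 0" by (rule kernel_trivial[OF c d z])
    then have "?w $ 1 = 0" "?w $ 2 = 0" by simp_all
    then show ?thesis by (simp add: vector_2)
  qed
  show ?thesis
    unfolding vol_def by (rule pencil_indefinite[OF o(1,2,2,3,3,4) ker neg])
qed

lemma null_form_cdom:
  assumes z: "z \<in> cdom c d"
  shows "null_form null c z (cdom c d) (\<lambda>z. vol c d z (P z 1) (Q z 1))
    (\<lambda>z. (vol c d z (P z 1) (Q z 2) + vol c d z (P z 2) (Q z 1)) / 2) (\<lambda>z. vol c d z (P z 2) (Q z 2))"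
proof -
  have "null c y w \<longleftrightarrow> qform (vol c d y (P y 1) (Q y 1)) ((vol c d y (P y 1) (Q y 2) + vol c d y (P y 2) (Q y 1)) / 2)
      (vol c d y (P y 2) (Q y 2)) w = 0" if y: "y \<in> cdom c d" for y w
  proof -
    interpret pos_matrix "gmat c d y" by (rule pos_matrix_gmat[OF c d y])
    note o = frame_orthogonal[OF y]
    have v: "vector [w $ 1, w $ 2] = w" by (simp add: vec_eq_iff forall_2 vector_2)
    have "null c y w \<longleftrightarrow> vol c d y (phi c d y w) (psi c d y w) = 0"
      unfolding null_chart[OF c d y] vol_def by (rule dependent_iff_vol3[OF o(1,2,3)])
    also have "vol c d y (phi c d y w) (psi c d y w) = qform (vol c d y (P y 1) (Q y 1)) ((vol c d y (P y 1) (Q y 2) + vol c d y (P y 2) (Q y 1)) / 2)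
      (vol c d y (P y 2) (Q y 2)) w"
      unfolding vol_def phi_expand[OF c d y, of w] psi_expand[OF c d y, of w] matrix_vector_right_distrib matrix_vector_mult_scaleR vol3_lincomb v ..
    finally show ?thesis .
  qed
  moreover have "llip (\<lambda>z. (vol c d z (P z 1) (Q z 2) + vol c d z (P z 2) (Q z 1)) / 2) z"
    unfolding divide_inverse by (intro llip_mult llip_add llip_vol[OF z] llip_const)
  moreover have "cdom c d \<subseteq> snd c ` fst c" unfolding cdom_def by blast
  ultimately show ?thesis
    unfolding null_form_def using open_cdom[OF c d] z llip_vol(2)[OF z] discriminant[OF z] by blast
qed

end

lemma null_field_null:
  assumes "smooth_manifold A" "compact_space (mfd_topology A)"
  shows "null_field A null"
proof
  fix c z assume c: "c \<in> A" and z: "z \<in> snd c ` fst c"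
  obtain p where p: "p \<in> fst c" "z = snd c p" using z by blast
  have fp: "f p \<in> points B" using f in_points[OF c p(1)] unfolding smooth_map_def by blast
  have d: "chart_at B (f p) \<in> B" "f p \<in> fst (chart_at B (f p))" using chart_at[OF fp] by simp_all
  show "\<exists>U a b d. null_form null c z U a b d"
    unfolding p(2) by (intro exI) (rule null_form_cdom[OF c d(1) mem_cdom[OF c d(1) p(1) d(2)]])
qed (rule assms null_trans; assumption?)+

end

theorem theorem3p30:
  fixes A :: "('a, real^2) chart set"
    and B :: "('b, real^3) chart set"
    and g :: "('b, real^3) metric"
    and c :: real
    and f :: "'a \<Rightarrow> 'b"
    and \<nu> :: "'a \<Rightarrow> ('b, real^3) tvec"
    and \<omega> :: "'a \<Rightarrow> (('b, real^3) tvec \<times> ('b, real^3) tvec) set"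
  assumes "smooth_manifold B" and "riemannian_metric B g"
    and "complete_metric B g" and "constant_curvature B g c"
    and "smooth_manifold A" and "oriented_atlas A" and "compact_space (mfd_topology A)"
    and "co_oriented_front A B g f \<nu> \<omega>"
    and "mfd_topology A closure_of (points A - singular_set A B g f \<nu>) = points A"
    and "\<And>p. p \<in> points A - singular_set A B g f \<nu> \<Longrightarrow> extrinsic_curvature A B g f \<nu> p < 0"
    and "bounded ((\<lambda>p. ln \<bar>extrinsic_curvature A B g f \<nu> p\<bar>) `
           (points A - singular_set A B g f \<nu>))"
  shows "euler_characteristic A = 0"
proof -
  let ?R = "points A - singular_set A B g f \<nu>"
  let ?K = "extrinsic_curvature A B g f \<nu>"
  obtain M where M: "\<And>p. p \<in> ?R \<Longrightarrow> \<bar>ln \<bar>?K p\<bar>\<bar> \<le> M"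
    using assms(11) unfolding bounded_iff real_norm_def by blast
  \<comment> \<open>If the logarithm of the absolute value is bounded by \<open>M\<close>, a
    negative curvature lies between \<open>- exp M\<close> and \<open>- exp (- M)\<close>, so
    \<open>exp M\<close> serves as the constant \<open>C\<close>.\<close>
  have K: "- exp M \<le> ?K p \<and> exp M * ?K p \<le> - 1" if p: "p \<in> ?R" for p
  proof -
    have n: "?K p < 0" by (rule assms(10)[OF p])
    have l: "ln (- ?K p) \<le> M" "- M \<le> ln (- ?K p)" using M[OF p] n by (simp_all add: abs_le_iff)
    have e: "exp (ln (- ?K p)) = - ?K p" using n by simp
    have 1: "- ?K p \<le> exp M" using exp_le_cancel_iff[THEN iffD2, OF l(1)] unfolding e .
    have "exp (- M) \<le> - ?K p" using exp_le_cancel_iff[THEN iffD2, OF l(2)] unfolding e .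
    then have "exp M * exp (- M) \<le> exp M * - ?K p" by (rule mult_left_mono) simp
    then have "1 \<le> - (exp M * ?K p)" by (simp flip: exp_add)
    with 1 show ?thesis by linarith
  qed
  interpret bounded_front B g A f \<nu> ?R "exp M"
  proof
    show "smooth_map A B f" using assms(8) unfolding co_oriented_front_def front_def by blast
    show "unit_normal_on A B g (points A) f \<nu>" using assms(8) unfolding co_oriented_front_def by blast
  qed (use assms K in \<open>simp_all add: smooth_manifold_def\<close>)
  interpret null_field A null by (rule null_field_null[OF assms(5,7)])
  show ?thesis by (rule euler_characteristic_eq[OF has_euler_null_field])
qed

end
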